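(* Consider the mKdV equation $v_t+v_{xxx}\mp 6v^2v_x=0$ on $\mathbb T$. (i) (Either sign.) For any $u_0\in L^2(\mathbb T)$ there exists a weak solution $u\in C_w(\mathbb R;L^2(\mathbb T))\cap\big(\bigcup_{s<0}\tilde F^{s,1/2}\big)$ of the mKdV equation such that $u(0)=u_0$. Moreover $u(t)\to u_0$ in $L^2(\mathbb T)$ as $t\to 0$. (ii) (Defocusing case, i.e. $v_t+v_{xxx}-6v^2v_x=0$.) The $C(\mathbb R;L^2(\mathbb T))$-functions determined by the unique continuous extension $L^2(\mathbb T)\to C(\mathbb R;L^2(\mathbb T))$ of the solution-map $H^\infty(\mathbb T)\to C(\mathbb R;H^\infty(\mathbb T))$ of the defocusing mKdV equation are weak solutions of the mKdV equation and belong to $\bigcup_{s<0}\tilde F^{s,1/2}$.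
   Context: $\mathbb T=\mathbb R/2\pi\mathbb Z$, functions are real-valued, $P_0(u)=\frac1{2\pi}\int_{\mathbb T}u\,dx$ (for $u(t,x)$, taken at fixed $t$), and $C_w(\mathbb R;L^2(\mathbb T))$ denotes weakly continuous functions of $t$ with values in $L^2(\mathbb T)$. It is a known theorem (Kappeler–Topalov) that the smooth solution-map of the defocusing mKdV equation extends uniquely to a continuous map $L^2(\mathbb T)\to C(\mathbb R;L^2(\mathbb T))$; this is the extension referred to in (ii). Cutoffs: $\psi\in C_0^\infty(\mathbb R)$ is even, $\psi\ge0$, $\operatorname{supp}\psi\subset[-3/2,3/2]$, $\psi\equiv1$ on $[-5/4,5/4]$; $\eta_0=\psi$ and $\eta_k(\xi)=\psi(2^{-k}\xi)-\psi(2^{-k+1}\xi)$ for $k\ge1$. $\Delta_k$ and $S_k$ are the Fourier multipliers in $x$ with symbols $\eta_k(\xi)$ and $\psi(2^{-k}\xi)$. Spaces: let $u_0$ be the initial datum and let $q(\xi)=\xi^3\pm 6P_0(u_0^2)\xi$ (upper sign for the upper, defocusing, sign in the equation), so that $e^{iq(\xi)t}$ is the symbol of the linear group $V(t)$ of $v_t+v_{xxx}\mp 6P_0(u_0^2)v_x=0$. For $0\le b<1$ set $$\|f\|_{\tilde X^{0,b,1}}=\sum_{j\ge0}2^{jb}\|\eta_j(\tau-q(\xi))\hat f(\tau,\xi)\|_{L^2_{\tau,\xi}(\mathbb R\times\mathbb Z)},$$ $\hat f$ being the space-time Fourier transform. For $k\in\mathbb N$, $t_0\in\mathbb R$ let $\|f\|_{\tilde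 F^b_{k,t_0}}$ be the infimum of $\|\tilde f\|_{\tilde X^{0,b,1}}$ over all $\tilde f$ with $\tilde f=f$ on $]t_0-2^{-k},t_0+2^{-k}[$. $\tilde F^{s,b}$ is the space of distributions on $\mathbb R\times\mathbb T$ with $$\|f\|_{\tilde F^{s,b}}^2=\sum_{k\ge0}\Big(\sup_{t\in\mathbb R}2^{ks}\|\Delta_kf\|_{\tilde F^b_{k,t}}\Big)^2<\infty .$$ Interpretation of the nonlinear term: the map $u\mapsto 6(u^2-P_0(u^2))u_x$, defined for Schwartz $u$, has a continuous extension $\mathcal N$ (after localization in time by $\psi(\cdot/T)$ and letting $T\to\infty$ in the sense of distributions) to $\tilde F^{-2^{-6},15/32}$ with values in distributions on $\mathbb R\times\mathbb T$. Concretely $\mathcal N(u)=\lim_{n\to\infty}6\big((S_nu)^2-P_0((S_nu)^2)\big)\partial_xS_nu$ in the sense of distributions ($S_nu$ has finitely many spatial Fourier modes, each locally in $L^3$ in time). Weak solution: $v\in C_w(\mathbb R;L^2(\mathbb T))$ is a weak solution of mKdV with initial datum $v_0$ if $v\in\tilde F^{-2^{-6},15/32}$ (so that $\mathcal N(v)$ is defined), $v(0)=v_0$, and, in the sense of distributions on $\mathbb R\times\mathbb T$, $$v_t+v_{xxx}\mp\mathcal N(v)\mp 6P_0(v_0^2)v_x=0 .$$ *)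

theory Defs
  imports "HOL-Analysis.Analysis"
begin

section \<open>Functions on the circle\<close>

text \<open>Functions on the circle are $2\pi$-periodic functions on the line, integrated over one
  period; elements of $L^2$ are represented by such functions, and equality in $L^2$ is equality
  almost everywhere.\<close>

definition circle :: "real measure" where
  "circle = restrict_space lborel {0..<2 * pi}"

definition periodic :: "(real \<Rightarrow> 'a) \<Rightarrow> bool" where
  "periodic u \<longleftrightarrow> (\<forall>x. u (x + 2 * pi) = u x)"

definition P0 :: "(real \<Rightarrow> 'a::{banach,second_countable_topology}) \<Rightarrow> 'a" where
  "P0 u = (1 / (2 * pi)) *\<^sub>R (LINT x|circle. u x)"

definition L2T :: "(real \<Rightarrow> real) set" where
  "L2T = {u. periodic u \<and> u \<in> borel_measurable borel \<and> integrable circle (\<lambda>x. (u x)^2)}"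

definition L2T_norm :: "(real \<Rightarrow> real) \<Rightarrow> real" where
  "L2T_norm u = sqrt (LINT x|circle. (u x)^2)"

definition Cw_L2T :: "(real \<Rightarrow> real \<Rightarrow> real) set" where
  "Cw_L2T = {v. (\<forall>t. v t \<in> L2T) \<and>
     (\<forall>g\<in>L2T. continuous_on UNIV (\<lambda>t. LINT x|circle. v t x * g x))}"

definition C_L2T :: "(real \<Rightarrow> real \<Rightarrow> real) set" where
  "C_L2T = {v. (\<forall>t. v t \<in> L2T) \<and>
     (\<forall>t. ((\<lambda>s. L2T_norm (\<lambda>x. v s x - v t x)) \<longlongrightarrow> 0) (at t))}"

definition vderiv :: "(real \<Rightarrow> 'a::real_normed_vector) \<Rightarrow> real \<Rightarrow> 'a" where
  "vderiv f x = vector_derivative f (at x)"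

definition smooth1 :: "(real \<Rightarrow> 'a::real_normed_vector) \<Rightarrow> bool" where
  "smooth1 f \<longleftrightarrow> (\<forall>n x. (vderiv ^^ n) f differentiable (at x))"

definition Hinf :: "(real \<Rightarrow> real) set" where
  "Hinf = {u. periodic u \<and> smooth1 u}"

definition C_Hinf :: "(real \<Rightarrow> real \<Rightarrow> real) set" where
  "C_Hinf = {u. (\<forall>t. u t \<in> Hinf) \<and>
     (\<forall>j t. ((\<lambda>s. L2T_norm (\<lambda>x. (vderiv ^^ j) (u s) x - (vderiv ^^ j) (u t) x))
                \<longlongrightarrow> 0) (at t))}"


section \<open>Distributions on the product of the line and the circle\<close>

definition dt :: "(real \<times> real \<Rightarrow> complex) \<Rightarrow> real \<times> real \<Rightarrow> complex" where
  "dt \<phi> = (\<lambda>(t, x). vector_derivative (\<lambda>s. \<phi> (s, x)) (at t))"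

definition dx :: "(real \<times> real \<Rightarrow> complex) \<Rightarrow> real \<times> real \<Rightarrow> complex" where
  "dx \<phi> = (\<lambda>(t, x). vector_derivative (\<lambda>y. \<phi> (t, y)) (at x))"

text \<open>The derivatives below are Frechet derivatives in both variables, so mixed partial
  derivatives commute and the fixed order of differentiation is no restriction.\<close>

definition smooth_RT :: "(real \<times> real \<Rightarrow> complex) \<Rightarrow> bool" where
  "smooth_RT \<phi> \<longleftrightarrow> (\<forall>t. periodic (\<lambda>x. \<phi> (t, x))) \<and>
     (\<forall>i j p. (dt ^^ i) ((dx ^^ j) \<phi>) differentiable (at p))"

definition supp_within :: "(real \<times> real \<Rightarrow> complex) \<Rightarrow> real \<Rightarrow> real \<Rightarrow> bool" where
  "supp_within \<phi> c d \<longleftrightarrow> (\<forall>t x. t \<notin> {c..d} \<longrightarrow> \<phi> (t, x) = 0)"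

definition test_RT :: "(real \<times> real \<Rightarrow> complex) set" where
  "test_RT = {\<phi>. smooth_RT \<phi> \<and> (\<exists>R. supp_within \<phi> (- R) R)}"

definition schwartz_RT :: "(real \<times> real \<Rightarrow> complex) set" where
  "schwartz_RT = {\<phi>. smooth_RT \<phi> \<and>
     (\<forall>m i j. bounded (range (\<lambda>p. of_real (fst p) ^ m * (dt ^^ i) ((dx ^^ j) \<phi>) p)))}"

definition seminorm_RT :: "nat \<Rightarrow> nat \<Rightarrow> nat \<Rightarrow> (real \<times> real \<Rightarrow> complex) \<Rightarrow> real" where
  "seminorm_RT m i j \<phi> = (SUP p. \<bar>fst p\<bar> ^ m * norm ((dt ^^ i) ((dx ^^ j) \<phi>) p))"

text \<open>A (tempered) distribution is a functional of which only the values on test (Schwartz)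
  functions matter.\<close>

type_synonym distr = "(real \<times> real \<Rightarrow> complex) \<Rightarrow> complex"

definition linear_fun_on :: "(real \<times> real \<Rightarrow> complex) set \<Rightarrow> distr \<Rightarrow> bool" where
  "linear_fun_on A f \<longleftrightarrow> (\<forall>\<phi>\<in>A. \<forall>\<rho>\<in>A. \<forall>a b.
     f (\<lambda>p. a * \<phi> p + b * \<rho> p) = a * f \<phi> + b * f \<rho>)"

definition distribution :: "distr \<Rightarrow> bool" where
  "distribution f \<longleftrightarrow> linear_fun_on test_RT f \<and>
     (\<forall>R. \<exists>C N. \<forall>\<phi>\<in>test_RT. supp_within \<phi> (- R) R \<longrightarrow>
        norm (f \<phi>) \<le> C * (\<Sum>i\<le>N. \<Sum>j\<le>N. seminorm_RT 0 i j \<phi>))"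

definition tempered :: "distr \<Rightarrow> bool" where
  "tempered f \<longleftrightarrow> linear_fun_on schwartz_RT f \<and>
     (\<exists>C N. \<forall>\<phi>\<in>schwartz_RT.
        norm (f \<phi>) \<le> C * (\<Sum>m\<le>N. \<Sum>i\<le>N. \<Sum>j\<le>N. seminorm_RT m i j \<phi>))"

definition agree_on :: "real \<Rightarrow> real \<Rightarrow> distr \<Rightarrow> distr \<Rightarrow> bool" where
  "agree_on a b f g \<longleftrightarrow>
     (\<forall>\<phi>\<in>test_RT. (\<exists>c d. a < c \<and> d < b \<and> supp_within \<phi> c d) \<longrightarrow> f \<phi> = g \<phi>)"

text \<open>An iterated integral is used, since for weakly continuous functions of time the
  representatives at different times need not be jointly measurable.\<close>

definition distr_of :: "(real \<times> real \<Rightarrow> complex) \<Rightarrow> distr" where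
  "distr_of w \<phi> = (LINT t|lborel. LINT x|circle. w (t, x) * \<phi> (t, x))"

definition distr_of_real :: "(real \<Rightarrow> real \<Rightarrow> real) \<Rightarrow> distr" where
  "distr_of_real v = distr_of (\<lambda>(t, x). of_real (v t x))"

definition distr_dt :: "distr \<Rightarrow> distr" where
  "distr_dt f \<phi> = - f (dt \<phi>)"

definition distr_dx :: "distr \<Rightarrow> distr" where
  "distr_dx f \<phi> = - f (dx \<phi>)"


section \<open>Cutoffs and Fourier multipliers\<close>

definition cutoff :: "(real \<Rightarrow> real) \<Rightarrow> bool" where
  "cutoff \<psi> \<longleftrightarrow> smooth1 \<psi> \<and> (\<forall>x. \<psi> (- x) = \<psi> x) \<and> (\<forall>x. \<psi> x \<ge> 0) \<and>
     (\<forall>x. \<bar>x\<bar> > 3/2 \<longrightarrow> \<psi> x = 0) \<and> (\<forall>x. \<bar>x\<bar> \<le> 5/4 \<longrightarrow> \<psi> x = 1)"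

definition eta :: "(real \<Rightarrow> real) \<Rightarrow> nat \<Rightarrow> real \<Rightarrow> real" where
  "eta \<psi> k \<xi> = (if k = 0 then \<psi> \<xi>
     else \<psi> (2 powr (- real k) * \<xi>) - \<psi> (2 powr (- real k + 1) * \<xi>))"

definition mult_fun :: "(real \<Rightarrow> real) \<Rightarrow> (real \<times> real \<Rightarrow> complex) \<Rightarrow> real \<times> real \<Rightarrow> complex" where
  "mult_fun m \<phi> = (\<lambda>(t, x). infsum (\<lambda>\<xi>::int.
      of_real (m (of_int \<xi>)) * P0 (\<lambda>y. \<phi> (t, y) * cis (- of_int \<xi> * y)) * cis (of_int \<xi> * x)) UNIV)"

text \<open>The multiplier on distributions, by duality: the transpose of the operator with symbol
  \<open>m \<xi>\<close> has symbol \<open>m (- \<xi>)\<close>.\<close>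

definition mult_distr :: "(real \<Rightarrow> real) \<Rightarrow> distr \<Rightarrow> distr" where
  "mult_distr m f \<phi> = f (mult_fun (\<lambda>\<xi>. m (- \<xi>)) \<phi>)"

definition Delta :: "(real \<Rightarrow> real) \<Rightarrow> nat \<Rightarrow> distr \<Rightarrow> distr" where
  "Delta \<psi> k = mult_distr (eta \<psi> k)"


section \<open>The function spaces\<close>

text \<open>The parameter \<open>\<sigma>\<close> is \<open>1\<close> for the upper (defocusing) sign and \<open>-1\<close> for the lower one.\<close>

definition qsym :: "real \<Rightarrow> (real \<Rightarrow> real) \<Rightarrow> int \<Rightarrow> real" where
  "qsym \<sigma> u0 \<xi> = of_int \<xi> ^ 3 + \<sigma> * 6 * P0 (\<lambda>x. (u0 x)^2) * of_int \<xi>"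

text \<open>The space-time Fourier transform
  $\hat f(\tau,\xi) = \int\int f(t,x) e^{-i(t\tau + x\xi)}$ of a tempered distribution; for each
  integer frequency it is a distribution in $\tau$, defined by duality.\<close>

definition fourier_st :: "distr \<Rightarrow> int \<Rightarrow> (real \<Rightarrow> complex) \<Rightarrow> complex" where
  "fourier_st f \<xi> \<theta> =
     f (\<lambda>(t, x). (LINT \<tau>|lborel. \<theta> \<tau> * cis (- t * \<tau>)) * cis (- of_int \<xi> * x))"

definition test_R :: "(real \<Rightarrow> complex) set" where
  "test_R = {\<theta>. smooth1 \<theta> \<and> (\<exists>R. \<forall>t. \<bar>t\<bar> > R \<longrightarrow> \<theta> t = 0)}"

definition esqrt :: "ennreal \<Rightarrow> ennreal" where
  "esqrt x = (if x = top then top else ennreal (sqrt (enn2real x)))"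

text \<open>The $L^2(\mathbb{R}\times\mathbb{Z})$ norm of a family \<open>h\<close> of distributions in $\tau$, indexed
  by $\xi$. The density \<open>g\<close> is unique up to null sets; if there is none, the infimum is
  infinite.\<close>

definition L2_RZ_norm :: "(int \<Rightarrow> (real \<Rightarrow> complex) \<Rightarrow> complex) \<Rightarrow> ennreal" where
  "L2_RZ_norm h =
     (INF g \<in> {g :: int \<Rightarrow> real \<Rightarrow> complex. (\<forall>\<xi>. g \<xi> \<in> borel_measurable borel) \<and>
                 (\<forall>\<xi>. \<forall>\<theta>\<in>test_R. h \<xi> \<theta> = (LINT \<tau>|lborel. g \<xi> \<tau> * \<theta> \<tau>))}.
        esqrt (\<integral>\<^sup>+ \<xi>. (\<integral>\<^sup>+ \<tau>. ennreal ((norm (g \<xi> \<tau>))^2) \<partial>lborel) \<partial>count_space UNIV))"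

definition X_norm :: "(real \<Rightarrow> real) \<Rightarrow> (int \<Rightarrow> real) \<Rightarrow> real \<Rightarrow> distr \<Rightarrow> ennreal" where
  "X_norm \<psi> q b f = (\<Sum>j. ennreal (2 powr (real j * b)) *
     L2_RZ_norm (\<lambda>\<xi> \<theta>. fourier_st f \<xi> (\<lambda>\<tau>. of_real (eta \<psi> j (\<tau> - q \<xi>)) * \<theta> \<tau>)))"

definition Fk_norm ::
  "(real \<Rightarrow> real) \<Rightarrow> (int \<Rightarrow> real) \<Rightarrow> real \<Rightarrow> nat \<Rightarrow> real \<Rightarrow> distr \<Rightarrow> ennreal" where
  "Fk_norm \<psi> q b k t0 f =
     (INF g \<in> {g. tempered g \<and> agree_on (t0 - 2 powr (- real k)) (t0 + 2 powr (- real k)) g f}.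
        X_norm \<psi> q b g)"

definition F_space :: "(real \<Rightarrow> real) \<Rightarrow> (int \<Rightarrow> real) \<Rightarrow> real \<Rightarrow> real \<Rightarrow> distr set" where
  "F_space \<psi> q s b = {f. distribution f \<and>
     (\<Sum>k. (SUP t. ennreal (2 powr (real k * s)) * Fk_norm \<psi> q b k t (Delta \<psi> k f))^2) < top}"


section \<open>Weak and smooth solutions\<close>

text \<open>\<open>c \<xi>\<close> is the \<open>\<xi>\<close>-th spatial Fourier coefficient of the distribution \<open>u\<close>, as a locally
  $L^3$ function of time.\<close>

definition fourier_modes :: "distr \<Rightarrow> (int \<Rightarrow> real \<Rightarrow> complex) \<Rightarrow> bool" where
  "fourier_modes u c \<longleftrightarrow> (\<forall>\<xi>. c \<xi> \<in> borel_measurable borel \<and>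
     (\<forall>R. set_integrable lborel {- R..R} (\<lambda>t. (norm (c \<xi> t))^3)) \<and>
     (\<forall>\<theta>\<in>test_R. u (\<lambda>(t, x). \<theta> t * cis (- of_int \<xi> * x)) / of_real (2 * pi)
                  = (LINT t|lborel. c \<xi> t * \<theta> t)))"

definition S_fun ::
  "(real \<Rightarrow> real) \<Rightarrow> nat \<Rightarrow> (int \<Rightarrow> real \<Rightarrow> complex) \<Rightarrow> real \<times> real \<Rightarrow> complex" where
  "S_fun \<psi> n c = (\<lambda>(t, x). infsum (\<lambda>\<xi>::int.
      of_real (\<psi> (2 powr (- real n) * of_int \<xi>)) * c \<xi> t * cis (of_int \<xi> * x)) UNIV)"

definition nonlin :: "(real \<times> real \<Rightarrow> complex) \<Rightarrow> real \<times> real \<Rightarrow> complex" where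
  "nonlin w = (\<lambda>(t, x). 6 * ((w (t, x))^2 - P0 (\<lambda>y. (w (t, y))^2)) * dx w (t, x))"

text \<open>\<open>is_N \<psi> u L\<close>: the nonlinear term of \<open>u\<close> exists and is the distribution \<open>L\<close>.\<close>

definition is_N :: "(real \<Rightarrow> real) \<Rightarrow> distr \<Rightarrow> distr \<Rightarrow> bool" where
  "is_N \<psi> u L \<longleftrightarrow> distribution L \<and> (\<exists>c. fourier_modes u c \<and>
     (\<forall>\<phi>\<in>test_RT. (\<lambda>n. distr_of (nonlin (S_fun \<psi> n c)) \<phi>) \<longlonglongrightarrow> L \<phi>))"

definition weak_solution ::
  "(real \<Rightarrow> real) \<Rightarrow> real \<Rightarrow> (real \<Rightarrow> real) \<Rightarrow> (real \<Rightarrow> real \<Rightarrow> real) \<Rightarrow> bool" where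
  "weak_solution \<psi> \<sigma> v0 v \<longleftrightarrow>
     v \<in> Cw_L2T \<and>
     distr_of_real v \<in> F_space \<psi> (qsym \<sigma> v0) (- (2 powr (-6))) (15/32) \<and>
     (AE x in circle. v 0 x = v0 x) \<and>
     (\<exists>L. is_N \<psi> (distr_of_real v) L \<and>
        (\<forall>\<phi>\<in>test_RT.
           distr_dt (distr_of_real v) \<phi>
           + distr_dx (distr_dx (distr_dx (distr_of_real v))) \<phi>
           - of_real \<sigma> * L \<phi>
           - of_real (\<sigma> * 6 * P0 (\<lambda>x. (v0 x)^2)) * distr_dx (distr_of_real v) \<phi> = 0))"

definition smooth_solution :: "real \<Rightarrow> (real \<Rightarrow> real) \<Rightarrow> (real \<Rightarrow> real \<Rightarrow> real) \<Rightarrow> bool" where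
  "smooth_solution \<sigma> u0 u \<longleftrightarrow> u \<in> C_Hinf \<and> u 0 = u0 \<and>
     (\<forall>t x. ((\<lambda>s. u s x) has_vector_derivative
        (\<sigma> * 6 * (u t x)^2 * vderiv (u t) x - (vderiv ^^ 3) (u t) x)) (at t))"

text \<open>\<open>\<Phi>\<close> is a continuous map from $L^2$ to $C(\mathbb{R};L^2)$, the latter with locally uniform
  convergence in time, that sends every smooth datum to the smooth defocusing solution. By
  density of the smooth data it is unique, up to equality almost everywhere.\<close>

definition defocusing_flow_extension ::
  "((real \<Rightarrow> real) \<Rightarrow> real \<Rightarrow> real \<Rightarrow> real) \<Rightarrow> bool" where
  "defocusing_flow_extension \<Phi> \<longleftrightarrow>
     (\<forall>u0\<in>L2T. \<Phi> u0 \<in> C_L2T) \<and>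
     (\<forall>u0\<in>L2T. \<forall>R. \<forall>\<epsilon>>0. \<exists>\<delta>>0. \<forall>w0\<in>L2T. L2T_norm (\<lambda>x. w0 x - u0 x) < \<delta> \<longrightarrow>
        (\<forall>t\<in>{- R..R}. L2T_norm (\<lambda>x. \<Phi> w0 t x - \<Phi> u0 t x) < \<epsilon>)) \<and>
     (\<forall>u0\<in>Hinf. \<exists>u. smooth_solution 1 u0 u \<and> (\<forall>t. AE x in circle. \<Phi> u0 t x = u t x))"

end

theory Submission
 imports Defs
begin

text \<open>The profiles $v_\xi(t) = e^{-iq(\xi)t}\hat u(t,\xi)$ solve
 $v_\xi' = -6i\sigma\xi v_\xi^2 v_{-\xi} + 2i\sigma\xi\sum e^{i\Omega t} v_k v_l v_m$, where $k + l + m = \xi$,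
 $k, l, m \ne \xi$ and $\Omega = -3(\xi-k)(\xi-l)(\xi-m)$. A bound of $u$ in $L^2$ alone gives
 $\sum_\xi \langle\xi\rangle^{-2\kappa}|v_\xi(t) - v_\xi(s)|^2 \le M^2|t-s|^{2\beta}$ with $\beta = 1/2 + a$,
 $\kappa = 1/2 + 4a$ and $a = 1/256$: the oscillating integrals are Young integrals, summed over dyadic
 partitions, and gaining the factor $|\Omega|^{-(1+a)/2}$ makes the sums over $k$ and $l$ converge. This
 estimate makes the approximations compact, it makes the truncated nonlinear terms converge one frequency
 at a time, and by Plancherel's theorem it bounds the norms of the function spaces. The solutions in (i) are
 limits of Galerkin approximations, those in (ii) of truncations of smooth solutions.\<close>

text \<open>The exponents arise as follows. An oscillating factor integrated against an increment of
  the profiles yields the time exponent 1 - (1+a)/2 + beta = 1 + a/2, just above 1, so the dyadic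
  sums converge. The loss in the function spaces exceeds 3a/(1+2a) = 1/86 and has to stay below
  1/64, which limits a.

  The obstacle is that the resonant term and the increments lose powers of |xi|. Over a time step h
  this is affordable only while h|xi| is small; beyond that, the weight |xi|^(-kappa) and the L2
  bound alone give h^beta. The outcome is a small factor in front of the Hoelder constant, enough
  for absorption but not for a contraction, so solutions come from compactness. The profile equation
  is allowed an error so that Euler polygons and truncated smooth solutions are treated
  alike.\<close>

abbreviation lims :: "(nat => 'a::topological_space) => 'a => bool" (infix "---->" 60) where
 "X ----> L \<equiv> X \<longlonglongrightarrow> L"

abbreviation mag :: "int => real" where "mag k \<equiv> \<bar>real_of_int k\<bar>"

section \<open>Counting estimates for the cubic interaction\<close>

text \<open>The exponent is 1 + a. Twice the one-sided series bounds every finite sum of |m|^(-1-a)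
  over the integers; the summand 1 makes the constant at least 1, so that its square root can be
  replaced by the constant itself.\<close>

definition zeta0 :: real where
 "zeta0 = 1 + 2 * (\<Sum>n. real n powr (-(257/256)))"

lemma zeta0_pos: "zeta0 > 0"
proof -
 have "(\<Sum>n. real n powr (-(257/256))) >= 0" by (rule suminf_nonneg) (simp_all add: summable_real_powr_iff)
 then show ?thesis by (simp add: zeta0_def)
qed

lemma sum_int_powr_le:
 assumes "finite F"
 shows "(\<Sum>m\<in>F. mag m powr (-(257/256))) <= zeta0"
proof -
 let ?g = "%n::nat. real n powr (-(257/256))"
 have s: "summable ?g" by (simp add: summable_real_powr_iff)
 obtain N :: nat where N: "!!m. m \<in> F ==> \<bar>m\<bar> <= int N" proof -
  have "\<bar>m\<bar> <= int (nat (\<Sum>m\<in>F. \<bar>m\<bar>))" if "m \<in> F" for m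
   using member_le_sum[OF that, of abs] assms by simp
  then show ?thesis using that by blast
 qed
 have sub: "F \<subseteq> int ` {..N} \<union> (%n. - int n) ` {..N}" proof
  fix m assume "m \<in> F"
  then have "\<bar>m\<bar> <= int N" by (rule N)
  then show "m \<in> int ` {..N} \<union> (%n. - int n) ` {..N}" by (cases m rule: int_cases2) auto
 qed
 have "(\<Sum>m\<in>F. mag m powr (-(257/256)))
   <= (\<Sum>m\<in>int ` {..N} \<union> (%n. - int n) ` {..N}. mag m powr (-(257/256)))"
  by (rule sum_mono2) (use sub in auto)
 also have "... <= (\<Sum>m\<in>int ` {..N}. mag m powr (-(257/256)))
   + (\<Sum>m\<in>(%n. - int n) ` {..N}. mag m powr (-(257/256)))"
  by (subst sum.union_inter[symmetric]) (auto intro!: sum_nonneg)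
 also have "... = 2 * (\<Sum>n\<le>N. ?g n)" by (subst (1 2) sum.reindex) (auto simp: inj_on_def)
 also have "... <= 2 * (\<Sum>n. ?g n)" using sum_le_suminf[OF s, of "{..N}"] by simp
 finally show ?thesis by (simp add: zeta0_def)
qed

text \<open>The exponent is (1+a)/2: one of the three factors of |Omega|^(-(1+a)/2). Its square is
  summable, which is what every use of Cauchy-Schwarz below relies on. The value at 0 is 0.\<close>

definition pw :: "int => real" where
 "pw m = mag m powr (-(257/512))"

lemma pw_nonneg [simp]: "pw m >= 0" by (simp add: pw_def)

lemma pw_sq: "(pw m)^2 = mag m powr (-(257/256))" by (simp add: pw_def power2_eq_square flip: powr_add)

lemma sum_pw_sq_le: "finite F ==> (\<Sum>m\<in>F. (pw m)^2) <= zeta0" by (simp add: pw_sq sum_int_powr_le)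

definition conv3 :: "int set => int => (int \<times> int) set" where
 "conv3 K xi = {(k, l). k \<in> K \<and> l \<in> K \<and> xi - k - l \<in> K}"

text \<open>With m = xi - k - l the last condition says m ~= xi. These are the triples whose phase
  \<open>om\<close> does not vanish.\<close>

definition nres :: "int set => int => (int \<times> int) set" where
 "nres K xi = {(k, l). (k, l) \<in> conv3 K xi \<and> k ~= xi \<and> l ~= xi \<and> k + l ~= 0}"

lemma conv3_subset: "conv3 K xi \<subseteq> K \<times> K" by (auto simp: conv3_def)

lemma finite_conv3 [simp]: "finite K ==> finite (conv3 K xi)" by (rule finite_subset[OF conv3_subset]) simp

lemma nres_subset: "nres K xi \<subseteq> conv3 K xi" by (auto simp: nres_def)

lemma finite_nres [simp]: "finite K ==> finite (nres K xi)" by (rule finite_subset[OF nres_subset]) simp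

text \<open>The three numbers xi - k, xi - l and k + l = xi - m add up to 2 xi. This identity is
  behind all case distinctions that compare \<open>dmax\<close> with |xi|.\<close>

definition dmax :: "int => int => int => real" where
 "dmax xi k l = real_of_int (max \<bar>xi - k\<bar> (max \<bar>xi - l\<bar> \<bar>k + l\<bar>))"

abbreviation pw3 :: "int => int => int => real" where
 "pw3 xi k l \<equiv> pw (xi - k) * pw (xi - l) * pw (k + l)"

abbreviation pws :: "int => int => int => real" where
 "pws xi k l \<equiv> pw (xi - k) + pw (xi - l) + pw (k + l)"

abbreviation nhi :: "int set => int => real => (int \<times> int) set" where
 "nhi K xi d \<equiv> {(k, l)\<in>nres K xi. dmax xi k l >= d}"

abbreviation nlo :: "int set => int => real => (int \<times> int) set" where
 "nlo K xi d \<equiv> {(k, l)\<in>nres K xi. dmax xi k l <= d}"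

section \<open>Weighted trilinear sums\<close>

definition wgt :: "real => int => int => int => real" where
 "wgt rho xi k l = pw3 xi k l * dmax xi k l powr rho"

lemma wgt_nonneg [simp]: "wgt rho xi k l >= 0" by (simp add: wgt_def)

abbreviation wsum :: "real => (int \<times> int) set => int => (int => real) => (int => real) => (int => real) => real" where
 "wsum rho S xi f g h \<equiv> \<Sum>(k, l)\<in>S. wgt rho xi k l * f k * g l * h (xi - k - l)"

lemma sum_conv3_swap:
 "(\<Sum>(k, l)\<in>conv3 K xi. h k l (xi - k - l)) = (\<Sum>(k, l)\<in>conv3 K xi. h l k (xi - k - l))"
 by (rule sum.reindex_bij_witness[of _ "%(k, l). (l, k)" "%(k, l). (l, k)"]) (auto simp: conv3_def algebra_simps)

lemma sum_conv3_rot: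
 "(\<Sum>(k, l)\<in>conv3 K xi. h k l (xi - k - l)) = (\<Sum>(k, l)\<in>conv3 K xi. h (xi - k - l) l k)"
 by (rule sum.reindex_bij_witness[of _ "%(k, l). (xi - k - l, l)" "%(k, l). (xi - k - l, l)"])
  (auto simp: conv3_def algebra_simps)

text \<open>Young's inequality with exponents 1, 2, 2: for fixed k, Cauchy-Schwarz in l, where l ->
  xi - k - l is injective.\<close>

lemma sum_conv3_le:
 assumes K: "finite K" and nn: "!!k. g k >= 0" "!!k. f k >= 0" "!!k. h k >= (0::real)"
 shows "(\<Sum>(k, l)\<in>conv3 K xi. g k * f l * h (xi - k - l)) <= (\<Sum>k\<in>K. g k) * L2_set f K * L2_set h K"
proof -
 have eq: "conv3 K xi = Sigma K (%k. {l\<in>K. xi - k - l \<in> K})" by (auto simp: conv3_def)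
 have "(\<Sum>(k, l)\<in>conv3 K xi. g k * f l * h (xi - k - l))
   = (\<Sum>k\<in>K. \<Sum>l\<in>{l\<in>K. xi - k - l \<in> K}. g k * f l * h (xi - k - l))"
  unfolding eq by (subst sum.Sigma) (use K in auto)
 also have "... <= (\<Sum>k\<in>K. g k * (L2_set f K * L2_set h K))" proof (rule sum_mono)
  fix k assume "k \<in> K"
  let ?S = "{l\<in>K. xi - k - l \<in> K}"
  have "(\<Sum>l\<in>?S. f l * h (xi - k - l)) <= L2_set f ?S * L2_set (%l. h (xi - k - l)) ?S"
   using L2_set_mult_ineq[of f "%l. h (xi - k - l)" ?S] nn by simp
  also have "... <= L2_set f K * L2_set h K" proof (rule mult_mono)
   show "L2_set f ?S <= L2_set f K" unfolding L2_set_def by (rule real_sqrt_le_mono, rule sum_mono2) (use K in auto)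
   have "(\<Sum>l\<in>?S. (h (xi - k - l))^2) = (\<Sum>l\<in>(%l. xi - k - l) ` ?S. (h l)^2)"
    by (subst sum.reindex) (auto simp: inj_on_def)
   also have "... <= (\<Sum>l\<in>K. (h l)^2)" by (rule sum_mono2) (use K in auto)
   finally show "L2_set (%l. h (xi - k - l)) ?S <= L2_set h K" unfolding L2_set_def by (rule real_sqrt_le_mono)
  qed auto
  finally have "g k * (\<Sum>l\<in>?S. f l * h (xi - k - l)) <= g k * (L2_set f K * L2_set h K)"
   using nn by (intro mult_left_mono) auto
  then show "(\<Sum>l\<in>?S. g k * f l * h (xi - k - l)) <= g k * (L2_set f K * L2_set h K)"
   by (simp add: sum_distrib_left mult.assoc)
 qed
 finally show ?thesis by (simp add: sum_distrib_right mult.assoc)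
qed

lemma sum_pw_le:
 assumes K: "finite K" and nn: "!!k. f k >= (0::real)"
 shows "(\<Sum>k\<in>K. pw (xi - k) * f k) <= sqrt zeta0 * L2_set f K"
proof -
 have "(\<Sum>k\<in>K. pw (xi - k) * f k) <= L2_set (%k. pw (xi - k)) K * L2_set f K"
  using L2_set_mult_ineq[of "%k. pw (xi - k)" f K] nn by simp
 also have "... <= sqrt zeta0 * L2_set f K" proof (rule mult_right_mono)
  have "(\<Sum>k\<in>K. (pw (xi - k))^2) = (\<Sum>m\<in>(%k. xi - k) ` K. (pw m)^2)"
   by (subst sum.reindex) (auto simp: inj_on_def)
  also have "... <= zeta0" using K by (intro sum_pw_sq_le) auto
  finally show "L2_set (%k. pw (xi - k)) K <= sqrt zeta0" unfolding L2_set_def by (rule real_sqrt_le_mono)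
 qed auto
 finally show ?thesis .
qed

lemma pw_mono: "[|0 < d; d <= mag m|] ==> pw m <= d powr (-(257/512))" unfolding pw_def by (rule powr_mono2') auto

lemma pw_pair_le:
 assumes "0 < d" "3 / 8 * d <= mag m" "3 / 8 * d <= mag n"
 shows "pw m * pw n <= 8 * d powr (-(257/256))"
proof -
 have "pw m * pw n <= (3/8*d) powr (-(257/512)) * (3/8*d) powr (-(257/512))"
  using assms by (intro mult_mono pw_mono) auto
 also have "... = (3/8) powr (-(257/256)) * d powr (-(257/256))"
  using assms by (subst (1 2) powr_mult) (auto simp: mult_ac simp flip: powr_add)
 also have "(3/8) powr (-(257/256)) <= (3/8::real) powr (-2)" by (rule powr_mono') auto
 also have "(3/8::real) powr (-2) <= 8" by (simp add: powr_minus_divide power2_eq_square)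
 finally show ?thesis using assms by (simp add: mult_right_mono)
qed

text \<open>The three differences add up to 2 xi, so if the largest one, d, is at least 8|xi|, the
  other two have sizes adding up to at least 3/4 d. Hence two of them are at least 3/8 d and
  together give d^(-1-a). The third factor is bounded by the sum of all three, which avoids
  recording which one it is.\<close>

lemma wgt_high_le:
 assumes D: "dmax xi k l >= 8 * mag xi" "dmax xi k l > 0"
 shows "wgt rho xi k l <= 8 * dmax xi k l powr (rho - 257/256)
   * pws xi k l"
proof -
 define d where "d = dmax xi k l"
 define a b c where "a = mag (xi - k)" "b = mag (xi - l)" "c = mag (k + l)"
 have d: "d = max a (max b c)" unfolding d_def dmax_def a_b_c_def by (simp only: of_int_max of_int_abs)
 have tri: "a <= b + c + 2 * mag xi" "b <= a + c + 2 * mag xi"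
   "c <= a + b + 2 * mag xi" unfolding a_b_c_def by auto
 have D': "8 * mag xi <= d" "d > 0" using D by (auto simp: d_def)
 have "(3/8*d <= a \<and> 3/8*d <= b) \<or> (3/8*d <= a \<and> 3/8*d <= c) \<or> (3/8*d <= b \<and> 3/8*d <= c)" proof -
  have "d = a \<or> d = b \<or> d = c" using d by auto
  moreover have "3/8*d <= a \<or> 3/8*d <= b" "3/8*d <= a \<or> 3/8*d <= c" "3/8*d <= b \<or> 3/8*d <= c"
   using tri D' d by linarith+
  ultimately show ?thesis by blast
 qed
 then have "pw3 xi k l <= 8 * d powr (-(257/256))
   * pws xi k l" proof (elim disjE conjE)
  assume "3/8*d <= a" "3/8*d <= b"
  then have "pw (xi - k) * pw (xi - l) <= 8 * d powr (-(257/256))" using D' by (intro pw_pair_le) (auto simp: a_b_c_def)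
  then have "pw3 xi k l <= 8 * d powr (-(257/256)) * pw (k+l)" by (rule mult_right_mono) simp
  also have "... <= 8 * d powr (-(257/256)) * pws xi k l" by (rule mult_left_mono) auto
  finally show ?thesis .
 next
  assume "3/8*d <= a" "3/8*d <= c"
  then have "pw (xi - k) * pw (k + l) <= 8 * d powr (-(257/256))" using D' by (intro pw_pair_le) (auto simp: a_b_c_def)
  then have "pw (xi - k) * pw (k + l) * pw (xi - l) <= 8 * d powr (-(257/256)) * pw (xi - l)"
   by (rule mult_right_mono) simp
  also have "... <= 8 * d powr (-(257/256)) * pws xi k l" by (rule mult_left_mono) auto
  finally show ?thesis by (simp add: mult_ac)
 next
  assume "3/8*d <= b" "3/8*d <= c"
  then have "pw (xi - l) * pw (k + l) <= 8 * d powr (-(257/256))" using D' by (intro pw_pair_le) (auto simp: a_b_c_def)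
  then have "pw (xi - l) * pw (k + l) * pw (xi - k) <= 8 * d powr (-(257/256)) * pw (xi - k)"
   by (rule mult_right_mono) simp
  also have "... <= 8 * d powr (-(257/256)) * pws xi k l" by (rule mult_left_mono) auto
  finally show ?thesis by (simp add: mult_ac)
 qed
 then have "wgt rho xi k l <= 8 * d powr (-(257/256))
   * pws xi k l * d powr rho" unfolding wgt_def d_def[symmetric] by (rule mult_right_mono) simp
 also have "... = 8 * (d powr rho * d powr (-(257/256))) * pws xi k l" by (simp add: algebra_simps)
 finally show ?thesis by (simp add: d_def flip: powr_add)
qed

text \<open>The factor \<open>pw\<close> left over by \<open>wgt_high_le\<close> is attached to the
  function at the same frequency, which becomes summable by Cauchy-Schwarz, while the other two
  functions stay in l2. Swap and rotation bring that frequency to the first place. The constant is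
  24 = 3 * 8.\<close>

lemma trilinear_high:
 assumes K: "finite K" and nn: "!!k. f k >= 0" "!!k. g k >= 0" "!!k. h k >= (0::real)"
  and D0: "D0 >= 8 * mag xi" "D0 > 0" and rho: "rho <= 257/256"
 shows "wsum rho ((nhi K xi D0)) xi f g h
   <= 24 * sqrt zeta0 * D0 powr (rho - 257/256) * (L2_set f K * L2_set g K * L2_set h K)"
proof -
 let ?c = "8 * D0 powr (rho - 257/256)"
 let ?P = "L2_set f K * L2_set g K * L2_set h K"
 let ?T = "(nhi K xi D0)"
 have "wsum rho ?T xi f g h
   <= (\<Sum>(k, l)\<in>?T. ?c * (pw (xi - k) * f k * g l * h (xi - k - l)
     + pw (xi - l) * f k * g l * h (xi - k - l)
     + pw (xi - (xi - k - l)) * f k * g l * h (xi - k - l)))" proof (rule sum_mono, clarify)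
  fix k l assume kl: "dmax xi k l >= D0"
  have "wgt rho xi k l <= 8 * dmax xi k l powr (rho - 257/256) * pws xi k l" using kl D0 by (intro wgt_high_le) auto
  also have "... <= ?c * pws xi k l" using kl D0 rho by (intro mult_right_mono mult_left_mono powr_mono2') auto
  finally have "wgt rho xi k l * (f k * g l * h (xi - k - l))
    <= ?c * pws xi k l * (f k * g l * h (xi - k - l))" using nn by (intro mult_right_mono) auto
  then show "wgt rho xi k l * f k * g l * h (xi - k - l) <= ?c * (pw (xi - k) * f k * g l * h (xi - k - l)
     + pw (xi - l) * f k * g l * h (xi - k - l)
     + pw (xi - (xi - k - l)) * f k * g l * h (xi - k - l))" by (simp add: algebra_simps)
 qed
 also have "... <= (\<Sum>(k, l)\<in>conv3 K xi. ?c * (pw (xi - k) * f k * g l * h (xi - k - l)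
     + pw (xi - l) * f k * g l * h (xi - k - l)
     + pw (xi - (xi - k - l)) * f k * g l * h (xi - k - l)))"
  by (rule sum_mono2) (use K nn in \<open>auto simp: nres_def intro!: mult_nonneg_nonneg add_nonneg_nonneg\<close>)
 also have "... = ?c * ((\<Sum>(k, l)\<in>conv3 K xi. pw (xi - k) * f k * g l * h (xi - k - l))
    + (\<Sum>(k, l)\<in>conv3 K xi. pw (xi - l) * f k * g l * h (xi - k - l))
    + (\<Sum>(k, l)\<in>conv3 K xi. pw (xi - (xi - k - l)) * f k * g l * h (xi - k - l)))"
  by (simp add: sum.distrib sum_distrib_left case_prod_unfold distrib_left)
 also have "... <= ?c * (sqrt zeta0 * ?P + sqrt zeta0 * ?P + sqrt zeta0 * ?P)" proof (intro mult_left_mono add_mono)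
 show "(\<Sum>(k, l)\<in>conv3 K xi. pw (xi - k) * f k * g l * h (xi - k - l)) <= sqrt zeta0 * ?P" proof -
  have "(\<Sum>(k, l)\<in>conv3 K xi. pw (xi - k) * f k * g l * h (xi - k - l))
    <= (\<Sum>k\<in>K. pw (xi - k) * f k) * L2_set g K * L2_set h K" by (rule sum_conv3_le) (use K nn in auto)
  also have "... <= sqrt zeta0 * L2_set f K * L2_set g K * L2_set h K"
   using K nn by (intro mult_right_mono sum_pw_le) auto
  finally show ?thesis by (simp add: mult_ac)
 qed
 show "(\<Sum>(k, l)\<in>conv3 K xi. pw (xi - l) * f k * g l * h (xi - k - l)) <= sqrt zeta0 * ?P" proof -
  have "(\<Sum>(k, l)\<in>conv3 K xi. pw (xi - l) * f k * g l * h (xi - k - l))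
    = (\<Sum>(k, l)\<in>conv3 K xi. pw (xi - k) * g k * f l * h (xi - k - l))"
   by (subst sum_conv3_swap[of "%k l m. pw (xi - l) * f k * g l * h m"]) (simp add: mult_ac)
  also have "... <= (\<Sum>k\<in>K. pw (xi - k) * g k) * L2_set f K * L2_set h K"
   by (rule sum_conv3_le) (use K nn in auto)
  also have "... <= sqrt zeta0 * L2_set g K * L2_set f K * L2_set h K"
   using K nn by (intro mult_right_mono sum_pw_le) auto
  finally show ?thesis by (simp add: mult_ac)
 qed
 show "(\<Sum>(k, l)\<in>conv3 K xi. pw (xi - (xi - k - l)) * f k * g l * h (xi - k - l)) <= sqrt zeta0 * ?P" proof -
  have "(\<Sum>(k, l)\<in>conv3 K xi. pw (xi - (xi - k - l)) * f k * g l * h (xi - k - l))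
    = (\<Sum>(k, l)\<in>conv3 K xi. pw (xi - k) * h k * g l * f (xi - k - l))"
   by (subst sum_conv3_rot[of "%k l m. pw (xi - m) * f k * g l * h m"]) (simp add: mult_ac)
  also have "... <= (\<Sum>k\<in>K. pw (xi - k) * h k) * L2_set g K * L2_set f K"
   by (rule sum_conv3_le) (use K nn in auto)
  also have "... <= sqrt zeta0 * L2_set h K * L2_set g K * L2_set f K"
   using K nn by (intro mult_right_mono sum_pw_le) auto
  finally show ?thesis by (simp add: mult_ac)
 qed
 qed simp
 finally show ?thesis by (simp add: algebra_simps)
qed

text \<open>One of the three differences is at least 2/3 |xi|, since they add up to 2 xi; its square
  yields 3 |xi|^(-1-a). The other two determine (k, l), so their squares are summed independently,
  each sum being at most \<open>zeta0\<close>.\<close>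

lemma sum_pw3_le:
 assumes K: "finite K" and xi: "xi ~= 0"
 shows "(\<Sum>(k, l)\<in>nres K xi. (pw3 xi k l)^2)
   <= 9 * zeta0^2 * mag xi powr (-(257/256))"
proof -
 let ?q = "%m. (pw m)^2"
 let ?x = "mag xi"
 let ?e = "3 * ?x powr (-(257/256))"
 have big: "?q m <= ?e" if "2/3 * ?x <= mag m" for m proof -
  have "?q m <= (2/3 * ?x) powr (-(257/256))" unfolding pw_sq using that xi by (intro powr_mono2') auto
  also have "... = (2/3) powr (-(257/256)) * ?x powr (-(257/256))" by (subst powr_mult) auto
  also have "(2/3) powr (-(257/256)) <= (2/3::real) powr (-2)" by (rule powr_mono') auto
  also have "(2/3::real) powr (-2) <= 3" by (simp add: powr_minus_divide power2_eq_square)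
  finally show ?thesis by (simp add: mult_right_mono)
 qed
 have prod2: "(\<Sum>(k, l)\<in>nres K xi. ?q (u k l) * ?q (v k l)) <= zeta0^2"
  if inj: "inj (%(k, l). (u k l, v k l))" for u v proof -
  let ?F = "(%(k, l). (u k l, v k l)) ` nres K xi"
  have fin: "finite ?F" using K by simp
  have "(\<Sum>(k, l)\<in>nres K xi. ?q (u k l) * ?q (v k l)) = (\<Sum>(m, n)\<in>?F. ?q m * ?q n)"
   by (subst sum.reindex) (use inj in \<open>auto simp: case_prod_unfold intro: inj_on_subset\<close>)
  also have "... <= (\<Sum>(m, n)\<in>fst ` ?F \<times> snd ` ?F. ?q m * ?q n)"
   by (rule sum_mono2) (use fin in \<open>auto simp: image_iff\<close>, force+)
  also have "... = (\<Sum>m\<in>fst ` ?F. ?q m) * (\<Sum>n\<in>snd ` ?F. ?q n)"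
   by (simp add: sum_product sum.cartesian_product)
  also have "... <= zeta0 * zeta0" using fin zeta0_pos by (intro mult_mono sum_pw_sq_le sum_nonneg) auto
  finally show ?thesis by (simp add: power2_eq_square)
 qed
 have "(\<Sum>(k, l)\<in>nres K xi. (pw3 xi k l)^2)
   <= (\<Sum>(k, l)\<in>nres K xi. ?e * (?q (xi - k) * ?q (xi - l) + ?q (xi - k) * ?q (k + l) + ?q (xi - l) * ?q (k + l)))"
 proof (rule sum_mono, clarify)
  fix k l
  let ?A = "?q (xi - k)" and ?B = "?q (xi - l)" and ?C = "?q (k + l)"
  have "2/3 * ?x <= mag (xi - k) \<or> 2/3 * ?x <= mag (xi - l) \<or> 2/3 * ?x <= mag (k + l)"
   unfolding of_int_diff of_int_add by linarith
  then consider "?A <= ?e" | "?B <= ?e" | "?C <= ?e" using big by blast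
  then have "?A * ?B * ?C <= ?e * (?A * ?B + ?A * ?C + ?B * ?C)" proof cases
   case 1
   then have "?A * (?B * ?C) <= ?e * (?B * ?C)" by (intro mult_right_mono) auto
   also have "... <= ?e * (?A * ?B + ?A * ?C + ?B * ?C)" by (intro mult_left_mono) auto
   finally show ?thesis by (simp add: mult_ac)
  next
   case 2
   then have "?B * (?A * ?C) <= ?e * (?A * ?C)" by (intro mult_right_mono) auto
   also have "... <= ?e * (?A * ?B + ?A * ?C + ?B * ?C)" by (intro mult_left_mono) auto
   finally show ?thesis by (simp add: mult_ac)
  next
   case 3
   then have "?C * (?A * ?B) <= ?e * (?A * ?B)" by (intro mult_right_mono) auto
   also have "... <= ?e * (?A * ?B + ?A * ?C + ?B * ?C)" by (intro mult_left_mono) auto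
   finally show ?thesis by (simp add: mult_ac)
  qed
  then show "(pw3 xi k l)^2 <= ?e * (?A * ?B + ?A * ?C + ?B * ?C)" by (simp add: power_mult_distrib)
 qed
 also have "... = ?e * ((\<Sum>(k, l)\<in>nres K xi. ?q (xi - k) * ?q (xi - l))
   + (\<Sum>(k, l)\<in>nres K xi. ?q (xi - k) * ?q (k + l)) + (\<Sum>(k, l)\<in>nres K xi. ?q (xi - l) * ?q (k + l)))"
  by (simp add: sum.distrib sum_distrib_left case_prod_unfold distrib_left)
 also have "... <= ?e * (zeta0^2 + zeta0^2 + zeta0^2)" by (intro mult_left_mono add_mono prod2) (auto simp: inj_def)
 finally show ?thesis by (simp add: algebra_simps)
qed

text \<open>Here dmax^rho costs no more than 8 |xi|^rho, and Cauchy-Schwarz separates the weights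
  from the functions. The sum over (k, l) on the right is kept because it is still to be summed over
  xi. The constant is 576 = 8^2 * 9.\<close>

lemma trilinear_low:
 assumes K: "finite K" and nn: "!!k. f k >= 0" "!!k. g k >= 0" "!!k. h k >= (0::real)"
  and xi: "xi ~= 0" and rho: "0 <= rho" "rho <= 1"
 shows "(wsum rho ((nlo K xi (8 * mag xi))) xi f g h)^2
   <= 576 * zeta0^2 * mag xi powr (2 * rho - 257/256)
     * (\<Sum>(k, l)\<in>conv3 K xi. (f k * g l * h (xi - k - l))^2)"
proof -
 let ?x = "mag xi"
 let ?T = "(nlo K xi (8 * ?x))"
 let ?c = "8 * ?x powr rho"
 have fT: "finite ?T" by (rule finite_subset[of _ "nres K xi"]) (use K in auto)
 have "wsum rho ?T xi f g h
   <= (\<Sum>(k, l)\<in>?T. ?c * (pw3 xi k l * (f k * g l * h (xi - k - l))))" proof (rule sum_mono, clarify)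
  fix k l assume kl: "dmax xi k l <= 8 * ?x"
  have "dmax xi k l powr rho <= (8 * ?x) powr rho"
   using kl rho by (intro powr_mono2) (auto simp: dmax_def le_max_iff_disj)
  also have "... = 8 powr rho * ?x powr rho" by (simp add: powr_mult)
  also have "8 powr rho <= (8::real) powr 1" using rho by (intro powr_mono) auto
  finally have "dmax xi k l powr rho <= ?c" by (simp add: mult_right_mono)
  then have "dmax xi k l powr rho * (pw3 xi k l * (f k * g l * h (xi - k - l)))
    <= ?c * (pw3 xi k l * (f k * g l * h (xi - k - l)))" using nn by (intro mult_right_mono) auto
  then show "wgt rho xi k l * f k * g l * h (xi - k - l)
    <= ?c * (pw3 xi k l * (f k * g l * h (xi - k - l)))" by (simp add: wgt_def mult_ac)
 qed
 also have "... = ?c * (\<Sum>(k, l)\<in>?T. pw3 xi k l * (f k * g l * h (xi - k - l)))"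
  by (simp add: sum_distrib_left case_prod_unfold)
 finally have "(wsum rho ?T xi f g h)^2
   <= (?c * (\<Sum>(k, l)\<in>?T. pw3 xi k l * (f k * g l * h (xi - k - l))))^2"
  using nn by (intro power_mono) (auto intro!: sum_nonneg mult_nonneg_nonneg)
 also have "... = ?c^2 * (\<Sum>p\<in>?T. (pw (xi - fst p) * pw (xi - snd p) * pw (fst p + snd p)) * (f (fst p) * g (snd p) * h (xi - fst p - snd p)))^2"
  by (simp add: power_mult_distrib case_prod_unfold)
 also have "... <= ?c^2 * ((\<Sum>p\<in>?T. (pw (xi - fst p) * pw (xi - snd p) * pw (fst p + snd p))^2)
    * (\<Sum>p\<in>?T. (f (fst p) * g (snd p) * h (xi - fst p - snd p))^2))"
  by (intro mult_left_mono Cauchy_Schwarz_ineq_sum) auto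
 also have "... <= ?c^2 * ((9 * zeta0^2 * ?x powr (-(257/256)))
    * (\<Sum>(k, l)\<in>conv3 K xi. (f k * g l * h (xi - k - l))^2))" proof (intro mult_left_mono mult_mono)
  have "(\<Sum>p\<in>?T. (pw (xi - fst p) * pw (xi - snd p) * pw (fst p + snd p))^2)
    <= (\<Sum>p\<in>nres K xi. (pw (xi - fst p) * pw (xi - snd p) * pw (fst p + snd p))^2)"
   by (rule sum_mono2) (use K in auto)
  also have "... <= 9 * zeta0^2 * ?x powr (-(257/256))" using sum_pw3_le[OF K xi] by (simp add: case_prod_unfold)
  finally show "(\<Sum>p\<in>?T. (pw (xi - fst p) * pw (xi - snd p) * pw (fst p + snd p))^2) <= 9 * zeta0^2 * ?x powr (-(257/256))" .
  show "(\<Sum>p\<in>?T. (f (fst p) * g (snd p) * h (xi - fst p - snd p))^2)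
    <= (\<Sum>(k, l)\<in>conv3 K xi. (f k * g l * h (xi - k - l))^2)"
   unfolding case_prod_unfold by (rule sum_mono2) (use K in \<open>auto simp: nres_def\<close>)
 qed (auto intro!: sum_nonneg)
 also have "... = 576 * zeta0^2 * (?x powr rho * ?x powr rho * ?x powr (-(257/256)))
     * (\<Sum>(k, l)\<in>conv3 K xi. (f k * g l * h (xi - k - l))^2)" by (simp add: power2_eq_square algebra_simps)
 also have "?x powr rho * ?x powr rho * ?x powr (-(257/256)) = ?x powr (2 * rho - 257/256)" by (simp flip: powr_add)
 finally show ?thesis .
qed

text \<open>The triple (k, l, m) determines xi = k + l + m, so no triple occurs twice.\<close>

lemma sum_conv3_sq_le:
 assumes K: "finite K" and X: "finite X"
 shows "(\<Sum>xi\<in>X. \<Sum>(k, l)\<in>conv3 K xi. (f k * g l * h (xi - k - l))^2)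
  <= (L2_set f K * L2_set g K * L2_set h K)^2"
proof -
 have "(\<Sum>xi\<in>X. \<Sum>(k, l)\<in>conv3 K xi. (f k * g l * h (xi - k - l))^2)
   = (\<Sum>(xi, k, l)\<in>Sigma X (conv3 K). (f k * g l * h (xi - k - l))^2)" by (subst sum.Sigma) (use K X in auto)
 also have "... = (\<Sum>(k, l, m)\<in>(%(xi, k, l). (k, l, xi - k - l)) ` Sigma X (conv3 K). (f k * g l * h m)^2)"
  by (subst sum.reindex) (auto simp: inj_on_def case_prod_unfold)
 also have "... <= (\<Sum>(k, l, m)\<in>K \<times> K \<times> K. (f k * g l * h m)^2)"
  by (rule sum_mono2) (use K in \<open>auto simp: conv3_def\<close>)
 also have "... = (\<Sum>k\<in>K. (f k)^2) * ((\<Sum>l\<in>K. (g l)^2) * (\<Sum>m\<in>K. (h m)^2))" proof -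
  have "(\<Sum>(k, l, m)\<in>K \<times> K \<times> K. (f k * g l * h m)^2)
   = (\<Sum>k\<in>K. \<Sum>l\<in>K. \<Sum>m\<in>K. (f k)^2 * ((g l)^2 * (h m)^2))"
   by (simp add: sum.cartesian_product[symmetric] power_mult_distrib mult.assoc)
  also have "... = (\<Sum>k\<in>K. (f k)^2 * (\<Sum>l\<in>K. (g l)^2 * (\<Sum>m\<in>K. (h m)^2)))"
   by (simp only: sum_distrib_left)
  also have "... = (\<Sum>k\<in>K. (f k)^2) * ((\<Sum>l\<in>K. (g l)^2) * (\<Sum>m\<in>K. (h m)^2))"
   by (simp only: sum_distrib_right)
  finally show ?thesis .
 qed
 also have "... = (L2_set f K * L2_set g K * L2_set h K)^2" by (simp add: L2_set_def power_mult_distrib sum_nonneg)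
 finally show ?thesis .
qed

section \<open>Oscillatory integrals by dyadic refinement\<close>

definition osc :: "real => real => real => complex" where
 "osc Om x y = integral {x..y} (%r. cis (Om * r))"

lemma vector_derivative_continuous_on:
 "(!!x. (f has_vector_derivative f' x) (at x)) ==> continuous_on S f"
 by (meson continuous_at_imp_continuous_on has_vector_derivative_continuous)

lemma continuous_on_cis_mult [continuous_intros]: "continuous_on S (%r. cis (Om * r))" by (intro continuous_intros)

lemma osc_combine: "[|x <= y; y <= z|] ==> osc Om x y + osc Om y z = osc Om x z" unfolding osc_def
 by (rule Henstock_Kurzweil_Integration.integral_combine) (auto intro!: integrable_continuous_real continuous_intros)

lemma norm_osc_le: "x <= y ==> norm (osc Om x y) <= y - x" unfolding osc_def
 using integral_bound[of x y "%r. cis (Om * r)" 1] by (auto intro!: continuous_intros)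

lemma norm_osc_le2:
 assumes "x <= y" "Om ~= 0"
 shows "norm (osc Om x y) <= 2 / \<bar>Om\<bar>"
proof -
 have "((%r. cis (Om * r)) has_integral
   (cis (Om * y) / (\<i> * Om) - cis (Om * x) / (\<i> * Om))) {x..y}"
 proof (rule fundamental_theorem_of_calculus[OF assms(1)])
  fix r :: real
  have "((%r. cis (Om * r)) has_vector_derivative (Om *\<^sub>R (\<i> * cis (Om * r)))) (at r within {x..y})"
   by (auto intro!: derivative_eq_intros simp: has_vector_derivative_def)
  then have "((%r. cis (Om * r) / (\<i> * Om)) has_vector_derivative
    (Om *\<^sub>R (\<i> * cis (Om * r))) / (\<i> * Om)) (at r within {x..y})" by (rule has_vector_derivative_divide)
  then show "((%r. cis (Om * r) / (\<i> * Om)) has_vector_derivative cis (Om * r)) (at r within {x..y})"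
   using assms by (simp add: scaleR_conv_of_real)
 qed
 then have "osc Om x y = (cis (Om * y) - cis (Om * x)) / (\<i> * Om)"
  unfolding osc_def by (simp add: integral_unique diff_divide_distrib)
 then have "norm (osc Om x y) = norm (cis (Om * y) - cis (Om * x)) / \<bar>Om\<bar>"
  by (simp add: norm_divide norm_mult)
 also have "... <= 2 / \<bar>Om\<bar>"
  using norm_triangle_ineq4[of "cis (Om * y)" "cis (Om * x)"] by (intro divide_right_mono) auto
 finally show ?thesis .
qed

text \<open>A geometric mean of the trivial bound y - x and the bound 2/|Om| from explicit
  integration. It trades powers of time for powers of the phase.\<close>

lemma norm_osc_interp:
 assumes xy: "x < y" and Om: "Om ~= 0" and ta: "0 <= ta" "ta <= 1"
 shows "norm (osc Om x y) <= 2 * (y - x) powr (1 - ta) * \<bar>Om\<bar> powr (-ta)"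
proof -
 let ?n = "norm (osc Om x y)"
 have "?n = ?n powr (1 - ta) * ?n powr ta" by (simp flip: powr_add)
 also have "... <= (y - x) powr (1 - ta) * (2 / \<bar>Om\<bar>) powr ta"
  using assms norm_osc_le[of x y Om] norm_osc_le2[of x y Om] by (intro mult_mono powr_mono2) auto
 also have "(2 / \<bar>Om\<bar>) powr ta = 2 powr ta * \<bar>Om\<bar> powr (-ta)"
  using Om by (simp add: powr_divide powr_minus_divide)
 also have "(y - x) powr (1 - ta) * (2 powr ta * \<bar>Om\<bar> powr (-ta)) <= (y - x) powr (1 - ta) * (2 * \<bar>Om\<bar> powr (-ta))"
  using powr_mono[of ta 1 "2::real"] ta by (intro mult_left_mono mult_right_mono) auto
 finally show ?thesis by (simp add: mult_ac)
qed

section \<open>Dyadic partitions and left-point sums\<close>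

definition node :: "real => real => nat => nat => real" where
 "node s h p i = s + h * real i / 2 ^ p"

definition mid :: "real => real => nat => nat => real" where
 "mid s h p i = node s h (Suc p) (2 * i + 1)"

lemma node_Suc_even: "node s h (Suc p) (2 * i) = node s h p i" by (simp add: node_def field_simps)

lemma node_0: "node s h p 0 = s" by (simp add: node_def)
lemma node_end: "node s h p (2 ^ p) = s + h" by (simp add: node_def)

lemma node_step: "node s h p (Suc i) - node s h p i = h / 2 ^ p" by (simp add: node_def field_simps)

lemma mid_node: "mid s h p i - node s h p i = h / 2 ^ Suc p" by (simp add: mid_def node_def field_simps)

lemma node_mid: "node s h p (Suc i) - mid s h p i = h / 2 ^ Suc p" by (simp add: mid_def node_def field_simps)

lemma node_bounds: "[|h >= 0; i <= 2 ^ p|] ==> s <= node s h p i \<and> node s h p i <= s + h"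
proof -
 assume h: "h >= 0" and "i <= 2 ^ p"
 then have "real i <= 2 ^ p" by (metis of_nat_le_iff of_nat_numeral of_nat_power)
 then have "real i / 2 ^ p <= 1" by simp
 then have "h * (real i / 2 ^ p) <= h * 1" using h by (intro mult_left_mono) auto
 then show ?thesis using h by (simp add: node_def)
qed

lemma mid_bounds: "[|h >= 0; i < 2 ^ p|] ==> s <= mid s h p i \<and> mid s h p i <= s + h"
 unfolding mid_def by (rule node_bounds) auto

text \<open>The oscillating factor is integrated exactly over each cell and only F is frozen, at the
  left end. Halving the cells then changes the sum just on the right halves, by an increment of F
  times an oscillating integral, which is \<open>ldiff\<close>.\<close>

definition lsum :: "real => (real => complex) => real => real => nat => complex" where
 "lsum Om F s h p = (\<Sum>i<2 ^ p. F (node s h p i) * osc Om (node s h p i) (node s h p (Suc i)))"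

definition ldiff :: "real => (real => complex) => real => real => nat => nat => complex" where
 "ldiff Om F s h p i =
   (F (mid s h p i) - F (node s h p i)) * osc Om (mid s h p i) (node s h p (Suc i))"

lemma sum_lessThan_double: "(\<Sum>i<2 * n. g i) = (\<Sum>i<n. g (2 * i) + g (2 * i + 1))"
 for g :: "nat => 'a::comm_monoid_add" by (induction n) (auto simp: add_ac)

lemma lsum_Suc:
 assumes "h >= 0"
 shows "lsum Om F s h (Suc p) = lsum Om F s h p + (\<Sum>i<2 ^ p. ldiff Om F s h p i)"
proof -
 have "lsum Om F s h (Suc p) = (\<Sum>i<2 ^ p. F (node s h p i) * osc Om (node s h p i) (mid s h p i)
    + F (mid s h p i) * osc Om (mid s h p i) (node s h p (Suc i)))" proof -
  have "node s h (Suc p) (Suc (Suc (2 * i))) = node s h p (Suc i)" for i using node_Suc_even[of s h p "Suc i"] by simp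
  then show ?thesis unfolding lsum_def power_Suc sum_lessThan_double by (simp add: node_Suc_even mid_def)
 qed
 also have "... = (\<Sum>i<2 ^ p. F (node s h p i) * osc Om (node s h p i) (node s h p (Suc i)) + ldiff Om F s h p i)"
 proof (rule sum.cong[OF refl])
  fix i
  have "h / 2 ^ Suc p >= 0" using assms by simp
  then have "node s h p i <= mid s h p i" "mid s h p i <= node s h p (Suc i)"
   using mid_node[of s h p i] node_mid[of s h p i] by linarith+
  then have "osc Om (node s h p i) (node s h p (Suc i))
   = osc Om (node s h p i) (mid s h p i) + osc Om (mid s h p i) (node s h p (Suc i))" by (simp add: osc_combine)
  then show "F (node s h p i) * osc Om (node s h p i) (mid s h p i)
    + F (mid s h p i) * osc Om (mid s h p i) (node s h p (Suc i))
    = F (node s h p i) * osc Om (node s h p i) (node s h p (Suc i)) + ldiff Om F s h p i"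
   by (simp add: ldiff_def algebra_simps)
 qed
 finally show ?thesis by (simp add: lsum_def sum.distrib)
qed

lemma lsum_0: "lsum Om F s h 0 = F s * osc Om s (s + h)" by (simp add: lsum_def node_def)

lemma lsum_telescope:
 assumes "h >= 0"
 shows "lsum Om F s h P = F s * osc Om s (s + h) + (\<Sum>p<P. \<Sum>i<2 ^ p. ldiff Om F s h p i)"
 by (induction P) (auto simp: lsum_0 lsum_Suc[OF assms])

lemma lsum_tendsto:
 assumes h: "h >= 0" and F: "continuous_on {s..s + h} F"
 shows "(%p. lsum Om F s h p) ----> integral {s..s + h} (%r. cis (Om * r) * F r)"
proof (rule metric_LIMSEQ_I)
 fix e :: real assume "e > 0"
 define e' where "e' = e / (h + 1) / 2"
 have e': "e' > 0" using \<open>e > 0\<close> h by (simp add: e'_def)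
 have "uniformly_continuous_on {s..s + h} F" using F compact_Icc by (rule compact_uniformly_continuous)
 then obtain d where d: "d > 0"
  "!!x y. [|x \<in> {s..s + h}; y \<in> {s..s + h}; dist y x < d|] ==> dist (F y) (F x) < e'"
  unfolding uniformly_continuous_on_def using e' by metis
 have "(%p. h * inverse ((2::real) ^ p)) ----> h * 0" by (intro tendsto_intros LIMSEQ_inverse_realpow_zero) auto
 then have "eventually (%p. h * inverse ((2::real) ^ p) < d) sequentially" using d(1) by (intro order_tendstoD) auto
 then obtain P where P: "!!p. p >= P ==> h / 2 ^ p < d" unfolding eventually_sequentially by (auto simp: divide_inverse)
 have "dist (lsum Om F s h p) (integral {s..s + h} (%r. cis (Om * r) * F r)) < e" if "p >= P" for p proof -
  let ?x = "node s h p"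
  have cont: "continuous_on {a..b} (%r. cis (Om * r) * F r)" if "s <= a" "b <= s + h" for a b
   by (intro continuous_intros continuous_on_subset[OF F]) (use that in auto)
  have mono: "?x i <= ?x (Suc i)" for i proof -
   have "h / 2 ^ p >= 0" using h by simp
   then show ?thesis using node_step[of s h p i] by linarith
  qed
  have split: "integral {s..?x n} (%r. cis (Om * r) * F r)
    = (\<Sum>i<n. integral {?x i..?x (Suc i)} (%r. cis (Om * r) * F r))" if "n <= 2 ^ p" for n using that
  proof (induction n)
   case 0
   then show ?case by (simp add: node_0)
  next
   case (Suc n)
   have b: "s <= ?x n" "?x (Suc n) <= s + h" using node_bounds[of h _ p s] h Suc.prems by auto
   have "integral {s..?x (Suc n)} (%r. cis (Om * r) * F r)
     = integral {s..?x n} (%r. cis (Om * r) * F r) + integral {?x n..?x (Suc n)} (%r. cis (Om * r) * F r)"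
    by (rule Henstock_Kurzweil_Integration.integral_combine[symmetric])
     (use b mono[of n] in \<open>auto intro!: integrable_continuous_real cont\<close>)
   then show ?case using Suc by simp
  qed
  have piece: "norm (F (?x i) * osc Om (?x i) (?x (Suc i)) - integral {?x i..?x (Suc i)} (%r. cis (Om * r) * F r))
    <= e' * (h / 2 ^ p)" if i: "i < 2 ^ p" for i proof -
   have b: "s <= ?x i" "?x (Suc i) <= s + h" using node_bounds[of h _ p s] h i by auto
   have c1: "continuous_on {?x i..?x (Suc i)} (%r. F (?x i) * cis (Om * r))" by (intro continuous_intros)
   have "F (?x i) * osc Om (?x i) (?x (Suc i)) - integral {?x i..?x (Suc i)} (%r. cis (Om * r) * F r)
     = integral {?x i..?x (Suc i)} (%r. F (?x i) * cis (Om * r) - cis (Om * r) * F r)"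
    unfolding osc_def integral_mult_right[symmetric] by (rule Henstock_Kurzweil_Integration.integral_diff[symmetric])
     (use b in \<open>auto intro!: integrable_continuous_real cont c1\<close>)
   also have "norm ... <= e' * (?x (Suc i) - ?x i)" proof (rule integral_bound[OF mono])
    show "continuous_on {?x i..?x (Suc i)} (%r. F (?x i) * cis (Om * r) - cis (Om * r) * F r)"
     using b by (intro continuous_on_diff c1 cont)
    fix r assume r: "r \<in> {?x i..?x (Suc i)}"
    have "dist (F (?x i)) (F r) < e'" using r b node_step[of s h p i] P[OF \<open>p >= P\<close>]
     by (intro d(2)) (auto simp: dist_real_def)
    moreover have "F (?x i) * cis (Om * r) - cis (Om * r) * F r = cis (Om * r) * (F (?x i) - F r)"
     by (simp add: algebra_simps)
    ultimately show "norm (F (?x i) * cis (Om * r) - cis (Om * r) * F r) <= e'" by (simp add: norm_mult dist_norm)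
   qed
   finally show ?thesis by (simp add: node_step)
  qed
  have "lsum Om F s h p - integral {s..s + h} (%r. cis (Om * r) * F r)
    = (\<Sum>i<2^p. F (?x i) * osc Om (?x i) (?x (Suc i)) - integral {?x i..?x (Suc i)} (%r. cis (Om * r) * F r))"
   using split[of "2 ^ p"] by (simp add: node_end lsum_def sum_subtractf)
  also have "norm ... <= (\<Sum>i<(2::nat)^p. e' * (h / 2 ^ p))"
   by (rule order_trans[OF norm_sum sum_mono]) (use piece in auto)
  also have "... = e' * h" by simp
  also have "... < e" using \<open>e > 0\<close> h by (simp add: e'_def field_simps add_nonneg_pos)
  finally show ?thesis by (simp add: dist_norm)
 qed
 then show "\<exists>no. \<forall>n\<ge>no. dist (lsum Om F s h n) (integral {s..s + h} (%r. cis (Om * r) * F r)) < e"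
  by blast
qed

lemma L2_set_sum_le: "finite A ==> L2_set (%x. \<Sum>a\<in>A. f a x) X <= (\<Sum>a\<in>A. L2_set (f a) X)"
proof (induction A rule: finite_induct)
 case empty
 then show ?case by (simp add: L2_set_def)
next
 case (insert a A)
 then show ?case using L2_set_triangle_ineq[of "f a" "%x. \<Sum>a\<in>A. f a x" X] by simp
qed

text \<open>The integrals of finitely many oscillating terms are controlled by a frozen term and by
 the increments of the amplitudes on all dyadic scales; this is the estimate of Young integrals
 in the controlled-path approach to dispersive equations.\<close>

lemma young_sum_bound:
 fixes F :: "'x => 'k => real => complex" and b :: "'x => 'k => complex"
 assumes h: "h >= 0" and X: "finite X" and T: "!!x. finite (S x)"
  and F: "!!x k. x \<in> X ==> k \<in> S x ==> continuous_on {s..s + h} (F x k)"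
  and W: "!!x. W x >= 0"
  and Z0: "L2_set (%x. W x * norm (\<Sum>k\<in>S x. b x k * (F x k s * osc (Om x k) s (s + h)))) X <= Z0"
  and Z: "!!p i. i < 2 ^ p ==>
    L2_set (%x. W x * norm (\<Sum>k\<in>S x. b x k * ldiff (Om x k) (F x k) s h p i)) X <= z p"
  and Zs: "!!P. (\<Sum>p<P. 2 ^ p * z p) <= Z1"
 shows "L2_set (%x. W x * norm (integral {s..s + h} (%r. \<Sum>k\<in>S x. b x k * (cis (Om x k * r) * F x k r)))) X
   <= Z0 + Z1"
proof -
 let ?A = "%P x. \<Sum>k\<in>S x. b x k * lsum (Om x k) (F x k) s h P"
 let ?I = "%x. integral {s..s + h} (%r. \<Sum>k\<in>S x. b x k * (cis (Om x k * r) * F x k r))"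
 have lim: "(%P. ?A P x) ----> ?I x" if x: "x \<in> X" for x proof -
  have "?I x = (\<Sum>k\<in>S x. integral {s..s + h} (%r. b x k * (cis (Om x k * r) * F x k r)))"
   by (rule Henstock_Kurzweil_Integration.integral_sum)
    (use F[OF x] T in \<open>auto intro!: integrable_continuous_real continuous_intros\<close>)
  also have "... = (\<Sum>k\<in>S x. b x k * integral {s..s + h} (%r. cis (Om x k * r) * F x k r))" by simp
  finally show ?thesis by (simp only:) (intro tendsto_intros lsum_tendsto F x h)
 qed
 have "(%P. L2_set (%x. W x * norm (?A P x)) X) ----> L2_set (%x. W x * norm (?I x)) X"
  unfolding L2_set_def by (intro tendsto_intros lim)
 moreover have "L2_set (%x. W x * norm (?A P x)) X <= Z0 + Z1" for P proof -
  let ?B = "%x. \<Sum>k\<in>S x. b x k * (F x k s * osc (Om x k) s (s + h))"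
  let ?D = "%p i x. \<Sum>k\<in>S x. b x k * ldiff (Om x k) (F x k) s h p i"
  have "?A P x = ?B x + (\<Sum>p<P. \<Sum>i<2^p. ?D p i x)" for x proof -
   have "?A P x = ?B x + (\<Sum>k\<in>S x. \<Sum>p<P. \<Sum>i<2^p. b x k * ldiff (Om x k) (F x k) s h p i)"
    by (simp add: lsum_telescope[OF h] distrib_left sum.distrib sum_distrib_left)
   also have "(\<Sum>k\<in>S x. \<Sum>p<P. \<Sum>i<2^p. b x k * ldiff (Om x k) (F x k) s h p i)
     = (\<Sum>p<P. \<Sum>k\<in>S x. \<Sum>i<2^p. b x k * ldiff (Om x k) (F x k) s h p i)" by (rule sum.swap)
   also have "... = (\<Sum>p<P. \<Sum>i<2^p. ?D p i x)" by (rule sum.cong[OF refl], rule sum.swap)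
   finally show ?thesis .
  qed
  then have le: "W x * norm (?A P x) <= W x * norm (?B x) + (\<Sum>p<P. \<Sum>i<2^p. W x * norm (?D p i x))" for x
  proof -
   assume eq: "!!x. ?A P x = ?B x + (\<Sum>p<P. \<Sum>i<2^p. ?D p i x)"
   have "norm (?A P x) <= norm (?B x) + (\<Sum>p<P. \<Sum>i<2^p. norm (?D p i x))" unfolding eq
    by (rule order_trans[OF norm_triangle_ineq], rule add_left_mono,
      rule order_trans[OF norm_sum sum_mono], rule norm_sum)
   then have "W x * norm (?A P x) <= W x * (norm (?B x) + (\<Sum>p<P. \<Sum>i<2^p. norm (?D p i x)))"
    using W by (rule mult_left_mono)
   then show ?thesis by (simp add: distrib_left sum_distrib_left)
  qed
  have "L2_set (%x. W x * norm (?A P x)) X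
    <= L2_set (%x. W x * norm (?B x) + (\<Sum>p<P. \<Sum>i<2^p. W x * norm (?D p i x))) X"
   by (rule L2_set_mono) (use le W in auto)
  also have "... <= L2_set (%x. W x * norm (?B x)) X
    + L2_set (%x. \<Sum>p<P. \<Sum>i<2^p. W x * norm (?D p i x)) X" by (rule L2_set_triangle_ineq)
  also have "... <= Z0 + (\<Sum>p<P. 2 ^ p * z p)" proof (rule add_mono[OF Z0])
   have "L2_set (%x. \<Sum>p<P. \<Sum>i<2^p. W x * norm (?D p i x)) X
     <= (\<Sum>p<P. L2_set (%x. \<Sum>i<2^p. W x * norm (?D p i x)) X)" by (rule L2_set_sum_le) simp
   also have "... <= (\<Sum>p<P. \<Sum>i<2^p. L2_set (%x. W x * norm (?D p i x)) X)"
    by (rule sum_mono, rule L2_set_sum_le) simp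
   also have "... <= (\<Sum>p<P. \<Sum>i<(2::nat)^p. z p)" by (intro sum_mono Z) auto
   finally show "L2_set (%x. \<Sum>p<P. \<Sum>i<2^p. W x * norm (?D p i x)) X <= (\<Sum>p<P. 2 ^ p * z p)" by simp
  qed
  also have "... <= Z0 + Z1" using Zs by simp
  finally show ?thesis .
 qed
 ultimately show ?thesis by (intro LIMSEQ_le_const2) auto
qed

section \<open>The a priori estimate\<close>

definition jb :: "int => real" where
 "jb k = max 1 (mag k)"

abbreviation incr :: "(int => real => complex) => real => real => int => real" where
 "incr v s t \<equiv> %k. jb k powr (-(33/64)) * norm (v k t - v k s)"

lemma jb_ge_1 [simp]: "jb k >= 1" by (simp add: jb_def)
lemma jb_pos [simp]: "jb k > 0" by (simp add: jb_def)
lemma jb_nz: "k ~= 0 ==> jb k = mag k" by (simp add: jb_def max_def)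

text \<open>This is q(k) + q(l) + q(m) - q(xi) with m = xi - k - l, see \<open>qsym_om\<close>; the
  linear part of q cancels because k + l + m = xi.\<close>

definition om :: "int => int => int => real" where
 "om xi k l = - 3 * real_of_int ((xi - k) * (xi - l) * (k + l))"

abbreviation omp :: "int => int \<times> int => real" where
 "omp xi p \<equiv> om xi (fst p) (snd p)"

abbreviation cub :: "(int => real => complex) => int => int \<times> int => real => complex" where
 "cub v xi p r \<equiv> v (fst p) r * v (snd p) r * v (xi - fst p - snd p) r"

abbreviation nlc :: "real => int => complex" where
 "nlc sg xi \<equiv> 2 * \<i> * of_real sg * of_int xi"

lemma om_nz: "(k, l) \<in> nres K xi ==> om xi k l ~= 0" by (auto simp: om_def nres_def)

lemma zeta0_ge_1: "zeta0 >= 1" unfolding zeta0_def by (simp add: suminf_nonneg summable_real_powr_iff)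

lemma sqrt_zeta0_le: "sqrt zeta0 * sqrt zeta0 = zeta0" using zeta0_pos by simp

lemma dmax_ge_1: "(k, l) \<in> nres K xi ==> dmax xi k l >= 1"
 by (auto simp: nres_def dmax_def le_max_iff_disj simp del: of_int_max)

text \<open>The power -ta is split as -(1+a)/2 + mu with mu = 257/512 - ta. The first part is the
  product of the three factors \<open>pw\<close>; in the second each of the three factors of the
  phase is at most \<open>dmax\<close>, whence 3 mu.\<close>

lemma om_powr_le:
 assumes kl: "(k, l) \<in> nres K xi" and ta: "0 <= ta" "ta <= 257/512"
 shows "\<bar>om xi k l\<bar> powr (-ta) <= wgt (3 * (257/512 - ta)) xi k l"
proof -
 define a b c where "a = mag (xi - k)" "b = mag (xi - l)" "c = mag (k + l)"
 define d where "d = dmax xi k l"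
 have 1: "a >= 1" "b >= 1" "c >= 1" "a <= d" "b <= d" "c <= d"
  using kl by (auto simp: a_b_c_def nres_def d_def dmax_def)
 have d1: "d >= 1" using 1 by linarith
 let ?\<mu> = "257/512 - ta"
 have "\<bar>om xi k l\<bar> = 3 * (a * b * c)" by (simp add: om_def a_b_c_def abs_mult)
 then have "\<bar>om xi k l\<bar> powr (-ta) <= (a * b * c) powr (-ta)" using 1 ta by (intro powr_mono2') auto
 also have "... = (a * b * c) powr (-(257/512)) * (a * b * c) powr ?\<mu>" by (simp flip: powr_add)
 also have "... <= (a * b * c) powr (-(257/512)) * (d powr 3) powr ?\<mu>" proof (intro mult_left_mono powr_mono2)
  have "a * b * c <= d * d * d" using 1 d1 by (intro mult_mono) auto
  then show "a * b * c <= d powr 3" using d1 by (simp add: power3_eq_cube)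
 qed (use 1 ta in auto)
 also have "(a * b * c) powr (-(257/512)) = pw3 xi k l" using 1 by (simp add: powr_mult pw_def a_b_c_def)
 also have "(d powr 3) powr ?\<mu> = d powr (3 * ?\<mu>)" by (simp only: powr_powr)
 finally show ?thesis by (simp add: wgt_def d_def)
qed

text \<open>The full power (1+a)/2 of the phase is spent. This version meets increments, which bring
  the time exponent 129/256, and 255/512 + 129/256 = 513/512 exceeds 1.\<close>

lemma osc_wgt0:
 assumes "(k, l) \<in> nres K xi" "x < y"
 shows "norm (osc (om xi k l) x y) <= 2 * (y - x) powr (255/512) * wgt 0 xi k l"
proof -
 have "norm (osc (om xi k l) x y) <= 2 * (y - x) powr (1 - 257/512) * \<bar>om xi k l\<bar> powr (-(257/512))"
  using assms om_nz[OF assms(1)] by (intro norm_osc_interp) auto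
 also have "... <= 2 * (y - x) powr (1 - 257/512) * wgt 0 xi k l"
  using om_powr_le[OF assms(1), of "257/512"] by (intro mult_left_mono) auto
 finally show ?thesis by simp
qed

lemma osc_wgt9:
 assumes "(k, l) \<in> nres K xi" "x < y"
 shows "norm (osc (om xi k l) x y) <= 2 * (y - x) powr (129/256) * wgt (9/512) xi k l"
proof -
 have "norm (osc (om xi k l) x y) <= 2 * (y - x) powr (1 - 127/256) * \<bar>om xi k l\<bar> powr (-(127/256))"
  using assms om_nz[OF assms(1)] by (intro norm_osc_interp) auto
 also have "... <= 2 * (y - x) powr (1 - 127/256) * wgt (9/512) xi k l"
  using om_powr_le[OF assms(1), of "127/256"] by (intro mult_left_mono) auto
 finally show ?thesis by simp
qed

lemma nres_split_le:
 assumes K: "finite K" and nn: "!!k. f k >= 0" "!!k. g k >= 0" "!!k. h k >= (0::real)"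
 shows "wsum rho (nres K xi) xi f g h
  <= wsum rho ((nlo K xi d)) xi f g h
   + wsum rho ((nhi K xi d)) xi f g h"
 (is "_ <= sum ?F ?A + sum ?F ?B")
proof -
 have fin: "finite ?A" "finite ?B" by (rule finite_subset[of _ "nres K xi"]; use K in auto)+
 have "nres K xi = ?A \<union> ?B" by auto
 then have "sum ?F (nres K xi) = sum ?F (?A \<union> ?B)" by simp
 also have "... <= sum ?F ?A + sum ?F ?B"
  using fin nn by (subst sum.union_inter[symmetric]) (auto intro!: sum_nonneg mult_nonneg_nonneg)
 finally show ?thesis .
qed

text \<open>Interactions with \<open>dmax\<close> at most 8|xi| are summed over xi by
  \<open>sum_conv3_sq_le\<close>. For the others \<open>trilinear_high\<close> leaves, after the
  weight, exactly \<open>pw xi\<close>, which is square summable in xi.\<close>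

lemma trilinear_L2:
 assumes K: "finite K" and nn: "!!k. f k >= 0" "!!k. g k >= 0" "!!k. h k >= (0::real)"
  and X: "finite X" "0 \<notin> X" and rho: "0 <= rho" "rho <= 1"
 shows "L2_set (%xi. mag xi powr (257/512 - rho)
      * wsum rho (nres K xi) xi f g h) X
   <= 48 * zeta0 * (L2_set f K * L2_set g K * L2_set h K)"
proof -
 let ?P = "L2_set f K * L2_set g K * L2_set h K"
 let ?w = "%xi. mag xi powr (257/512 - rho)"
 let ?S = "%xi T. wsum rho T xi f g h"
 let ?L = "%xi. (nlo K xi (8 * mag xi))"
 let ?H = "%xi. (nhi K xi (8 * mag xi))"
 have nnS: "?S xi T >= 0" for xi T using nn by (auto intro!: sum_nonneg mult_nonneg_nonneg)
 have "L2_set (%xi. ?w xi * ?S xi (nres K xi)) X <= L2_set (%xi. ?w xi * ?S xi (?L xi) + ?w xi * ?S xi (?H xi)) X"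
  using nres_split_le[OF K nn] nnS by (intro L2_set_mono) (auto simp flip: distrib_left intro!: mult_left_mono)
 also have "... <= L2_set (%xi. ?w xi * ?S xi (?L xi)) X + L2_set (%xi. ?w xi * ?S xi (?H xi)) X"
  by (rule L2_set_triangle_ineq)
 also have "L2_set (%xi. ?w xi * ?S xi (?L xi)) X <= 24 * zeta0 * ?P" proof -
  have "(\<Sum>xi\<in>X. (?w xi * ?S xi (?L xi))^2)
    <= (\<Sum>xi\<in>X. 576 * zeta0^2 * (\<Sum>(k, l)\<in>conv3 K xi. (f k * g l * h (xi - k - l))^2))"
  proof (rule sum_mono)
   fix xi assume "xi \<in> X"
   then have xi: "xi ~= 0" using X by auto
   let ?G = "\<Sum>(k, l)\<in>conv3 K xi. (f k * g l * h (xi - k - l))^2"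
   have "(?w xi * ?S xi (?L xi))^2 = (?w xi)^2 * (?S xi (?L xi))^2" by (simp add: power_mult_distrib)
   also have "... <= (?w xi)^2 * (576 * zeta0^2 * mag xi powr (2 * rho - 257/256) * ?G)"
    by (intro mult_left_mono trilinear_low K nn xi rho) auto
   also have "... = 576 * zeta0^2 * ((?w xi)^2 * mag xi powr (2 * rho - 257/256)) * ?G" by (simp add: mult_ac)
   also have "(?w xi)^2 * mag xi powr (2 * rho - 257/256) = 1" using xi by (simp add: power2_eq_square flip: powr_add)
   finally show "(?w xi * ?S xi (?L xi))^2 <= 576 * zeta0^2 * ?G" by simp
  qed
  also have "... <= 576 * zeta0^2 * ?P^2"
   unfolding sum_distrib_left[symmetric] by (intro mult_left_mono sum_conv3_sq_le K X) auto
  also have "... = (24 * zeta0 * ?P)^2" by (simp add: power_mult_distrib)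
  finally show ?thesis
   using zeta0_pos by (subst L2_set_def, intro real_le_lsqrt) (auto intro!: sum_nonneg mult_nonneg_nonneg)
 qed
 also have "L2_set (%xi. ?w xi * ?S xi (?H xi)) X <= 24 * zeta0 * ?P" proof -
  have "L2_set (%xi. ?w xi * ?S xi (?H xi)) X <= L2_set (%xi. (24 * sqrt zeta0 * ?P) * pw xi) X"
  proof (rule L2_set_mono)
   fix xi assume "xi \<in> X"
   then have xi: "xi ~= 0" using X by auto
   let ?x = "mag xi"
   have "?S xi (?H xi) <= 24 * sqrt zeta0 * (8 * ?x) powr (rho - 257/256) * ?P"
    by (rule trilinear_high) (use K nn rho xi in auto)
   also have "(8 * ?x) powr (rho - 257/256) <= ?x powr (rho - 257/256)" using rho xi by (intro powr_mono2') auto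
   finally have "?w xi * ?S xi (?H xi) <= ?w xi * (24 * sqrt zeta0 * ?x powr (rho - 257/256) * ?P)"
    using zeta0_pos by (intro mult_left_mono) (auto simp: mult_left_mono mult_right_mono)
   also have "... = (24 * sqrt zeta0 * ?P) * (?w xi * ?x powr (rho - 257/256))" by (simp add: mult_ac)
   also have "?w xi * ?x powr (rho - 257/256) = pw xi" by (simp add: pw_def flip: powr_add)
   finally show "?w xi * ?S xi (?H xi) <= (24 * sqrt zeta0 * ?P) * pw xi" .
  qed (use nnS in auto)
  also have "... = (24 * sqrt zeta0 * ?P) * L2_set pw X" using zeta0_pos by (subst L2_set_right_distrib) auto
  also have "... <= (24 * sqrt zeta0 * ?P) * sqrt zeta0" proof (rule mult_left_mono)
   show "L2_set pw X <= sqrt zeta0" using sum_pw_sq_le[OF X(1)] by (simp add: L2_set_def)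
  qed (use zeta0_pos in simp)
  also have "... = 24 * zeta0 * ?P" using sqrt_zeta0_le by (simp add: mult_ac)
  finally show ?thesis .
 qed
 finally show ?thesis by simp
qed

text \<open>The sum over the dyadic scales: on scale p there are 2^p cells, each contributing the
  power 513/512 of its length, so a factor 2^(-1/512) is gained from each scale to the next.\<close>

definition geo0 :: real where
 "geo0 = 1 / (1 - 2 powr (-(1/512)))"

lemma geo0_pos: "geo0 > 0"
proof -
 have "2 powr (-(1/512)) < 2 powr (0::real)" by (rule powr_less_mono) auto
 then show ?thesis by (simp add: geo0_def)
qed

lemma geo0_sum: "(\<Sum>p<P. (2 powr (-(1/512))) ^ Suc p) <= geo0"
proof -
 let ?x = "2 powr (-(1/512)) :: real"
 have x: "0 < ?x" "?x < 1" using powr_less_mono[of "-(1/512)" 0 "2::real"] by auto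
 have "(\<Sum>p<P. ?x ^ Suc p) <= (\<Sum>p<P. ?x ^ p)" using x by (intro sum_mono) (auto simp: mult_le_cancel_right1)
 also have "... = (1 - ?x ^ P) / (1 - ?x)" using x by (subst sum_gp_strict) auto
 also have "... <= geo0" unfolding geo0_def using x by (intro divide_right_mono) auto
 finally show ?thesis .
qed

lemma norm_prod3_diff_le:
 fixes a b c a' b' c' :: complex
 shows "norm (a' * b' * c' - a * b * c) <= norm (a' - a) * norm b' * norm c'
  + norm a * norm (b' - b) * norm c' + norm a * norm b * norm (c' - c)"
proof -
 have "a' * b' * c' - a * b * c = (a' - a) * b' * c' + a * (b' - b) * c' + a * b * (c' - c)"
  by (simp add: algebra_simps)
 then show ?thesis
  by (metis (no_types) norm_mult norm_triangle_le norm_triangle_mono order_refl add_mono norm_triangle_ineq)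
qed

text \<open>Since 2 xi is the sum of the three differences, |xi| is at most 3/2 \<open>dmax\<close>,
  and each of k, l, m differs from xi by one of them, so it is at most 5/2 \<open>dmax\<close>. The
  weight of the Hoelder norm is thus absorbed by a power of \<open>dmax\<close>, whichever factor
  carries the increment.\<close>

lemma jb_powr_le:
 assumes "(k, l) \<in> nres K xi" "xi ~= 0" "m \<in> {k, l, xi - k - l}"
 shows "jb m powr (33/64) <= 3 * dmax xi k l powr (33/64)"
proof -
 let ?d = "dmax xi k l"
 have d1: "?d >= 1" by (rule dmax_ge_1[OF assms(1)])
 have d: "?d = max \<bar>real_of_int xi - k\<bar> (max \<bar>real_of_int xi - l\<bar> \<bar>real_of_int k + l\<bar>)"
  unfolding dmax_def by (simp only: of_int_max of_int_abs of_int_diff of_int_add)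
 have "jb m <= 5/2 * ?d" proof -
  have "\<bar>real_of_int xi - k\<bar> <= ?d" "\<bar>real_of_int xi - l\<bar> <= ?d" "\<bar>real_of_int k + l\<bar> <= ?d"
   unfolding d by simp_all
  then have "mag m <= 5/2 * ?d" using assms(3) unfolding abs_le_iff by (auto simp del: of_int_diff) simp_all
  then show ?thesis using d1 by (simp add: jb_def)
 qed
 then have "jb m powr (33/64) <= (5/2 * ?d) powr (33/64)" using jb_pos[of m] by (intro powr_mono2) (auto simp: jb_def)
 also have "... = (5/2) powr (33/64) * ?d powr (33/64)" using d1 by (subst powr_mult) auto
 also have "(5/2) powr (33/64) <= (5/2::real) powr 1" by (intro powr_mono) auto
 finally show ?thesis using d1 by (simp add: mult_right_mono order_trans[of _ "5/2 * _"])
qed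

lemma L2_set_sum3_le:
 "L2_set (%x. f x + g x + h x) X <= L2_set f X + L2_set g X + L2_set h X"
 using L2_set_triangle_ineq[of "%x. f x + g x" h X] L2_set_triangle_ineq[of f g X] by simp

lemma dyadic_powr:
 fixes h :: real
 shows
 "2 ^ p * (h / 2 ^ Suc p) powr (513/512) = h powr (513/512) * (1/2 * (2 powr (-(1/512))) ^ Suc p)"
proof -
 let ?y = "2 ^ Suc p :: real"
 have e2: "(h / ?y) powr (513/512) = h powr (513/512) / ?y powr (513/512)" by (rule powr_divide)
 have e3: "?y powr (513/512) = ?y * ?y powr (1/512)" using powr_add[of ?y 1 "1/512"] by (simp del: power_Suc)
 have e5: "?y powr (1/512) = (2 powr (1/512)) ^ Suc p"
  by (simp only: powr_realpow[symmetric] powr_gt_zero zero_less_numeral powr_powr mult.commute)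
 have "(2 powr (1/512)) ^ Suc p * (2 powr (-(1/512))) ^ Suc p = (1::real)"
  unfolding power_mult_distrib[symmetric] by (simp flip: powr_add del: power_Suc)
 then have e4: "1 / ?y powr (1/512) = (2 powr (-(1/512))) ^ Suc p"
  unfolding e5 by (metis nonzero_eq_divide_eq mult.commute zero_neq_one mult_zero_left)
 have "2 ^ p * (h / ?y) powr (513/512) = h powr (513/512) * ((2 ^ p / ?y) * (1 / ?y powr (1/512)))"
  unfolding e2 e3 by (simp del: power_Suc)
 also have "2 ^ p / ?y = 1/2" by simp
 finally show ?thesis unfolding e4 .
qed

lemma norm_le_jb:
 assumes "jb k powr (-(33/64)) * norm z <= c"
 shows "norm z <= jb k powr (33/64) * c"
proof -
 have "norm z = jb k powr (33/64) * (jb k powr (-(33/64)) * norm z)"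
  by (simp add: mult.assoc[symmetric] less_imp_neq[symmetric] flip: powr_add)
 also have "... <= jb k powr (33/64) * c" by (rule mult_left_mono[OF assms]) simp
 finally show ?thesis .
qed

lemma norm_prod3_increment_le:
 fixes a b :: "int => complex"
 assumes kl: "(k, l) \<in> nres K xi" "xi ~= 0" and e: "!!j. norm (b j - a j) = jb j powr (33/64) * e j" "!!j. e j >= 0"
  and m: "m = xi - k - l"
 shows "norm (b k * b l * b m - a k * a l * a m) <= 3 * dmax xi k l powr (33/64) *
  (e k * norm (b l) * norm (b m) + norm (a k) * e l * norm (b m) + norm (a k) * norm (a l) * e m)"
proof -
 let ?d = "dmax xi k l powr (33/64)"
 have j: "jb k powr (33/64) <= 3 * ?d" "jb l powr (33/64) <= 3 * ?d" "jb m powr (33/64) <= 3 * ?d"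
  using jb_powr_le[OF kl] by (auto simp: m)
 have "norm (b k * b l * b m - a k * a l * a m) <= (3 * ?d * e k) * norm (b l) * norm (b m)
   + norm (a k) * (3 * ?d * e l) * norm (b m) + norm (a k) * norm (a l) * (3 * ?d * e m)"
  by (rule order_trans[OF norm_prod3_diff_le], unfold e(1), intro add_mono mult_right_mono mult_left_mono)
   (use j e(2) in \<open>auto intro!: mult_nonneg_nonneg\<close>)
 then show ?thesis by (simp add: algebra_simps)
qed

abbreviation yng :: "real => real => real" where
 "yng R lam \<equiv> 864 * zeta0 * geo0 * R^2 * lam powr (255/512)"

lemma nonres_bound:
 fixes v :: "int => real => complex"
 assumes K: "finite K" and X: "finite X" "0 \<notin> X" and h: "h > 0" and lam: "lam > 0"
  and hX: "!!xi. xi \<in> X ==> h * mag xi <= lam"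
  and R: "R >= 0" "!!r. r \<in> {s..s + h} ==> L2_set (%k. norm (v k r)) K <= R"
  and cont: "!!k. k \<in> K ==> continuous_on {s..s + h} (v k)"
  and M: "M >= 0" "!!x y. [|s <= x; x < y; y <= s + h|] ==>
    L2_set (incr v x y) K <= M * (y - x) powr (129/256)"
  and sg: "\<bar>sg\<bar> = 1"
 shows "L2_set (%xi. mag xi powr (-(33/64)) * norm (integral {s..s + h}
    (%r. \<Sum>p\<in>nres K xi. nlc sg xi *
     (cis (omp xi p * r) * cub v xi p r)))) X
   <= 192 * zeta0 * R ^ 3 * h powr (129/256)
    + yng R lam * M * h powr (129/256)"
proof (rule young_sum_bound)
 let ?x = "%xi. mag xi"
 let ?F = "%xi p r. cub v xi p r"
 let ?b = "%xi. 2 * \<i> * complex_of_real sg * of_int xi"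
 have nb: "norm (?b xi) = 2 * ?x xi" for xi using sg by (simp add: norm_mult)
 show "h >= 0" "finite X" "finite (nres K xi)" for xi using K X h by auto
 show "continuous_on {s..s + h} (%r. ?F xi p r)" if "xi \<in> X" "p \<in> nres K xi" for xi p
  using that by (intro continuous_intros cont) (auto simp: nres_def conv3_def)
 show "?x xi powr (-(33/64)) >= 0" for xi by simp
 have s_in: "s \<in> {s..s + h}" using h by auto
 have split: "?x xi powr (31/64) = ?x xi powr (257/512 - 9/512)" for xi by simp
 show "L2_set (%xi. ?x xi powr (-(33/64)) * norm (\<Sum>p\<in>nres K xi. ?b xi *
      (?F xi p s * osc (omp xi p) s (s + h)))) X <= 192 * zeta0 * R ^ 3 * h powr (129/256)" proof -
  let ?f = "%k. norm (v k s)"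
  have "L2_set (%xi. ?x xi powr (-(33/64)) * norm (\<Sum>p\<in>nres K xi. ?b xi *
      (?F xi p s * osc (omp xi p) s (s + h)))) X
   <= L2_set (%xi. (4 * h powr (129/256)) * (?x xi powr (257/512 - 9/512)
     * wsum (9/512) (nres K xi) xi ?f ?f ?f)) X" proof (rule L2_set_mono)
   fix xi assume "xi \<in> X"
   then have xi: "xi ~= 0" using X by auto
   have "norm (\<Sum>p\<in>nres K xi. ?b xi * (?F xi p s * osc (omp xi p) s (s + h)))
     <= (\<Sum>p\<in>nres K xi. 2 * ?x xi * (2 * h powr (129/256) *
      (wgt (9/512) xi (fst p) (snd p) * ?f (fst p) * ?f (snd p) * ?f (xi - fst p - snd p))))" proof (rule sum_norm_le)
    fix p assume p: "p \<in> nres K xi"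
    have "norm (osc (omp xi p) s (s + h)) <= 2 * (s + h - s) powr (129/256) * wgt (9/512) xi (fst p) (snd p)"
     using p h by (intro osc_wgt9) auto
    then have "(2 * ?x xi * (?f (fst p) * ?f (snd p) * ?f (xi - fst p - snd p))) * norm (osc (omp xi p) s (s + h))
      <= (2 * ?x xi * (?f (fst p) * ?f (snd p) * ?f (xi - fst p - snd p))) * (2 * h powr (129/256) * wgt (9/512) xi (fst p) (snd p))"
     by (intro mult_left_mono) auto
    then show "norm (?b xi * (?F xi p s * osc (omp xi p) s (s + h)))
      <= 2 * ?x xi * (2 * h powr (129/256) *
      (wgt (9/512) xi (fst p) (snd p) * ?f (fst p) * ?f (snd p) * ?f (xi - fst p - snd p)))"
     unfolding norm_mult nb[unfolded norm_mult] by (simp add: mult_ac)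
   qed
   also have "... = 4 * h powr (129/256) * ?x xi * wsum (9/512) (nres K xi) xi ?f ?f ?f"
    by (simp add: sum_distrib_left case_prod_unfold mult_ac)
   finally have "?x xi powr (-(33/64)) * norm (\<Sum>p\<in>nres K xi. ?b xi * (?F xi p s * osc (omp xi p) s (s + h)))
     <= ?x xi powr (-(33/64)) * (4 * h powr (129/256) * ?x xi * wsum (9/512) (nres K xi) xi ?f ?f ?f)"
    by (intro mult_left_mono) auto
   also have "... = (4 * h powr (129/256)) * ((?x xi powr (-(33/64)) * ?x xi powr 1)
     * wsum (9/512) (nres K xi) xi ?f ?f ?f)" by (simp add: mult_ac)
   also have "?x xi powr (-(33/64)) * ?x xi powr 1 = ?x xi powr (257/512 - 9/512)"
    by (simp only: powr_add[symmetric]) simp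
   finally show "?x xi powr (-(33/64)) * norm (\<Sum>p\<in>nres K xi. ?b xi * (?F xi p s * osc (omp xi p) s (s + h)))
    <= (4 * h powr (129/256)) * (?x xi powr (257/512 - 9/512)
     * wsum (9/512) (nres K xi) xi ?f ?f ?f)" .
  qed auto
  also have "... = (4 * h powr (129/256)) * L2_set (%xi. ?x xi powr (257/512 - 9/512)
     * wsum (9/512) (nres K xi) xi ?f ?f ?f) X" by (subst L2_set_right_distrib) auto
  also have "... <= (4 * h powr (129/256)) * (48 * zeta0 * (L2_set ?f K * L2_set ?f K * L2_set ?f K))"
   by (intro mult_left_mono trilinear_L2 K X) auto
  also have "... <= (4 * h powr (129/256)) * (48 * zeta0 * (R * R * R))"
   using R(1) R(2)[OF s_in] zeta0_pos by (intro mult_left_mono mult_mono) auto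
  also have "... = 192 * zeta0 * R ^ 3 * h powr (129/256)" by (simp add: power3_eq_cube)
  finally show ?thesis .
 qed
 \<comment> \<open>1728 = 12 * 48 * 3: the 12 collects 2|xi| of the coefficient, 3 of
   \<open>jb_powr_le\<close> and 2 of \<open>osc_wgt0\<close>; 48 is the constant of
   \<open>trilinear_L2\<close>; and each of the three factors of the product is incremented
   once.\<close>
 define z where "z = (%p::nat. 1728 * zeta0 * M * R^2 * ((lam / h) powr (255/512) *
   ((h / 2 ^ Suc p) powr (255/512) * (h / 2 ^ Suc p) powr (129/256))))"
 show "L2_set (%xi. ?x xi powr (-(33/64)) * norm (\<Sum>q\<in>nres K xi. ?b xi *
      ldiff (omp xi q) (%r. ?F xi q r) s h p i)) X <= z p" if i: "i < 2 ^ p" for p i proof -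
  define h' where "h' = h / 2 ^ Suc p"
  have h': "h' > 0" using h by (simp add: h'_def)
  define a b c where "a = node s h p i" "b = mid s h p i" "c = node s h p (Suc i)"
  have abc: "b - a = h'" "c - b = h'" "s <= a" "b <= s + h" "a <= s + h" "s <= b"
   using mid_node[of s h p i] node_mid[of s h p i] node_bounds[of h i p s] mid_bounds[of h i p s] h i
   by (auto simp: a_b_c_def h'_def)
  have ab: "a \<in> {s..s + h}" "b \<in> {s..s + h}" "a < b" using abc h' by auto
  define e where "e = (incr v a b)"
  define f where "f = (%k. norm (v k a))"
  define g where "g = (%k. norm (v k b))"
  have nn: "e k >= 0" "f k >= 0" "g k >= 0" for k by (auto simp: e_def f_def g_def)
  have Le: "L2_set e K <= M * h' powr (129/256)" unfolding e_def using M(2)[of a b] abc ab by simp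
  have Lf: "L2_set f K <= R" "L2_set g K <= R" unfolding f_def g_def using R ab by auto
  have je: "norm (v k b - v k a) = jb k powr (33/64) * e k" for k
   by (simp add: e_def mult.assoc[symmetric] less_imp_neq[symmetric] flip: powr_add)
  let ?S = "%xi f g h. wsum (33/64) (nres K xi) xi f g h"
  let ?T = "%xi f g h. ?x xi powr (257/512 - 33/64) * ?S xi f g h"
  let ?c = "12 * h' powr (255/512) * (lam / h) powr (255/512)"
  have "L2_set (%xi. ?x xi powr (-(33/64)) * norm (\<Sum>q\<in>nres K xi. ?b xi *
      ldiff (omp xi q) (%r. ?F xi q r) s h p i)) X
   <= L2_set (%xi. ?c * (?T xi e g g + ?T xi f e g + ?T xi f f e)) X" proof (rule L2_set_mono)
   fix xi assume X': "xi \<in> X"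
   then have xi: "xi ~= 0" using X by auto
   have "norm (\<Sum>q\<in>nres K xi. ?b xi * ldiff (omp xi q) (%r. ?F xi q r) s h p i)
     <= (\<Sum>q\<in>nres K xi. case q of (k, l) => 12 * ?x xi * h' powr (255/512) * (
       wgt (33/64) xi k l * e k * g l * g (xi - k - l)
      + wgt (33/64) xi k l * f k * e l * g (xi - k - l)
      + wgt (33/64) xi k l * f k * f l * e (xi - k - l)))" proof (rule sum_norm_le, clarify)
    fix k l assume kl: "(k, l) \<in> nres K xi"
    define m where "m = xi - k - l"
    let ?d = "dmax xi k l powr (33/64)"
    have 1: "norm (v k b * v l b * v m b - v k a * v l a * v m a)
      <= 3 * ?d * (e k * g l * g m + f k * e l * g m + f k * f l * e m)"
     unfolding f_def g_def by (rule norm_prod3_increment_le[of k l K xi "%k. v k b" "%k. v k a", OF kl xi je nn(1) m_def])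
    have 2: "norm (osc (om xi k l) b c) <= 2 * h' powr (255/512) * wgt 0 xi k l"
     using osc_wgt0[OF kl, of b c] abc h' by simp
    have w: "wgt 0 xi k l * ?d = wgt (33/64) xi k l" using dmax_ge_1[OF kl] by (simp add: wgt_def)
    have "norm (?b xi * ldiff (om xi k l) (%r. ?F xi (k, l) r) s h p i)
     = 2 * ?x xi * (norm (v k b * v l b * v m b - v k a * v l a * v m a) * norm (osc (om xi k l) b c))"
     unfolding ldiff_def norm_mult nb[unfolded norm_mult] a_b_c_def[symmetric] by (simp add: m_def)
    also have "... <= 2 * ?x xi * ((3 * ?d * (e k * g l * g m + f k * e l * g m + f k * f l * e m))
       * (2 * h' powr (255/512) * wgt 0 xi k l))"
     by (intro mult_left_mono mult_mono 1 2) (use nn in \<open>auto intro!: mult_nonneg_nonneg add_nonneg_nonneg\<close>)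
    also have "... = 12 * ?x xi * h' powr (255/512) * ((wgt 0 xi k l * ?d) * (e k * g l * g m + f k * e l * g m + f k * f l * e m))"
     by (simp add: mult_ac)
    finally show "norm (?b xi * ldiff (om xi (fst (k, l)) (snd (k, l))) (%r. ?F xi (k, l) r) s h p i)
      <= 12 * ?x xi * h' powr (255/512) * (wgt (33/64) xi k l * e k * g l * g (xi - k - l)
      + wgt (33/64) xi k l * f k * e l * g (xi - k - l)
      + wgt (33/64) xi k l * f k * f l * e (xi - k - l))" unfolding w by (simp add: m_def algebra_simps)
   qed
   also have "... = 12 * ?x xi * h' powr (255/512) * (?S xi e g g + ?S xi f e g + ?S xi f f e)"
    by (simp add: sum_distrib_left sum.distrib case_prod_unfold distrib_left)
   finally have "?x xi powr (-(33/64)) * norm (\<Sum>q\<in>nres K xi. ?b xi * ldiff (omp xi q) (%r. ?F xi q r) s h p i)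
    <= ?x xi powr (-(33/64)) * (12 * ?x xi * h' powr (255/512) * (?S xi e g g + ?S xi f e g + ?S xi f f e))"
    by (intro mult_left_mono) auto
   also have "... = 12 * h' powr (255/512) * (?x xi powr (-(33/64)) * ?x xi powr 1) * (?S xi e g g + ?S xi f e g + ?S xi f f e)"
    by (simp add: mult_ac)
   also have "?x xi powr (-(33/64)) * ?x xi powr 1 = ?x xi powr (255/512) * ?x xi powr (257/512 - 33/64)"
    by (simp only: powr_add[symmetric]) simp
   also have "12 * h' powr (255/512) * (?x xi powr (255/512) * ?x xi powr (257/512 - 33/64)) * (?S xi e g g + ?S xi f e g + ?S xi f f e)
    <= 12 * h' powr (255/512) * ((lam/h) powr (255/512) * ?x xi powr (257/512 - 33/64)) * (?S xi e g g + ?S xi f e g + ?S xi f f e)"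
   proof (intro mult_right_mono mult_left_mono powr_mono2)
    show "?x xi <= lam / h" using hX[OF X'] h by (simp add: field_simps)
   qed (use nn in \<open>auto intro!: add_nonneg_nonneg sum_nonneg mult_nonneg_nonneg\<close>)
   also have "... = ?c * (?T xi e g g + ?T xi f e g + ?T xi f f e)" by (simp add: algebra_simps)
   finally show "?x xi powr (-(33/64)) * norm (\<Sum>q\<in>nres K xi. ?b xi * ldiff (omp xi q) (%r. ?F xi q r) s h p i)
    <= ?c * (?T xi e g g + ?T xi f e g + ?T xi f f e)" .
  qed auto
  also have "... = ?c * L2_set (%xi. ?T xi e g g + ?T xi f e g + ?T xi f f e) X" by (subst L2_set_right_distrib) auto
  also have "... <= ?c * (L2_set (%xi. ?T xi e g g) X + L2_set (%xi. ?T xi f e g) X + L2_set (%xi. ?T xi f f e) X)"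
   by (intro mult_left_mono L2_set_sum3_le) auto
  also have "... <= ?c * (48 * zeta0 * (L2_set e K * L2_set g K * L2_set g K)
    + 48 * zeta0 * (L2_set f K * L2_set e K * L2_set g K) + 48 * zeta0 * (L2_set f K * L2_set f K * L2_set e K))"
   by (intro mult_left_mono add_mono trilinear_L2 K X nn) auto
  also have "... <= ?c * (48 * zeta0 * ((M * h' powr (129/256)) * R * R)
    + 48 * zeta0 * (R * (M * h' powr (129/256)) * R) + 48 * zeta0 * (R * R * (M * h' powr (129/256))))"
   using zeta0_pos R(1) M(1) by (intro mult_left_mono add_mono mult_mono Le Lf) auto
  also have "... = z p" by (simp add: z_def h'_def power2_eq_square mult_ac)
  finally show ?thesis .
 qed
 show "(\<Sum>p<P. 2 ^ p * z p) <= yng R lam * M * h powr (129/256)" for P proof -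
  have zp: "2 ^ p * z p = 864 * zeta0 * R^2 * lam powr (255/512) * M * h powr (129/256) * (2 powr (-(1/512))) ^ Suc p" for p
  proof -
   let ?h = "h / 2 ^ Suc p"
   have "(lam/h) powr (255/512) * h powr (513/512) = lam powr (255/512) / h powr (255/512) * (h powr (255/512) * h powr (129/256))"
    by (simp add: powr_divide flip: powr_add)
   then have e: "(lam/h) powr (255/512) * h powr (513/512) = lam powr (255/512) * h powr (129/256)" using h by simp
   have "2 ^ p * z p = 1728 * zeta0 * M * R^2 * ((lam/h) powr (255/512) * (2 ^ p * ?h powr (513/512)))"
    unfolding z_def powr_add[symmetric] by simp
   also have "... = 864 * zeta0 * M * R^2 * ((lam/h) powr (255/512) * h powr (513/512)) * (2 powr (-(1/512))) ^ Suc p"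
    unfolding dyadic_powr by simp
   finally show ?thesis unfolding e by (simp add: mult_ac)
  qed
  have "(\<Sum>p<P. 2 ^ p * z p) = 864 * zeta0 * R^2 * lam powr (255/512) * M * h powr (129/256) * (\<Sum>p<P. (2 powr (-(1/512))) ^ Suc p)"
   unfolding zp sum_distrib_left ..
  also have "... <= 864 * zeta0 * R^2 * lam powr (255/512) * M * h powr (129/256) * geo0"
   using zeta0_pos M(1) by (intro mult_left_mono geo0_sum) auto
  finally show ?thesis by (simp add: mult_ac)
 qed
qed

text \<open>The coefficient -6 is 2 * (-3). By \<open>cube_resonant\<close> the resonant part of the
  cube is 3 P v_xi - 3 v_xi^2 v_(-xi), and the first of these two terms is the one cancelled by the
  mean subtracted in the nonlinearity.\<close>

definition gf :: "real => int => (int => real => complex) => int => real => complex" where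
 "gf sg N v xi r = - 6 * \<i> * of_real sg * of_int xi * ((v xi r)^2 * v (- xi) r) +
   (\<Sum>p\<in>nres {-N..N} xi. nlc sg xi *
     (cis (omp xi p * r) * cub v xi p r))"

text \<open>The equation for the profiles $e^{-iq(\xi)t}\hat u(t,\xi)$ of a solution with frequencies in
 \<open>{-N..N}\<close> on the time interval \<open>{-T..T}\<close>, up to an error \<open>ep\<close>.\<close>

definition approx_sol ::
 "real => int => real => real => real => (int => real => complex) => bool" where
 "approx_sol sg N T ep R v \<longleftrightarrow>
   (\<forall>k t. \<bar>k\<bar> > N --> v k t = 0) \<and>
   (\<forall>k. continuous_on {-T..T} (v k)) \<and>
   (\<forall>t\<in>{-T..T}. L2_set (%k. norm (v k t)) {-N..N} <= R) \<and>
   (\<forall>xi\<in>{-N..N}. \<forall>s t. - T <= s \<and> s <= t \<and> t <= T -->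
    norm (v xi t - v xi s - integral {s..t} (gf sg N v xi)) <= ep * (t - s))"

definition hold_bd :: "int => real => (int => real => complex) => real => bool" where
 "hold_bd N T v M \<longleftrightarrow> (\<forall>s t. - T <= s \<and> s < t \<and> t <= T -->
   L2_set (incr v s t) {-N..N} <= M * (t - s) powr (129/256))"

lemma L2_set_Un_le:
 assumes "finite A" "finite B" "A \<inter> B = {}"
 shows "L2_set f (A \<union> B) <= L2_set f A + L2_set f B" unfolding L2_set_def using assms
 by (simp add: sum.union_disjoint sqrt_add_le_add_sqrt sum_nonneg)

lemma L2_set_subset: "[|finite B; A \<subseteq> B|] ==> L2_set f A <= L2_set f B"
 unfolding L2_set_def by (intro real_sqrt_le_mono sum_mono2) auto

lemma norm_add3_le: "x = a + b + c ==> norm x <= norm a + norm b + norm c" for a :: "'a::real_normed_vector"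
 using norm_triangle_ineq[of "a + b" c] norm_triangle_ineq[of a b] by simp

lemma integral_sq_le:
 fixes g :: "real => real"
 assumes h: "s < t" and g: "continuous_on {s..t} g"
 shows "(integral {s..t} g)^2 <= (t - s) * integral {s..t} (%r. (g r)^2)"
proof -
 define m where "m = integral {s..t} g / (t - s)"
 have i: "g integrable_on {s..t}" "(%r. (g r)^2) integrable_on {s..t}"
  by (auto intro!: integrable_continuous_real continuous_intros g)
 have "0 <= integral {s..t} (%r. (g r - m)^2)"
  by (intro integral_nonneg integrable_continuous_real continuous_intros g) auto
 also have "integral {s..t} (%r. (g r - m)^2) = integral {s..t} (%r. (g r)^2 - 2 * m * g r + m^2)"
  by (simp add: power2_eq_square algebra_simps)
 also have "... = integral {s..t} (%r. (g r)^2) - 2 * m * integral {s..t} g + m^2 * (t - s)"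
 proof (rule integral_unique)
  have "((%r. (g r)^2 - 2 * m * g r + m^2) has_integral
    integral {s..t} (%r. (g r)^2) - 2 * m * integral {s..t} g + (t - s) *\<^sub>R m^2) {s..t}"
   using has_integral_const_real[of "m^2" s t] h
   by (intro has_integral_add has_integral_diff has_integral_mult_right integrable_integral i) auto
  then show "((%r. (g r)^2 - 2 * m * g r + m^2) has_integral
    integral {s..t} (%r. (g r)^2) - 2 * m * integral {s..t} g + m^2 * (t - s)) {s..t}" by (simp add: mult.commute)
 qed
 also have "... = integral {s..t} (%r. (g r)^2) - m * integral {s..t} g" proof -
  have "m * (t - s) = integral {s..t} g" using h by (simp add: m_def)
  then have "m^2 * (t - s) = m * integral {s..t} g" by (simp add: power2_eq_square)
  then show ?thesis by linarith
 qed
 finally have "m * integral {s..t} g * (t - s) <= integral {s..t} (%r. (g r)^2) * (t - s)"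
  using h by (intro mult_right_mono) auto
 moreover have "m * integral {s..t} g * (t - s) = (integral {s..t} g)^2" using h by (simp add: m_def power2_eq_square)
 ultimately show ?thesis by (simp add: mult.commute)
qed

lemma gf_continuous:
 assumes "approx_sol sg N T ep R v" "-T <= s" "t <= T"
 shows "continuous_on {s..t} (gf sg N v xi)"
proof -
 have "continuous_on {s..t} (v k)" for k using assms unfolding approx_sol_def by (auto intro: continuous_on_subset)
 then show ?thesis unfolding gf_def by (intro continuous_intros)
qed

text \<open>Frequencies are split at h |xi|^(44/43) = lam. Above, the weight itself is at most
  (h/lam)^(129/256), because 44/43 * 129/256 = 33/64, and the bound by R suffices. Below, also h|xi|
  <= lam, so \<open>nonres_bound\<close> applies. The old constant M survives only with the factor
  \<open>yng R lam\<close>.\<close>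

lemma hold_bd_step:
 assumes sol: "approx_sol sg N T ep R v" and sg: "\<bar>sg\<bar> = 1" and ep: "0 <= ep" "ep <= 1"
  and R: "R >= 0" and lam: "0 < lam" "lam <= 1" and M: "M >= 0" "hold_bd N T v M"
 shows "hold_bd N T v (2 * R * lam powr (-(129/256)) + 1 + sqrt zeta0 + 6 * R ^ 3 + 192 * zeta0 * R ^ 3
   + yng R lam * M)" unfolding hold_bd_def
proof (intro allI impI, elim conjE)
 fix s t assume st: "- T <= s" "s < t" "t <= T"
 define h where "h = t - s"
 have h: "h > 0" "t = s + h" using st by (auto simp: h_def)
 let ?K = "{-N..N}"
 let ?x = "%xi. mag xi"
 let ?d = "%xi. jb xi powr (-(33/64)) * norm (v xi t - v xi s)"
 let ?hb = "h powr (129/256)"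
 define X2 where "X2 = {xi\<in>?K. xi ~= 0 \<and> h * ?x xi powr (44/43) < lam}"
 define X1 where "X1 = ?K - X2"
 have cont: "continuous_on {s..t} (v k)" for k
  using sol st unfolding approx_sol_def by (auto intro: continuous_on_subset)
 have RR: "L2_set (%k. norm (v k r)) ?K <= R" if "r \<in> {s..t}" for r
  using sol st that unfolding approx_sol_def by auto
 have Rk: "norm (v k r) <= R" if "r \<in> {s..t}" for k r proof (cases "k \<in> ?K")
  case True
  then show ?thesis using member_le_L2_set[of ?K k "%k. norm (v k r)"] RR[OF that] by auto
 next
  case False
  then have "\<bar>k\<bar> > N" by auto
  then show ?thesis using sol R unfolding approx_sol_def by auto
 qed
 have err: "norm (v xi t - v xi s - integral {s..t} (gf sg N v xi)) <= ep * h" if "xi \<in> ?K" for xi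
  using sol st that unfolding approx_sol_def h_def by auto
 have h_le: "h <= ?hb" if "h <= 1" using powr_mono'[of "129/256" 1 h] h that by simp
 have 1: "L2_set ?d X1 <= (2 * R * lam powr (-(129/256)) + 1) * ?hb" proof -
  let ?c = "?hb * lam powr (-(129/256))"
  have "L2_set ?d X1 <= L2_set (%xi. ?c * norm (v xi t) + ?c * norm (v xi s) + (if xi = 0 then ?hb else 0)) X1"
  proof (rule L2_set_mono)
   fix xi assume xi: "xi \<in> X1"
   have c: "?c = (h / lam) powr (129/256)" unfolding powr_divide powr_minus by (simp only: divide_inverse)
   have n: "norm (v xi t - v xi s) <= norm (v xi t) + norm (v xi s)" by (rule norm_triangle_ineq4)
   have *: "?d xi <= ?c * (norm (v xi t) + norm (v xi s))" if "jb xi powr (-(33/64)) <= ?c"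
    by (rule mult_mono[OF that n]) auto
   show "?d xi <= ?c * norm (v xi t) + ?c * norm (v xi s) + (if xi = 0 then ?hb else 0)" proof (cases "xi = 0")
    case False
    then have "lam <= h * ?x xi powr (44/43)" using xi by (auto simp: X1_def X2_def)
    moreover have xp: "?x xi powr (44/43) > 0" using False by simp
    ultimately have "lam / ?x xi powr (44/43) <= h" by (simp only: pos_divide_le_eq)
    then have "1 / ?x xi powr (44/43) * lam <= h" by simp
    then have "1 / ?x xi powr (44/43) <= h / lam" using lam by (simp only: pos_le_divide_eq)
    then have "(?x xi powr (-(44/43))) powr (129/256) <= (h / lam) powr (129/256)"
     by (intro powr_mono2) (auto simp: powr_minus_divide)
    then have "jb xi powr (-(33/64)) <= ?c" unfolding c jb_nz[OF False] powr_powr by simp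
    then show ?thesis using * False by (simp add: distrib_left)
   next
    case True
    \<comment> \<open>The mode 0 has a vanishing right-hand side. For h < lam only the error ep * h
      remains; for longer intervals the trivial bound works as for high frequencies.\<close>
    show ?thesis proof (cases "h >= lam")
     case h': True
     have "1 powr (129/256) <= (h / lam) powr (129/256)" using h' lam by (intro powr_mono2) auto
     then have "jb xi powr (-(33/64)) <= ?c" unfolding c using True by (simp add: jb_def)
     then have "?d xi <= ?c * (norm (v xi t) + norm (v xi s))" by (rule *)
     then show ?thesis using True by (simp only: distrib_left if_True) (rule add_increasing2, auto)
    next
     case False
     then have h1: "h <= 1" using lam by auto
     have "xi \<in> ?K" using xi by (auto simp: X1_def)
     have "gf sg N v xi = (%_. 0)" by (simp add: gf_def True fun_eq_iff)
     then have "norm (v xi t - v xi s) <= ep * h" using err[OF \<open>xi \<in> ?K\<close>] by simp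
     also have "... <= 1 * h" using ep h by (intro mult_right_mono) auto
     also have "... <= ?hb" using h_le h1 by simp
     finally have "?d xi <= ?hb" using True by (simp add: jb_def)
     then show ?thesis using True by (simp only: if_True) (rule add_increasing, auto)
    qed
   qed
  qed auto
  also have "... <= L2_set (%xi. ?c * norm (v xi t)) X1 + L2_set (%xi. ?c * norm (v xi s)) X1
    + L2_set (%xi. if xi = 0 then ?hb else 0) X1" by (rule L2_set_sum3_le)
  also have "... = ?c * L2_set (%xi. norm (v xi t)) X1 + ?c * L2_set (%xi. norm (v xi s)) X1
    + L2_set (%xi. if xi = 0 then ?hb else 0) X1" by (subst (1 2) L2_set_right_distrib) auto
  also have "... <= ?c * R + ?c * R + ?hb" proof (intro add_mono mult_left_mono)
   show "L2_set (%xi. norm (v xi t)) X1 <= R"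
    using RR[of t] st L2_set_subset[of ?K X1 "%xi. norm (v xi t)"] by (auto simp: X1_def)
   show "L2_set (%xi. norm (v xi s)) X1 <= R"
    using RR[of s] st L2_set_subset[of ?K X1 "%xi. norm (v xi s)"] by (auto simp: X1_def)
   have "L2_set (%xi. if xi = 0 then ?hb else 0) X1 <= (\<Sum>xi\<in>X1. if xi = 0 then ?hb else 0)"
    by (rule L2_set_le_sum) auto
   also have "... <= ?hb" by (simp add: X1_def sum.delta)
   finally show "L2_set (%xi. if xi = 0 then ?hb else 0) X1 <= ?hb" .
  qed auto
  finally show ?thesis by (simp add: algebra_simps)
 qed
 have 2: "L2_set ?d X2 <= (sqrt zeta0 + 6 * R ^ 3 + (192 * zeta0 * R ^ 3
    + yng R lam * M)) * ?hb" proof (cases "X2 = {}")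
  case True
  then show ?thesis using R M zeta0_pos geo0_pos by simp
 next
  case False
  have X2: "0 \<notin> X2" "X2 \<subseteq> ?K" by (auto simp: X2_def)
  have fX2: "finite X2" using X2(2) by (rule finite_subset) simp
  have x1: "?x xi >= 1" if "xi \<in> X2" for xi using that by (auto simp: X2_def)
  have hx: "h * ?x xi <= lam" if "xi \<in> X2" for xi proof -
   have "?x xi powr 1 <= ?x xi powr (44/43)" using x1[OF that] by (intro powr_mono) auto
   then have "h * ?x xi <= h * ?x xi powr (44/43)" using h by (intro mult_left_mono) auto
   also have "... < lam" using that by (simp add: X2_def)
   finally show ?thesis by simp
  qed
  have h1: "h <= 1" proof -
   obtain xi where xi: "xi \<in> X2" using False by auto
   have "h * 1 <= h * ?x xi" using x1[OF xi] h by (intro mult_left_mono) auto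
   then show ?thesis using hx[OF xi] lam by simp
  qed
  let ?w = "%xi. ?x xi powr (-(33/64))"
  let ?E = "%xi. v xi t - v xi s - integral {s..t} (gf sg N v xi)"
  let ?r = "%xi r. - 6 * \<i> * of_real sg * of_int xi * ((v xi r)^2 * v (- xi) r)"
  let ?n = "%xi r. \<Sum>p\<in>nres ?K xi. nlc sg xi *
     (cis (omp xi p * r) * cub v xi p r)"
  let ?Ir = "%xi. norm (integral {s..t} (?r xi))" and ?In = "%xi. norm (integral {s..t} (?n xi))"
  let ?v1 = "%xi. integral {s..t} (%r. norm (v xi r))" and ?v2 = "%xi. integral {s..t} (%r. (norm (v xi r))^2)"
  have "L2_set ?d X2 <= L2_set (%xi. ?w xi * norm (?E xi) + ?w xi * ?Ir xi
    + ?w xi * ?In xi) X2" proof (rule L2_set_mono)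
   fix xi assume xi: "xi \<in> X2"
   have "integral {s..t} (gf sg N v xi) = integral {s..t} (?r xi) + integral {s..t} (?n xi)" unfolding gf_def
    by (rule Henstock_Kurzweil_Integration.integral_add)
     (intro integrable_continuous_real continuous_intros cont)+
   then have "norm (v xi t - v xi s) <= norm (?E xi) + ?Ir xi + ?In xi" by (intro norm_add3_le) simp
   then have "?w xi * norm (v xi t - v xi s) <= ?w xi * (norm (?E xi) + ?Ir xi + ?In xi)" by (intro mult_left_mono) auto
   moreover have "jb xi = ?x xi" using xi X2 by (intro jb_nz) auto
   ultimately show "?d xi <= ?w xi * norm (?E xi) + ?w xi * ?Ir xi
    + ?w xi * ?In xi" by (simp add: distrib_left)
  qed auto
  also have "... <= L2_set (%xi. ?w xi * norm (?E xi)) X2 + L2_set (%xi. ?w xi * ?Ir xi) X2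
    + L2_set (%xi. ?w xi * ?In xi) X2" by (rule L2_set_sum3_le)
  also have "... <= sqrt zeta0 * ?hb + 6 * R ^ 3 * ?hb + (192 * zeta0 * R ^ 3 * ?hb
    + yng R lam * M * ?hb)" proof (intro add_mono)
   \<comment> \<open>The error is the same for every mode, so it is summed with the help of the
     weight: 33/64 exceeds 257/512, the exponent of the square summable \<open>pw\<close>.\<close>
   have "L2_set (%xi. ?w xi * norm (?E xi)) X2 <= L2_set (%xi. ?hb * pw xi) X2" proof (rule L2_set_mono)
    fix xi assume xi: "xi \<in> X2"
    have "norm (?E xi) <= ep * h" using xi X2 by (intro err) auto
    also have "... <= 1 * h" using ep h by (intro mult_right_mono) auto
    also have "... <= ?hb" using h_le h1 by simp
    finally have "?w xi * norm (?E xi) <= pw xi * ?hb"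
     unfolding pw_def using x1[OF xi] by (intro mult_mono powr_mono) auto
    then show "?w xi * norm (?E xi) <= ?hb * pw xi" by (simp add: mult.commute)
   qed auto
   also have "... = ?hb * L2_set pw X2" by (subst L2_set_right_distrib) auto
   also have "... <= ?hb * sqrt zeta0" using sum_pw_sq_le[OF fX2] by (intro mult_left_mono) (auto simp: L2_set_def)
   finally show "L2_set (%xi. ?w xi * norm (?E xi)) X2 <= sqrt zeta0 * ?hb" by (simp add: mult.commute)
   \<comment> \<open>The weighted resonant term contains |xi|^(31/64), at most h^(-31/64) on these
     frequencies. Cauchy-Schwarz in time, used before summing over xi so that the l2 bound is
     available at each time, gives back a factor h; the total h^(33/64) is at most h^(129/256)
     because h <= 1.\<close>
   show "L2_set (%xi. ?w xi * ?Ir xi) X2 <= 6 * R ^ 3 * ?hb" proof -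
    have "(\<Sum>xi\<in>X2. (?w xi * ?Ir xi)^2)
     <= (\<Sum>xi\<in>X2. 36 * R ^ 4 * h powr (1/32) * ?v2 xi)" proof (rule sum_mono)
     fix xi assume xi: "xi \<in> X2"
     have "?Ir xi <= integral {s..t} (%r. (6 * ?x xi * R^2) * norm (v xi r))" proof (rule integral_norm_bound_integral)
      fix r assume r: "r \<in> {s..t}"
      have "norm (?r xi r) = 6 * ?x xi * ((norm (v xi r) * norm (v (-xi) r)) * norm (v xi r))"
       using sg by (simp add: norm_mult power2_eq_square)
      also have "... <= 6 * ?x xi * ((R * R) * norm (v xi r))"
       using Rk[OF r] R by (intro mult_left_mono mult_right_mono mult_mono) auto
      finally show "norm (?r xi r) <= (6 * ?x xi * R^2) * norm (v xi r)" by (simp add: power2_eq_square mult_ac)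
     qed (auto intro!: integrable_continuous_real continuous_intros cont)
     also have "... = (6 * ?x xi * R^2) * ?v1 xi" by simp
     finally have "(?w xi * ?Ir xi)^2
       <= (?w xi * ((6 * ?x xi * R^2) * ?v1 xi))^2" by (intro power_mono mult_left_mono) auto
     also have "... = 36 * R ^ 4 * (?w xi * ?x xi)^2 * (?v1 xi)^2" by (simp add: power_mult_distrib)
     also have "(?w xi * ?x xi)^2 = ?x xi powr (31/32)" proof -
      have "?w xi * ?x xi = ?w xi * ?x xi powr 1" by simp
      also have "... = ?x xi powr (31/64)" by (simp only: powr_add[symmetric]) simp
      finally show ?thesis by (simp add: power2_eq_square flip: powr_add)
     qed
     also have "36 * R ^ 4 * ?x xi powr (31/32) * (?v1 xi)^2
      <= 36 * R ^ 4 * (1 / h) powr (31/32) * (h * ?v2 xi)" proof (intro mult_mono mult_left_mono powr_mono2)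
      show "?x xi <= 1 / h" using hx[OF xi] lam h by (simp add: field_simps)
      show "(?v1 xi)^2 <= h * ?v2 xi" unfolding h_def by (rule integral_sq_le[OF st(2)]) (intro continuous_intros cont)
     qed (use R in auto)
     also have "... = 36 * R ^ 4 * ((1 / h) powr (31/32) * h powr 1) * ?v2 xi" using h by (simp add: mult_ac)
     also have "(1 / h) powr (31/32) * h powr 1 = h powr (1/32)" proof -
      have "(1 / h) powr (31/32) = h powr (-(31/32))" by (simp add: powr_divide powr_minus_divide)
      then show ?thesis by (simp only: powr_add[symmetric]) simp
     qed
     finally show "(?w xi * ?Ir xi)^2
       <= 36 * R ^ 4 * h powr (1/32) * ?v2 xi" .
    qed
    also have "... = 36 * R ^ 4 * h powr (1/32) * integral {s..t} (%r. \<Sum>xi\<in>X2. (norm (v xi r))^2)"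
     unfolding sum_distrib_left[symmetric] by (subst Henstock_Kurzweil_Integration.integral_sum)
      (use X2 fX2 in \<open>auto intro!: integrable_continuous_real continuous_intros cont\<close>)
    also have "... <= 36 * R ^ 4 * h powr (1/32) * (R^2 * h)" proof (intro mult_left_mono)
     have "norm (integral {s..t} (%r. \<Sum>xi\<in>X2. (norm (v xi r))^2)) <= R^2 * (t - s)" proof (rule integral_bound)
      fix r assume r: "r \<in> {s..t}"
      have "(\<Sum>xi\<in>X2. (norm (v xi r))^2) <= (\<Sum>xi\<in>?K. (norm (v xi r))^2)"
       using X2 by (intro sum_mono2) auto
      also have "... <= R^2" using RR[OF r] unfolding L2_set_def by (intro sqrt_le_D)
      finally show "norm (\<Sum>xi\<in>X2. (norm (v xi r))^2) <= R^2" by (simp add: sum_nonneg)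
     qed (use st in \<open>auto intro!: continuous_intros cont\<close>)
     then show "integral {s..t} (%r. \<Sum>xi\<in>X2. (norm (v xi r))^2) <= R^2 * h" by (simp add: h_def)
    qed (use R in auto)
    also have "... = 36 * R ^ 6 * (h powr (1/32) * h powr 1)"
     using h by (simp add: power2_eq_square eval_nat_numeral mult_ac)
    also have "h powr (1/32) * h powr 1 = h powr (33/32)" by (simp only: powr_add[symmetric]) simp
    also have "36 * R ^ 6 * h powr (33/32) <= 36 * R ^ 6 * h powr (129/128)"
     using h h1 R by (intro mult_left_mono powr_mono') auto
    also have "... = (6 * R ^ 3 * ?hb)^2" proof -
     have "h powr (129/128) = ?hb^2" by (simp add: power2_eq_square flip: powr_add)
     then show ?thesis by (simp add: power_mult_distrib)
    qed
    finally show ?thesis using R by (subst L2_set_def, intro real_le_lsqrt) (auto intro!: sum_nonneg)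
   qed
   show "L2_set (%xi. ?w xi * ?In xi) X2
    <= 192 * zeta0 * R ^ 3 * ?hb + yng R lam * M * ?hb" unfolding h(2) proof (rule nonres_bound)
    fix x y assume "s <= x" "x < y" "y <= s + h"
    then show "L2_set (incr v x y) ?K <= M * (y - x) powr (129/256)" using M(2) st h unfolding hold_bd_def by auto
   qed (use X2 fX2 h lam hx R RR cont M sg in auto)
  qed
  finally show ?thesis by (simp add: algebra_simps)
 qed
 have "?K = X1 \<union> X2" "X1 \<inter> X2 = {}" by (auto simp: X1_def X2_def)
 moreover have "finite X1" "finite X2" by (rule finite_subset[of _ ?K]; auto simp: X1_def X2_def)+
 ultimately have "L2_set ?d ?K <= L2_set ?d X1 + L2_set ?d X2" by (simp add: L2_set_Un_le)
 with 1 2 show "L2_set ?d ?K <= (2 * R * lam powr (-(129/256)) + 1 + sqrt zeta0 + 6 * R ^ 3 + 192 * zeta0 * R ^ 3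
   + yng R lam * M) * (t - s) powr (129/256)" unfolding h_def[symmetric] by (simp add: algebra_simps)
qed

text \<open>The constant depends on N and on the solution. It merely guarantees that the iteration
  in \<open>hold_bd_uniform\<close> starts from something finite.\<close>

lemma hold_bd_initial:
 assumes sol: "approx_sol sg N T ep R v" and R: "R >= 0" and ep: "0 <= ep"
 obtains M where "M >= 0" "hold_bd N T v M"
proof -
 let ?K = "{-N..N}"
 have "\<exists>B. \<forall>r\<in>{-T..T}. norm (gf sg N v xi r) <= B" for xi proof -
  have "compact (gf sg N v xi ` {-T..T})" by (intro compact_continuous_image gf_continuous[OF sol]) auto
  then have "bounded (gf sg N v xi ` {-T..T})" by (rule compact_imp_bounded)
  then show ?thesis by (auto simp: bounded_iff)
 qed
 then obtain B where B: "!!xi r. r \<in> {-T..T} ==> norm (gf sg N v xi r) <= B xi" by metis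
 define L where "L = (\<Sum>xi\<in>?K. ep + \<bar>B xi\<bar>)"
 have L0: "L >= 0" unfolding L_def using ep by (intro sum_nonneg) auto
 have "hold_bd N T v (L + 2 * R)" unfolding hold_bd_def proof (intro allI impI, elim conjE)
  fix s t assume st: "- T <= s" "s < t" "t <= T"
  let ?h = "t - s"
  let ?d = "incr v s t"
  have j: "jb k powr (-(33/64)) <= 1" for k using powr_mono[of "-(33/64)" 0 "jb k"] jb_pos[of k] by simp
  show "L2_set ?d ?K <= (L + 2 * R) * ?h powr (129/256)" proof (cases "?h <= 1")
   case True
   have "L2_set ?d ?K <= (\<Sum>k\<in>?K. ?d k)" by (rule L2_set_le_sum) auto
   also have "... <= (\<Sum>k\<in>?K. (ep + \<bar>B k\<bar>) * ?h)" proof (rule sum_mono)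
    fix k assume k: "k \<in> ?K"
    have "norm (v k t - v k s - integral {s..t} (gf sg N v k)) <= ep * ?h"
     using sol st k unfolding approx_sol_def by auto
    moreover have "norm (integral {s..t} (gf sg N v k)) <= \<bar>B k\<bar> * ?h"
     using st by (intro integral_bound gf_continuous[OF sol] order_trans[OF B abs_ge_self]) auto
    ultimately have "norm (v k t - v k s) <= (ep + \<bar>B k\<bar>) * ?h"
     using norm_triangle_ineq[of "v k t - v k s - integral {s..t} (gf sg N v k)" "integral {s..t} (gf sg N v k)"]
     by (simp add: distrib_right)
    moreover have "?d k <= 1 * norm (v k t - v k s)" by (intro mult_right_mono j) auto
    ultimately show "?d k <= (ep + \<bar>B k\<bar>) * ?h" by simp
   qed
   also have "... = L * ?h" by (simp add: L_def sum_distrib_right)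
   also have "... <= L * ?h powr (129/256)"
    using powr_mono'[of "129/256" 1 ?h] st True L0 by (intro mult_left_mono) auto
   also have "... <= (L + 2 * R) * ?h powr (129/256)" using R by (intro mult_right_mono) auto
   finally show ?thesis .
  next
   case False
   have "L2_set ?d ?K <= L2_set (%k. norm (v k t) + norm (v k s)) ?K" proof (rule L2_set_mono)
    fix k
    have "?d k <= 1 * norm (v k t - v k s)" by (intro mult_right_mono j) auto
    then show "?d k <= norm (v k t) + norm (v k s)" using norm_triangle_ineq4[of "v k t" "v k s"] by simp
   qed auto
   also have "... <= L2_set (%k. norm (v k t)) ?K + L2_set (%k. norm (v k s)) ?K" by (rule L2_set_triangle_ineq)
   also have "... <= R + R" using sol st unfolding approx_sol_def by (intro add_mono) auto
   also have "... <= (L + 2 * R) * 1" using L0 by simp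
   also have "... <= (L + 2 * R) * ?h powr (129/256)"
    using powr_mono2[of "129/256" 1 ?h] False L0 R by (intro mult_left_mono) auto
   finally show ?thesis .
  qed
 qed
 then show thesis using that[of "L + 2 * R"] L0 R by auto
qed

text \<open>The threshold lam depends on R only and makes \<open>yng R lam\<close> at most 1/2; its
  exponent 512/255 inverts the 255/512 in \<open>yng\<close>. Each application of
  \<open>hold_bd_step\<close> then replaces M by C + M/2, and in the limit 2C remains, whatever the
  initial constant was.\<close>

theorem hold_bd_uniform:
 assumes R: "R >= 0"
 obtains M where "M >= 0"
  "!!sg N T ep v. [|\<bar>sg\<bar> = 1; 0 <= ep; ep <= 1; approx_sol sg N T ep R v|] ==> hold_bd N T v M"
proof -
 define A where "A = 864 * zeta0 * geo0 * R^2 * 2 + 1"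
 have A: "A >= 1" unfolding A_def using zeta0_pos geo0_pos by simp
 define lam where "lam = A powr (-(512/255))"
 have lam: "0 < lam" "lam <= 1" using A powr_mono[of "-(512/255)" 0 A] by (simp_all add: lam_def)
 have lamA: "lam powr (255/512) = 1 / A" unfolding lam_def powr_powr using A by (simp add: powr_minus_divide)
 define C where "C = 2 * R * lam powr (-(129/256)) + 1 + sqrt zeta0 + 6 * R ^ 3 + 192 * zeta0 * R ^ 3"
 have C: "C >= 0" unfolding C_def using R zeta0_pos by simp
 have half: "yng R lam <= 1/2" proof -
  have "(864 * zeta0 * geo0 * R^2) * 2 <= A" by (simp add: A_def)
  then have "864 * zeta0 * geo0 * R^2 <= 1/2 * A" by simp
  then have "864 * zeta0 * geo0 * R^2 / A <= 1/2" using A by (simp only: pos_divide_le_eq)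
  then show ?thesis unfolding lamA by simp
 qed
 show thesis proof (rule that[of "2 * C"])
  show "2 * C >= 0" using C by simp
  fix sg N T ep v assume sg: "\<bar>sg\<bar> = (1::real)" and ep: "0 <= ep" "ep <= 1" and sol: "approx_sol sg N T ep R v"
  obtain M0 where M0: "M0 >= 0" "hold_bd N T v M0" using hold_bd_initial[OF sol R ep(1)] by blast
  have mono: "hold_bd N T v M'" if "hold_bd N T v M" "M <= M'" for M M' unfolding hold_bd_def proof (intro allI impI)
   fix s t assume st: "- T <= s \<and> s < t \<and> t <= T"
   have "L2_set (incr v s t) {-N..N} <= M * (t - s) powr (129/256)" using that(1) st unfolding hold_bd_def by blast
   also have "... <= M' * (t - s) powr (129/256)" using that(2) by (intro mult_right_mono) auto
   finally show "L2_set (incr v s t) {-N..N} <= M' * (t - s) powr (129/256)" .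
  qed
  have it: "hold_bd N T v (2 * C + M0 / 2 ^ n)" for n proof (induction n)
   case 0
   show ?case by (rule mono[OF M0(2)]) (use C in simp)
  next
   case (Suc n)
   let ?M = "2 * C + M0 / 2 ^ n"
   have Mn: "?M >= 0" using C M0 by simp
   have 1: "hold_bd N T v (C + yng R lam * ?M)"
    using hold_bd_step[OF sol sg ep R lam Mn Suc] by (simp only: C_def[symmetric])
   have 2: "C + yng R lam * ?M <= C + 1/2 * ?M" by (intro add_left_mono mult_right_mono half Mn)
   have 3: "C + 1/2 * ?M = 2 * C + M0 / 2 ^ Suc n" by simp
   show ?case by (rule mono[OF 1 2[unfolded 3]])
  qed
  show "hold_bd N T v (2 * C)" unfolding hold_bd_def proof (intro allI impI)
   fix s t assume st: "- T <= s \<and> s < t \<and> t <= T"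
   have "(%n. (2 * C + M0 * inverse (2 ^ n)) * (t - s) powr (129/256)) ----> (2 * C + M0 * 0) * (t - s) powr (129/256)"
    by (rule tendsto_mult_right, rule tendsto_add[OF tendsto_const], rule tendsto_mult_left,
      rule LIMSEQ_inverse_realpow_zero) simp
   then have lim: "(%n. (2 * C + M0 * inverse (2 ^ n)) * (t - s) powr (129/256)) ----> 2 * C * (t - s) powr (129/256)" by simp
   show "L2_set (incr v s t) {-N..N} <= 2 * C * (t - s) powr (129/256)" proof (rule LIMSEQ_le_const[OF lim])
    have "L2_set (incr v s t) {-N..N}
      <= (2 * C + M0 * inverse (2 ^ n)) * (t - s) powr (129/256)" for n
     using it[of n] st unfolding hold_bd_def divide_inverse by blast
    then show "\<exists>n0. \<forall>n\<ge>n0. L2_set (incr v s t) {-N..N}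
      <= (2 * C + M0 * inverse (2 ^ n)) * (t - s) powr (129/256)" by blast
   qed
  qed
 qed
qed

section \<open>Pointwise bounds for tested interactions\<close>

lemma wgt_mono:
 assumes "(k, l) \<in> nres K xi" "rho <= rho'"
 shows "wgt rho xi k l <= wgt rho' xi k l"
 unfolding wgt_def using dmax_ge_1[OF assms(1)] assms(2) by (intro mult_left_mono powr_mono) auto

text \<open>The mechanism of \<open>nonres_bound\<close> at one frequency, with
  \<open>young_sum_bound\<close> on a one-point index set. The function \<open>ta\<close> is
  incremented too, whence R^3 next to 9 M R^2. The trilinear constant E stays open because
  \<open>tail_bound\<close> uses only interactions with large \<open>dmax\<close> and
  \<open>tested_bound\<close> uses all.\<close>

lemma pointwise_bound:
 fixes v :: "int => real => complex" and b :: "int \<times> int => complex"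
 assumes K: "finite K" and S: "S \<subseteq> nres K xi" and xi: "xi ~= 0" and h: "h > 0"
  and R: "R >= 0" "!!r. r \<in> {s..s + h} ==> L2_set (%k. norm (v k r)) K <= R"
  and cont: "!!k. k \<in> K ==> continuous_on {s..s + h} (v k)"
  and M: "M >= 0" "!!x y. [|s <= x; x < y; y <= s + h|] ==>
    L2_set (incr v x y) K <= M * (y - x) powr (129/256)"
  and ta: "continuous_on {s..s + h} ta" "!!r. r \<in> {s..s + h} ==> norm (ta r) <= A"
   "!!x y. [|s <= x; x < y; y <= s + h|] ==> norm (ta y - ta x) <= A * (y - x) powr (129/256)"
  and A: "A >= 0" and B: "B >= 0" "!!p. p \<in> S ==> norm (b p) <= B"
  and E: "E >= 0" "!!f g h. [|!!k. f k >= 0; !!k. g k >= 0; !!k. h k >= 0|] ==>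
    wsum (33/64) S xi f g h <= E * (L2_set f K * L2_set g K * L2_set h K)"
 shows "norm (integral {s..s + h} (%r. \<Sum>p\<in>S. b p *
    (cis (omp xi p * r) * (ta r * cub v xi p r))))
  <= B * A * E * (2 * h powr (255/512) * R ^ 3 + geo0 * h powr (513/512) * (R ^ 3 + 9 * M * R^2))"
proof -
 let ?F = "%p r. ta r * cub v xi p r"
 let ?S = "%f g h. wsum (33/64) S xi f g h"
 have fS: "finite S" using S K finite_subset[of S "nres K xi"] by auto
 have s_in: "s \<in> {s..s + h}" using h by auto
 define z where "z = (%p::nat. 2 * B * A * E * (R ^ 3 + 9 * M * R^2) * (h / 2 ^ Suc p) powr (513/512))"
 have "L2_set (%x::unit. 1 * norm (integral {s..s + h} (%r. \<Sum>p\<in>S. b p *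
    (cis (omp xi p * r) * ?F p r)))) {()}
   <= B * A * E * (2 * h powr (255/512) * R ^ 3) + B * A * E * (geo0 * h powr (513/512) * (R ^ 3 + 9 * M * R^2))"
 proof (rule young_sum_bound[where z = z])
  show "h >= 0" "finite {()}" "finite S" using h fS by auto
  show "(0::real) <= 1" by simp
  show "continuous_on {s..s + h} (?F p)" if "p \<in> S" for p proof -
   have "p \<in> nres K xi" using S that by auto
   then show ?thesis by (intro continuous_intros cont ta) (auto simp: nres_def conv3_def)
  qed
  let ?f = "%k. norm (v k s)"
  have "norm (\<Sum>p\<in>S. b p * (?F p s * osc (omp xi p) s (s + h)))
    <= (\<Sum>p\<in>S. case p of (k, l) => B * (A * (2 * h powr (255/512))) * (wgt (33/64) xi k l * ?f k * ?f l * ?f (xi - k - l)))"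
  proof (rule sum_norm_le, clarify)
   fix k l assume kl: "(k, l) \<in> S"
   then have nr: "(k, l) \<in> nres K xi" using S by auto
   have o: "norm (osc (om xi k l) s (s + h)) <= 2 * h powr (255/512) * wgt (33/64) xi k l" proof -
    have "norm (osc (om xi k l) s (s + h)) <= 2 * (s + h - s) powr (255/512) * wgt 0 xi k l"
     using nr h by (intro osc_wgt0) auto
    also have "... <= 2 * h powr (255/512) * wgt (33/64) xi k l"
     using wgt_mono[OF nr, of 0 "33/64"] by (simp add: mult_left_mono)
    finally show ?thesis .
   qed
   have "norm (b (k, l) * (?F (k, l) s * osc (om xi k l) s (s + h)))
     = norm (b (k, l)) * ((norm (ta s) * (?f k * ?f l * ?f (xi - k - l))) * norm (osc (om xi k l) s (s + h)))"
    by (simp add: norm_mult)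
   also have "... <= B * ((A * (?f k * ?f l * ?f (xi - k - l))) * (2 * h powr (255/512) * wgt (33/64) xi k l))"
    using A B kl ta(2)[OF s_in] by (intro mult_mono o) auto
   also have "... = B * (A * (2 * h powr (255/512))) * (wgt (33/64) xi k l * ?f k * ?f l * ?f (xi - k - l))"
    by (simp add: mult_ac)
   finally show "norm (b (k, l) * (?F (k, l) s * osc (om xi (fst (k, l)) (snd (k, l))) s (s + h)))
    <= B * (A * (2 * h powr (255/512))) * (wgt (33/64) xi k l * ?f k * ?f l * ?f (xi - k - l))" by simp
  qed
  also have "... = B * (A * (2 * h powr (255/512))) * ?S ?f ?f ?f" by (simp add: sum_distrib_left case_prod_unfold)
  also have "... <= B * (A * (2 * h powr (255/512))) * (E * (L2_set ?f K * L2_set ?f K * L2_set ?f K))"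
   using A B by (intro mult_left_mono E(2)[of ?f ?f ?f]) auto
  also have "... <= B * (A * (2 * h powr (255/512))) * (E * (R * R * R))"
   using A B E(1) R(1) R(2)[OF s_in] by (intro mult_left_mono mult_mono) auto
  also have "... = B * A * E * (2 * h powr (255/512) * R ^ 3)" by (simp add: power3_eq_cube mult_ac)
  finally show "L2_set (%x::unit. 1 * norm (\<Sum>p\<in>S. b p * (?F p s * osc (omp xi p) s (s + h)))) {()}
    <= B * A * E * (2 * h powr (255/512) * R ^ 3)" by simp
  show "L2_set (%x::unit. 1 * norm (\<Sum>q\<in>S. b q * ldiff (omp xi q) (?F q) s h p i)) {()} <= z p"
   if i: "i < 2 ^ p" for p i proof -
   define h' where "h' = h / 2 ^ Suc p"
   have h': "h' > 0" using h by (simp add: h'_def)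
   define a b' c where "a = node s h p i" "b' = mid s h p i" "c = node s h p (Suc i)"
   have abc: "b' - a = h'" "c - b' = h'" "s <= a" "b' <= s + h" "a <= s + h" "s <= b'"
    using mid_node[of s h p i] node_mid[of s h p i] node_bounds[of h i p s] mid_bounds[of h i p s] h i
    by (auto simp: a_b'_c_def h'_def)
   have ab: "a \<in> {s..s + h}" "b' \<in> {s..s + h}" "a < b'" using abc h' by auto
   define e where "e = (incr v a b')"
   define f where "f = (%k. norm (v k a))"
   define g where "g = (%k. norm (v k b'))"
   have nn: "e k >= 0" "f k >= 0" "g k >= 0" for k by (auto simp: e_def f_def g_def)
   have Le: "L2_set e K <= M * h' powr (129/256)" unfolding e_def using M(2)[of a b'] abc ab by simp
   have Lf: "L2_set f K <= R" "L2_set g K <= R" unfolding f_def g_def using R ab by auto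
   have je: "norm (v k b' - v k a) = jb k powr (33/64) * e k" for k
    by (simp add: e_def mult.assoc[symmetric] less_imp_neq[symmetric] flip: powr_add)
   let ?hb = "h' powr (129/256)"
   let ?c = "B * (A * (2 * h' powr (255/512)))"
   have "norm (\<Sum>q\<in>S. b q * ldiff (omp xi q) (?F q) s h p i)
    <= (\<Sum>q\<in>S. case q of (k, l) => ?c * (?hb * (wgt (33/64) xi k l * g k * g l * g (xi - k - l))
       + 3 * (wgt (33/64) xi k l * e k * g l * g (xi - k - l))
       + 3 * (wgt (33/64) xi k l * f k * e l * g (xi - k - l))
       + 3 * (wgt (33/64) xi k l * f k * f l * e (xi - k - l))))" proof (rule sum_norm_le, clarify)
    fix k l assume kl: "(k, l) \<in> S"
    then have nr: "(k, l) \<in> nres K xi" using S by auto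
    define m where "m = xi - k - l"
    let ?d = "dmax xi k l powr (33/64)"
    have d1: "?d >= 1" using dmax_ge_1[OF nr] powr_mono2[of "33/64" 1 "dmax xi k l"] by simp
    have 1: "norm (v k b' * v l b' * v m b' - v k a * v l a * v m a)
      <= 3 * ?d * (e k * g l * g m + f k * e l * g m + f k * f l * e m)"
     unfolding f_def g_def by (rule norm_prod3_increment_le[of k l K xi "%k. v k b'" "%k. v k a", OF nr xi je nn(1) m_def])
    have "?F (k, l) b' - ?F (k, l) a = (ta b' - ta a) * (v k b' * v l b' * v m b')
      + ta a * (v k b' * v l b' * v m b' - v k a * v l a * v m a)" by (simp add: m_def algebra_simps)
    also have "norm ... <= norm (ta b' - ta a) * (g k * g l * g m)
      + norm (ta a) * norm (v k b' * v l b' * v m b' - v k a * v l a * v m a)"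
     unfolding g_def by (rule order_trans[OF norm_triangle_ineq]) (simp add: norm_mult)
    also have "... <= (A * ?hb) * (g k * g l * g m)
      + A * (3 * ?d * (e k * g l * g m + f k * e l * g m + f k * f l * e m))" proof (intro add_mono mult_mono 1)
     show "norm (ta b' - ta a) <= A * ?hb" using ta(3)[of a b'] abc ab by simp
     show "norm (ta a) <= A" using ta(2)[OF ab(1)] .
    qed (use A nn in auto)
    also have "... <= A * (?d * (?hb * (g k * g l * g m)))
      + A * (3 * ?d * (e k * g l * g m + f k * e l * g m + f k * f l * e m))" proof -
     have "1 * (A * ?hb * (g k * g l * g m)) <= ?d * (A * ?hb * (g k * g l * g m))"
      using A nn by (intro mult_right_mono d1) auto
     then show ?thesis by (simp add: mult_ac)
    qed
    also have "... = A * ?d * (?hb * (g k * g l * g m) + 3 * (e k * g l * g m + f k * e l * g m + f k * f l * e m))"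
     by (simp add: algebra_simps)
    finally have 3: "norm (?F (k, l) b' - ?F (k, l) a)
      <= A * ?d * (?hb * (g k * g l * g m) + 3 * (e k * g l * g m + f k * e l * g m + f k * f l * e m))" .
    have 2: "norm (osc (om xi k l) b' c) <= 2 * h' powr (255/512) * wgt 0 xi k l"
     using osc_wgt0[OF nr, of b' c] abc h' by simp
    have w: "wgt 0 xi k l * ?d = wgt (33/64) xi k l" using dmax_ge_1[OF nr] by (simp add: wgt_def)
    have "norm (b (k, l) * ldiff (om xi k l) (?F (k, l)) s h p i)
     = norm (b (k, l)) * (norm (?F (k, l) b' - ?F (k, l) a) * norm (osc (om xi k l) b' c))"
     unfolding ldiff_def norm_mult a_b'_c_def[symmetric] ..
    also have "... <= B * ((A * ?d * (?hb * (g k * g l * g m) + 3 * (e k * g l * g m + f k * e l * g m + f k * f l * e m)))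
       * (2 * h' powr (255/512) * wgt 0 xi k l))" using B(1) B(2)[OF kl] A nn
     by (intro mult_mono 3 2) (auto intro!: mult_nonneg_nonneg add_nonneg_nonneg)
    also have "... = ?c * ((wgt 0 xi k l * ?d) * (?hb * (g k * g l * g m) + 3 * (e k * g l * g m + f k * e l * g m + f k * f l * e m)))"
     by (simp add: mult_ac)
    also have "... = ?c * (?hb * (wgt (33/64) xi k l * g k * g l * g m)
       + 3 * (wgt (33/64) xi k l * e k * g l * g m)
       + 3 * (wgt (33/64) xi k l * f k * e l * g m)
       + 3 * (wgt (33/64) xi k l * f k * f l * e m))" unfolding w by (simp only: distrib_left mult_ac add_ac)
    finally show "norm (b (k, l) * ldiff (om xi (fst (k, l)) (snd (k, l))) (?F (k, l)) s h p i)
     <= ?c * (?hb * (wgt (33/64) xi k l * g k * g l * g (xi - k - l))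
       + 3 * (wgt (33/64) xi k l * e k * g l * g (xi - k - l))
       + 3 * (wgt (33/64) xi k l * f k * e l * g (xi - k - l))
       + 3 * (wgt (33/64) xi k l * f k * f l * e (xi - k - l)))" by (simp add: m_def)
   qed
   also have "... = ?c * (?hb * ?S g g g + 3 * ?S e g g + 3 * ?S f e g + 3 * ?S f f e)"
    by (simp only: sum_distrib_left sum.distrib case_prod_unfold distrib_left)
   also have "... <= ?c * (?hb * (E * (L2_set g K * L2_set g K * L2_set g K)) + 3 * (E * (L2_set e K * L2_set g K * L2_set g K))
     + 3 * (E * (L2_set f K * L2_set e K * L2_set g K)) + 3 * (E * (L2_set f K * L2_set f K * L2_set e K)))"
    using A B(1) by (intro mult_left_mono add_mono E(2)[OF nn(3) nn(3) nn(3)] E(2)[OF nn(1) nn(3) nn(3)]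
      E(2)[OF nn(2) nn(1) nn(3)] E(2)[OF nn(2) nn(2) nn(1)]) auto
   also have "... <= ?c * (?hb * (E * (R * R * R)) + 3 * (E * (M * ?hb * R * R))
     + 3 * (E * (R * (M * ?hb) * R)) + 3 * (E * (R * R * (M * ?hb))))"
    using A B(1) E(1) R(1) M(1) by (intro mult_left_mono add_mono mult_mono Le Lf) auto
   also have "... = 2 * B * A * E * (R ^ 3 + 9 * M * R^2) * (h' powr (255/512) * ?hb)"
    by (simp add: power2_eq_square power3_eq_cube algebra_simps)
   also have "h' powr (255/512) * ?hb = h' powr (513/512)" by (simp flip: powr_add)
   finally show ?thesis by (simp add: z_def h'_def)
  qed
  show "(\<Sum>p<P. 2 ^ p * z p) <= B * A * E * (geo0 * h powr (513/512) * (R ^ 3 + 9 * M * R^2))" for P proof -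
   let ?k = "B * A * E * (R ^ 3 + 9 * M * R^2) * h powr (513/512)"
   have zp: "2 ^ p * z p = ?k * (2 powr (-(1/512))) ^ Suc p" for p proof -
    have "2 ^ p * z p = 2 * B * A * E * (R ^ 3 + 9 * M * R^2) * (2 ^ p * (h / 2 ^ Suc p) powr (513/512))"
     unfolding z_def by (simp only: mult_ac)
    then show ?thesis unfolding dyadic_powr by simp
   qed
   have "(\<Sum>p<P. 2 ^ p * z p) = ?k * (\<Sum>p<P. (2 powr (-(1/512))) ^ Suc p)" unfolding zp sum_distrib_left ..
   also have "... <= ?k * geo0" using A B(1) E(1) R(1) M(1)
    by (intro mult_left_mono geo0_sum) (intro mult_nonneg_nonneg add_nonneg_nonneg, simp_all)
   finally show ?thesis by (simp add: mult_ac)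
  qed
 qed
 then show ?thesis by (simp add: algebra_simps)
qed

text \<open>The exponent is 33/64 - 257/256. The decay in D0 is what makes the truncated nonlinear
  terms converge.\<close>

lemma wgt_sum_high:
 assumes K: "finite K" and nn: "!!k. f k >= 0" "!!k. g k >= 0" "!!k. h k >= (0::real)"
  and D0: "D0 >= 8 * mag xi" "D0 > 0"
 shows "wsum (33/64) ((nhi K xi D0)) xi f g h
   <= 24 * sqrt zeta0 * D0 powr (-(125/256)) * (L2_set f K * L2_set g K * L2_set h K)"
 using trilinear_high[OF K nn D0, of "33/64"] by simp

text \<open>A crude power of |xi| is enough here: the estimate is only used at fixed xi, against
  rapidly decaying coefficients of test functions.\<close>

lemma wgt_sum_all:
 assumes K: "finite K" and nn: "!!k. f k >= 0" "!!k. g k >= 0" "!!k. h k >= (0::real)"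
  and xi: "xi ~= 0"
 shows "wsum (33/64) (nres K xi) xi f g h
   <= 48 * zeta0 * mag xi * (L2_set f K * L2_set g K * L2_set h K)"
proof -
 let ?x = "mag xi"
 let ?P = "L2_set f K * L2_set g K * L2_set h K"
 have x1: "?x >= 1" using xi by linarith
 have z: "sqrt zeta0 <= zeta0" using zeta0_ge_1 real_le_lsqrt[of zeta0 zeta0] by (simp add: power2_eq_square)
 let ?L = "wsum (33/64) ((nlo K xi (8 * ?x))) xi f g h"
 let ?H = "wsum (33/64) ((nhi K xi (8 * ?x))) xi f g h"
 have "?L^2 <= 576 * zeta0^2 * ?x powr (2 * (33/64) - 257/256) * (\<Sum>(k, l)\<in>conv3 K xi. (f k * g l * h (xi - k - l))^2)"
  by (rule trilinear_low[OF K nn xi]) auto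
 also have "... <= 576 * zeta0^2 * ?x powr 2 * ?P^2" proof (intro mult_mono mult_left_mono powr_mono)
  show "(\<Sum>(k, l)\<in>conv3 K xi. (f k * g l * h (xi - k - l))^2) <= ?P^2"
   using sum_conv3_sq_le[OF K, of "{xi}" f g h] by simp
 qed (use x1 in \<open>auto intro!: sum_nonneg\<close>)
 also have "... = (24 * zeta0 * ?x * ?P)^2" using x1 by (simp add: power_mult_distrib)
 finally have L: "?L <= 24 * zeta0 * ?x * ?P" by (rule power2_le_imp_le) (use zeta0_pos in simp)
 have "?H <= 24 * sqrt zeta0 * (8 * ?x) powr (-(125/256)) * ?P" by (rule wgt_sum_high[OF K nn]) (use x1 in auto)
 also have "... <= 24 * zeta0 * ?x * ?P" proof (intro mult_right_mono mult_mono mult_left_mono)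
  have "(8 * ?x) powr (-(125/256)) <= (8 * ?x) powr 0" using x1 by (intro powr_mono) auto
  then show "(8 * ?x) powr (-(125/256)) <= ?x" using x1 xi by simp
 qed (use z zeta0_pos in auto)
 finally show ?thesis using L nres_split_le[where f = f and g = g and h = h and xi = xi and rho = "33/64" and d = "8 * ?x", OF K nn] by linarith
qed

section \<open>Limits of approximate solutions\<close>

text \<open>No equation is imposed on v itself, because the l2 bound does not control the infinite
  nonresonant sum at a fixed time. The equation reappears in time-integrated form in
  \<open>tested_limit\<close>. The bound R is common to the whole sequence.\<close>

definition limit_sol :: "real => real => (int => real => complex) => bool" where
 "limit_sol sg R v \<longleftrightarrow> (\<exists>N T ep vj.
   (\<forall>j. approx_sol sg (N j) (T j) (ep j) R (vj j) \<and> 0 <= ep j \<and> ep j <= 1) \<and>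
   filterlim N at_top sequentially \<and> filterlim T at_top sequentially \<and>
   ep ----> 0 \<and> (\<forall>k t. (%j. vj j k t) ----> v k t))"

lemma limit_solE:
 assumes "limit_sol sg R v"
 obtains N T ep vj where
  "!!j. approx_sol sg (N j) (T j) (ep j) R (vj j)" "!!j. 0 <= ep j" "!!j. ep j <= 1"
  "!!j. (n::int) <= N j" "!!j. r <= T j" "ep ----> 0" "!!k t. (%j. vj j k t) ----> v k t"
proof -
 obtain N T ep vj where *:
  "!!j. approx_sol sg (N j) (T j) (ep j) R (vj j)" "!!j. 0 <= ep j" "!!j. ep j <= 1"
  "filterlim N at_top sequentially" "filterlim T at_top sequentially"
  "ep ----> 0" "!!k t. (%j. vj j k t) ----> v k t" using assms unfolding limit_sol_def by blast
 have "eventually (%j. n <= N j \<and> r <= T j) sequentially"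
  using *(4,5) unfolding filterlim_at_top by (auto intro: eventually_conj)
 then obtain j0 where j0: "!!j. j >= j0 ==> n <= N j \<and> r <= T j" unfolding eventually_sequentially by blast
 show thesis proof (rule that[of "%j. N (j + j0)" "%j. T (j + j0)" "%j. ep (j + j0)" "%j. vj (j + j0)"])
  show "(%j. ep (j + j0)) ----> 0" using *(6) by (rule LIMSEQ_ignore_initial_segment)
  show "(%j. vj (j + j0) k t) ----> v k t" for k t using LIMSEQ_ignore_initial_segment[OF *(7)[of k t], of j0] .
 qed (use * j0 in auto)
qed

lemma approx_sol_support:
 assumes "approx_sol sg N T ep R v" "k \<notin> {-N..N}"
 shows "v k t = 0"
proof -
 have "\<bar>k\<bar> > N" using assms(2) by auto
 then show ?thesis using assms(1) unfolding approx_sol_def by blast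
qed

lemma approx_sol_L2:
 assumes "approx_sol sg N T ep R v" "t \<in> {-T..T}" "finite F"
 shows "L2_set (%k. norm (v k t)) F <= R"
proof -
 have "(\<Sum>k\<in>F. (norm (v k t))^2) = (\<Sum>k\<in>F \<inter> {-N..N}. (norm (v k t))^2)"
  by (rule sum.mono_neutral_right) (use approx_sol_support[OF assms(1)] \<open>finite F\<close> in auto)
 also have "... <= (\<Sum>k\<in>{-N..N}. (norm (v k t))^2)" by (rule sum_mono2) auto
 finally have "L2_set (%k. norm (v k t)) F <= L2_set (%k. norm (v k t)) {-N..N}"
  unfolding L2_set_def by (rule real_sqrt_le_mono)
 moreover have "L2_set (%k. norm (v k t)) {-N..N} <= R" using assms(1,2) unfolding approx_sol_def by blast
 ultimately show ?thesis by (rule order_trans)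
qed

lemma approx_sol_hold:
 assumes "approx_sol sg N T ep R v" "hold_bd N T v M" "- T <= s" "s < t" "t <= T" "finite F"
 shows "L2_set (incr v s t) F <= M * (t - s) powr (129/256)"
proof -
 let ?d = "incr v s t"
 have "(\<Sum>k\<in>F. (?d k)^2) = (\<Sum>k\<in>F \<inter> {-N..N}. (?d k)^2)"
  by (rule sum.mono_neutral_right) (use approx_sol_support[OF assms(1)] \<open>finite F\<close> in auto)
 also have "... <= (\<Sum>k\<in>{-N..N}. (?d k)^2)" by (rule sum_mono2) auto
 finally have "L2_set ?d F <= L2_set ?d {-N..N}" unfolding L2_set_def by (rule real_sqrt_le_mono)
 moreover have "L2_set ?d {-N..N} <= M * (t - s) powr (129/256)" using assms(2-5) unfolding hold_bd_def by blast
 ultimately show ?thesis by (rule order_trans)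
qed

lemma limit_sol_L2:
 assumes "limit_sol sg R v" "finite F"
 shows "L2_set (%k. norm (v k t)) F <= R"
proof -
 obtain N T ep vj where *:
  "!!j. approx_sol sg (N j) (T j) (ep j) R (vj j)" "!!j. 0 <= ep j" "!!j. ep j <= 1"
  "!!j. 0 <= N j" "!!j. \<bar>t\<bar> <= T j" "ep ----> 0" "!!k t. (%j. vj j k t) ----> v k t"
  using limit_solE[OF assms(1), of 0 "\<bar>t\<bar>"] by metis
 have "(%j. L2_set (%k. norm (vj j k t)) F) ----> L2_set (%k. norm (v k t)) F"
  unfolding L2_set_def by (intro tendsto_intros *(7))
 moreover have "L2_set (%k. norm (vj j k t)) F <= R" for j
  using *(5)[of j] by (intro approx_sol_L2[OF *(1)] assms(2)) (auto simp: abs_le_iff)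
 ultimately show ?thesis by (intro LIMSEQ_le_const2) auto
qed

lemma limit_sol_R: "limit_sol sg R v ==> R >= 0" using limit_sol_L2[of sg R v "{}" 0] by simp

lemma limit_sol_norm_le: "limit_sol sg R v ==> norm (v k t) <= R" using limit_sol_L2[of sg R v "{k}" t] by simp

lemma hold_uniform_ex:
 assumes "R >= 0"
 shows "\<exists>M\<ge>0. \<forall>sg N T ep v. \<bar>sg\<bar> = 1 --> 0 <= ep --> ep <= 1 --> approx_sol sg N T ep R v --> hold_bd N T v M"
 using hold_bd_uniform[OF assms] by metis

definition Mh :: "real => real" where
 "Mh R = (SOME M. M >= 0 \<and> (\<forall>sg N T ep v. \<bar>sg\<bar> = 1 --> 0 <= ep --> ep <= 1 --> approx_sol sg N T ep R v --> hold_bd N T v M))"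

lemma Mh:
 assumes "R >= 0"
 shows "Mh R >= 0" "[|\<bar>sg\<bar> = 1; 0 <= ep; ep <= 1; approx_sol sg N T ep R v|] ==> hold_bd N T v (Mh R)"
 using someI_ex[OF hold_uniform_ex[OF assms]] unfolding Mh_def by blast+

lemma limit_sol_hold:
 assumes v: "limit_sol sg R v" and sg: "\<bar>sg\<bar> = 1" and "finite F" and st: "s < t"
 shows "L2_set (incr v s t) F <= Mh R * (t - s) powr (129/256)"
proof -
 obtain N T ep vj where *:
  "!!j. approx_sol sg (N j) (T j) (ep j) R (vj j)" "!!j. 0 <= ep j" "!!j. ep j <= 1"
  "!!j. 0 <= N j" "!!j. \<bar>t\<bar> + \<bar>s\<bar> <= T j" "ep ----> 0" "!!k t. (%j. vj j k t) ----> v k t"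
  using limit_solE[OF assms(1), of 0 "\<bar>t\<bar> + \<bar>s\<bar>"] by metis
 have "(%j. L2_set (incr (vj j) s t) F)
   ----> L2_set (incr v s t) F" unfolding L2_set_def by (intro tendsto_intros *(7))
 moreover have "L2_set (incr (vj j) s t) F <= Mh R * (t - s) powr (129/256)" for j
  using Mh(2)[OF limit_sol_R[OF v] sg *(2) *(3) *(1)] *(5)[of j] st by (intro approx_sol_hold[OF *(1)] assms) auto
 ultimately show ?thesis by (intro LIMSEQ_le_const2) auto
qed

lemma powr_tendsto_0: "((%t. \<bar>t - s\<bar> powr (129/256)) \<longlongrightarrow> 0) (at (s::real))"
proof (rule tendsto_zero_powrI)
 have "((%t. \<bar>t - s\<bar>) \<longlongrightarrow> \<bar>s - s\<bar>) (at s)" by (intro tendsto_intros)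
 then show "((%t. \<bar>t - s\<bar>) \<longlongrightarrow> 0) (at s)" by simp
qed (auto intro: tendsto_const)

lemma limit_sol_hold1:
 assumes v: "limit_sol sg R v" and sg: "\<bar>sg\<bar> = 1"
 shows "norm (v k t - v k s) <= jb k powr (33/64) * Mh R * \<bar>t - s\<bar> powr (129/256)"
proof -
 have *: "norm (v k t - v k s) <= jb k powr (33/64) * Mh R * \<bar>t - s\<bar> powr (129/256)" if "s < t" for s t
 proof -
  have "incr v s t k <= Mh R * (t - s) powr (129/256)" using limit_sol_hold[OF v sg, of "{k}" s t] that by simp
  from norm_le_jb[OF this] show ?thesis using that by (simp add: mult.assoc)
 qed
 show ?thesis
  using *[of s t] *[of t s] by (cases s t rule: linorder_cases) (auto simp: norm_minus_commute abs_minus_commute)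
qed

lemma limit_sol_continuous:
 assumes v: "limit_sol sg R v" and sg: "\<bar>sg\<bar> = 1"
 shows "continuous_on S (v k)"
proof -
 have "isCont (v k) s" for s unfolding isCont_def proof (rule LIM_zero_cancel)
  show "((%t. v k t - v k s) \<longlongrightarrow> 0) (at s)" proof (rule Lim_null_comparison)
   show "eventually (%t. norm (v k t - v k s) <= jb k powr (33/64) * Mh R * \<bar>t - s\<bar> powr (129/256)) (at s)"
    using limit_sol_hold1[OF v sg] by simp
   show "((%t. jb k powr (33/64) * Mh R * \<bar>t - s\<bar> powr (129/256)) \<longlongrightarrow> 0) (at s)"
    using tendsto_mult_left[OF powr_tendsto_0, of "jb k powr (33/64) * Mh R" s] by simp
  qed
 qed
 then show ?thesis by (simp add: continuous_at_imp_continuous_on)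
qed

lemma gf_extend:
 assumes "N <= N'" "!!k. \<bar>k\<bar> > N ==> v k r = 0"
 shows "gf sg N' v xi r = gf sg N v xi r"
proof -
 let ?f = "%p. nlc sg xi *
     (cis (omp xi p * r) * cub v xi p r)"
 have "sum ?f (nres {-N'..N'} xi) = sum ?f (nres {-N..N} xi)" proof (rule sum.mono_neutral_right)
  show "nres {-N..N} xi \<subseteq> nres {-N'..N'} xi" using assms(1) by (auto simp: nres_def conv3_def)
  show "\<forall>p\<in>nres {-N'..N'} xi - nres {-N..N} xi. ?f p = 0" proof
   fix p assume p: "p \<in> nres {-N'..N'} xi - nres {-N..N} xi"
   then have "\<not> (fst p \<in> {-N..N} \<and> snd p \<in> {-N..N} \<and> xi - fst p - snd p \<in> {-N..N})"
    by (auto simp: nres_def conv3_def)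
   then have "\<bar>fst p\<bar> > N \<or> \<bar>snd p\<bar> > N \<or> \<bar>xi - fst p - snd p\<bar> > N"
    unfolding atLeastAtMost_iff by linarith
   then show "?f p = 0" using assms(2) by auto
  qed
 qed simp
 then show ?thesis by (simp add: gf_def)
qed

section \<open>Truncated profiles and tested nonlinear terms\<close>

definition mlt :: "(real => real) => nat => int => real" where
 "mlt psi n k = psi (2 powr (- real n) * of_int k)"

abbreviation mlt3 :: "(real => real) => nat => int => int \<times> int => real" where
 "mlt3 psi n xi p \<equiv> mlt psi n (fst p) * mlt psi n (snd p) * mlt psi n (xi - fst p - snd p)"

definition mv :: "(real => real) => nat => (int => real => complex) => int => real => complex" where
 "mv psi n v k r = of_real (mlt psi n k) * v k r"

lemma cutoff_continuous: "cutoff psi ==> continuous_on S psi"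
proof -
 assume "cutoff psi"
 then have "smooth1 psi" by (simp add: cutoff_def)
 then have "(vderiv ^^ 0) psi differentiable (at x)" for x unfolding smooth1_def by blast
 then have "psi differentiable (at x)" for x by simp
 then show ?thesis by (meson continuous_at_imp_continuous_on differentiable_imp_continuous_within)
qed

lemma cutoff_bounded:
 assumes "cutoff psi"
 obtains B where "B >= 1" "!!x. \<bar>psi x\<bar> <= B"
proof -
 have "compact (psi ` {-2..2})" by (intro compact_continuous_image cutoff_continuous assms compact_Icc)
 then have "bounded (psi ` {-2..2})" by (rule compact_imp_bounded)
 then obtain B where "\<forall>y\<in>psi ` {-2..2}. norm y <= B" unfolding bounded_iff by blast
 then have B: "\<bar>psi x\<bar> <= B" if "x \<in> {-2..2}" for x using that by force
 have "\<bar>psi x\<bar> <= max B 1" for x proof (cases "x \<in> {-2..2}")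
  case False
  then have "\<bar>x\<bar> > 3/2" by auto
  then have "psi x = 0" using assms unfolding cutoff_def by blast
  then show ?thesis by simp
 qed (use B in \<open>auto simp: le_max_iff_disj\<close>)
 then show thesis using that[of "max B 1"] by auto
qed

lemma mlt_zero:
 assumes "cutoff psi" "\<bar>k\<bar> > 2 ^ Suc n"
 shows "mlt psi n k = 0"
proof -
 have "2 powr (- real n) * 2 ^ Suc n = (2::real)" by (simp add: powr_minus powr_realpow)
 moreover have "mag k > 2 ^ Suc n" using assms(2) by (metis of_int_abs of_int_less_iff of_int_numeral of_int_power)
 then have "2 powr (- real n) * mag k > 2 powr (- real n) * 2 ^ Suc n" by (intro mult_strict_left_mono) auto
 moreover have "\<bar>2 powr (- real n) * real_of_int k\<bar> = 2 powr (- real n) * mag k" by (simp add: abs_mult)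
 ultimately have "\<bar>2 powr (- real n) * real_of_int k\<bar> > 3/2" by linarith
 then show ?thesis using assms(1) unfolding mlt_def cutoff_def by blast
qed

lemma mlt_one:
 assumes "cutoff psi" "mag k <= 5/4 * 2 ^ n"
 shows "mlt psi n k = 1"
proof -
 have "2 powr (- real n) * (5/4 * 2 ^ n) = (5/4::real)" by (simp add: powr_minus powr_realpow)
 moreover have "2 powr (- real n) * mag k <= 2 powr (- real n) * (5/4 * 2 ^ n)"
  using assms(2) by (intro mult_left_mono) auto
 moreover have "\<bar>2 powr (- real n) * real_of_int k\<bar> = 2 powr (- real n) * mag k" by (simp add: abs_mult)
 ultimately have "\<bar>2 powr (- real n) * real_of_int k\<bar> <= 5/4" by linarith
 then show ?thesis using assms(1) unfolding mlt_def cutoff_def by blast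
qed

lemma mv_zero: "[|cutoff psi; \<bar>k\<bar> > 2 ^ Suc n|] ==> mv psi n v k r = 0" by (simp add: mv_def mlt_zero)

lemma gf_mv:
 "gf sg N (mv psi n v) xi r =
   - 6 * \<i> * of_real sg * of_int xi * of_real ((mlt psi n xi)^2 * mlt psi n (-xi)) * ((v xi r)^2 * v (- xi) r) +
   (\<Sum>p\<in>nres {-N..N} xi. (nlc sg xi
     * of_real (mlt3 psi n xi p)) *
     (cis (omp xi p * r) * cub v xi p r))" unfolding gf_def mv_def by (simp add: power_mult_distrib mult_ac)

definition cst :: "real => real => real => real" where
 "cst h R M = 2 * h powr (255/512) * R ^ 3 + geo0 * h powr (513/512) * (R ^ 3 + 9 * M * R^2)"

lemma norm_prod3_le:
 fixes a b c :: real
 assumes "\<bar>a\<bar> <= B" "\<bar>b\<bar> <= B" "\<bar>c\<bar> <= B"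
 shows "\<bar>a * b * c\<bar> <= B ^ 3"
proof -
 have "\<bar>a\<bar> * \<bar>b\<bar> * \<bar>c\<bar> <= B * B * B" using assms by (intro mult_mono) auto
 then show ?thesis by (simp add: abs_mult power3_eq_cube)
qed

text \<open>If \<open>dmax\<close> is below 2^n and 8|xi| <= 2^n, then k, l and m are at most 5/4 *
  2^n, where the multiplier equals 1. So only interactions with \<open>dmax\<close> at least 2^n
  survive in the difference, and \<open>wgt_sum_high\<close> applies. The bound is independent of N,
  T and ep and therefore survives the passage to limits.\<close>

lemma tail_bound:
 assumes psi: "cutoff psi" "B >= 1" "!!x. \<bar>psi x\<bar> <= B" and sol: "approx_sol sg N T ep R v"
  and sg: "\<bar>sg\<bar> = 1" and ep: "0 <= ep" "ep <= 1" and R: "R >= 0" and rT: "0 < r" "r <= T" and xi: "xi ~= 0"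
  and n: "8 * mag xi <= 2 ^ n"
  and ta: "continuous_on {-r..r} ta" "!!t. t \<in> {-r..r} ==> norm (ta t) <= A"
   "!!x y. [|-r <= x; x < y; y <= r|] ==> norm (ta y - ta x) <= A * (y - x) powr (129/256)"
  and A: "A >= 0"
 shows "norm (integral {-r..r} (%t. ta t * gf sg N v xi t) - integral {-r..r} (%t. ta t * gf sg (2 ^ Suc n) (mv psi n v) xi t))
  <= (4 * mag xi * B ^ 3) * A * (24 * sqrt zeta0 * (2 ^ n) powr (-(125/256))) * cst (2 * r) R (Mh R)"
proof -
 let ?x = "mag xi"
 define N' where "N' = max N (2 ^ Suc n)"
 let ?K = "{-N'..N'}"
 define S where "S = (nhi ?K xi (2 ^ n))"
 define b where "b = (%p. nlc sg xi
   * of_real (1 - mlt3 psi n xi p) :: complex)"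
 have T: "-T <= -r" using rT by simp
 have cont: "continuous_on {-r..r} (v k)" for k
  using sol rT unfolding approx_sol_def by (auto intro: continuous_on_subset)
 have hb: "hold_bd N T v (Mh R)" by (rule Mh(2)[OF R sg ep sol])
 have x1: "?x >= 1" using xi by linarith
 have eq1: "gf sg N v xi t = gf sg N' v xi t" for t
  by (rule gf_extend[symmetric]) (use sol in \<open>auto simp: approx_sol_def N'_def\<close>)
 have eq2: "gf sg (2 ^ Suc n) (mv psi n v) xi t = gf sg N' (mv psi n v) xi t" for t
  by (rule gf_extend[symmetric]) (use mv_zero[OF psi(1)] in \<open>auto simp: N'_def\<close>)
 have m1: "mlt psi n xi = 1" "mlt psi n (-xi) = 1" using n x1 by (auto intro!: mlt_one psi(1))
 have diff: "ta t * gf sg N v xi t - ta t * gf sg (2 ^ Suc n) (mv psi n v) xi t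
   = (\<Sum>p\<in>S. b p * (cis (omp xi p * t) * (ta t * (v (fst p) t * v (snd p) t * v (xi - fst p - snd p) t))))" for t
 proof -
  let ?g = "%p. b p * (cis (omp xi p * t) * (ta t * (v (fst p) t * v (snd p) t * v (xi - fst p - snd p) t)))"
  have "ta t * gf sg N v xi t - ta t * gf sg (2 ^ Suc n) (mv psi n v) xi t = ta t * (gf sg N' v xi t - gf sg N' (mv psi n v) xi t)"
   unfolding eq1 eq2 by (simp only: right_diff_distrib)
  also have "... = sum ?g (nres ?K xi)" unfolding gf_mv m1
   by (simp add: gf_def b_def sum_subtractf[symmetric] sum_distrib_left algebra_simps)
  also have "... = sum ?g S" proof (rule sum.mono_neutral_right)
   show "\<forall>p\<in>nres ?K xi - S. ?g p = 0" proof
    fix p assume p: "p \<in> nres ?K xi - S"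
    obtain k l where kl: "p = (k, l)" by (cases p)
    have d: "dmax xi k l < 2 ^ n" using p kl by (auto simp: S_def)
    then have "mag (xi - k) < 2 ^ n" "mag (xi - l) < 2 ^ n" "mag (k + l) < 2 ^ n"
     unfolding dmax_def of_int_max of_int_abs by auto
    then have "mag k <= 5/4 * 2 ^ n" "mag l <= 5/4 * 2 ^ n" "mag (xi - k - l) <= 5/4 * 2 ^ n"
     using n x1 unfolding of_int_diff of_int_add by linarith+
    then have "mlt psi n k = 1" "mlt psi n l = 1" "mlt psi n (xi - k - l) = 1" by (auto intro!: mlt_one psi(1))
    then show "?g p = 0" by (simp add: b_def kl)
   qed
  qed (auto simp: S_def)
  finally show ?thesis .
 qed
 have int1: "(%t. ta t * gf sg N v xi t) integrable_on {-r..r}"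
  by (intro integrable_continuous_real continuous_intros ta(1) gf_continuous[OF sol]) (use rT in auto)
 have int2: "(%t. ta t * gf sg (2 ^ Suc n) (mv psi n v) xi t) integrable_on {-r..r}"
  unfolding gf_mv by (intro integrable_continuous_real continuous_intros ta(1) cont)
 have "integral {-r..r} (%t. ta t * gf sg N v xi t) - integral {-r..r} (%t. ta t * gf sg (2 ^ Suc n) (mv psi n v) xi t)
   = integral {-r..-r+2*r} (%t. \<Sum>p\<in>S. b p * (cis (omp xi p * t) * (ta t * (v (fst p) t * v (snd p) t * v (xi - fst p - snd p) t))))"
  by (subst Henstock_Kurzweil_Integration.integral_diff[symmetric]) (use int1 int2 diff in auto)
 also have "norm ... <= (4 * ?x * B ^ 3) * A * (24 * sqrt zeta0 * (2 ^ n) powr (-(125/256))) * cst (2 * r) R (Mh R)"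
  unfolding cst_def proof (rule pointwise_bound)
  show "finite ?K" "S \<subseteq> nres ?K xi" "xi ~= 0" "0 < 2 * r" "R >= 0" "A >= 0" "Mh R >= 0"
   using xi rT R A Mh(1)[OF R] by (auto simp: S_def)
  show "L2_set (%k. norm (v k t)) ?K <= R" if "t \<in> {-r..-r+2*r}" for t
   using that rT by (intro approx_sol_L2[OF sol]) auto
  show "continuous_on {-r..-r+2*r} (v k)" for k using cont by simp
  show "L2_set (incr v x y) ?K <= Mh R * (y - x) powr (129/256)" if "-r <= x" "x < y" "y <= -r+2*r" for x y
   using that rT by (intro approx_sol_hold[OF sol hb]) auto
  show "continuous_on {-r..-r+2*r} ta" using ta(1) by simp
  show "norm (ta t) <= A" if "t \<in> {-r..-r+2*r}" for t using ta(2) that by simp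
  show "norm (ta y - ta x) <= A * (y - x) powr (129/256)" if "-r <= x" "x < y" "y <= -r+2*r" for x y
   using ta(3) that by simp
  show "0 <= 4 * ?x * B ^ 3" using psi(2) by simp
  show "norm (b p) <= 4 * ?x * B ^ 3" for p proof -
   let ?m = "mlt3 psi n xi p"
   have "\<bar>?m\<bar> <= B ^ 3" unfolding mlt_def by (intro norm_prod3_le psi(3))
   moreover have "1 <= B ^ 3" using psi(2) by simp
   ultimately have "\<bar>1 - ?m\<bar> <= 2 * B ^ 3" by linarith
   then have "2 * ?x * \<bar>1 - ?m\<bar> <= 2 * ?x * (2 * B ^ 3)" by (intro mult_left_mono) auto
   moreover have "norm (b p) = 2 * ?x * \<bar>1 - ?m\<bar>" unfolding b_def norm_mult norm_of_real using sg by simp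
   ultimately show ?thesis by simp
  qed
  show "0 <= 24 * sqrt zeta0 * (2 ^ n) powr (-(125/256))" using zeta0_pos by simp
  show "wsum (33/64) S xi f g h
    <= 24 * sqrt zeta0 * (2 ^ n) powr (-(125/256)) * (L2_set f ?K * L2_set g ?K * L2_set h ?K)"
   if "!!k. f k >= 0" "!!k. g k >= 0" "!!k. h k >= (0::real)" for f g h
   unfolding S_def by (rule wgt_sum_high) (use that n in auto)
 qed
 finally show ?thesis .
qed

lemma integral_by_parts_zero:
 fixes ta ta' g :: "real => complex"
 assumes r: "0 < r" and d: "!!t. (ta has_vector_derivative ta' t) (at t)"
  and z: "ta (-r) = 0" "ta r = 0" and c: "continuous_on UNIV ta'" and g: "continuous_on {-r..r} g"
 shows "integral {-r..r} (%t. ta t * g t) = - integral {-r..r} (%t. ta' t * integral {-r..t} g)"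
proof -
 let ?G = "%t. integral {-r..t} g"
 have tac: "continuous_on S ta" for S by (rule vector_derivative_continuous_on[OF d])
 have Gd: "(?G has_vector_derivative g t) (at t within {-r..r})" if "t \<in> {-r..r}" for t
  using integral_has_vector_derivative[OF g that] .
 have Gc: "continuous_on {-r..r} ?G" by (intro indefinite_integral_continuous_1 integrable_continuous_real g)
 have "((%t. ta t * g t + ta' t * ?G t) has_integral (ta r * ?G r - ta (-r) * ?G (-r))) {-r..r}"
 proof (rule fundamental_theorem_of_calculus)
  fix t assume t: "t \<in> {-r..r}"
  show "((%t. ta t * ?G t) has_vector_derivative ta t * g t + ta' t * ?G t) (at t within {-r..r})"
   by (rule has_vector_derivative_mult[OF has_vector_derivative_at_within[OF d] Gd[OF t]])
 qed (use r in auto)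
 then have "integral {-r..r} (%t. ta t * g t + ta' t * ?G t) = 0" using z by (simp add: integral_unique)
 moreover have "integral {-r..r} (%t. ta t * g t + ta' t * ?G t)
   = integral {-r..r} (%t. ta t * g t) + integral {-r..r} (%t. ta' t * ?G t)"
  by (rule Henstock_Kurzweil_Integration.integral_add)
   (intro integrable_continuous_real continuous_on_mult tac g Gc continuous_on_subset[OF c] subset_UNIV)+
 ultimately show ?thesis by (simp add: add_eq_0_iff)
qed

text \<open>After an integration by parts both terms carry ta', and the constant v(-r) can be
  inserted because the integral of ta' vanishes; what remains is the defect of the profile equation
  on {-r..t}.\<close>

lemma tested_error:
 assumes sol: "approx_sol sg N T ep R v" and r: "0 < r" "r <= T" and ep: "0 <= ep" and xi: "\<bar>xi\<bar> <= N"
  and d: "!!t. (ta has_vector_derivative ta' t) (at t)"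
  and z: "ta (-r) = 0" "ta r = 0" and c: "continuous_on UNIV ta'"
  and A: "!!t. t \<in> {-r..r} ==> norm (ta' t) <= A"
 shows "norm (- integral {-r..r} (%t. ta' t * v xi t) - integral {-r..r} (%t. ta t * gf sg N v xi t))
   <= A * (ep * (2 * r)) * (2 * r)"
proof -
 let ?g = "gf sg N v xi"
 let ?G = "%t. integral {-r..t} ?g"
 have g: "continuous_on {-r..r} ?g" by (rule gf_continuous[OF sol]) (use r in auto)
 have vc: "continuous_on {-r..r} (v xi)" using sol r unfolding approx_sol_def by (auto intro: continuous_on_subset)
 have Gc: "continuous_on {-r..r} ?G" by (intro indefinite_integral_continuous_1 integrable_continuous_real g)
 have c': "continuous_on {-r..r} ta'" by (rule continuous_on_subset[OF c]) auto
 have i0: "integral {-r..r} ta' = 0" proof -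
  have "(ta' has_integral (ta r - ta (-r))) {-r..r}"
   by (rule fundamental_theorem_of_calculus) (use r d in \<open>auto intro: has_vector_derivative_at_within\<close>)
  then show ?thesis using z by (simp add: integral_unique)
 qed
 have "- integral {-r..r} (%t. ta' t * v xi t) - integral {-r..r} (%t. ta t * ?g t)
   = - (integral {-r..r} (%t. ta' t * v xi t) - integral {-r..r} (%t. ta' t * ?G t) - integral {-r..r} (%t. ta' t * v xi (-r)))"
  unfolding integral_by_parts_zero[OF r(1) d z c g] using i0 by simp
 also have "... = - integral {-r..r} (%t. ta' t * v xi t - ta' t * ?G t - ta' t * v xi (-r))" proof -
  have i: "(%t. ta' t * v xi t) integrable_on {-r..r}" "(%t. ta' t * ?G t) integrable_on {-r..r}"
   "(%t. ta' t * v xi (-r)) integrable_on {-r..r}"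
   by (intro integrable_continuous_real continuous_on_mult continuous_on_const c' vc Gc)+
  show ?thesis by (simp only: Henstock_Kurzweil_Integration.integral_diff[OF i(1) i(2)]
     Henstock_Kurzweil_Integration.integral_diff[OF integrable_diff[OF i(1) i(2)] i(3)])
 qed
 finally have eq: "norm (- integral {-r..r} (%t. ta' t * v xi t) - integral {-r..r} (%t. ta t * ?g t))
   = norm (integral {-r..r} (%t. ta' t * v xi t - ta' t * ?G t - ta' t * v xi (-r)))" by simp
 have "... <= A * (ep * (2 * r)) * (r - (-r))" proof (rule integral_bound)
  fix t assume t: "t \<in> {-r..r}"
  have "norm (v xi t - v xi (-r) - ?G t) <= ep * (t - (-r))" proof -
   have "xi \<in> {-N..N}" "- T <= -r \<and> -r <= t \<and> t <= T" using r t xi by auto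
   then show ?thesis using sol unfolding approx_sol_def by blast
  qed
  also have "... <= ep * (2 * r)" using t ep by (intro mult_left_mono) auto
  finally have e: "norm (v xi t - v xi (-r) - ?G t) <= ep * (2 * r)" .
  have "ta' t * v xi t - ta' t * ?G t - ta' t * v xi (-r) = ta' t * (v xi t - v xi (-r) - ?G t)"
   by (simp add: algebra_simps)
  also have "norm ... <= A * (ep * (2 * r))"
   unfolding norm_mult using A[OF t] e order_trans[OF norm_ge_zero A[OF t]] by (intro mult_mono) auto
  finally show "norm (ta' t * v xi t - ta' t * ?G t - ta' t * v xi (-r)) <= A * (ep * (2 * r))" .
 qed (use r in \<open>auto intro!: continuous_intros c' vc Gc\<close>)
 then show ?thesis unfolding eq by simp
qed

lemma lipschitz_holder:
 fixes ta ta' :: "real => complex"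
 assumes d: "!!t. (ta has_vector_derivative ta' t) (at t)" and r: "0 < r"
  and A: "!!t. t \<in> {-r..r} ==> norm (ta' t) <= A" and xy: "-r <= x" "x < y" "y <= r"
 shows "norm (ta y - ta x) <= A * (1 + 2 * r) * (y - x) powr (129/256)"
proof -
 have A0: "A >= 0" using order_trans[OF norm_ge_zero A[of 0]] r by auto
 have "norm (ta y - ta x) <= A * norm (y - x)"
 proof (rule differentiable_bound[of "{-r..r}" ta "%t h. h *\<^sub>R ta' t"])
  show "(ta has_derivative (%h. h *\<^sub>R ta' t)) (at t within {-r..r})" for t
   using has_vector_derivative_at_within[OF d] unfolding has_vector_derivative_def .
  show "onorm (%h. h *\<^sub>R ta' t) <= A" if "t \<in> {-r..r}" for t
   using A[OF that] by (intro onorm_le) (simp add: mult.commute[of A] mult_left_mono)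
 qed (use xy in auto)
 also have "... = A * (y - x)" using xy by simp
 also have "... <= A * ((1 + 2 * r) * (y - x) powr (129/256))" proof (rule mult_left_mono[OF _ A0])
  have "y - x = (y - x) powr (127/256) * (y - x) powr (129/256)" using xy by (simp flip: powr_add)
  also have "... <= (1 + 2 * r) * (y - x) powr (129/256)" proof (rule mult_right_mono)
   have "(y - x) powr (127/256) <= (1 + 2 * r) powr (127/256)" using xy r by (intro powr_mono2) auto
   also have "... <= (1 + 2 * r) powr 1" using r by (intro powr_mono) auto
   finally show "(y - x) powr (127/256) <= 1 + 2 * r" using r by simp
  qed simp
  finally show "y - x <= (1 + 2 * r) * (y - x) powr (129/256)" .
 qed
 finally show ?thesis by (simp add: mult.assoc)
qed

lemma gf_mv_bound:
 assumes sg: "\<bar>sg\<bar> = 1" and B: "!!x. \<bar>psi x\<bar> <= B" "B >= 1" and R: "R >= 0" "!!k. norm (v k t) <= R"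
 shows "norm (gf sg N (mv psi n v) xi t) <= 6 * mag xi * (B * R) ^ 3
  + real (card (nres {-N..N} xi)) * (2 * mag xi * (B * R) ^ 3)"
proof -
 have m: "norm (mv psi n v k t) <= B * R" for k
  unfolding mv_def norm_mult norm_of_real mlt_def using B R by (intro mult_mono) auto
 have p: "norm (mv psi n v k t) * norm (mv psi n v l t) * norm (mv psi n v j t) <= (B * R) ^ 3" for k l j proof -
  have "norm (mv psi n v k t) * norm (mv psi n v l t) * norm (mv psi n v j t) <= (B * R) * (B * R) * (B * R)"
   using B R by (intro mult_mono m) auto
  then show ?thesis by (simp add: power3_eq_cube)
 qed
 show ?thesis unfolding gf_def proof (rule order_trans[OF norm_triangle_ineq add_mono])
  show "norm (- 6 * \<i> * of_real sg * of_int xi * ((mv psi n v xi t)^2 * mv psi n v (- xi) t)) <= 6 * mag xi * (B * R) ^ 3"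
   using mult_left_mono[OF p[of xi xi "-xi"], of "6 * mag xi"] sg by (simp add: norm_mult power2_eq_square mult.assoc)
  show "norm (\<Sum>p\<in>nres {-N..N} xi. nlc sg xi * (cis (omp xi p * t) *
    (mv psi n v (fst p) t * mv psi n v (snd p) t * mv psi n v (xi - fst p - snd p) t)))
    <= real (card (nres {-N..N} xi)) * (2 * mag xi * (B * R) ^ 3)" proof (rule sum_norm_bound)
   fix p
   show "norm (nlc sg xi * (cis (omp xi p * t) *
    (mv psi n v (fst p) t * mv psi n v (snd p) t * mv psi n v (xi - fst p - snd p) t))) <= 2 * mag xi * (B * R) ^ 3"
    using mult_left_mono[OF p[of "fst p" "snd p" "xi - fst p - snd p"], of "2 * mag xi"] sg
    by (simp add: norm_mult mult.assoc)
  qed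
 qed
qed

text \<open>Two limits are interchanged. The error of the truncation at level n is at most
  \<open>\<eta> n\<close> for all approximations j alike, so with n fixed one lets j tend to
  infinity, by dominated convergence since only finitely many interactions are involved, and n
  afterwards.\<close>

lemma tested_limit:
 assumes psi: "cutoff psi" and sol: "limit_sol sg R v" and sg: "\<bar>sg\<bar> = 1" and xi: "xi ~= 0" and r: "0 < r"
  and d: "!!t. (ta has_vector_derivative ta' t) (at t)"
  and z: "ta (-r) = 0" "ta r = 0" and c: "continuous_on UNIV ta'"
 shows "(%n. integral {-r..r} (%t. ta t * gf sg (2 ^ Suc n) (mv psi n v) xi t))
   ----> - integral {-r..r} (%t. ta' t * v xi t)"
proof -
 obtain B where B: "B >= 1" "!!x. \<bar>psi x\<bar> <= B" using cutoff_bounded[OF psi] by blast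
 have R: "R >= 0" by (rule limit_sol_R[OF sol])
 let ?x = "mag xi"
 have tac: "continuous_on S ta" for S by (rule vector_derivative_continuous_on[OF d])
 have c': "continuous_on {-r..r} ta'" by (rule continuous_on_subset[OF c]) auto
 have bnd: "\<exists>A\<ge>0. \<forall>t\<in>{-r..r}. norm (f t) <= A" if "continuous_on {-r..r} f" for f :: "real => complex"
 proof -
  have "bounded (f ` {-r..r})" using that by (intro compact_imp_bounded compact_continuous_image) auto
  then obtain a where "\<forall>y\<in>f ` {-r..r}. norm y <= a" unfolding bounded_iff by blast
  then show ?thesis by (intro exI[of _ "max a 0"]) (auto simp: le_max_iff_disj)
 qed
 obtain A0 where A0: "A0 >= 0" "!!t. t \<in> {-r..r} ==> norm (ta t) <= A0" using bnd[OF tac] by blast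
 obtain A1 where A1: "A1 >= 0" "!!t. t \<in> {-r..r} ==> norm (ta' t) <= A1" using bnd[OF c'] by blast
 define A where "A = A0 + A1 * (1 + 2 * r)"
 have A: "A >= 0" "!!t. t \<in> {-r..r} ==> norm (ta t) <= A"
  "!!x y. [|-r <= x; x < y; y <= r|] ==> norm (ta y - ta x) <= A * (y - x) powr (129/256)" proof -
  show "A >= 0" using A0 A1 r by (simp add: A_def)
  have le: "A0 <= A" "A1 * (1 + 2 * r) <= A" using A0 A1 r by (auto simp: A_def)
  show "norm (ta t) <= A" if "t \<in> {-r..r}" for t using A0(2)[OF that] le by simp
  show "norm (ta y - ta x) <= A * (y - x) powr (129/256)" if "-r <= x" "x < y" "y <= r" for x y
   using lipschitz_holder[OF d r A1(2) that] le(2) by (meson mult_right_mono order_trans powr_ge_zero)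
 qed
 define \<eta> where "\<eta> = (%n. (4 * ?x * B ^ 3) * A * (24 * sqrt zeta0 * (2 ^ n) powr (-(125/256))) * cst (2 * r) R (Mh R))"
 let ?J = "- integral {-r..r} (%t. ta' t * v xi t)"
 let ?G = "%n. integral {-r..r} (%t. ta t * gf sg (2 ^ Suc n) (mv psi n v) xi t)"
 have main: "norm (?J - ?G n) <= \<eta> n" if n: "8 * ?x <= 2 ^ n" for n proof -
  obtain N T ep vj where *:
   "!!j. approx_sol sg (N j) (T j) (ep j) R (vj j)" "!!j. 0 <= ep j" "!!j. ep j <= 1"
   "!!j. \<bar>xi\<bar> <= N j" "!!j. r <= T j" "ep ----> 0" "!!k t. (%j. vj j k t) ----> v k t"
   using limit_solE[OF sol, of "\<bar>xi\<bar>" r] by metis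
  let ?Jj = "%j. - integral {-r..r} (%t. ta' t * vj j xi t)"
  let ?Gj = "%j. integral {-r..r} (%t. ta t * gf sg (2 ^ Suc n) (mv psi n (vj j)) xi t)"
  have vjc: "continuous_on {-r..r} (vj j k)" for j k
   using *(1)[of j] *(5)[of j] unfolding approx_sol_def by (auto intro: continuous_on_subset)
  have vjR: "norm (vj j k t) <= R" if "t \<in> {-r..r}" for j k t
   using approx_sol_L2[OF *(1), of t j "{k}"] that *(5)[of j] by auto
  have 1: "norm (?Jj j - ?Gj j) <= A1 * (ep j * (2 * r)) * (2 * r) + \<eta> n" for j proof -
   let ?H = "integral {-r..r} (%t. ta t * gf sg (N j) (vj j) xi t)"
   have "norm (?Jj j - ?H) <= A1 * (ep j * (2 * r)) * (2 * r)"
    by (rule tested_error[OF *(1) r *(5) *(2) *(4) d z c A1(2)])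
   moreover have "norm (?H - ?Gj j) <= \<eta> n" unfolding \<eta>_def
    by (rule tail_bound[OF psi B *(1) sg *(2) *(3) R r *(5) xi n tac A(2) A(3) A(1)])
   ultimately show ?thesis using norm_triangle_ineq[of "?Jj j - ?H" "?H - ?Gj j"] by simp
  qed
  have lJ: "?Jj ----> ?J" proof (intro tendsto_minus dominated_convergence(2))
   show "(%t. ta' t * vj j xi t) integrable_on {-r..r}" for j
    by (intro integrable_continuous_real continuous_intros c' vjc)
   show "(%t. A1 * R) integrable_on {-r..r}" by (intro integrable_continuous_real continuous_intros)
   show "norm (ta' t * vj j xi t) <= A1 * R" if "t \<in> {-r..r}" for j t
    unfolding norm_mult using A1 vjR that R by (intro mult_mono) auto
   show "(%j. ta' t * vj j xi t) ----> ta' t * v xi t" for t by (intro tendsto_intros *(7))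
  qed
  have lG: "?Gj ----> ?G n" proof (rule dominated_convergence(2))
   let ?b = "6 * ?x * (B * R) ^ 3 + real (card (nres {-(2 ^ Suc n)..2 ^ Suc n} xi)) * (2 * ?x * (B * R) ^ 3)"
   show "(%t. ta t * gf sg (2 ^ Suc n) (mv psi n (vj j)) xi t) integrable_on {-r..r}" for j
    unfolding gf_mv by (intro integrable_continuous_real continuous_intros tac vjc)
   show "(%t. A0 * ?b) integrable_on {-r..r}" by (intro integrable_continuous_real continuous_intros)
   show "norm (ta t * gf sg (2 ^ Suc n) (mv psi n (vj j)) xi t) <= A0 * ?b" if "t \<in> {-r..r}" for j t
    unfolding norm_mult using A0 vjR that R B sg by (intro mult_mono gf_mv_bound) auto
   show "(%j. ta t * gf sg (2 ^ Suc n) (mv psi n (vj j)) xi t) ----> ta t * gf sg (2 ^ Suc n) (mv psi n v) xi t" for t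
    unfolding gf_mv by (intro tendsto_intros *(7))
  qed
  have "(%j. A1 * (ep j * (2 * r)) * (2 * r) + \<eta> n) ----> A1 * (0 * (2 * r)) * (2 * r) + \<eta> n"
   by (intro tendsto_intros *(6))
  moreover have "(%j. norm (?Jj j - ?Gj j)) ----> norm (?J - ?G n)" by (intro tendsto_norm tendsto_diff lJ lG)
  ultimately show ?thesis using 1 by (intro LIMSEQ_le[where X = "%j. norm (?Jj j - ?Gj j)"]) auto
 qed
 have "\<eta> ----> 0" proof -
  have "(%n. (2 powr (-(125/256))) ^ n) ----> (0::real)"
   using powr_less_mono[of "-(125/256)" 0 "2::real"] by (intro LIMSEQ_realpow_zero) auto
  moreover have "(2 ^ n) powr (-(125/256)) = (2 powr (-(125/256)) :: real) ^ n" for n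
   by (simp only: powr_realpow[symmetric] powr_gt_zero zero_less_numeral powr_powr mult.commute)
  ultimately have "(%n. (2 ^ n) powr (-(125/256))) ----> (0::real)" by simp
  then have "\<eta> ----> (4 * ?x * B ^ 3) * A * (24 * sqrt zeta0 * 0) * cst (2 * r) R (Mh R)"
   unfolding \<eta>_def by (intro tendsto_intros)
  then show ?thesis by simp
 qed
 moreover have "eventually (%n. norm (?G n - ?J) <= \<eta> n) sequentially" proof -
  obtain n0 where n0: "8 * ?x < 2 ^ n0" using real_arch_pow[of 2 "8 * ?x"] by auto
  have "norm (?G n - ?J) <= \<eta> n" if "n >= n0" for n proof -
   have "(2::real) ^ n0 <= 2 ^ n" using that by simp
   then have "norm (?J - ?G n) <= \<eta> n" using n0 by (intro main) linarith
   then show ?thesis by (simp only: norm_minus_commute)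
  qed
  then show ?thesis unfolding eventually_sequentially by blast
 qed
 ultimately have "(%n. ?G n - ?J) ----> 0" by (rule Lim_null_comparison[rotated])
 then show ?thesis by (rule LIM_zero_cancel)
qed

text \<open>The bound is uniform in n and N and grows polynomially in xi; it is the domination for
  the sum over xi in \<open>is_N_f\<close>. The sign \<open>sg\<close> of the tested term is
  separate from the sign \<open>sg'\<close> of the equation because the nonlinearity of
  \<open>is_N\<close> carries the sign 1 in both cases.\<close>

lemma tested_bound:
 assumes psi: "cutoff psi" and B: "B >= 1" "!!x. \<bar>psi x\<bar> <= B" and sol: "limit_sol sg' R v" and sg': "\<bar>sg'\<bar> = 1"
  and sg: "\<bar>sg\<bar> = 1" and xi: "xi ~= 0" and r: "0 < r"
  and d: "!!t. (ta has_vector_derivative ta' t) (at t)"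
  and A0: "!!t. t \<in> {-r..r} ==> norm (ta t) <= A" and A1: "!!t. t \<in> {-r..r} ==> norm (ta' t) <= A"
 shows "norm (integral {-r..r} (%t. ta t * gf sg N (mv psi n v) xi t))
   <= (12 * r * (B * R) ^ 3 + 2 * B ^ 3 * (2 + 2 * r) * (48 * zeta0) * cst (2 * r) R (Mh R)) * mag xi^2 * A"
proof -
 let ?x = "mag xi"
 let ?K = "{-N..N}"
 have R: "R >= 0" by (rule limit_sol_R[OF sol])
 have x1: "?x >= 1" using xi by linarith
 have A: "A >= 0" using order_trans[OF norm_ge_zero A0[of 0]] r by auto
 have tac: "continuous_on S ta" for S by (rule vector_derivative_continuous_on[OF d])
 have vc: "continuous_on S (v k)" for S k by (rule limit_sol_continuous[OF sol sg'])
 define A' where "A' = A * (2 + 2 * r)"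
 have A': "A' >= 0" "A <= A'" "A * (1 + 2 * r) <= A'"
  using A r by (auto simp: A'_def mult_le_cancel_left1 intro!: mult_left_mono)
 let ?m = "(mlt psi n xi)^2 * mlt psi n (-xi)"
 let ?f1 = "%t. ta t * (- 6 * \<i> * of_real sg * of_int xi * of_real ?m * ((v xi t)^2 * v (- xi) t))"
 define b where "b = (%p. nlc sg xi
     * of_real (mlt3 psi n xi p) :: complex)"
 let ?f2 = "%t. \<Sum>p\<in>nres ?K xi. b p * (cis (omp xi p * t) * (ta t * (v (fst p) t * v (snd p) t * v (xi - fst p - snd p) t)))"
 have i1: "?f1 integrable_on {-r..r}" by (intro integrable_continuous_real continuous_intros tac vc)
 have i2: "?f2 integrable_on {-r..r}" by (intro integrable_continuous_real continuous_intros tac vc)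
 have "integral {-r..r} (%t. ta t * gf sg N (mv psi n v) xi t) = integral {-r..r} (%t. ?f1 t + ?f2 t)"
  unfolding gf_mv distrib_left b_def sum_distrib_left by (simp add: mult_ac)
 also have "... = integral {-r..r} ?f1 + integral {-r..-r+2*r} ?f2"
  using Henstock_Kurzweil_Integration.integral_add[OF i1 i2] by simp
 also have "norm ... <= 6 * ?x * (B * R) ^ 3 * A * (r - (-r))
   + (2 * ?x * B ^ 3) * A' * (48 * zeta0 * ?x) * cst (2 * r) R (Mh R)"
 proof (rule order_trans[OF norm_triangle_ineq add_mono])
  show "norm (integral {-r..r} ?f1) <= 6 * ?x * (B * R) ^ 3 * A * (r - (-r))" proof (rule integral_bound)
   fix t assume t: "t \<in> {-r..r}"
   have m: "\<bar>?m\<bar> <= B ^ 3" using norm_prod3_le[OF B(2) B(2) B(2)] unfolding mlt_def power2_eq_square .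
   have vv: "norm ((v xi t)^2 * v (- xi) t) <= R ^ 3" proof -
    have "norm (v xi t) * norm (v xi t) * norm (v (-xi) t) <= R * R * R"
     using R by (intro mult_mono limit_sol_norm_le[OF sol]) auto
    then show ?thesis by (simp add: norm_mult power2_eq_square power3_eq_cube)
   qed
   have "norm (?f1 t) = norm (ta t) * (6 * ?x * \<bar>?m\<bar> * norm ((v xi t)^2 * v (- xi) t))"
    using sg unfolding norm_mult norm_of_real by simp
   also have "... <= A * (6 * ?x * B ^ 3 * R ^ 3)" using A0[OF t] A R B x1 by (intro mult_mono m vv) auto
   finally show "norm (?f1 t) <= 6 * ?x * (B * R) ^ 3 * A" by (simp add: power_mult_distrib mult_ac)
  qed (use r in \<open>auto intro!: continuous_intros tac vc\<close>)
  show "norm (integral {-r..-r+2*r} ?f2) <= (2 * ?x * B ^ 3) * A' * (48 * zeta0 * ?x) * cst (2 * r) R (Mh R)"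
   unfolding cst_def proof (rule pointwise_bound[where K = ?K])
   show "finite ?K" "nres ?K xi \<subseteq> nres ?K xi" "xi ~= 0" "0 < 2 * r" "R >= 0" "A' >= 0" "Mh R >= 0"
    using xi r R A' Mh(1)[OF R] by auto
   show "L2_set (%k. norm (v k t)) ?K <= R" for t by (rule limit_sol_L2[OF sol]) simp
   show "continuous_on {-r..-r+2*r} (v k)" for k by (rule vc)
   show "L2_set (incr v x y) ?K <= Mh R * (y - x) powr (129/256)"
    if "x < y" for x y using that by (intro limit_sol_hold[OF sol sg']) auto
   show "continuous_on {-r..-r+2*r} ta" by (rule tac)
   show "norm (ta t) <= A'" if "t \<in> {-r..-r+2*r}" for t using A0[of t] A' that by simp
   show "norm (ta y - ta x) <= A' * (y - x) powr (129/256)" if "-r <= x" "x < y" "y <= -r+2*r" for x y proof -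
    have "norm (ta y - ta x) <= A * (1 + 2 * r) * (y - x) powr (129/256)"
     using that by (intro lipschitz_holder[OF d r A1]) auto
    also have "... <= A' * (y - x) powr (129/256)" by (intro mult_right_mono A'(3)) auto
    finally show ?thesis .
   qed
   show "0 <= 2 * ?x * B ^ 3" using B by simp
   show "norm (b p) <= 2 * ?x * B ^ 3" for p proof -
    have "\<bar>mlt3 psi n xi p\<bar> <= B ^ 3" unfolding mlt_def by (intro norm_prod3_le B(2))
    then have "2 * ?x * \<bar>mlt3 psi n xi p\<bar> <= 2 * ?x * B ^ 3" by (intro mult_left_mono) auto
    moreover have "norm (b p) = 2 * ?x * \<bar>mlt3 psi n xi p\<bar>"
     unfolding b_def norm_mult[of _ "of_real _"] norm_of_real using sg by (simp add: norm_mult)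
    ultimately show ?thesis by simp
   qed
   show "0 <= 48 * zeta0 * ?x" using zeta0_pos by simp
   show "wsum (33/64) (nres ?K xi) xi f g h
     <= 48 * zeta0 * ?x * (L2_set f ?K * L2_set g ?K * L2_set h ?K)"
    if "!!k. f k >= 0" "!!k. g k >= 0" "!!k. h k >= (0::real)" for f g h by (rule wgt_sum_all) (use that xi in auto)
  qed
 qed
 also have "... = 12 * r * (B * R) ^ 3 * A * ?x + (2 * B ^ 3 * (2 + 2 * r) * (48 * zeta0) * cst (2 * r) R (Mh R)) * ?x^2 * A"
  by (simp add: A'_def power2_eq_square mult_ac)
 also have "... <= 12 * r * (B * R) ^ 3 * A * ?x^2 + (2 * B ^ 3 * (2 + 2 * r) * (48 * zeta0) * cst (2 * r) R (Mh R)) * ?x^2 * A"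
 proof (rule add_right_mono, rule mult_left_mono)
  have "?x * 1 <= ?x * ?x" by (intro mult_left_mono x1) simp
  then show "?x <= ?x^2" by (simp only: power2_eq_square mult_1_right)
  show "0 <= 12 * r * (B * R) ^ 3 * A" using r B R A by simp
 qed
 finally show ?thesis by (simp add: algebra_simps)
qed

section \<open>Integration on the circle\<close>

lemma space_circle [simp]: "space circle = {0..<2 * pi}" by (simp add: circle_def space_restrict_space)

lemma sets_circle: "sets circle = sets (restrict_space borel {0..<2 * pi})"
 unfolding circle_def by (rule sets_restrict_space_cong) simp

lemma emeasure_circle: "emeasure circle (space circle) = ennreal (2 * pi)"
 by (simp add: circle_def emeasure_restrict_space)

interpretation circle: finite_measure circle
 by standard (simp only: emeasure_circle ennreal_less_top infinity_ennreal_def top_neq_ennreal ennreal_neq_top not_False_eq_True)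

lemma measure_circle: "measure circle {0..<2 * pi} = 2 * pi" using emeasure_circle by (simp add: measure_def)

lemma borel_measurable_circle [measurable (raw)]:
 "f \<in> borel_measurable borel ==> f \<in> borel_measurable circle"
 unfolding circle_def by (rule measurable_restrict_space1) simp

lemma integral_circle_eq:
 fixes f :: "real => 'a::{banach, second_countable_topology}"
 shows "(LINT x|circle. f x) = (LINT x:{0..<2 * pi}|lborel. f x)"
 unfolding circle_def set_lebesgue_integral_def by (rule integral_restrict_space) simp

lemma integrable_circle_bounded:
 fixes f :: "real => 'a::{banach, second_countable_topology}"
 assumes "f \<in> borel_measurable borel" "!!x. x \<in> {0..<2*pi} ==> norm (f x) <= B"
 shows "integrable circle f" by (rule circle.integrable_const_bound[where B = B])
  (use assms in \<open>auto intro!: AE_I2 borel_measurable_circle\<close>)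

lemma continuous_imp_borel: "continuous_on UNIV f ==> f \<in> borel_measurable borel"
 for f :: "real => 'a::{banach, second_countable_topology}" by (rule borel_measurable_continuous_onI)

lemma integrable_circle_continuous:
 fixes f :: "real => 'a::{banach, second_countable_topology}"
 assumes "continuous_on UNIV f"
 shows "integrable circle f"
proof -
 have "compact (f ` {0..2*pi})" by (intro compact_continuous_image continuous_on_subset[OF assms]) auto
 then have "bounded (f ` {0..2*pi})" by (rule compact_imp_bounded)
 then obtain B where "\<forall>y\<in>f ` {0..2*pi}. norm y <= B" unfolding bounded_iff by blast
 then show ?thesis by (intro integrable_circle_bounded[of _ B] continuous_imp_borel assms) auto
qed

lemma integral_circle_FTC:
 fixes F :: "real => 'a::euclidean_space"
 assumes F: "!!x. (F has_vector_derivative f x) (at x)" and c: "continuous_on UNIV f"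
 shows "(LINT x|circle. f x) = F (2 * pi) - F 0"
proof -
 have "(LINT x|circle. f x) = (LINT x:{0..2 * pi}|lborel. f x)" unfolding integral_circle_eq set_lebesgue_integral_def
 proof (rule integral_cong_AE)
  have "AE x in lborel. x ~= 2 * pi" by (rule AE_lborel_singleton)
  then show "AE x in lborel. indicat_real {0..<2 * pi} x *\<^sub>R f x = indicat_real {0..2 * pi} x *\<^sub>R f x"
   by eventually_elim (auto simp: indicator_def)
 qed (use continuous_imp_borel[OF c] in measurable)
 also have "... = F (2 * pi) - F 0" unfolding set_lebesgue_integral_def by (rule integral_FTC_atLeastAtMost)
   (use c F in \<open>auto intro: has_vector_derivative_at_within continuous_on_subset\<close>)
 finally show ?thesis .
qed

lemma has_vector_derivative_cis: "((%x. cis (a * x)) has_vector_derivative (\<i> * of_real a * cis (a * x))) (at x)"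
 by (auto intro!: derivative_eq_intros simp: has_vector_derivative_def scaleR_conv_of_real)

lemma cis_2pi_int: "cis (of_int k * (2 * pi)) = 1" by (metis cis_multiple_2pi Ints_of_int mult.commute)

lemma integral_circle_cis: "(LINT x|circle. cis (of_int k * x)) = (if k = 0 then 2 * pi else 0)"
proof (cases "k = 0")
 case True
 then show ?thesis by (simp add: measure_circle scaleR_conv_of_real)
next
 case False
 have "(LINT x|circle. cis (of_int k * x)) = cis (of_int k * (2 * pi)) / (\<i> * of_int k) - cis (of_int k * 0) / (\<i> * of_int k)"
 proof (rule integral_circle_FTC)
  show "((%x. cis (of_int k * x) / (\<i> * of_int k)) has_vector_derivative cis (of_int k * x)) (at x)" for x
   using has_vector_derivative_divide[OF has_vector_derivative_cis[of "of_int k" x], of "\<i> * of_int k"] False by simp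
 qed (intro continuous_intros)
 then show ?thesis using False by (simp add: cis_2pi_int)
qed

lemma periodic_int:
 assumes "periodic u" shows "u (x + 2 * pi * of_int k) = u x"
proof (induction k rule: int_induct[where k = 0])
 case (step1 i)
 have "u (x + 2 * pi * of_int (i + 1)) = u ((x + 2 * pi * of_int i) + 2 * pi)" by (simp add: algebra_simps)
 also have "... = u (x + 2 * pi * of_int i)" using assms by (simp add: periodic_def)
 finally show ?case using step1 by simp
next
 case (step2 i)
 have "u (x + 2 * pi * of_int i) = u ((x + 2 * pi * of_int (i - 1)) + 2 * pi)" by (simp add: algebra_simps)
 also have "... = u (x + 2 * pi * of_int (i - 1))" using assms by (simp add: periodic_def)
 finally show ?case using step2 by simp
qed simp

lemma circle_rep: "\<exists>y\<in>{0..<2*pi}. \<exists>k. x = y + 2 * pi * of_int k"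
proof (intro bexI exI)
 let ?k = "\<lfloor>x / (2 * pi)\<rfloor>"
 show "x = (x - 2 * pi * of_int ?k) + 2 * pi * of_int ?k" by simp
 have "of_int ?k <= x / (2 * pi)" "x / (2 * pi) < of_int ?k + 1" by linarith+
 then have "of_int ?k * (2 * pi) <= x" "x < (of_int ?k + 1) * (2 * pi)"
  using pos_le_divide_eq[of "2 * pi" "of_int ?k" x] pos_divide_less_eq[of "2 * pi" x "of_int ?k + 1"] by auto
 then show "x - 2 * pi * of_int ?k \<in> {0..<2*pi}" by (auto simp: algebra_simps)
qed

section \<open>Square integrable functions\<close>

lemma quadratic_nonneg_imp:
 fixes a b c :: real
 assumes "!!t. 0 <= a + 2 * t * b + t^2 * c"
 shows "b^2 <= a * c"
proof (cases "c = 0")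
 case True
 show ?thesis proof (cases "b = 0")
  case False
  have "a + 2 * (- (a + 1) / (2 * b)) * b = -1" using False by (simp add: field_simps)
  then have False using assms[of "- (a + 1) / (2 * b)"] True by simp
  then show ?thesis ..
 qed (use True in simp)
next
 case False
 have c: "c > 0" proof (rule ccontr)
  assume "\<not> c > 0"
  then have cn: "c < 0" using False by simp
  define t where "t = 1 + (\<bar>a\<bar> + 2 * \<bar>b\<bar>) / (- c)"
  have "0 <= (\<bar>a\<bar> + 2 * \<bar>b\<bar>) / (- c)" using cn by (intro divide_nonneg_pos) auto
  then have t1: "t >= 1" unfolding t_def by linarith
  have "t * (- c) = - c + (\<bar>a\<bar> + 2 * \<bar>b\<bar>)" using cn by (simp add: t_def field_simps)
  then have "t * (t * (- c)) = t * (- c + \<bar>a\<bar> + 2 * \<bar>b\<bar>)" by simp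
  moreover have "t * \<bar>a\<bar> >= \<bar>a\<bar>" using t1 by (simp add: mult_le_cancel_right1)
  moreover have "t * (-c) > 0" using t1 cn by (intro mult_pos_pos) auto
  moreover have "t * b <= t * \<bar>b\<bar>" using t1 by (intro mult_left_mono) auto
  ultimately have "a + 2 * t * b + t^2 * c < 0" by (simp add: power2_eq_square algebra_simps)
  then show False using assms[of t] by simp
 qed
 have "0 <= a + 2 * (- b / c) * b + (- b / c)^2 * c" by (rule assms)
 also have "... = a - b^2 / c" using False by (simp add: power2_eq_square field_simps)
 finally show ?thesis using c by (simp add: field_simps)
qed

lemma L2T_measurable: "u \<in> L2T ==> u \<in> borel_measurable borel" by (simp add: L2T_def)
lemma L2T_sq: "u \<in> L2T ==> integrable circle (%x. (u x)^2)" by (simp add: L2T_def)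
lemma L2T_periodic: "u \<in> L2T ==> periodic u" by (simp add: L2T_def)

lemma L2T_continuous: "[|periodic u; continuous_on UNIV u|] ==> u \<in> L2T"
 unfolding L2T_def by (auto intro!: continuous_imp_borel integrable_circle_continuous continuous_intros)

lemma L2T_prod:
 assumes "u \<in> L2T" "v \<in> L2T" shows "integrable circle (%x. u x * v x)"
proof (rule Bochner_Integration.integrable_bound)
 show "integrable circle (%x. (u x)^2 + (v x)^2)" using assms by (intro Bochner_Integration.integrable_add L2T_sq)
 show "(%x. u x * v x) \<in> borel_measurable circle"
  using assms[THEN L2T_measurable] by (intro borel_measurable_circle) measurable
 have "\<bar>u x * v x\<bar> <= (u x)^2 + (v x)^2" for x proof -
  have "2 * (\<bar>u x\<bar> * \<bar>v x\<bar>) <= \<bar>u x\<bar>^2 + \<bar>v x\<bar>^2" using sum_squares_bound[of "\<bar>u x\<bar>" "\<bar>v x\<bar>"] by simp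
  moreover have "0 <= \<bar>u x\<bar> * \<bar>v x\<bar>" by simp
  ultimately have "\<bar>u x\<bar> * \<bar>v x\<bar> <= \<bar>u x\<bar>^2 + \<bar>v x\<bar>^2" by linarith
  then show ?thesis by (simp add: abs_mult)
 qed
 then show "AE x in circle. norm (u x * v x) <= norm ((u x)^2 + (v x)^2)" by (intro AE_I2) simp
qed

lemma L2T_lin:
 assumes "u \<in> L2T" "v \<in> L2T" shows "(%x. a * u x + b * v x) \<in> L2T"
proof -
 have "integrable circle (%x. a^2 * (u x)^2 + 2 * a * b * (u x * v x) + b^2 * (v x)^2)"
  using assms by (intro Bochner_Integration.integrable_add integrable_mult_right L2T_sq L2T_prod)
 moreover have "a^2 * (u x)^2 + 2 * a * b * (u x * v x) + b^2 * (v x)^2 = (a * u x + b * v x)^2" for x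
  by (simp add: power2_eq_square algebra_simps)
 ultimately show ?thesis using assms unfolding L2T_def periodic_def by auto
qed

lemma L2T_diff: "[|u \<in> L2T; v \<in> L2T|] ==> (%x. u x - v x) \<in> L2T" using L2T_lin[of u v 1 "-1"] by simp

lemma L2T_add: "[|u \<in> L2T; v \<in> L2T|] ==> (%x. u x + v x) \<in> L2T" using L2T_lin[of u v 1 1] by simp

lemma L2T_norm_nonneg [simp]: "L2T_norm u >= 0" by (simp add: L2T_norm_def)

lemma L2T_norm_sq: "(L2T_norm u)^2 = (LINT x|circle. (u x)^2)" by (simp add: L2T_norm_def)

lemma L2T_norm_sq_lin:
 assumes "u \<in> L2T" "v \<in> L2T"
 shows "(LINT x|circle. (a * u x + b * v x)^2)
  = a^2 * (LINT x|circle. (u x)^2) + 2 * a * b * (LINT x|circle. u x * v x) + b^2 * (LINT x|circle. (v x)^2)"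
proof -
 have "(LINT x|circle. (a * u x + b * v x)^2) = (LINT x|circle. (a^2 * (u x)^2 + 2 * a * b * (u x * v x)) + b^2 * (v x)^2)"
  by (intro Bochner_Integration.integral_cong) (auto simp: power2_eq_square algebra_simps)
 also have "... = (LINT x|circle. a^2 * (u x)^2 + 2 * a * b * (u x * v x)) + (LINT x|circle. b^2 * (v x)^2)"
  using assms by (intro Bochner_Integration.integral_add Bochner_Integration.integrable_add integrable_mult_right L2T_sq L2T_prod)
 also have "(LINT x|circle. a^2 * (u x)^2 + 2 * a * b * (u x * v x))
   = (LINT x|circle. a^2 * (u x)^2) + (LINT x|circle. 2 * a * b * (u x * v x))"
  using assms by (intro Bochner_Integration.integral_add integrable_mult_right L2T_sq L2T_prod)
 finally show ?thesis by simp
qed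

lemma L2T_Cauchy_Schwarz:
 assumes "u \<in> L2T" "v \<in> L2T"
 shows "\<bar>LINT x|circle. u x * v x\<bar> <= L2T_norm u * L2T_norm v"
proof -
 have "(LINT x|circle. u x * v x)^2 <= (LINT x|circle. (u x)^2) * (LINT x|circle. (v x)^2)"
 proof (rule quadratic_nonneg_imp)
  fix t
  have "(LINT x|circle. (u x)^2) + 2 * t * (LINT x|circle. u x * v x) + t^2 * (LINT x|circle. (v x)^2)
   = (LINT x|circle. (1 * u x + t * v x)^2)" using L2T_norm_sq_lin[OF assms, of 1 t] by simp
  also have "... >= 0" by simp
  finally show "0 <= (LINT x|circle. (u x)^2) + 2 * t * (LINT x|circle. u x * v x) + t^2 * (LINT x|circle. (v x)^2)" .
 qed
 also have "... = (L2T_norm u * L2T_norm v)^2" by (simp add: power_mult_distrib L2T_norm_sq)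
 finally have "\<bar>LINT x|circle. u x * v x\<bar>^2 <= (L2T_norm u * L2T_norm v)^2" by simp
 then show ?thesis by (rule power2_le_imp_le) simp
qed

lemma L2T_norm_triangle:
 assumes "u \<in> L2T" "v \<in> L2T"
 shows "L2T_norm (%x. u x + v x) <= L2T_norm u + L2T_norm v"
proof -
 have "(L2T_norm (%x. u x + v x))^2 = (L2T_norm u)^2 + 2 * (LINT x|circle. u x * v x) + (L2T_norm v)^2"
  using L2T_norm_sq_lin[OF assms, of 1 1] by (simp add: L2T_norm_sq)
 also have "... <= (L2T_norm u)^2 + 2 * (L2T_norm u * L2T_norm v) + (L2T_norm v)^2"
  using L2T_Cauchy_Schwarz[OF assms] by simp
 also have "... = (L2T_norm u + L2T_norm v)^2" by (simp add: power2_sum)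
 finally show ?thesis by (rule power2_le_imp_le) simp
qed

lemma L2T_norm_minus_commute: "L2T_norm (%x. u x - v x) = L2T_norm (%x. v x - u x)"
 by (simp add: L2T_norm_def power2_commute)

lemma L2T_norm_diff_abs:
 assumes "u \<in> L2T" "v \<in> L2T"
 shows "\<bar>L2T_norm u - L2T_norm v\<bar> <= L2T_norm (%x. u x - v x)"
proof -
 have "L2T_norm u <= L2T_norm (%x. u x - v x) + L2T_norm v"
  using L2T_norm_triangle[OF L2T_diff[OF assms] assms(2)] by simp
 moreover have "L2T_norm v <= L2T_norm (%x. u x - v x) + L2T_norm u"
  using L2T_norm_triangle[OF L2T_diff[OF assms(2,1)] assms(1)] L2T_norm_minus_commute[of u v] by simp
 ultimately show ?thesis by linarith
qed

lemma L2T_integrable: assumes "u \<in> L2T" shows "integrable circle u"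
proof -
 have "(%x. 1) \<in> L2T" by (rule L2T_continuous) (auto simp: periodic_def)
 from L2T_prod[OF assms this] show ?thesis by simp
qed

lemma integrable_circle_mult_bounded:
 fixes f g :: "real => complex"
 assumes f: "integrable circle f" and g: "g \<in> borel_measurable borel" "!!x. norm (g x) <= B"
 shows "integrable circle (%x. f x * g x)"
proof (rule Bochner_Integration.integrable_bound[of _ "%x. B * norm (f x)"])
 show "integrable circle (%x. B * norm (f x))" using f by simp
 show "(%x. f x * g x) \<in> borel_measurable circle"
  by (rule borel_measurable_times[OF borel_measurable_integrable[OF f] borel_measurable_circle[OF g(1)]])
 show "AE x in circle. norm (f x * g x) <= norm (B * norm (f x))" proof (intro AE_I2)
  fix x
  have "norm (f x) * norm (g x) <= norm (f x) * B" by (intro mult_left_mono g) auto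
  also have "... <= \<bar>B * norm (f x)\<bar>" by (simp add: mult.commute abs_mult mult_right_mono)
  finally show "norm (f x * g x) <= norm (B * norm (f x))" by (simp add: norm_mult)
 qed
qed

lemma cis_measurable [measurable]: "(%x. cis (a * x)) \<in> borel_measurable borel"
 by (intro continuous_imp_borel continuous_intros)

lemma integrable_circle_mult_cis:
 "integrable circle f ==> integrable circle (%x. f x * cis (a * x))"
 by (rule integrable_circle_mult_bounded[where B = 1]) auto

section \<open>Uniqueness of Fourier coefficients\<close>

definition fc :: "(real => complex) => int => complex" where
 "fc f k = P0 (%y. f y * cis (- of_int k * y))"

lemma fc_eq: "fc f k = (LINT y|circle. f y * cis (- of_int k * y)) / (2 * pi)"
 by (simp add: fc_def P0_def scaleR_conv_of_real)

definition zero_modes :: "(real => complex) => bool" where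
 "zero_modes f \<longleftrightarrow> integrable circle f \<and> (\<forall>k. (LINT y|circle. f y * cis (of_int k * y)) = 0)"

lemma zero_modes_lin:
 assumes "zero_modes f" "zero_modes g"
 shows "zero_modes (%y. a * f y + b * g y)"
proof -
 have "(%y. (a * f y + b * g y) * cis (of_int k * y))
   = (%y. a * (f y * cis (of_int k * y)) + b * (g y * cis (of_int k * y)))" for k by (simp add: algebra_simps)
 then show ?thesis using assms by (simp add: zero_modes_def integrable_circle_mult_cis)
qed

lemma zero_modes_cis:
 assumes "zero_modes f"
 shows "zero_modes (%y. f y * cis (of_int l * y))"
proof -
 have "f y * cis (of_int l * y) * cis (of_int k * y) = f y * cis (of_int (l + k) * y)" for k y
  by (simp add: cis_mult algebra_simps)
 then show ?thesis using assms unfolding zero_modes_def by (simp only: integrable_circle_mult_cis) simp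
qed

text \<open>A real polynomial in the point \<open>cis y\<close> of the plane is a trigonometric
  polynomial, and multiplication by a character only shifts the vanishing integrals. With f
  arbitrary, the product case is one induction hypothesis applied to the other.\<close>

lemma zero_modes_polynomial:
 assumes "real_polynomial_function (p :: complex => real)" "zero_modes f"
 shows "zero_modes (%y. f y * of_real (p (cis y)))" using assms
proof (induction p arbitrary: f rule: real_polynomial_function.induct)
 case (linear l)
 define a b where "a = (of_real (l 1) - \<i> * of_real (l \<i>)) / 2" "b = (of_real (l 1) + \<i> * of_real (l \<i>)) / 2"
 have "of_real (l (cis y)) = a * cis (of_int 1 * y) + b * cis (of_int (-1) * y)" for y proof -
  have "cis y = cos y *\<^sub>R 1 + sin y *\<^sub>R \<i>" by (simp add: complex_eq_iff)
  then have "l (cis y) = cos y * l 1 + sin y * l \<i>"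
   by (simp only: linear.hyps bounded_linear.linear linear_add linear_scale real_scaleR_def)
  then show ?thesis by (simp add: a_b_def complex_eq_iff field_simps)
 qed
 then have "f y * of_real (l (cis y)) = a * (f y * cis (of_int 1 * y)) + b * (f y * cis (of_int (-1) * y))" for y
  by (simp add: algebra_simps)
 then show ?case using zero_modes_lin[OF zero_modes_cis zero_modes_cis, OF linear.prems linear.prems] by presburger
next
 case (const c)
 then show ?case using zero_modes_lin[of f f "of_real c" 0] by (simp add: mult.commute)
next
 case (add p q)
 then show ?case using zero_modes_lin[OF add.IH, of f f 1 1] by (simp add: algebra_simps)
next
 case (mult p q)
 then show ?case using mult.IH(2)[OF mult.IH(1)] by (simp add: mult.assoc)
qed

lemma Arg2pi_cis: "x \<in> {0..<2*pi} ==> Arg2pi (cis x) = x"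
 using Arg2pi_unique[of 1 x "cis x"] by (simp add: cis_conv_exp)

text \<open>The theorem of Stone and Weierstrass on the unit circle in the plane, where continuity
  already contains periodicity.\<close>

lemma zero_modes_continuous:
 assumes f: "zero_modes f" and g: "continuous_on (sphere 0 1) g"
 shows "(LINT y|circle. f y * of_real (g (cis y))) = 0"
proof -
 have fi: "integrable circle f" using f by (simp add: zero_modes_def)
 have gc: "(%y. complex_of_real (g (cis y))) \<in> borel_measurable borel"
  by (intro continuous_imp_borel continuous_on_of_real continuous_on_compose2[OF g] continuous_intros) auto
 have "bounded (g ` sphere 0 1)" by (intro compact_imp_bounded compact_continuous_image g) auto
 then obtain G where G: "\<forall>y\<in>g ` sphere 0 1. norm y <= G" unfolding bounded_iff by blast
 have ig: "integrable circle (%y. f y * of_real (g (cis y)))"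
  by (rule integrable_circle_mult_bounded[OF fi gc, of G]) (use G in auto)
 have le: "norm (LINT y|circle. f y * of_real (g (cis y))) <= e * (LINT y|circle. norm (f y))" if e: "e > 0" for e
 proof -
  obtain p where p: "real_polynomial_function p" "!!z. z \<in> sphere 0 1 ==> \<bar>g z - p z\<bar> < e"
   using Stone_Weierstrass_real_polynomial_function[of "sphere (0::complex) 1" g e] g e by (metis compact_sphere)
  have pf: "integrable circle (%y. f y * of_real (p (cis y)))"
   "(LINT y|circle. f y * of_real (p (cis y)) * cis (of_int 0 * y)) = 0"
   using zero_modes_polynomial[OF p(1) f] unfolding zero_modes_def by blast+
  have "(LINT y|circle. f y * of_real (g (cis y)))
    = (LINT y|circle. f y * of_real (g (cis y)) - f y * of_real (p (cis y)))"
   using pf(2) Bochner_Integration.integral_diff[OF ig pf(1)] by simp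
  also have "norm ... <= (LINT y|circle. e * norm (f y))"
  proof (rule order_trans[OF integral_norm_bound Bochner_Integration.integral_mono])
   show "integrable circle (%y. norm (f y * of_real (g (cis y)) - f y * of_real (p (cis y))))"
    by (intro integrable_norm Bochner_Integration.integrable_diff ig pf(1))
   show "integrable circle (%y. e * norm (f y))" using fi by simp
   fix y
   have "f y * of_real (g (cis y)) - f y * of_real (p (cis y)) = f y * of_real (g (cis y) - p (cis y))"
    by (simp add: algebra_simps)
   also have "norm ... <= norm (f y) * e"
    unfolding norm_mult norm_of_real using p(2)[of "cis y"] by (intro mult_left_mono) auto
   finally show "norm (f y * of_real (g (cis y)) - f y * of_real (p (cis y))) <= e * norm (f y)"
    by (simp add: mult.commute)
  qed
  finally show ?thesis using fi by simp
 qed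
 have "(%n. inverse (real (Suc n)) * (LINT y|circle. norm (f y))) ----> 0"
  by (intro tendsto_mult_left_zero LIMSEQ_inverse_real_of_nat)
 then have "norm (LINT y|circle. f y * of_real (g (cis y))) <= 0" by (rule LIMSEQ_le_const) (auto intro!: le)
 then show ?thesis by simp
qed

text \<open>It suffices that the integral over every measurable set vanishes. Indicators are almost
  everywhere limits of continuous functions, which after clipping to {-1..1} can be carried to the
  unit circle, where \<open>zero_modes_continuous\<close> applies.\<close>

lemma fourier_unique:
 assumes "zero_modes f"
 shows "AE x in circle. f x = 0"
proof (rule circle.density_zero)
 show f: "integrable circle f" using assms by (simp add: zero_modes_def)
 fix A assume "A \<in> sets circle"
 then obtain B where B: "B \<in> sets borel" "A = B \<inter> {0..<2*pi}" by (auto simp: sets_circle sets_restrict_space)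
 have "indicat_real B measurable_on UNIV" using B(1) by (intro indicator_measurable_on) simp
 then obtain N g where N: "negligible N" and g: "!!n::nat. continuous_on UNIV (g n)"
  and gl: "!!x. x \<notin> N ==> (%n. g n x) ----> indicat_real B x" unfolding measurable_on_def by auto
 text \<open>The approximants are damped near the point where the circle is cut open.\<close>
 define G where "G = (%n z. min 1 (real n * norm (z - 1)) * max (-1) (min 1 (g n (Arg2pi z))))"
 have G1: "\<bar>G n z\<bar> <= min 1 (real n * norm (z - 1))" for n z
  using mult_right_le_one_le[of "min 1 (real n * norm (z - 1))" "\<bar>max (-1) (min 1 (g n (Arg2pi z)))\<bar>"]
  by (simp add: G_def abs_mult)
 have gG: "continuous_on (sphere 0 1) (G n)" for n proof (rule continuous_at_imp_continuous_on, rule ballI)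
  fix z :: complex assume z: "z \<in> sphere 0 1"
  show "isCont (G n) z" proof (cases "z = 1")
   case True
   have "((%z::complex. real n * norm (z - 1)) \<longlongrightarrow> real n * norm (1 - 1 :: complex)) (at 1)" by (intro tendsto_intros)
   then have "(G n \<longlongrightarrow> 0) (at 1)"
    by (intro Lim_null_comparison[where f = "G n"] always_eventually allI) (use G1 in \<open>auto simp: min_le_iff_disj\<close>)
   then show ?thesis unfolding isCont_def True by (simp add: G_def)
  next
   case False
   then have "z \<notin> \<real>\<^sub>\<ge>\<^sub>0" using z by (auto simp: complex_nonneg_Reals_iff complex_eq_iff norm_complex_def power2_eq_1_iff)
   then have "isCont Arg2pi z" by (rule continuous_at_Arg2pi)
   moreover have "isCont (g n) (Arg2pi z)" using g by (simp add: continuous_on_eq_continuous_at)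
   ultimately have "isCont (%z. g n (Arg2pi z)) z" by (rule isCont_o2)
   then show ?thesis unfolding G_def by (intro continuous_intros)
  qed
 qed
 have "(%n. LINT y|circle. f y * of_real (G n (cis y))) ----> (LINT y|circle. indicat_real A y *\<^sub>R f y)"
 proof (rule integral_dominated_convergence[where w = "%y. norm (f y)"])
  show "(%y. indicat_real A y *\<^sub>R f y) \<in> borel_measurable circle"
   using f \<open>A \<in> sets circle\<close> by measurable
  have "(%y. complex_of_real (G n (cis y))) \<in> borel_measurable borel" for n
   by (intro continuous_imp_borel continuous_on_of_real continuous_on_compose2[OF gG] continuous_intros) auto
  then show "(%y. f y * of_real (G n (cis y))) \<in> borel_measurable circle" for n
   by (intro borel_measurable_times[OF borel_measurable_integrable[OF f]] borel_measurable_circle)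
  show "integrable circle (%y. norm (f y))" using f by simp
  show "AE y in circle. norm (f y * of_real (G n (cis y))) <= norm (f y)" for n
   using G1[of n] by (intro AE_I2) (auto simp: norm_mult intro!: mult_right_le_one_le)
  have "AE y in lborel. y \<notin> N \<union> {0}"
   using AE_not_in[OF negligible_Un[OF N negligible_sing, unfolded negligible_iff_null_sets]]
   by (simp only: AE_completion_iff)
  then have "AE y in circle. y \<notin> N \<union> {0}" unfolding circle_def
   by (subst AE_restrict_space_iff) (simp, erule eventually_mono, simp)
  then show "AE y in circle. (%n. f y * of_real (G n (cis y))) ----> indicat_real A y *\<^sub>R f y" using AE_space
  proof eventually_elim
   case (elim y)
   then have y: "Arg2pi (cis y) = y" by (intro Arg2pi_cis) simp
   have "cis y ~= 1" using elim(1) y Arg2pi_of_real[of 1] by auto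
   then have "norm (cis y - 1) > 0" by simp
   then obtain m where "1 <= real m * norm (cis y - 1)"
    using reals_Archimedean3[of "norm (cis y - 1)"] less_imp_le by blast
   then have "eventually (%n. min 1 (real n * norm (cis y - 1)) = 1) sequentially" unfolding eventually_sequentially
    by (intro exI[of _ m]) (auto intro!: min_absorb1 intro: order_trans[OF _ mult_right_mono])
   then have "(%n. min 1 (real n * norm (cis y - 1))) ----> 1" by (rule tendsto_eventually)
   moreover have "(%n. g n y) ----> indicat_real B y" using elim by (intro gl) simp
   ultimately have "(%n. f y * of_real (G n (cis y))) ----> f y * of_real (1 * max (-1) (min 1 (indicat_real B y)))"
    unfolding G_def y by (intro tendsto_intros)
   then show ?case using elim by (cases "y \<in> B") (simp_all add: B(2))
  qed
 qed
 then show "set_lebesgue_integral circle A f = 0"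
  unfolding zero_modes_continuous[OF assms gG] set_lebesgue_integral_def by (simp add: LIMSEQ_const_iff)
qed

lemma fc_cong_AE:
 assumes "integrable circle f" "integrable circle g" "AE x in circle. f x = g x"
 shows "fc f k = fc g k"
proof -
 have "(LINT y|circle. f y * cis (- of_int k * y)) = (LINT y|circle. g y * cis (- of_int k * y))"
  by (rule integral_cong_AE)
   (use assms borel_measurable_integrable[OF integrable_circle_mult_cis[OF assms(1), of "- of_int k"]]
     borel_measurable_integrable[OF integrable_circle_mult_cis[OF assms(2), of "- of_int k"]]
    in \<open>auto elim!: eventually_mono\<close>)
 then show ?thesis by (simp add: fc_eq)
qed

lemma fc_lin:
 assumes "integrable circle f" "integrable circle g"
 shows "fc (%x. a * f x + b * g x) k = a * fc f k + b * fc g k"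
proof -
 have "(LINT y|circle. (a * f y + b * g y) * cis (- of_int k * y))
   = (LINT y|circle. a * (f y * cis (- of_int k * y)) + b * (g y * cis (- of_int k * y)))" by (simp add: algebra_simps)
 also have "... = (LINT y|circle. a * (f y * cis (- of_int k * y))) + (LINT y|circle. b * (g y * cis (- of_int k * y)))"
  by (intro Bochner_Integration.integral_add integrable_mult_right integrable_circle_mult_cis assms)
 finally show ?thesis by (simp add: fc_eq add_divide_distrib)
qed

lemma fc_diff:
 "[|integrable circle f; integrable circle g|] ==> fc (%x. f x - g x) k = fc f k - fc g k"
 using fc_lin[of f g 1 "-1"] by simp

lemma norm_fc_le:
 assumes "integrable circle f"
 shows "norm (fc f k) <= (LINT y|circle. norm (f y)) / (2 * pi)"
proof -
 have "norm (LINT y|circle. f y * cis (- of_int k * y)) <= (LINT y|circle. norm (f y * cis (- of_int k * y)))"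
  by (rule integral_norm_bound)
 then show ?thesis by (simp add: fc_eq norm_divide norm_mult divide_right_mono)
qed

definition trig :: "(int => complex) => int set => real => complex" where
 "trig c F x = (\<Sum>k\<in>F. c k * cis (of_int k * x))"

lemma continuous_trig [continuous_intros]: "continuous_on S (trig c F)" unfolding trig_def by (intro continuous_intros)

lemma periodic_cis: "periodic (%x. cis (of_int k * x))"
 by (simp add: periodic_def distrib_left cis_2pi_int flip: cis_mult)

lemma periodic_trig: "periodic (trig c F)" using periodic_cis unfolding trig_def periodic_def by simp

lemma integrable_trig: "integrable circle (trig c F)" by (intro integrable_circle_continuous continuous_intros)

lemma integral_mult_trig:
 assumes "integrable circle f" "finite F"
 shows "(LINT x|circle. f x * trig c F x) = 2 * pi * (\<Sum>k\<in>F. c k * fc f (-k))"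
proof -
 have "(LINT x|circle. f x * trig c F x) = (LINT x|circle. (\<Sum>k\<in>F. c k * (f x * cis (of_int k * x))))"
  unfolding trig_def by (simp add: sum_distrib_left mult_ac)
 also have "... = (\<Sum>k\<in>F. LINT x|circle. c k * (f x * cis (of_int k * x)))"
  by (intro Bochner_Integration.integral_sum integrable_mult_right integrable_circle_mult_cis assms)
 also have "... = (\<Sum>k\<in>F. c k * (2 * pi * fc f (-k)))" by (simp add: fc_eq)
 finally show ?thesis by (simp add: sum_distrib_left mult_ac)
qed

lemma fc_cis: "fc (%x. cis (of_int k * x)) l = (if k = l then 1 else 0)"
proof -
 have "cis (of_int k * y) * cis (- of_int l * y) = cis (of_int (k - l) * y)" for y by (simp add: cis_mult algebra_simps)
 then have "fc (%x. cis (of_int k * x)) l = (LINT y|circle. cis (of_int (k - l) * y)) / (2 * pi)"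
  unfolding fc_eq by presburger
 then show ?thesis unfolding integral_circle_cis by simp
qed

lemma fc_trig:
 assumes "finite F"
 shows "fc (trig c F) l = (if l \<in> F then c l else 0)"
proof -
 have "(LINT y|circle. trig c F y * cis (- of_int l * y)) = (LINT y|circle. cis (of_int (-l) * y) * trig c F y)"
  by (simp add: mult.commute)
 also have "... = 2 * pi * (\<Sum>k\<in>F. c k * fc (%y. cis (of_int (-l) * y)) (-k))"
  by (intro integral_mult_trig assms integrable_circle_continuous continuous_intros)
 also have "(\<Sum>k\<in>F. c k * fc (%y. cis (of_int (-l) * y)) (-k)) = (\<Sum>k\<in>F. if k = l then c k else 0)"
  by (intro sum.cong refl) (auto simp: fc_cis simp del: of_int_minus)
 finally show ?thesis using assms by (simp add: fc_eq)
qed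

lemma cnj_trig: "cnj (trig c F x) = trig (%k. cnj (c (-k))) (uminus ` F) x"
 unfolding trig_def by (subst sum.reindex) (auto simp: cis_cnj)

lemma integral_norm_trig:
 assumes "finite F"
 shows "(LINT x|circle. (norm (trig c F x))^2) = 2 * pi * (\<Sum>k\<in>F. (norm (c k))^2)"
proof -
 have "complex_of_real (LINT x|circle. (norm (trig c F x))^2) = (LINT x|circle. trig c F x * trig (%k. cnj (c (-k))) (uminus ` F) x)"
  unfolding cnj_trig[symmetric] complex_norm_square[symmetric] by (rule integral_complex_of_real[symmetric])
 also have "... = 2 * pi * (\<Sum>k\<in>uminus ` F. cnj (c (-k)) * fc (trig c F) (-k))"
  by (intro integral_mult_trig integrable_trig) (use assms in auto)
 also have "(\<Sum>k\<in>uminus ` F. cnj (c (-k)) * fc (trig c F) (-k)) = (\<Sum>k\<in>F. cnj (c k) * c k)"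
  by (subst sum.reindex) (auto simp: fc_trig[OF assms] intro!: sum.cong)
 also have "... = (\<Sum>k\<in>F. complex_of_real ((norm (c k))^2))"
  by (intro sum.cong refl) (subst mult.commute, rule complex_norm_square[symmetric])
 finally have "complex_of_real (LINT x|circle. (norm (trig c F x))^2) = complex_of_real (2 * pi * (\<Sum>k\<in>F. (norm (c k))^2))"
  by simp
 then show ?thesis unfolding of_real_eq_iff .
qed

section \<open>Real functions: Bessel, Riesz-Fischer and Parseval\<close>

definition rc :: "(real => real) => int => complex" where
 "rc u k = fc (%x. of_real (u x)) k"

lemma rc_neg: "rc u (-k) = cnj (rc u k)"
proof -
 have "cnj (LINT y|circle. of_real (u y) * cis (- of_int k * y)) = (LINT y|circle. cnj (of_real (u y) * cis (- of_int k * y)))"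
  by (simp only: Bochner_Integration.integral_cnj)
 also have "... = (LINT y|circle. of_real (u y) * cis (- of_int (-k) * y))" by (simp add: cis_cnj)
 finally show ?thesis by (simp add: rc_def fc_eq)
qed

lemma L2T_integrable_c: "u \<in> L2T ==> integrable circle (%x. complex_of_real (u x))" by (simp add: L2T_integrable)

definition symF :: "nat => int set" where "symF n = {- int n..int n}"

abbreviation msq :: "nat => (int => complex) => real" where
 "msq n f \<equiv> \<Sum>k\<in>symF n. (norm (f k))^2"

lemma symF_simps [simp]: "finite (symF n)" "k \<in> symF n \<longleftrightarrow> \<bar>k\<bar> <= int n" "uminus ` symF n = symF n"
 by (auto simp: symF_def image_iff)

lemma symF_mono: "m <= n ==> symF m \<subseteq> symF n" by (auto simp: symF_def)

lemma trig_real: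
 assumes "!!k. c (-k) = cnj (c k)"
 shows "of_real (Re (trig c (symF n) x)) = trig c (symF n) x"
proof -
 have "cnj (trig c (symF n) x) = trig c (symF n) x" unfolding cnj_trig using assms by simp
 then show ?thesis by (metis Reals_cnj_iff of_real_Re)
qed

definition psum :: "(int => complex) => nat => real => real" where
 "psum c n x = Re (trig c (symF n) x)"

lemma psum_L2T: "psum c n \<in> L2T"
proof (rule L2T_continuous)
 show "periodic (psum c n)" using periodic_trig by (simp add: psum_def periodic_def)
 show "continuous_on UNIV (psum c n)" unfolding psum_def by (intro continuous_intros)
qed

lemma rc_psum:
 assumes "!!k. c (-k) = cnj (c k)"
 shows "rc (psum c n) k = (if \<bar>k\<bar> <= int n then c k else 0)"
 unfolding rc_def psum_def trig_real[of c, OF assms] using fc_trig[of "symF n" c k] by simp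

lemma psum_diff_sq:
 assumes c: "!!k. c (-k) = cnj (c k)" and mn: "m <= n"
 shows "(LINT x|circle. (psum c n x - psum c m x)^2)
  = 2 * pi * (msq n c - msq m c)"
proof -
 let ?F = "symF n - symF m"
 have d: "(psum c n x - psum c m x)^2 = (norm (trig c ?F x))^2" for x proof -
  have "complex_of_real (psum c n x - psum c m x) = trig c (symF n) x - trig c (symF m) x"
   unfolding psum_def of_real_diff trig_real[of c, OF c] ..
  also have "... = trig c ?F x" unfolding trig_def using symF_mono[OF mn] by (subst sum_diff) auto
  finally have "norm (complex_of_real (psum c n x - psum c m x)) = norm (trig c ?F x)" by simp
  then show ?thesis unfolding norm_of_real by (metis power2_abs)
 qed
 show ?thesis unfolding d using symF_mono[OF mn] by (subst integral_norm_trig) (auto simp: sum_diff)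
qed

lemma L2T_sub_psum:
 assumes u: "u \<in> L2T"
 shows "(LINT x|circle. (u x - psum (rc u) n x)^2)
  = (LINT x|circle. (u x)^2) - 2 * pi * msq n (rc u)"
proof -
 let ?p = "psum (rc u) n"
 have "complex_of_real (LINT x|circle. u x * ?p x) = (LINT x|circle. of_real (u x) * trig (rc u) (symF n) x)"
  unfolding integral_complex_of_real[symmetric] of_real_mult psum_def trig_real[of "rc u", OF rc_neg] ..
 also have "... = 2 * pi * (\<Sum>k\<in>symF n. rc u k * rc u (-k))"
  unfolding rc_def[of u "- _"] by (rule integral_mult_trig[OF L2T_integrable_c[OF u]]) simp
 also have "... = complex_of_real (2 * pi * msq n (rc u))" proof -
  have "rc u k * rc u (-k) = complex_of_real ((norm (rc u k))^2)" for k by (simp only: rc_neg complex_norm_square)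
  then show ?thesis by simp
 qed
 finally have 1: "(LINT x|circle. u x * ?p x) = 2 * pi * msq n (rc u)" unfolding of_real_eq_iff .
 have "(?p x)^2 = (norm (trig (rc u) (symF n) x))^2" for x proof -
  have "norm (complex_of_real (?p x)) = norm (trig (rc u) (symF n) x)"
   unfolding psum_def trig_real[of "rc u", OF rc_neg] ..
  then show ?thesis unfolding norm_of_real by (metis power2_abs)
 qed
 then have 2: "(LINT x|circle. (?p x)^2) = 2 * pi * msq n (rc u)" using integral_norm_trig[of "symF n" "rc u"] by simp
 show ?thesis using L2T_norm_sq_lin[OF u psum_L2T[of "rc u" n], of 1 "-1"] 1 2 by simp
qed

lemma bessel:
 assumes u: "u \<in> L2T"
 shows "2 * pi * msq n (rc u) <= (LINT x|circle. (u x)^2)"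
proof -
 have "0 <= (LINT x|circle. (u x - psum (rc u) n x)^2)" by simp
 then show ?thesis unfolding L2T_sub_psum[OF u] by simp
qed

lemma norm_rc_le: assumes u: "u \<in> L2T" shows "norm (rc u k) <= L2T_norm u"
proof -
 have "2 * pi * (norm (rc u k))^2 <= 2 * pi * (\<Sum>k\<in>symF (nat \<bar>k\<bar>). (norm (rc u k))^2)"
  by (intro mult_left_mono member_le_sum) auto
 also have "... <= (L2T_norm u)^2" using bessel[OF u] by (simp add: L2T_norm_sq)
 finally have "2 * pi * (norm (rc u k))^2 <= (L2T_norm u)^2" .
 moreover have "1 * (norm (rc u k))^2 <= 2 * pi * (norm (rc u k))^2" using pi_ge_two by (intro mult_right_mono) auto
 ultimately have "(norm (rc u k))^2 <= (L2T_norm u)^2" by linarith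
 then show ?thesis by (rule power2_le_imp_le) simp
qed

lemma rc_diff: "[|u \<in> L2T; v \<in> L2T|] ==> rc (%x. u x - v x) k = rc u k - rc v k"
 unfolding rc_def of_real_diff by (intro fc_diff L2T_integrable_c)

lemma L2T_L1_le:
 assumes u: "u \<in> L2T" shows "(LINT x|circle. \<bar>u x\<bar>) <= sqrt (2 * pi) * L2T_norm u"
proof -
 have a: "(%x. \<bar>u x\<bar>) \<in> L2T" using u by (auto simp: L2T_def periodic_def)
 have one: "(%x. 1) \<in> L2T" by (rule L2T_continuous) (auto simp: periodic_def)
 have "\<bar>LINT x|circle. \<bar>u x\<bar> * 1\<bar> <= L2T_norm (%x. \<bar>u x\<bar>) * L2T_norm (%x. 1)"
  by (rule L2T_Cauchy_Schwarz[OF a one])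
 also have "L2T_norm (%x. \<bar>u x\<bar>) = L2T_norm u" by (simp add: L2T_norm_def)
 also have "L2T_norm (%x. 1) = sqrt (2 * pi)" by (simp add: L2T_norm_def measure_circle)
 finally show ?thesis by (simp add: mult.commute)
qed

text \<open>The partial sums are Cauchy in L1, hence a subsequence converges almost everywhere, and
  its pointwise limit is a genuine periodic Borel function, as \<open>L2T\<close> demands. Fatou's
  lemma transfers the bound of the tails to the limit and gives L2 convergence of the full
  sequence.\<close>

lemma riesz_fischer:
 assumes c: "!!k. c (-k) = cnj (c k)" and B: "!!n. msq n c <= B"
 obtains u where "u \<in> L2T" "!!k. rc u k = c k"
  "(%n. L2T_norm (%x. u x - psum c n x)) ----> 0"
proof -
 let ?a = "%n. \<Sum>k\<in>symF n. (norm (c k))^2"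
 let ?p = "psum c"
 have mono: "?a m <= ?a n" if "m <= n" for m n using that by (intro sum_mono2) auto
 obtain L where L: "?a ----> L" "!!n. ?a n <= L" using incseq_convergent[of ?a B] mono B by (auto simp: incseq_def)
 have D: "(LINT x|circle. (?p n x - ?p m x)^2) <= 2 * pi * (L - ?a m)" if "m <= n" for m n
  unfolding psum_diff_sq[of c, OF c that] using L(2) by (intro mult_left_mono diff_right_mono) auto
 have lim0: "(%m. sqrt (2 * pi * (L - ?a m))) ----> 0"
  using tendsto_real_sqrt[OF tendsto_mult_left[OF tendsto_diff[OF tendsto_const L(1)]], of "2 * pi" L] by simp
 obtain r where r: "strict_mono r" and ae: "AE x in circle. Cauchy (%i. ?p (r i) x)"
 proof (rule cauchy_L1_AE_cauchy_subseq[of circle ?p])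
  show "integrable circle (?p n)" for n by (intro L2T_integrable psum_L2T)
  fix e :: real assume "e > 0"
  then have "eventually (%m. sqrt (2 * pi) * sqrt (2 * pi * (L - ?a m)) < e) sequentially"
   using order_tendstoD(2)[OF tendsto_mult_left[OF lim0, of "sqrt (2 * pi)"], of e] by simp
  then obtain N where N: "!!m. m >= N ==> sqrt (2 * pi) * sqrt (2 * pi * (L - ?a m)) < e"
   unfolding eventually_sequentially by blast
  have le: "(LINT x|circle. norm (?p n x - ?p m x)) < e" if "N <= m" "m <= n" for m n proof -
   have "(LINT x|circle. norm (?p n x - ?p m x)) <= sqrt (2 * pi) * L2T_norm (%x. ?p n x - ?p m x)"
    unfolding real_norm_def by (intro L2T_L1_le L2T_diff psum_L2T)
   also have "... <= sqrt (2 * pi) * sqrt (2 * pi * (L - ?a m))"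
    unfolding L2T_norm_def by (intro mult_left_mono real_sqrt_le_mono D that) simp
   finally show ?thesis using N[OF that(1)] by linarith
  qed
  have "(LINT x|circle. norm (?p i x - ?p j x)) < e" if "N <= i" "N <= j" for i j proof (cases "i <= j")
   case True
   then show ?thesis using le[OF that(1) True] by (simp only: norm_minus_commute[of "?p i _"])
  qed (use le[OF that(2)] in simp)
  then show "\<exists>N. \<forall>i\<ge>N. \<forall>j\<ge>N. (LINT x|circle. norm (?p i x - ?p j x)) < e" by blast
 qed
 define u where "u x = lim (%i. ?p (r i) x)" for x
 have pm: "?p n \<in> borel_measurable borel" for n by (intro L2T_measurable psum_L2T)
 have um: "u \<in> borel_measurable borel" unfolding u_def using pm by (intro borel_measurable_lim_metric)
 have up: "periodic u" using L2T_periodic[OF psum_L2T] unfolding u_def periodic_def by simp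
 have usq: "integrable circle (%x. (u x - ?p m x)^2) \<and> (LINT x|circle. (u x - ?p m x)^2) <= 2 * pi * (L - ?a m)" for m
 proof -
  have m: "(%x. (u x - ?p m x)^2) \<in> borel_measurable circle"
   using um pm by (intro borel_measurable_circle) measurable
  have "(\<integral>\<^sup>+x. ennreal ((u x - ?p m x)^2) \<partial>circle) <= (\<integral>\<^sup>+x. liminf (%j. ennreal ((?p (r j) x - ?p m x)^2)) \<partial>circle)"
  proof (rule nn_integral_mono_AE)
   show "AE x in circle. ennreal ((u x - ?p m x)^2) <= liminf (%j. ennreal ((?p (r j) x - ?p m x)^2))" using ae
   proof eventually_elim
    case (elim x)
    then have "(%j. ?p (r j) x) ----> u x" unfolding u_def Cauchy_convergent_iff convergent_LIMSEQ_iff .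
    then have "(%j. ennreal ((?p (r j) x - ?p m x)^2)) ----> ennreal ((u x - ?p m x)^2)" by (intro tendsto_intros)
    from lim_imp_Liminf[OF _ this] show ?case by (simp only: sequentially_bot not_False_eq_True order_refl)
   qed
  qed
  also have "... <= liminf (%j. \<integral>\<^sup>+x. ennreal ((?p (r j) x - ?p m x)^2) \<partial>circle)"
   using pm by (intro nn_integral_liminf) (auto intro!: borel_measurable_circle)
  also have "... <= liminf (%j::nat. ennreal (2 * pi * (L - ?a m)))"
  proof (rule Liminf_mono, unfold eventually_sequentially, intro exI[of _ m] allI impI)
   fix j assume "m <= j"
   then have "m <= r j" using strict_mono_imp_increasing[OF r, of j] by simp
   moreover have "(\<integral>\<^sup>+x. ennreal ((?p (r j) x - ?p m x)^2) \<partial>circle) = ennreal (LINT x|circle. (?p (r j) x - ?p m x)^2)"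
    by (intro nn_integral_eq_integral L2T_sq L2T_diff psum_L2T) auto
   ultimately show "(\<integral>\<^sup>+x. ennreal ((?p (r j) x - ?p m x)^2) \<partial>circle) <= ennreal (2 * pi * (L - ?a m))"
    using D by (simp add: ennreal_leI)
  qed
  finally have le: "(\<integral>\<^sup>+x. ennreal ((u x - ?p m x)^2) \<partial>circle) <= ennreal (2 * pi * (L - ?a m))"
   by (simp add: Liminf_const)
  have int: "integrable circle (%x. (u x - ?p m x)^2)"
   by (rule integrableI_nonneg[OF m]) (use le in \<open>auto intro: le_less_trans\<close>)
  have "ennreal (LINT x|circle. (u x - ?p m x)^2) <= ennreal (2 * pi * (L - ?a m))"
   using le nn_integral_eq_integral[OF int] by simp
  then show ?thesis using int L(2)[of m] by (subst (asm) ennreal_le_iff) auto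
 qed
 have dL: "(%x. u x - ?p m x) \<in> L2T" for m
  using usq[of m] um pm up L2T_periodic[OF psum_L2T, of c m] unfolding L2T_def periodic_def by simp
 have uL: "u \<in> L2T" using L2T_add[OF dL[of 0] psum_L2T[of c 0]] by simp
 have lim: "(%m. L2T_norm (%x. u x - ?p m x)) ----> 0" by (rule Lim_null_comparison[OF _ lim0])
   (use usq in \<open>auto simp: L2T_norm_def intro!: always_eventually\<close>)
 have rcu: "rc u k = c k" for k proof -
  have "(%m. rc u k - rc (?p m) k) ----> 0" by (rule Lim_null_comparison[OF always_eventually lim])
    (use norm_rc_le[OF dL] in \<open>simp add: rc_diff uL psum_L2T\<close>)
  moreover have "eventually (%m. rc u k - rc (?p m) k = rc u k - c k) sequentially"
   unfolding eventually_sequentially rc_psum[of c, OF c] by (intro exI[of _ "nat \<bar>k\<bar>"]) auto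
  ultimately have "(%m::nat. rc u k - c k) ----> 0" by (rule Lim_transform_eventually)
  then show ?thesis by (simp add: LIMSEQ_const_iff)
 qed
 show thesis by (rule that[OF uL rcu lim])
qed

lemma rc_unique:
 assumes "u \<in> L2T" "v \<in> L2T" "!!k. rc u k = rc v k"
 shows "AE x in circle. u x = v x"
proof -
 have "rc (%x. u x - v x) (-k) = 0" for k using assms by (simp add: rc_diff)
 then have "AE x in circle. complex_of_real (u x - v x) = 0" using L2T_integrable_c[OF L2T_diff[OF assms(1,2)]]
  by (intro fourier_unique) (simp add: zero_modes_def rc_def fc_eq)
 then show ?thesis by eventually_elim simp
qed

lemma L2T_norm_cong_AE:
 assumes "u \<in> L2T" "v \<in> L2T" "AE x in circle. u x = v x"
 shows "L2T_norm u = L2T_norm v"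
proof -
 have "(LINT x|circle. (u x)^2) = (LINT x|circle. (v x)^2)"
  by (rule integral_cong_AE) (use assms in \<open>auto intro!: borel_measurable_circle simp: L2T_def\<close>)
 then show ?thesis by (simp add: L2T_norm_def)
qed

text \<open>Completeness of the characters: the function produced by \<open>riesz_fischer\<close>
  from the coefficients of u has the same coefficients as u, hence equals u almost
  everywhere.\<close>

lemma L2T_psum_tendsto:
 assumes u: "u \<in> L2T"
 shows "(%n. L2T_norm (%x. u x - psum (rc u) n x)) ----> 0"
proof -
 have B: "msq n (rc u) <= (LINT x|circle. (u x)^2) / (2 * pi)" for n using bessel[OF u, of n] by (simp add: field_simps)
 obtain w where w: "w \<in> L2T" "!!k. rc w k = rc u k"
  "(%n. L2T_norm (%x. w x - psum (rc u) n x)) ----> 0" using riesz_fischer[of "rc u", OF rc_neg B] by metis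
 have "AE x in circle. w x = u x" by (rule rc_unique[OF w(1) u w(2)])
 then have "L2T_norm (%x. w x - psum (rc u) n x) = L2T_norm (%x. u x - psum (rc u) n x)" for n
  by (intro L2T_norm_cong_AE) (use w u psum_L2T in \<open>auto intro!: L2T_diff elim!: eventually_mono\<close>)
 then show ?thesis using w(3) by simp
qed

lemma parseval:
 assumes u: "u \<in> L2T"
 shows "(%n. \<Sum>k\<in>symF n. (norm (rc u k))^2) ----> P0 (%x. (u x)^2)"
proof -
 have "(%n. (L2T_norm (%x. u x - psum (rc u) n x))^2) ----> 0^2" by (intro tendsto_power L2T_psum_tendsto u)
 then have "(%n. (LINT x|circle. (u x)^2) - 2 * pi * msq n (rc u)) ----> 0"
  unfolding L2T_norm_sq L2T_sub_psum[OF u] by simp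
 then have "(%n. ((LINT x|circle. (u x)^2) - ((LINT x|circle. (u x)^2) - 2 * pi * msq n (rc u))) / (2 * pi))
   ----> ((LINT x|circle. (u x)^2) - 0) / (2 * pi)" by (intro tendsto_intros) auto
 then show ?thesis by (simp add: P0_def)
qed

section \<open>Fourier modes of test functions\<close>

lemma integral_circle_HK:
 fixes f :: "real => 'a::euclidean_space"
 assumes c: "continuous_on UNIV f"
 shows "(LINT x|circle. f x) = integral {0..2 * pi} f"
proof -
 have "(LINT x|circle. f x) = (LINT x:{0..2 * pi}|lborel. f x)" unfolding integral_circle_eq set_lebesgue_integral_def
 proof (rule integral_cong_AE)
  have "AE x in lborel. x ~= 2 * pi" by (rule AE_lborel_singleton)
  then show "AE x in lborel. indicat_real {0..<2 * pi} x *\<^sub>R f x = indicat_real {0..2 * pi} x *\<^sub>R f x"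
   by eventually_elim (auto simp: indicator_def)
 qed (use continuous_imp_borel[OF c] in measurable)
 also have "... = integral {0..2 * pi} f"
  by (intro set_borel_integral_eq_integral(2) borel_integrable_atLeastAtMost' continuous_on_subset[OF c]) auto
 finally show ?thesis .
qed

abbreviation rem :: "(real => real) => nat => real" where
 "rem g n \<equiv> L2T_norm (%x. g x - psum (rc g) n x)"

text \<open>The pairing is bilinear, without a conjugate, which is why k meets -k. It is stated for
  symmetric partial sums because this is the form in which all series below are handled.\<close>

lemma pair_modes:
 assumes u: "u \<in> L2T" and f: "(%x. Re (f x)) \<in> L2T" "(%x. Im (f x)) \<in> L2T"
 shows "(%n. 2 * pi * (\<Sum>k\<in>symF n. rc u k * fc f (-k))) ----> (LINT x|circle. of_real (u x) * f x)"
proof -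
 let ?a = "%x. Re (f x)" and ?b = "%x. Im (f x)"
 have real: "(%n. 2 * pi * (\<Sum>k\<in>symF n. rc u k * rc g (-k))) ----> of_real (LINT x|circle. u x * g x)"
  if g: "g \<in> L2T" for g proof -
  have eq: "2 * pi * (\<Sum>k\<in>symF n. rc u k * rc g (-k)) = of_real (LINT x|circle. u x * psum (rc g) n x)" for n
  proof -
   have "complex_of_real (LINT x|circle. u x * psum (rc g) n x) = (LINT x|circle. of_real (u x) * trig (rc g) (symF n) x)"
    unfolding integral_complex_of_real[symmetric] of_real_mult psum_def trig_real[of "rc g", OF rc_neg] ..
   also have "... = 2 * pi * (\<Sum>k\<in>symF n. rc g k * rc u (-k))"
    unfolding rc_def[of u "- _"] by (rule integral_mult_trig[OF L2T_integrable_c[OF u]]) simp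
   also have "(\<Sum>k\<in>symF n. rc g k * rc u (-k)) = (\<Sum>k\<in>symF n. rc u k * rc g (-k))"
    by (rule sum.reindex_bij_witness[of _ uminus uminus]) auto
   finally show ?thesis ..
  qed
  have "(%n. LINT x|circle. u x * psum (rc g) n x) ----> (LINT x|circle. u x * g x)"
  proof (rule LIM_zero_cancel, rule Lim_null_comparison)
   show "eventually (%n. norm ((LINT x|circle. u x * psum (rc g) n x) - (LINT x|circle. u x * g x))
     <= L2T_norm u * rem g n) sequentially" proof (intro always_eventually allI)
    fix n
    have "(LINT x|circle. u x * psum (rc g) n x) - (LINT x|circle. u x * g x) = (LINT x|circle. u x * psum (rc g) n x - u x * g x)"
     by (rule Bochner_Integration.integral_diff[symmetric]) (intro L2T_prod u g psum_L2T)+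
    also have "... = (LINT x|circle. u x * (psum (rc g) n x - g x))" by (simp add: right_diff_distrib)
    also have "norm ... <= L2T_norm u * L2T_norm (%x. psum (rc g) n x - g x)"
     unfolding real_norm_def by (intro L2T_Cauchy_Schwarz u L2T_diff psum_L2T g)
    finally show "norm ((LINT x|circle. u x * psum (rc g) n x) - (LINT x|circle. u x * g x))
     <= L2T_norm u * rem g n" by (simp only: L2T_norm_minus_commute[of "psum (rc g) n" g])
   qed
   show "(%n. L2T_norm u * rem g n) ----> 0" using tendsto_mult_left[OF L2T_psum_tendsto[OF g], of "L2T_norm u"] by simp
  qed
  then show ?thesis unfolding eq by (intro tendsto_of_real)
 qed
 have fcf: "fc f k = rc ?a k + \<i> * rc ?b k" for k proof -
  have "f x = 1 * of_real (?a x) + \<i> * of_real (?b x)" for x by (simp add: complex_eq)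
  then have "fc f k = fc (%x. 1 * of_real (?a x) + \<i> * of_real (?b x)) k" by presburger
  also have "... = 1 * rc ?a k + \<i> * rc ?b k" unfolding rc_def by (intro fc_lin L2T_integrable_c f)
  finally show ?thesis by simp
 qed
 have "(LINT x|circle. of_real (u x) * f x) = (LINT x|circle. of_real (u x * ?a x) + \<i> * of_real (u x * ?b x))"
  by (intro Bochner_Integration.integral_cong refl) (simp add: complex_eq_iff)
 also have "... = (LINT x|circle. of_real (u x * ?a x)) + (LINT x|circle. \<i> * of_real (u x * ?b x))"
  by (intro Bochner_Integration.integral_add integrable_mult_right integrable_of_real L2T_prod u f)
 also have "... = of_real (LINT x|circle. u x * ?a x) + \<i> * of_real (LINT x|circle. u x * ?b x)"
  by (simp only: integral_complex_of_real Bochner_Integration.integral_mult_right_zero)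
 finally have I: "(LINT x|circle. of_real (u x) * f x) = of_real (LINT x|circle. u x * ?a x) + \<i> * of_real (LINT x|circle. u x * ?b x)" .
 have S: "2 * pi * (\<Sum>k\<in>symF n. rc u k * fc f (-k))
   = 2 * pi * (\<Sum>k\<in>symF n. rc u k * rc ?a (-k)) + \<i> * (2 * pi * (\<Sum>k\<in>symF n. rc u k * rc ?b (-k)))" for n
  unfolding fcf by (simp add: distrib_left sum.distrib sum_distrib_left mult_ac)
 show ?thesis unfolding I S by (intro tendsto_intros real f)
qed

lemma pair_modes_continuous:
 assumes u: "u \<in> L2T" and f: "periodic f" "continuous_on UNIV f"
 shows "(%n. 2 * pi * (\<Sum>k\<in>symF n. rc u k * fc f (-k))) ----> (LINT x|circle. of_real (u x) * f x)"
 by (rule pair_modes[OF u]; rule L2T_continuous)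
  (use f in \<open>auto simp: periodic_def intro!: continuous_intros\<close>)

section \<open>Spatial modes of test functions as functions of time\<close>

definition md :: "(real \<times> real => complex) => int => real => complex" where
 "md phi k t = fc (%y. phi (t, y)) k"

lemma cont_slice: "continuous_on UNIV phi ==> continuous_on UNIV (%y. phi (t, y))"
 for phi :: "real \<times> real => complex"
 by (rule continuous_on_compose2[of UNIV phi]) (auto intro!: continuous_intros)

lemma circle_leibniz:
 fixes phi phi' :: "real \<times> real => 'a::euclidean_space"
 assumes d: "!!s y. ((%s. phi (s, y)) has_vector_derivative phi' (s, y)) (at s)"
  and c: "continuous_on UNIV phi" "continuous_on UNIV phi'"
 shows "((%s. LINT y|circle. phi (s, y)) has_vector_derivative (LINT y|circle. phi' (t, y))) (at t)"
proof -
 have sl: "continuous_on S (%y. f (s, y))" if "continuous_on UNIV f" for S s and f :: "real \<times> real => 'a"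
  by (intro continuous_on_compose2[OF that] continuous_intros) auto
 have "((%s. integral (cbox 0 (2 * pi)) (%y. phi (s, y))) has_vector_derivative integral (cbox 0 (2 * pi)) (%y. phi' (t, y))) (at t within UNIV)"
  by (rule leibniz_rule_vector_derivative[where fx = "%s y. phi' (s, y)"])
   (use d in \<open>auto intro!: integrable_continuous_real sl c continuous_on_subset[OF c(2)]\<close>)
 then show ?thesis by (simp add: integral_circle_HK[OF sl] c)
qed

lemma md_continuous:
 assumes c: "continuous_on UNIV phi"
 shows "continuous_on UNIV (md phi k)"
proof -
 have eq: "md phi k = (%t. integral (cbox 0 (2 * pi)) (%y. phi (t, y) * cis (- of_int k * y)) / (2 * pi))"
  unfolding md_def fc_eq by (rule ext, subst integral_circle_HK) (auto intro!: continuous_intros cont_slice c)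
 show ?thesis unfolding eq by (intro continuous_intros integral_continuous_on_param)
   (auto simp: case_prod_unfold intro!: continuous_intros continuous_on_subset[OF c])
qed

lemma norm_md_le:
 assumes c: "continuous_on UNIV phi" and B: "!!x. norm (phi (t, x)) <= B"
 shows "norm (md phi k t) <= B"
proof -
 have i: "integrable circle (%y. phi (t, y))" by (intro integrable_circle_continuous cont_slice c)
 have "(LINT y|circle. norm (phi (t, y))) <= (LINT y|circle. B)"
  by (rule Bochner_Integration.integral_mono) (use i B in auto)
 also have "... = 2 * pi * B" by (simp add: measure_circle)
 finally have "(LINT y|circle. norm (phi (t, y))) / (2 * pi) <= B" by (simp add: field_simps)
 then show ?thesis unfolding md_def using norm_fc_le[OF i, of k] by linarith
qed

lemma smooth_RT_diff: "smooth_RT phi ==> (dt ^^ i) ((dx ^^ j) phi) differentiable (at p)" by (simp only: smooth_RT_def)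

lemma smooth_RT_dxj_diff: "smooth_RT phi ==> (dx ^^ j) phi differentiable (at p)"
 using smooth_RT_diff[of phi 0 j p] by simp

lemma smooth_RT_dt_dxj_diff: "smooth_RT phi ==> dt ((dx ^^ j) phi) differentiable (at p)"
 using smooth_RT_diff[of phi 1 j p] by simp

lemma diff_continuous: "(!!p. phi differentiable (at p)) ==> continuous_on UNIV phi"
 by (meson continuous_at_imp_continuous_on differentiable_imp_continuous_within)

lemma has_dx:
 assumes "phi differentiable (at (t, x))"
 shows "((%y. phi (t, y)) has_vector_derivative dx phi (t, x)) (at x)"
proof -
 have "(%y. phi (t, y)) differentiable (at x)" using differentiable_chain_at[of "%y. (t, y)" x phi] assms
  by (auto simp: o_def intro!: derivative_intros)
 then show ?thesis unfolding dx_def by (simp add: vector_derivative_works)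
qed

lemma has_dt:
 assumes "phi differentiable (at (t, x))"
 shows "((%s. phi (s, x)) has_vector_derivative dt phi (t, x)) (at t)"
proof -
 have "(%s. phi (s, x)) differentiable (at t)" using differentiable_chain_at[of "%s. (s, x)" t phi] assms
  by (auto simp: o_def intro!: derivative_intros)
 then show ?thesis unfolding dt_def by (simp add: vector_derivative_works)
qed

lemma vector_derivative_shift:
 fixes f :: "real => 'a::real_normed_vector"
 assumes "!!x. f (x + p) = f x"
 shows "vector_derivative f (at (x + p)) = vector_derivative f (at x)"
proof -
 have "(f has_vector_derivative D) (at (x + p)) \<longleftrightarrow> (f has_vector_derivative D) (at x)" for D proof -
  have "(f has_vector_derivative D) (at (x + p)) \<longleftrightarrow> (f \<circ> (%x. x + p) has_vector_derivative D) (at x)"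
  proof
   assume "(f has_vector_derivative D) (at (x + p))"
   then have "(f \<circ> (%x. x + p) has_vector_derivative 1 *\<^sub>R D) (at x)"
    by (intro vector_diff_chain_at) (auto intro!: derivative_eq_intros simp: has_vector_derivative_def)
   then show "(f \<circ> (%x. x + p) has_vector_derivative D) (at x)" by simp
  next
   assume "(f \<circ> (%x. x + p) has_vector_derivative D) (at x)"
   then have "(f \<circ> (%x. x + p) has_vector_derivative D) (at (x + p - p))" by simp
   then have "(f \<circ> (%x. x + p) \<circ> (%x. x - p) has_vector_derivative 1 *\<^sub>R D) (at (x + p))"
    by (intro vector_diff_chain_at) (auto intro!: derivative_eq_intros simp: has_vector_derivative_def)
   then show "(f has_vector_derivative D) (at (x + p))" by (simp add: o_def)
  qed
  then show ?thesis using assms by (simp add: o_def)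
 qed
 then show ?thesis unfolding vector_derivative_def by simp
qed

lemma periodic_dx: "periodic (%x. phi (t, x)) ==> periodic (%x. dx phi (t, x))"
 unfolding periodic_def dx_def by (simp add: vector_derivative_shift)

lemma periodic_dt: "(!!t. periodic (%x. phi (t, x))) ==> periodic (%x. dt phi (t, x))"
 unfolding periodic_def dt_def by simp

lemma smooth_RT_periodic: "smooth_RT phi ==> periodic (%x. (dx ^^ j) phi (t, x))"
 by (induction j) (auto simp: smooth_RT_def intro: periodic_dx)

lemma integral_circle_by_parts:
 fixes f g f' g' :: "real => complex"
 assumes "!!x. (f has_vector_derivative f' x) (at x)" "!!x. (g has_vector_derivative g' x) (at x)"
  and c: "continuous_on UNIV f'" "continuous_on UNIV g'" and p: "periodic f" "periodic g"
 shows "(LINT x|circle. f x * g' x) = - (LINT x|circle. f' x * g x)"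
proof -
 have fc: "continuous_on UNIV f" "continuous_on UNIV g" using assms(1,2)[THEN vector_derivative_continuous_on] by blast+
 have "(LINT x|circle. f x * g' x + f' x * g x) = f (2 * pi) * g (2 * pi) - f 0 * g 0"
  by (rule integral_circle_FTC[of "%x. f x * g x"]) (auto intro!: has_vector_derivative_mult assms continuous_intros fc)
 also have "... = 0" using p[unfolded periodic_def, rule_format, of 0] by simp
 finally have "(LINT x|circle. f x * g' x + f' x * g x) = 0" .
 moreover have "(LINT x|circle. f x * g' x + f' x * g x) = (LINT x|circle. f x * g' x) + (LINT x|circle. f' x * g x)"
  by (intro Bochner_Integration.integral_add integrable_circle_continuous continuous_intros fc c)
 ultimately show ?thesis by (simp add: add_eq_0_iff)
qed

lemma fc_deriv:
 assumes f: "!!x. (f has_vector_derivative f' x) (at x)" "continuous_on UNIV f'" "periodic f"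
 shows "fc f' k = \<i> * of_int k * fc f k"
proof -
 have "(LINT x|circle. cis (- of_int k * x) * f' x) = - (LINT x|circle. (\<i> * of_real (- of_int k) * cis (- of_int k * x)) * f x)"
 proof (rule integral_circle_by_parts)
  show "((%x. cis (- of_int k * x)) has_vector_derivative \<i> * of_real (- of_int k) * cis (- of_int k * x)) (at x)" for x
   by (rule has_vector_derivative_cis)
  show "periodic (%x. cis (- of_int k * x))" using periodic_cis[of "-k"] by simp
  show "continuous_on UNIV (%x. \<i> * of_real (- of_int k) * cis (- of_int k * x))" by (intro continuous_intros)
 qed (use f in auto)
 also have "... = - (LINT x|circle. (- \<i> * of_int k) * (f x * cis (- of_int k * x)))" by (simp add: mult_ac)
 also have "... = \<i> * of_int k * (LINT x|circle. f x * cis (- of_int k * x))"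
  by (simp only: Bochner_Integration.integral_mult_right_zero) simp
 finally show ?thesis by (simp add: fc_eq mult.commute)
qed

lemma md_dx:
 assumes s: "smooth_RT phi"
 shows "md ((dx ^^ j) phi) k t = (\<i> * of_int k) ^ j * md phi k t"
proof (induction j)
 case (Suc j)
 have "md ((dx ^^ Suc j) phi) k t = fc (%x. dx ((dx ^^ j) phi) (t, x)) k" by (simp add: md_def)
 also have "... = \<i> * of_int k * fc (%x. (dx ^^ j) phi (t, x)) k" proof (rule fc_deriv)
  show "((%x. (dx ^^ j) phi (t, x)) has_vector_derivative dx ((dx ^^ j) phi) (t, x)) (at x)" for x
   by (rule has_dx[OF smooth_RT_dxj_diff[OF s]])
  show "continuous_on UNIV (%x. dx ((dx ^^ j) phi) (t, x))"
   using smooth_RT_dxj_diff[OF s, of "Suc j"] by (intro cont_slice diff_continuous) simp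
  show "periodic (%x. (dx ^^ j) phi (t, x))" by (rule smooth_RT_periodic[OF s])
 qed
 finally show ?case using Suc by (simp add: md_def)
qed simp

lemma md_dt:
 assumes d: "!!p. phi differentiable (at p)" and c: "continuous_on UNIV (dt phi)"
 shows "(md phi k has_vector_derivative md (dt phi) k t) (at t)"
proof -
 have e: "continuous_on UNIV (%(t, y). f (t, y) * cis (- of_int k * y))" if "continuous_on UNIV f" for f :: "real \<times> real => complex"
  unfolding case_prod_unfold by (simp, intro continuous_intros that)
 have "((%s. LINT y|circle. phi (s, y) * cis (- of_int k * y)) has_vector_derivative
   (LINT y|circle. dt phi (t, y) * cis (- of_int k * y))) (at t)"
  using circle_leibniz[OF _ e[OF diff_continuous[OF d]] e[OF c], of t]
   has_vector_derivative_mult_left[OF has_dt[OF d]] by simp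
 then show ?thesis unfolding md_def fc_eq by (rule has_vector_derivative_divide)
qed

lemma smooth_RT_md_dt:
 assumes s: "smooth_RT phi"
 shows "(md ((dx ^^ j) phi) k has_vector_derivative md (dt ((dx ^^ j) phi)) k t) (at t)"
 by (rule md_dt[OF smooth_RT_dxj_diff[OF s] diff_continuous[OF smooth_RT_dt_dxj_diff[OF s]]])

text \<open>The identity \<open>md_dx\<close> is differentiated in time and derivatives are
  compared, which avoids commuting \<open>dt\<close> with \<open>dx\<close>.\<close>

lemma md_dt_dx:
 assumes s: "smooth_RT phi"
 shows "md (dt ((dx ^^ j) phi)) k t = (\<i> * of_int k) ^ j * md (dt phi) k t"
proof -
 have 1: "(md ((dx ^^ j) phi) k has_vector_derivative md (dt ((dx ^^ j) phi)) k t) (at t)"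
  by (rule smooth_RT_md_dt[OF s])
 have "((%t. (\<i> * of_int k) ^ j * md phi k t) has_vector_derivative (\<i> * of_int k) ^ j * md (dt phi) k t) (at t)"
  using smooth_RT_md_dt[OF s, of 0] by (intro has_vector_derivative_mult_right) simp
 have 2: "(md ((dx ^^ j) phi) k has_vector_derivative (\<i> * of_int k) ^ j * md (dt phi) k t) (at t)" proof -
  have "md ((dx ^^ j) phi) k = (%t. (\<i> * of_int k) ^ j * md phi k t)" by (rule ext, rule md_dx[OF s])
  then show ?thesis using \<open>((%t. (\<i> * of_int k) ^ j * md phi k t) has_vector_derivative (\<i> * of_int k) ^ j * md (dt phi) k t) (at t)\<close>
   by (simp only:)
 qed
 show ?thesis using vector_derivative_unique_at[OF 1 2] .
qed

lemma periodic_bounded: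
 fixes phi :: "real \<times> real => complex"
 assumes c: "continuous_on UNIV phi" and p: "!!t. periodic (%x. phi (t, x))"
 shows "\<exists>B\<ge>0. \<forall>t\<in>{-r..r}. \<forall>x. norm (phi (t, x)) <= B"
proof -
 have "bounded (phi ` ({-r..r} \<times> {0..2*pi}))"
  by (intro compact_imp_bounded compact_continuous_image continuous_on_subset[OF c] compact_Times) auto
 then obtain B where B: "\<forall>y\<in>phi ` ({-r..r} \<times> {0..2*pi}). norm y <= B" unfolding bounded_iff by blast
 have "norm (phi (t, x)) <= max B 0" if t: "t \<in> {-r..r}" for t x proof -
  obtain y k where y: "y \<in> {0..<2*pi}" "x = y + 2 * pi * of_int k" using circle_rep by blast
  have "phi (t, x) = phi (t, y)" unfolding y(2) by (rule periodic_int[OF p])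
  then show ?thesis using B t y(1) by (auto simp: le_max_iff_disj)
 qed
 then show ?thesis by (intro exI[of _ "max B 0"]) auto
qed

lemma test_md_decay:
 assumes s: "smooth_RT phi"
 shows "\<exists>C\<ge>0. \<forall>t\<in>{-r..r}. \<forall>k. mag k ^ j * norm (md phi k t) <= C \<and> mag k ^ j * norm (md (dt phi) k t) <= C"
proof -
 have c1: "continuous_on UNIV ((dx ^^ j) phi)" by (rule diff_continuous[OF smooth_RT_dxj_diff[OF s]])
 have c2: "continuous_on UNIV (dt ((dx ^^ j) phi))" by (rule diff_continuous[OF smooth_RT_dt_dxj_diff[OF s]])
 have p1: "periodic (%x. (dx ^^ j) phi (t, x))" for t by (rule smooth_RT_periodic[OF s])
 have p2: "periodic (%x. dt ((dx ^^ j) phi) (t, x))" for t by (rule periodic_dt[OF p1])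
 obtain B1 where B1: "B1 >= 0" "!!t x. t \<in> {-r..r} ==> norm ((dx ^^ j) phi (t, x)) <= B1"
  using periodic_bounded[OF c1 p1] by blast
 obtain B2 where B2: "B2 >= 0" "!!t x. t \<in> {-r..r} ==> norm (dt ((dx ^^ j) phi) (t, x)) <= B2"
  using periodic_bounded[OF c2 p2] by blast
 show ?thesis proof (intro exI[of _ "max B1 B2"] conjI ballI allI)
  show "0 <= max B1 B2" using B1 by simp
  fix t k assume t: "t \<in> {-r..r}"
  have "norm (md ((dx ^^ j) phi) k t) <= B1" by (rule norm_md_le[OF c1]) (use B1 t in auto)
  then show "mag k ^ j * norm (md phi k t) <= max B1 B2" unfolding md_dx[OF s] by (simp add: norm_mult norm_power)
  have "norm (md (dt ((dx ^^ j) phi)) k t) <= B2" by (rule norm_md_le[OF c2]) (use B2 t in auto)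
  then show "mag k ^ j * norm (md (dt phi) k t) <= max B1 B2"
   unfolding md_dt_dx[OF s] by (simp add: norm_mult norm_power)
 qed
qed

section \<open>Pairings with space-time functions\<close>

lemma sum_inv_sq_tail: "X >= 1 ==> X <= Y ==> (\<Sum>m\<in>{Suc X..Y}. 1 / (real m)^2) <= 1 / real X - 1 / real Y"
proof (induction Y)
 case (Suc Y)
 show ?case proof (cases "X <= Y")
  case True
  have Y: "Y >= 1" using True Suc.prems by simp
  have "(\<Sum>m\<in>{Suc X..Suc Y}. 1 / (real m)^2) = (\<Sum>m\<in>{Suc X..Y}. 1 / (real m)^2) + 1 / (real (Suc Y))^2"
   using True by simp
  also have "... <= 1 / real X - 1 / real Y + 1 / (real (Suc Y))^2" using Suc.IH[OF Suc.prems(1) True] by simp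
  also have "1 / (real (Suc Y))^2 <= 1 / (real Y * real (Suc Y))"
   using Y by (intro divide_left_mono) (auto simp: power2_eq_square)
  also have "1 / (real Y * real (Suc Y)) = 1 / real Y - 1 / real (Suc Y)" using Y by (simp add: field_simps)
  finally show ?thesis by simp
 next
  case False
  then have "X = Suc Y" using Suc.prems by simp
  then show ?thesis by simp
 qed
qed simp

lemma sym_tail_le:
 assumes X: "X >= 1" "X <= Y" and f: "!!k. k ~= 0 ==> norm (f k) <= B / (real_of_int k)^2"
 shows "norm ((\<Sum>k\<in>symF Y. f k) - (\<Sum>k\<in>symF X. f k :: complex)) <= 2 * B / real X"
proof -
 have B: "B >= 0" using order_trans[OF norm_ge_zero f[of 1]] by simp
 have eq: "symF Y - symF X = int ` {Suc X..Y} \<union> (%m. - int m) ` {Suc X..Y}" proof (intro set_eqI iffI)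
  fix k assume "k \<in> symF Y - symF X"
  then show "k \<in> int ` {Suc X..Y} \<union> (%m. - int m) ` {Suc X..Y}" by (cases k rule: int_cases2) auto
 qed auto
 have "(\<Sum>k\<in>symF Y. f k) - (\<Sum>k\<in>symF X. f k) = (\<Sum>k\<in>symF Y - symF X. f k)"
  by (rule sum_diff[symmetric]) (use symF_mono X in auto)
 also have "norm ... <= (\<Sum>k\<in>symF Y - symF X. B / (real_of_int k)^2)" by (rule sum_norm_le) (use X f in force)
 also have "... <= (\<Sum>k\<in>int ` {Suc X..Y}. B / (real_of_int k)^2) + (\<Sum>k\<in>(%m. - int m) ` {Suc X..Y}. B / (real_of_int k)^2)"
  unfolding eq using B by (subst sum.union_inter[symmetric]) (auto intro!: sum_nonneg)
 also have "... = 2 * B * (\<Sum>m\<in>{Suc X..Y}. 1 / (real m)^2)"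
  by (subst (1 2) sum.reindex) (auto simp: inj_on_def sum_distrib_left)
 also have "... <= 2 * B * (1 / real X - 1 / real Y)" using B by (intro mult_left_mono sum_inv_sq_tail X) auto
 also have "... <= 2 * B * (1 / real X)" using B by (intro mult_left_mono) auto
 finally show ?thesis by simp
qed

text \<open>Tannery's theorem for symmetric partial sums. The values G n and L of the series are
  hypotheses, because they are known from elsewhere as pairings. The index 0 needs no domination: it
  lies in every partial sum that is split off.\<close>

lemma sym_tannery:
 assumes g: "!!n k. k ~= 0 ==> norm (g n k) <= B / (real_of_int k)^2"
  and l: "!!k. (%n. g n k) ----> l k"
  and G: "!!n. (%X. \<Sum>k\<in>symF X. g n k :: complex) ----> G n" and L: "(%X. \<Sum>k\<in>symF X. l k) ----> L"
 shows "G ----> L"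
proof (rule LIMSEQ_I)
 fix e :: real assume e: "e > 0"
 have B: "B >= 0" using order_trans[OF norm_ge_zero g[of 1 0]] by simp
 obtain X :: nat where X: "X >= 1" "2 * B / real X < e / 4" proof -
  obtain X :: nat where "8 * B / e < real X" using reals_Archimedean2 by blast
  then have "8 * B / e < real (max X 1)" by (simp add: less_max_iff_disj)
  then have "2 * B / real (max X 1) < e / 4" using e by (simp add: field_simps)
  then show ?thesis using that[of "max X 1"] by auto
 qed
 have lb: "norm (l k) <= B / (real_of_int k)^2" if "k ~= 0" for k
  using tendsto_norm[OF l[of k]] g[OF that] by (intro LIMSEQ_le_const2) auto
 have tG: "norm (G n - (\<Sum>k\<in>symF X. g n k)) <= e / 4" for n proof -
  have "(%Y. norm ((\<Sum>k\<in>symF Y. g n k) - (\<Sum>k\<in>symF X. g n k))) ----> norm (G n - (\<Sum>k\<in>symF X. g n k))"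
   by (intro tendsto_intros G)
  moreover have "norm ((\<Sum>k\<in>symF Y. g n k) - (\<Sum>k\<in>symF X. g n k)) <= e / 4" if "Y >= X" for Y
   using sym_tail_le[OF X(1) that g[where n = n]] X(2) by fastforce
  ultimately show ?thesis by (intro LIMSEQ_le_const2) auto
 qed
 have tL: "norm (L - (\<Sum>k\<in>symF X. l k)) <= e / 4" proof -
  have "(%Y. norm ((\<Sum>k\<in>symF Y. l k) - (\<Sum>k\<in>symF X. l k))) ----> norm (L - (\<Sum>k\<in>symF X. l k))"
   by (intro tendsto_intros L)
  moreover have "norm ((\<Sum>k\<in>symF Y. l k) - (\<Sum>k\<in>symF X. l k)) <= e / 4" if "Y >= X" for Y
   using sym_tail_le[OF X(1) that lb] X(2) by fastforce
  ultimately show ?thesis by (intro LIMSEQ_le_const2) auto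
 qed
 have "(%n. \<Sum>k\<in>symF X. g n k) ----> (\<Sum>k\<in>symF X. l k)" by (intro tendsto_intros l)
 from LIMSEQ_D[OF this, of "e/4"] e obtain N where
  N: "!!n. n >= N ==> norm ((\<Sum>k\<in>symF X. g n k) - (\<Sum>k\<in>symF X. l k)) < e / 4" by auto
 have "norm (G n - L) < e" if "n >= N" for n proof -
  have "G n - L = (G n - (\<Sum>k\<in>symF X. g n k)) + ((\<Sum>k\<in>symF X. g n k) - (\<Sum>k\<in>symF X. l k)) + - (L - (\<Sum>k\<in>symF X. l k))"
   by simp
  then have "norm (G n - L) <= norm (G n - (\<Sum>k\<in>symF X. g n k)) + norm ((\<Sum>k\<in>symF X. g n k) - (\<Sum>k\<in>symF X. l k)) + norm (- (L - (\<Sum>k\<in>symF X. l k)))"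
   by (metis (no_types) norm_triangle_ineq norm_triangle_mono order_refl)
  then show ?thesis using tG[of n] tL N[OF that] e unfolding norm_minus_cancel by linarith
 qed
 then show "\<exists>no. \<forall>n\<ge>no. norm (G n - L) < e" by blast
qed

text \<open>The three terms with |k| <= 1 contribute 3 B, and the tail beyond them contributes 2
  B.\<close>

lemma sym_bound:
 assumes f: "!!k. k ~= 0 ==> norm (f k) <= B / (real_of_int k)^2" and f0: "norm (f 0) <= B"
 shows "norm (\<Sum>k\<in>symF X. f k :: complex) <= 5 * B"
proof (cases "X = 0")
 case True
 have "symF 0 = {0}" by (auto simp: symF_def)
 then show ?thesis using f0 order_trans[OF norm_ge_zero f0] True by simp
next
 case False
 have s1: "symF 1 = {-1, 0, 1}" by (auto simp: symF_def)
 have "norm ((\<Sum>k\<in>symF X. f k) - (\<Sum>k\<in>symF 1. f k)) <= 2 * B / real 1"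
  by (rule sym_tail_le) (use False f in auto)
 moreover have "norm (\<Sum>k\<in>symF 1. f k) <= B + B + B" proof -
  have "(\<Sum>k\<in>symF 1. f k) = f (-1) + f 0 + f 1" unfolding s1 by simp
  also have "norm ... <= norm (f (-1)) + norm (f 0) + norm (f 1)"
   using norm_triangle_ineq[of "f (-1) + f 0" "f 1"] norm_triangle_ineq[of "f (-1)" "f 0"] by linarith
  also have "... <= B + B + B" using f[of "-1"] f[of 1] f0 by (intro add_mono) auto
  finally show ?thesis .
 qed
 moreover have "norm (\<Sum>k\<in>symF X. f k) <= norm ((\<Sum>k\<in>symF X. f k) - (\<Sum>k\<in>symF 1. f k)) + norm (\<Sum>k\<in>symF 1. f k)"
  using norm_triangle_ineq[of "(\<Sum>k\<in>symF X. f k) - (\<Sum>k\<in>symF 1. f k)" "\<Sum>k\<in>symF 1. f k"] by simp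
 ultimately show ?thesis by simp
qed

lemma supp_integrable:
 fixes f :: "real => 'a::euclidean_space"
 assumes "continuous_on UNIV f" "!!t. t \<notin> {a..b} ==> f t = 0"
 shows "integrable lborel f" "(LINT t|lborel. f t) = integral {a..b} f"
proof -
 have eq: "indicat_real {a..b} t *\<^sub>R f t = f t" for t using assms(2) by (auto simp: indicator_def)
 have si: "set_integrable lborel {a..b} f"
  by (intro borel_integrable_atLeastAtMost' continuous_on_subset[OF assms(1)]) auto
 then show "integrable lborel f" unfolding set_integrable_def eq .
 show "(LINT t|lborel. f t) = integral {a..b} f"
  using set_borel_integral_eq_integral(2)[OF si] unfolding set_lebesgue_integral_def eq .
qed

text \<open>The inner integral is, at each time, the limit of finite sums of continuous functions of
  time. This makes it measurable although u need not be jointly measurable, and the decay of the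
  modes of phi gives the domination for the outer integral.\<close>

lemma distr_of_real_modes:
 assumes u: "!!t. u t \<in> L2T" and uc: "!!k. continuous_on UNIV (%t. rc (u t) k)" and R: "!!t k. norm (rc (u t) k) <= R"
  and phi: "continuous_on UNIV phi" "!!t. periodic (%x. phi (t, x))" "supp_within phi (-r) r"
  and C: "!!t k. t \<in> {-r..r} ==> k ~= 0 ==> norm (md phi k t) <= C / (real_of_int k)^2" and C0: "!!t. t \<in> {-r..r} ==> norm (md phi 0 t) <= C"
 shows "(%X. 2 * pi * (\<Sum>k\<in>symF X. LINT t|lborel. rc (u t) k * md phi (-k) t)) ----> distr_of_real u phi"
  and "integrable lborel (%t. LINT x|circle. of_real (u t x) * phi (t, x))"
proof -
 let ?S = "%X t. 2 * pi * (\<Sum>k\<in>symF X. rc (u t) k * md phi (-k) t)"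
 let ?I = "%t. LINT x|circle. of_real (u t x) * phi (t, x)"
 let ?w = "%t. 2 * pi * (5 * (R * C)) * indicat_real {-r..r} t"
 have R0: "R >= 0" using order_trans[OF norm_ge_zero R[of 0 0]] .
 have md0: "md phi k t = 0" if "t \<notin> {-r..r}" for k t proof -
  have "phi (t, x) = 0" for x using phi(3) that unfolding supp_within_def by blast
  then show ?thesis by (simp add: md_def fc_eq)
 qed
 have lim: "(%X. ?S X t) ----> ?I t" for t
  unfolding md_def by (rule pair_modes_continuous[OF u phi(2) cont_slice[OF phi(1)]])
 have mc: "continuous_on UNIV (%t. rc (u t) k * md phi (-k) t)" for k
  by (intro continuous_intros uc md_continuous phi(1))
 have mS: "?S X \<in> borel_measurable lborel" for X using continuous_imp_borel[OF mc] by simp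
 have bound: "norm (?S X t) <= ?w t" for X t proof (cases "t \<in> {-r..r}")
  case True
  have C00: "C >= 0" using order_trans[OF norm_ge_zero C0[OF True]] .
  have "norm (\<Sum>k\<in>symF X. rc (u t) k * md phi (-k) t) <= 5 * (R * C)" proof (rule sym_bound)
   fix k :: int assume "k ~= 0"
   then have "norm (rc (u t) k) * norm (md phi (-k) t) <= R * (C / (real_of_int (-k))^2)"
    using C[OF True, of "-k"] R R0 C00 by (intro mult_mono) auto
   then show "norm (rc (u t) k * md phi (-k) t) <= (R * C) / (real_of_int k)^2" by (simp add: norm_mult)
  next
   show "norm (rc (u t) 0 * md phi (-0) t) <= R * C"
    unfolding norm_mult using R C0[OF True] R0 by (intro mult_mono) auto
  qed
  then have "2 * pi * norm (\<Sum>k\<in>symF X. rc (u t) k * md phi (-k) t) <= 2 * pi * (5 * (R * C))"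
   by (intro mult_left_mono) auto
  then show ?thesis using True by (simp add: norm_mult)
 next
  case False
  then show ?thesis by (simp add: md0)
 qed
 have iw: "integrable lborel ?w" proof -
  have "integrable lborel (indicat_real {-r..r})" by (intro integrable_real_indicator) (auto simp: emeasure_lborel_Icc_eq)
  then show ?thesis by (rule integrable_mult_right)
 qed
 have mI: "?I \<in> borel_measurable lborel" by (rule borel_measurable_LIMSEQ_metric[OF mS]) (use lim in auto)
 show "integrable lborel ?I"
  by (rule integrable_dominated_convergence[where w = ?w and s = ?S]) (use mI mS iw lim bound in auto)
 have "(%X. LINT t|lborel. ?S X t) ----> (LINT t|lborel. ?I t)"
  by (rule integral_dominated_convergence[where w = ?w]) (use mI mS iw lim bound in auto)
 moreover have "(LINT t|lborel. ?S X t) = 2 * pi * (\<Sum>k\<in>symF X. LINT t|lborel. rc (u t) k * md phi (-k) t)" for X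
 proof -
  have "integrable lborel (%t. rc (u t) k * md phi (-k) t)" for k
   by (rule supp_integrable(1)[OF mc, of "-r" r]) (simp add: md0)
  then show ?thesis by (simp add: Bochner_Integration.integral_sum)
 qed
 moreover have "distr_of_real u phi = (LINT t|lborel. ?I t)" by (simp add: distr_of_real_def distr_of_def)
 ultimately show "(%X. 2 * pi * (\<Sum>k\<in>symF X. LINT t|lborel. rc (u t) k * md phi (-k) t)) ----> distr_of_real u phi"
  by simp
qed

section \<open>The cubic nonlinearity on trigonometric polynomials\<close>

lemma has_vector_derivative_trig:
 "(trig b F has_vector_derivative trig (%k. \<i> * of_int k * b k) F x) (at x)"
proof -
 have "((%x. \<Sum>k\<in>F. b k * cis (of_int k * x)) has_vector_derivative
   (\<Sum>k\<in>F. b k * (\<i> * of_real (of_int k) * cis (of_int k * x)))) (at x)"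
  by (intro has_vector_derivative_sum has_vector_derivative_mult_right has_vector_derivative_cis)
 moreover have "(\<Sum>k\<in>F. b k * (\<i> * of_real (of_int k) * cis (of_int k * x))) = trig (%k. \<i> * of_int k * b k) F x"
  unfolding trig_def by (intro sum.cong refl) (simp add: mult_ac)
 ultimately show ?thesis unfolding trig_def[of b F, abs_def] by simp
qed

definition cube :: "(int => complex) => nat => int => complex" where
 "cube b K xi = (\<Sum>(k, l)\<in>conv3 (symF K) xi. b k * b l * b (xi - k - l))"

lemma trig_cube: "(trig b (symF K) x) ^ 3 = trig (cube b K) (symF (3 * K)) x"
proof -
 let ?F = "symF K"
 have "trig (cube b K) (symF (3 * K)) x
   = (\<Sum>xi\<in>symF (3 * K). \<Sum>p\<in>conv3 ?F xi. b (fst p) * b (snd p) * b (xi - fst p - snd p) * cis (of_int xi * x))"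
  by (simp add: trig_def cube_def sum_distrib_right case_prod_unfold)
 also have "... = (\<Sum>(xi, p)\<in>Sigma (symF (3 * K)) (conv3 ?F). b (fst p) * b (snd p) * b (xi - fst p - snd p) * cis (of_int xi * x))"
  by (subst sum.Sigma) auto
 also have "... = (\<Sum>(k, l, m)\<in>?F \<times> ?F \<times> ?F. b k * b l * b m * cis (of_int (k + l + m) * x))"
  by (rule sum.reindex_bij_witness[of _ "%(k, l, m). (k + l + m, k, l)" "%(xi, k, l). (k, l, xi - k - l)"])
   (auto simp: conv3_def)
 also have "... = (\<Sum>(k, l, m)\<in>?F \<times> ?F \<times> ?F. (b k * cis (of_int k * x)) * ((b l * cis (of_int l * x)) * (b m * cis (of_int m * x))))"
  by (intro sum.cong refl) (auto simp: cis_mult algebra_simps)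
 also have "... = trig b ?F x * (trig b ?F x * trig b ?F x)"
  unfolding trig_def sum_product sum.cartesian_product by (simp add: sum.cartesian_product case_prod_unfold sum_distrib_left sum_distrib_right)
 finally show ?thesis by (simp add: power3_eq_cube mult.assoc)
qed

lemma P0_trig_sq: "P0 (%y. (trig b (symF K) y)^2) = (\<Sum>k\<in>symF K. b k * b (-k))"
proof -
 have "(LINT y|circle. trig b (symF K) y * trig b (symF K) y) = 2 * pi * (\<Sum>k\<in>symF K. b k * fc (trig b (symF K)) (-k))"
  by (intro integral_mult_trig integrable_trig) auto
 also have "(\<Sum>k\<in>symF K. b k * fc (trig b (symF K)) (-k)) = (\<Sum>k\<in>symF K. b k * b (-k))"
  by (intro sum.cong refl) (simp add: fc_trig)
 finally show ?thesis by (simp add: P0_def power2_eq_square scaleR_conv_of_real)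
qed

text \<open>Inclusion and exclusion over the three resonances $k=\xi$, $l=\xi$, $k+l=0$.\<close>

lemma cube_resonant:
 assumes b: "!!k. \<bar>k\<bar> > int K ==> b k = 0" and xi: "xi ~= 0"
 shows "cube b K xi = (\<Sum>(k, l)\<in>nres (symF K) xi. b k * b l * b (xi - k - l))
   + 3 * (\<Sum>k\<in>symF K. b k * b (-k)) * b xi - 3 * ((b xi)^2 * b (-xi))"
proof (cases "xi \<in> symF K")
 case False
 then have z: "b xi = 0" using b by auto
 have "nres (symF K) xi \<subseteq> conv3 (symF K) xi" by (rule nres_subset)
 then have "cube b K xi = (\<Sum>(k, l)\<in>nres (symF K) xi. b k * b l * b (xi - k - l))" unfolding cube_def
  by (rule sum.mono_neutral_right[OF finite_conv3[OF symF_simps(1)]])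
   (use False in \<open>auto simp: nres_def conv3_def add_eq_0_iff\<close>)
 then show ?thesis using z by simp
next
 case True
 let ?F = "symF K" and ?C = "conv3 (symF K) xi"
 let ?f = "%(k, l). b k * b l * b (xi - k - l)"
 let ?i = "%P. if P then 1 else (0::complex)"
 have neg: "-k \<in> ?F" if "k \<in> ?F" for k using that by simp
 have fC: "finite ?C" by simp
 \<comment> \<open>The lines meet in pairs in the three subtracted points. As xi ~= 0 these are
   distinct and no point lies on all three lines; each contributes b(xi)^2 b(-xi).\<close>
 have pt: "?f p = ?i (p \<in> nres ?F xi) * ?f p + ?i (fst p = xi) * ?f p + ?i (snd p = xi) * ?f p + ?i (fst p + snd p = 0) * ?f p
   - ?i (p = (xi, xi)) * ?f p - ?i (p = (xi, -xi)) * ?f p - ?i (p = (-xi, xi)) * ?f p" if "p \<in> ?C" for p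
  using that xi by (cases p) (auto simp: nres_def)
 have "cube b K xi = (\<Sum>p\<in>?C. ?f p)" by (simp add: cube_def)
 also have "... = (\<Sum>p\<in>?C. ?i (p \<in> nres ?F xi) * ?f p + ?i (fst p = xi) * ?f p + ?i (snd p = xi) * ?f p + ?i (fst p + snd p = 0) * ?f p
   - ?i (p = (xi, xi)) * ?f p - ?i (p = (xi, -xi)) * ?f p - ?i (p = (-xi, xi)) * ?f p)" by (rule sum.cong[OF refl pt])
 also have "... = (\<Sum>p\<in>?C. ?i (p \<in> nres ?F xi) * ?f p) + (\<Sum>p\<in>?C. ?i (fst p = xi) * ?f p) + (\<Sum>p\<in>?C. ?i (snd p = xi) * ?f p)
   + (\<Sum>p\<in>?C. ?i (fst p + snd p = 0) * ?f p) - (\<Sum>p\<in>?C. ?i (p = (xi, xi)) * ?f p)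
   - (\<Sum>p\<in>?C. ?i (p = (xi, -xi)) * ?f p) - (\<Sum>p\<in>?C. ?i (p = (-xi, xi)) * ?f p)"
  by (simp only: sum.distrib sum_subtractf)
 also have "(\<Sum>p\<in>?C. ?i (p \<in> nres ?F xi) * ?f p) = (\<Sum>p\<in>nres ?F xi. ?f p)"
  by (rule sum.mono_neutral_cong_right[OF fC]) (use nres_subset in auto)
 also have "(\<Sum>p\<in>?C. ?i (fst p = xi) * ?f p) = (\<Sum>k\<in>?F. b k * b (-k)) * b xi" proof -
  have "(\<Sum>p\<in>?C. ?i (fst p = xi) * ?f p) = (\<Sum>p\<in>Pair xi ` ?F. ?f p)"
   by (rule sum.mono_neutral_cong_right[OF fC]) (use True neg in \<open>auto simp: conv3_def\<close>)
  also have "... = (\<Sum>l\<in>?F. b xi * b l * b (-l))" by (subst sum.reindex) (auto simp: inj_on_def)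
  also have "... = (\<Sum>k\<in>?F. b k * b (-k)) * b xi"
   unfolding sum_distrib_right by (intro sum.cong refl) (simp only: mult_ac)
  finally show ?thesis .
 qed
 also have "(\<Sum>p\<in>?C. ?i (snd p = xi) * ?f p) = (\<Sum>k\<in>?F. b k * b (-k)) * b xi" proof -
  have "(\<Sum>p\<in>?C. ?i (snd p = xi) * ?f p) = (\<Sum>p\<in>(%k. (k, xi)) ` ?F. ?f p)"
   by (rule sum.mono_neutral_cong_right[OF fC]) (use True neg in \<open>auto simp: conv3_def\<close>)
  also have "... = (\<Sum>k\<in>?F. b k * b xi * b (-k))" by (subst sum.reindex) (auto simp: inj_on_def)
  also have "... = (\<Sum>k\<in>?F. b k * b (-k)) * b xi"
   unfolding sum_distrib_right by (intro sum.cong refl) (simp only: mult_ac)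
  finally show ?thesis .
 qed
 also have "(\<Sum>p\<in>?C. ?i (fst p + snd p = 0) * ?f p) = (\<Sum>k\<in>?F. b k * b (-k)) * b xi" proof -
  have "(\<Sum>p\<in>?C. ?i (fst p + snd p = 0) * ?f p) = (\<Sum>p\<in>(%k. (k, -k)) ` ?F. ?f p)"
   by (rule sum.mono_neutral_cong_right[OF fC]) (use True neg in \<open>auto simp: conv3_def image_iff add_eq_0_iff\<close>)
  also have "... = (\<Sum>k\<in>?F. b k * b (-k) * b xi)" by (subst sum.reindex) (auto simp: inj_on_def)
  finally show ?thesis by (simp only: sum_distrib_right)
 qed
 also have "(\<Sum>p\<in>?C. ?i (p = (xi, xi)) * ?f p) = (b xi)^2 * b (-xi)" proof -
  have "(\<Sum>p\<in>?C. ?i (p = (xi, xi)) * ?f p) = (\<Sum>p\<in>{(xi, xi)}. ?f p)"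
   by (rule sum.mono_neutral_cong_right[OF fC]) (use True neg in \<open>auto simp: conv3_def\<close>)
  then show ?thesis by (simp add: power2_eq_square)
 qed
 also have "(\<Sum>p\<in>?C. ?i (p = (xi, -xi)) * ?f p) = (b xi)^2 * b (-xi)" proof -
  have "(\<Sum>p\<in>?C. ?i (p = (xi, -xi)) * ?f p) = (\<Sum>p\<in>{(xi, -xi)}. ?f p)"
   by (rule sum.mono_neutral_cong_right[OF fC]) (use True neg in \<open>auto simp: conv3_def\<close>)
  then show ?thesis by (simp add: power2_eq_square)
 qed
 also have "(\<Sum>p\<in>?C. ?i (p = (-xi, xi)) * ?f p) = (b xi)^2 * b (-xi)" proof -
  have "(\<Sum>p\<in>?C. ?i (p = (-xi, xi)) * ?f p) = (\<Sum>p\<in>{(-xi, xi)}. ?f p)"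
   by (rule sum.mono_neutral_cong_right[OF fC]) (use True neg in \<open>auto simp: conv3_def\<close>)
  then show ?thesis by (simp add: power2_eq_square)
 qed
 finally show ?thesis by (simp add: algebra_simps)
qed

text \<open>The modes of $6(w^2-P_0(w^2))w_x$.\<close>

definition nlm :: "(int => complex) => nat => int => complex" where
 "nlm b K xi = 2 * \<i> * of_int xi * (\<Sum>(k, l)\<in>nres (symF K) xi. b k * b l * b (xi - k - l))
   - 6 * \<i> * of_int xi * ((b xi)^2 * b (-xi))"

lemma nlm_cube:
 assumes b: "!!k. \<bar>k\<bar> > int K ==> b k = 0"
 shows "\<i> * of_int xi * (2 * cube b K xi - 6 * (\<Sum>k\<in>symF K. b k * b (-k)) * b xi) = nlm b K xi"
proof (cases "xi = 0")
 case False
 have r: "cube b K xi = (\<Sum>(k, l)\<in>nres (symF K) xi. b k * b l * b (xi - k - l))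
   + 3 * (\<Sum>k\<in>symF K. b k * b (-k)) * b xi - 3 * ((b xi)^2 * b (-xi))" by (rule cube_resonant[OF b False])
 show ?thesis unfolding r nlm_def by (simp add: algebra_simps)
qed (simp add: nlm_def)

text \<open>As P_0(w^2) does not depend on x, the nonlinearity is the derivative of 2 w^3 - 6
  P_0(w^2) w. Integration by parts moves the derivative to f, and only the modes of the cube are
  needed.\<close>

lemma integral_nonlin:
 fixes f f' :: "real => complex"
 assumes b: "!!k. \<bar>k\<bar> > int K ==> b k = 0"
  and f: "!!x. (f has_vector_derivative f' x) (at x)" "continuous_on UNIV f'" "periodic f"
 shows "(LINT x|circle. 6 * ((trig b (symF K) x)^2 - P0 (%y. (trig b (symF K) y)^2)) * trig (%k. \<i> * of_int k * b k) (symF K) x * f x)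
   = 2 * pi * (\<Sum>xi\<in>symF (3 * K). nlm b K xi * fc f (-xi))"
proof -
 let ?w = "trig b (symF K)" and ?w' = "trig (%k. \<i> * of_int k * b k) (symF K)"
 let ?P = "\<Sum>k\<in>symF K. b k * b (-k)"
 define c where "c = (%xi. 2 * cube b K xi - 6 * ?P * b xi)"
 have fcont: "continuous_on UNIV f" by (rule vector_derivative_continuous_on[OF f(1)])
 have F: "2 * (?w x) ^ 3 - 6 * ?P * ?w x = trig c (symF (3 * K)) x" for x proof -
  have "?w x = trig b (symF (3 * K)) x" unfolding trig_def by (rule sum.mono_neutral_left) (auto intro!: b)
  then show ?thesis unfolding trig_cube
   by (simp add: trig_def c_def sum_subtractf left_diff_distrib sum_distrib_left mult.assoc)
 qed
 have dF: "((%x. 2 * (?w x) ^ 3 - 6 * ?P * ?w x) has_vector_derivative 6 * ((?w x)^2 - ?P) * ?w' x) (at x)" for x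
 proof -
  have d2: "((%x. ?w x * ?w x) has_vector_derivative ?w x * ?w' x + ?w' x * ?w x) (at x)"
   by (intro has_vector_derivative_mult has_vector_derivative_trig)
  have "((%x. ?w x * (?w x * ?w x)) has_vector_derivative ?w x * (?w x * ?w' x + ?w' x * ?w x) + ?w' x * (?w x * ?w x)) (at x)"
   by (rule has_vector_derivative_mult[OF has_vector_derivative_trig d2])
  then have "((%x. 2 * (?w x * (?w x * ?w x)) - 6 * ?P * ?w x) has_vector_derivative
    2 * (?w x * (?w x * ?w' x + ?w' x * ?w x) + ?w' x * (?w x * ?w x)) - 6 * ?P * ?w' x) (at x)"
   by (intro has_vector_derivative_diff has_vector_derivative_mult_right has_vector_derivative_trig)
  moreover have "2 * (?w x * (?w x * ?w' x + ?w' x * ?w x) + ?w' x * (?w x * ?w x)) - 6 * ?P * ?w' x = 6 * ((?w x)^2 - ?P) * ?w' x"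
   by (simp add: power2_eq_square algebra_simps)
  moreover have "?w x * (?w x * ?w x) = ?w x ^ 3" for x by (simp add: power3_eq_cube)
  ultimately show ?thesis by (simp only:)
 qed
 have "(LINT x|circle. 6 * ((?w x)^2 - P0 (%y. (?w y)^2)) * ?w' x * f x)
   = - (- (LINT x|circle. (6 * ((?w x)^2 - ?P) * ?w' x) * f x))" by (simp add: P0_trig_sq)
 also have "... = - (LINT x|circle. (2 * (?w x) ^ 3 - 6 * ?P * ?w x) * f' x)"
  by (subst integral_circle_by_parts[OF dF f(1) _ f(2) _ f(3)])
   (use periodic_trig[of b "symF K"] in \<open>auto simp: periodic_def intro!: continuous_intros\<close>)
 also have "... = - (LINT x|circle. f' x * trig c (symF (3 * K)) x)" unfolding F by (simp add: mult.commute)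
 also have "... = - (2 * pi * (\<Sum>xi\<in>symF (3 * K). c xi * fc f' (-xi)))"
  by (subst integral_mult_trig) (auto intro!: integrable_circle_continuous f)
 also have "... = 2 * pi * (\<Sum>xi\<in>symF (3 * K). \<i> * of_int xi * c xi * fc f (-xi))"
  unfolding fc_deriv[OF f] by (simp add: sum_negf mult_ac)
 also have "... = 2 * pi * (\<Sum>xi\<in>symF (3 * K). nlm b K xi * fc f (-xi))" proof -
  have "\<i> * of_int xi * c xi = nlm b K xi" for xi unfolding c_def by (rule nlm_cube[OF b])
  then show ?thesis by simp
 qed
 finally show ?thesis .
qed

lemma qsym_om: "qsym sg u0 k + qsym sg u0 l + qsym sg u0 (xi - k - l) - qsym sg u0 xi = om xi k l"
 unfolding qsym_def om_def by (simp add: power3_eq_cube algebra_simps)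

text \<open>The phases of k, l and m combine to that of xi times \<open>cis (om xi k l * t)\<close>;
  in the resonant term the phases of xi and -xi cancel because q is odd.\<close>

lemma nlm_gf:
 assumes q: "!!xi k l. q k + q l + q (xi - k - l) - q xi = om xi k l" and qn: "!!k. q (-k) = - q k"
 shows "nlm (%k. cis (q k * t) * v k t) K xi = cis (q xi * t) * gf 1 (int K) v xi t"
proof -
 have c: "cis (q k * t) * cis (q l * t) * cis (q (xi - k - l) * t) = cis (q xi * t) * cis (om xi k l * t)" for k l
  unfolding q[symmetric] cis_mult by (simp add: algebra_simps)
 have r: "(cis (q xi * t))^2 * cis (q (-xi) * t) = cis (q xi * t)"
  unfolding power2_eq_square cis_mult qn by (simp add: algebra_simps)
 have 1: "(\<Sum>(k, l)\<in>nres (symF K) xi. cis (q k * t) * v k t * (cis (q l * t) * v l t) * (cis (q (xi - k - l) * t) * v (xi - k - l) t))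
   = cis (q xi * t) * (\<Sum>p\<in>nres (symF K) xi. cis (omp xi p * t) * (v (fst p) t * v (snd p) t * v (xi - fst p - snd p) t))"
  unfolding sum_distrib_left case_prod_unfold proof (rule sum.cong[OF refl])
  fix p :: "int \<times> int"
  let ?k = "fst p" and ?l = "snd p"
  have "cis (q ?k * t) * v ?k t * (cis (q ?l * t) * v ?l t) * (cis (q (xi - ?k - ?l) * t) * v (xi - ?k - ?l) t)
   = (cis (q ?k * t) * cis (q ?l * t) * cis (q (xi - ?k - ?l) * t)) * (v ?k t * v ?l t * v (xi - ?k - ?l) t)"
   by (simp only: mult_ac)
  also have "... = cis (q xi * t) * (cis (om xi ?k ?l * t) * (v ?k t * v ?l t * v (xi - ?k - ?l) t))"
   unfolding c by (simp only: mult_ac)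
  finally show "cis (q ?k * t) * v ?k t * (cis (q ?l * t) * v ?l t) * (cis (q (xi - ?k - ?l) * t) * v (xi - ?k - ?l) t)
   = cis (q xi * t) * (cis (om xi ?k ?l * t) * (v ?k t * v ?l t * v (xi - ?k - ?l) t))" .
 qed
 have 2: "(cis (q xi * t) * v xi t)^2 * (cis (q (-xi) * t) * v (-xi) t) = cis (q xi * t) * ((v xi t)^2 * v (-xi) t)"
 proof -
  have "(cis (q xi * t) * v xi t)^2 * (cis (q (-xi) * t) * v (-xi) t) = ((cis (q xi * t))^2 * cis (q (-xi) * t)) * ((v xi t)^2 * v (-xi) t)"
   by (simp only: power_mult_distrib mult_ac)
  then show ?thesis unfolding r .
 qed
 show ?thesis unfolding nlm_def 1 2 unfolding gf_def symF_def by (simp add: sum_distrib_left algebra_simps)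
qed

lemma qsym_neg: "qsym sg u0 (-k) = - qsym sg u0 k" by (simp add: qsym_def)

lemma gf_sigma: "gf sg N v xi t = of_real sg * gf 1 N v xi t"
 unfolding gf_def by (simp add: sum_distrib_left algebra_simps)

lemma gf_0: "gf sg N v 0 t = 0" by (simp add: gf_def)

section \<open>Functions of space-time as distributions\<close>

lemma L2T_norm_le_modes:
 assumes u: "u \<in> L2T" and R: "R >= 0" "!!n. msq n (rc u) <= R^2"
 shows "L2T_norm u <= sqrt (2 * pi) * R"
proof -
 have "P0 (%x. (u x)^2) <= R^2" using parseval[OF u] R(2) by (intro LIMSEQ_le_const2) auto
 then have "(LINT x|circle. (u x)^2) <= 2 * pi * R^2" by (simp add: P0_def field_simps)
 then have "(L2T_norm u)^2 <= (sqrt (2 * pi) * R)^2" by (simp add: L2T_norm_sq power_mult_distrib)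
 then show ?thesis by (rule power2_le_imp_le) (use R in simp)
qed

lemma deriv_zero_off_support:
 fixes f :: "real => complex"
 assumes "!!s. s \<notin> {c..d} ==> f s = 0" "t \<notin> {c..d}"
 shows "vector_derivative f (at t) = 0"
proof -
 have o: "open (- {c..d})" by (intro open_Compl closed_atLeastAtMost)
 have "((%s. 0) has_vector_derivative 0) (at t)" by simp
 then have "(f has_vector_derivative 0) (at t)"
  by (rule has_vector_derivative_transform_within_open[OF _ o]) (use assms in auto)
 then show ?thesis by (rule vector_derivative_at)
qed

lemma supp_within_dt: "supp_within phi c d ==> supp_within (dt phi) c d"
 unfolding supp_within_def dt_def by (auto intro!: deriv_zero_off_support[of c d])

lemma supp_within_dx: "supp_within phi c d ==> supp_within (dx phi) c d" unfolding supp_within_def dx_def by simp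

lemma supp_within_funpow:
 assumes "supp_within phi c d" shows "supp_within ((dt ^^ i) ((dx ^^ j) phi)) c d"
proof -
 have "supp_within ((dx ^^ j) phi) c d" by (induction j) (auto intro: assms supp_within_dx)
 then show ?thesis by (induction i) (auto intro: supp_within_dt)
qed

lemma periodic_funpow: "smooth_RT phi ==> periodic (%x. (dt ^^ i) ((dx ^^ j) phi) (t, x))"
proof (induction i arbitrary: t)
 case 0
 then show ?case by (simp add: smooth_RT_periodic)
next
 case (Suc i)
 then show ?case by (simp add: periodic_dt)
qed

lemma continuous_funpow: "smooth_RT phi ==> continuous_on UNIV ((dt ^^ i) ((dx ^^ j) phi))"
 by (rule diff_continuous[OF smooth_RT_diff])

lemma supp_within_mono: "supp_within phi (-r) r ==> r <= r' ==> supp_within phi (-r') r'"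
 unfolding supp_within_def by auto

lemma bounded_supp:
 assumes c: "continuous_on UNIV phi" and p: "!!t. periodic (%x. phi (t, x))" and s: "supp_within phi (-r) r"
 shows "\<exists>B\<ge>0. \<forall>p. norm (phi p) <= B"
proof -
 obtain B where B: "B >= 0" "!!t x. t \<in> {-r..r} ==> norm (phi (t, x)) <= B" using periodic_bounded[OF c p] by blast
 have "norm (phi (t, x)) <= B" for t x proof (cases "t \<in> {-r..r}")
  case False
  then have "phi (t, x) = 0" using s unfolding supp_within_def by blast
  then show ?thesis using B by simp
 qed (use B in auto)
 then show ?thesis using B(1) by (intro exI[of _ B]) auto
qed

lemma seminorm_upper:
 assumes phi: "phi \<in> test_RT"
 shows "norm ((dt ^^ i) ((dx ^^ j) phi) p) <= seminorm_RT 0 i j phi"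
proof -
 obtain r where s: "smooth_RT phi" "supp_within phi (-r) r" using phi unfolding test_RT_def by blast
 obtain B where "!!p. norm ((dt ^^ i) ((dx ^^ j) phi) p) <= B"
  using bounded_supp[OF continuous_funpow periodic_funpow supp_within_funpow] s by metis
 then have "bdd_above (range (%p. \<bar>fst p\<bar> ^ 0 * norm ((dt ^^ i) ((dx ^^ j) phi) p)))"
  by (intro bdd_aboveI2[of _ _ B]) simp
 from cSUP_upper[OF UNIV_I this, of p] show ?thesis unfolding seminorm_RT_def by simp
qed

lemma seminorm_nonneg: "phi \<in> test_RT ==> seminorm_RT 0 i j phi >= 0"
 using order_trans[OF norm_ge_zero seminorm_upper] by blast

lemma seminorm_le_sum:
 assumes phi: "phi \<in> test_RT" and "i <= N" "j <= N"
 shows "seminorm_RT 0 i j phi <= (\<Sum>i\<le>N. \<Sum>j\<le>N. seminorm_RT 0 i j phi)"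
proof -
 have "seminorm_RT 0 i j phi <= (\<Sum>j\<le>N. seminorm_RT 0 i j phi)"
  by (rule member_le_sum) (use assms seminorm_nonneg in auto)
 also have "... <= (\<Sum>i\<le>N. \<Sum>j\<le>N. seminorm_RT 0 i j phi)"
  by (rule member_le_sum[of i "{..N}" "%i. \<Sum>j\<le>N. seminorm_RT 0 i j phi"])
   (use assms seminorm_nonneg in \<open>auto intro!: sum_nonneg\<close>)
 finally show ?thesis .
qed

abbreviation lc :: "complex => complex => (real \<times> real => complex) => (real \<times> real => complex) => real \<times> real => complex" where
 "lc a b phi rho \<equiv> %p. a * phi p + b * rho p"

lemma test_deriv_lin:
 assumes "!!p. phi differentiable (at p)" "!!p. rho differentiable (at p)"
 shows "dt (lc a b phi rho) = (%p. a * dt phi p + b * dt rho p)"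
  and "dx (lc a b phi rho) = (%p. a * dx phi p + b * dx rho p)"
proof -
 show "dt (lc a b phi rho) = (%p. a * dt phi p + b * dt rho p)" proof
  fix p :: "real \<times> real"
  obtain t x where p: "p = (t, x)" by (cases p)
  have "((%s. a * phi (s, x) + b * rho (s, x)) has_vector_derivative a * dt phi (t, x) + b * dt rho (t, x)) (at t)"
   by (intro has_vector_derivative_add has_vector_derivative_mult_right has_dt assms)
  then have "vector_derivative (%s. a * phi (s, x) + b * rho (s, x)) (at t) = a * dt phi (t, x) + b * dt rho (t, x)"
   by (rule vector_derivative_at)
  then show "dt (lc a b phi rho) p = a * dt phi p + b * dt rho p" unfolding p by (simp add: dt_def)
 qed
 show "dx (lc a b phi rho) = (%p. a * dx phi p + b * dx rho p)" proof
  fix p :: "real \<times> real"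
  obtain t x where p: "p = (t, x)" by (cases p)
  have "((%y. a * phi (t, y) + b * rho (t, y)) has_vector_derivative a * dx phi (t, x) + b * dx rho (t, x)) (at x)"
   by (intro has_vector_derivative_add has_vector_derivative_mult_right has_dx assms)
  then have "vector_derivative (%y. a * phi (t, y) + b * rho (t, y)) (at x) = a * dx phi (t, x) + b * dx rho (t, x)"
   by (rule vector_derivative_at)
  then show "dx (lc a b phi rho) p = a * dx phi p + b * dx rho p" unfolding p by (simp add: dx_def)
 qed
qed

lemma test_dxj_lin:
 assumes "smooth_RT phi" "smooth_RT rho"
 shows "(dx ^^ j) (lc a b phi rho) = (%p. a * (dx ^^ j) phi p + b * (dx ^^ j) rho p)"
 by (induction j) (simp_all add: test_deriv_lin(2)[OF smooth_RT_dxj_diff smooth_RT_dxj_diff, OF assms])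

lemma decay_conv:
 assumes "C >= 0" "mag k ^ 2 * norm z <= C" "k ~= 0"
 shows "norm z <= C / (real_of_int k)^2" using assms by (simp add: field_simps)

lemma md_decay2_dx:
 assumes s: "smooth_RT phi"
 shows "\<exists>C\<ge>0. \<forall>t\<in>{-r..r}. (\<forall>k. k ~= 0 --> norm (md ((dx ^^ j) phi) k t) <= C / (real_of_int k)^2) \<and> norm (md ((dx ^^ j) phi) 0 t) <= C"
proof -
 obtain C1 where C1: "C1 >= 0" "!!t k. t \<in> {-r..r} ==> mag k ^ (j + 2) * norm (md phi k t) <= C1"
  using test_md_decay[OF s, of r "j + 2"] by blast
 obtain C0 where C0: "C0 >= 0" "!!t k. t \<in> {-r..r} ==> mag k ^ 0 * norm (md phi k t) <= C0"
  using test_md_decay[OF s, of r 0] by blast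
 show ?thesis proof (intro exI[of _ "max C0 C1"] conjI ballI allI impI)
  show "0 <= max C0 C1" using C0 by simp
  fix t assume t: "t \<in> {-r..r}"
  show "norm (md ((dx ^^ j) phi) k t) <= max C0 C1 / (real_of_int k)^2" if k: "k ~= 0" for k
  proof (rule decay_conv[OF _ _ k])
   have "mag k ^ 2 * norm (md ((dx ^^ j) phi) k t) = mag k ^ (j + 2) * norm (md phi k t)"
    unfolding md_dx[OF s] by (simp add: norm_mult norm_power power_add power2_eq_square mult_ac)
   then show "mag k ^ 2 * norm (md ((dx ^^ j) phi) k t) <= max C0 C1" using C1(2)[OF t, of k] by linarith
   show "0 <= max C0 C1" using C0 by simp
  qed
  have "norm (md ((dx ^^ j) phi) 0 t) <= norm (md phi 0 t)"
   unfolding md_dx[OF s] by (simp add: norm_mult norm_power power_0_left)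
  then show "norm (md ((dx ^^ j) phi) 0 t) <= max C0 C1" using C0(2)[OF t, of 0] by simp
 qed
qed

lemma md_decay2_dt:
 assumes s: "smooth_RT phi"
 shows "\<exists>C\<ge>0. \<forall>t\<in>{-r..r}. (\<forall>k. k ~= 0 --> norm (md (dt phi) k t) <= C / (real_of_int k)^2) \<and> norm (md (dt phi) 0 t) <= C"
proof -
 obtain C1 where C1: "C1 >= 0" "!!t k. t \<in> {-r..r} ==> mag k ^ 2 * norm (md (dt phi) k t) <= C1"
  using test_md_decay[OF s, of r 2] by blast
 obtain C0 where C0: "C0 >= 0" "!!t k. t \<in> {-r..r} ==> mag k ^ 0 * norm (md (dt phi) k t) <= C0"
  using test_md_decay[OF s, of r 0] by blast
 show ?thesis proof (intro exI[of _ "max C0 C1"] conjI ballI allI impI)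
  show C: "0 <= max C0 C1" using C0 by simp
  fix t assume t: "t \<in> {-r..r}"
  show "norm (md (dt phi) k t) <= max C0 C1 / (real_of_int k)^2" if k: "k ~= 0" for k
   by (rule decay_conv[OF C _ k]) (use C1(2)[OF t, of k] in simp)
  show "norm (md (dt phi) 0 t) <= max C0 C1" using C0(2)[OF t, of 0] by simp
 qed
qed

text \<open>The common setting of both claims: profiles that are a limit of approximate solutions,
  and functions with the corresponding modes. The datum \<open>u0\<close> enters only through its
  mean square in q; the initial condition is added in \<open>weak_sol\<close>.\<close>

locale wsol =
 fixes psi :: "real => real" and sg :: real and u0 :: "real => real" and R :: real
  and v :: "int => real => complex" and u :: "real => real => real"
 assumes psi: "cutoff psi" and sigma: "\<bar>sg\<bar> = 1" and sol: "limit_sol sg R v"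
  and uL: "u t \<in> L2T" and modes: "rc (u t) k = cis (qsym sg u0 k * t) * v k t"
begin

abbreviation q where "q \<equiv> qsym sg u0"
abbreviation f where "f \<equiv> distr_of_real u"

lemma R_nonneg: "R >= 0" by (rule limit_sol_R[OF sol])

lemma v_cont: "continuous_on S (v k)" by (rule limit_sol_continuous[OF sol sigma])

lemma rc_cont: "continuous_on UNIV (%t. rc (u t) k)" unfolding modes by (intro continuous_intros v_cont)

lemma norm_rc: "norm (rc (u t) k) = norm (v k t)" by (simp add: modes norm_mult)

lemma rc_le: "norm (rc (u t) k) <= R" unfolding norm_rc by (rule limit_sol_norm_le[OF sol])

lemma uL_norm: "L2T_norm (u t) <= sqrt (2 * pi) * R"
proof (rule L2T_norm_le_modes[OF uL R_nonneg])
 fix n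
 have "sqrt (\<Sum>k\<in>symF n. (norm (v k t))^2) <= R"
  using limit_sol_L2[OF sol, of "symF n" t] by (simp add: L2_set_def)
 then have "(\<Sum>k\<in>symF n. (norm (v k t))^2) <= R^2" by (rule sqrt_le_D)
 then show "msq n (rc (u t)) <= R^2" unfolding norm_rc .
qed

lemma uL1: "(LINT x|circle. \<bar>u t x\<bar>) <= 2 * pi * R"
proof -
 have "sqrt (2 * pi) * L2T_norm (u t) <= sqrt (2 * pi) * (sqrt (2 * pi) * R)" by (intro mult_left_mono uL_norm) auto
 also have "... = (sqrt (2 * pi) * sqrt (2 * pi)) * R" by (simp only: mult.assoc)
 also have "sqrt (2 * pi) * sqrt (2 * pi) = 2 * pi" by (subst real_sqrt_mult_self) simp
 finally show ?thesis using L2T_L1_le[OF uL[of t]] by linarith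
qed

lemma inner_integrable:
 fixes phi :: "real \<times> real => complex"
 assumes c: "continuous_on UNIV phi"
 shows "integrable circle (%x. of_real (u t x) * phi (t, x))"
proof -
 have "compact ((%x. phi (t, x)) ` {0..2*pi})"
  by (intro compact_continuous_image continuous_on_subset[OF cont_slice[OF c]]) auto
 then have "bounded ((%x. phi (t, x)) ` {0..2*pi})" by (rule compact_imp_bounded)
 then obtain B where B: "\<forall>y\<in>(%x. phi (t, x)) ` {0..2*pi}. norm y <= B" unfolding bounded_iff by blast
 have i: "integrable circle (%x. complex_of_real (u t x))" by (rule L2T_integrable_c[OF uL])
 show ?thesis proof (rule Bochner_Integration.integrable_bound[of _ "%x. B * norm (complex_of_real (u t x))"])
  show "integrable circle (%x. B * norm (complex_of_real (u t x)))" by (intro integrable_mult_right integrable_norm i)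
  show "(%x. of_real (u t x) * phi (t, x)) \<in> borel_measurable circle"
   by (rule borel_measurable_times[OF borel_measurable_integrable[OF i] borel_measurable_circle[OF continuous_imp_borel[OF cont_slice[OF c]]]])
  show "AE x in circle. norm (of_real (u t x) * phi (t, x)) <= norm (B * norm (complex_of_real (u t x)))"
  proof (rule AE_I2)
   fix x assume "x \<in> space circle"
   then have "norm (phi (t, x)) <= B" using B by auto
   then have "norm (complex_of_real (u t x)) * norm (phi (t, x)) <= norm (complex_of_real (u t x)) * B"
    by (intro mult_left_mono) auto
   also have "... <= \<bar>B * norm (complex_of_real (u t x))\<bar>" by (simp add: mult.commute abs_mult mult_right_mono)
   finally show "norm (of_real (u t x) * phi (t, x)) <= norm (B * norm (complex_of_real (u t x)))"
    unfolding norm_mult by (simp add: abs_mult)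
  qed
 qed
qed

lemma inner_bound:
 fixes phi :: "real \<times> real => complex"
 assumes c: "continuous_on UNIV phi" and S: "!!x. norm (phi (t, x)) <= S"
 shows "norm (LINT x|circle. of_real (u t x) * phi (t, x)) <= 2 * pi * R * S"
proof -
 have S0: "S >= 0" using order_trans[OF norm_ge_zero S[of 0]] .
 have "norm (LINT x|circle. of_real (u t x) * phi (t, x)) <= (LINT x|circle. norm (of_real (u t x) * phi (t, x)))"
  by (rule integral_norm_bound)
 also have "... <= (LINT x|circle. S * \<bar>u t x\<bar>)" proof (rule Bochner_Integration.integral_mono)
  show "integrable circle (%x. norm (of_real (u t x) * phi (t, x)))" by (intro integrable_norm inner_integrable c)
  show "integrable circle (%x. S * \<bar>u t x\<bar>)" using L2T_integrable[OF uL[of t]] by simp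
  show "norm (of_real (u t x) * phi (t, x)) <= S * \<bar>u t x\<bar>" for x
   using mult_right_mono[OF S[of x] abs_ge_zero[of "u t x"]] by (simp add: norm_mult mult.commute)
 qed
 also have "... = S * (LINT x|circle. \<bar>u t x\<bar>)" by simp
 also have "... <= S * (2 * pi * R)" by (intro mult_left_mono uL1 S0)
 finally show ?thesis by (simp add: mult_ac)
qed

lemma outer_integrable:
 assumes s: "smooth_RT phi" and r: "supp_within phi (-r) r" and Ps: "Ps = (dx ^^ j) phi \<or> Ps = dt phi"
 shows "integrable lborel (%t. LINT x|circle. of_real (u t x) * Ps (t, x))"
  and "(%X. 2 * pi * (\<Sum>k\<in>symF X. LINT t|lborel. rc (u t) k * md Ps (-k) t)) ----> f Ps"
proof -
 have c: "continuous_on UNIV Ps" using Ps continuous_funpow[OF s, of 0 j] continuous_funpow[OF s, of 1 0] by auto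
 have p: "periodic (%x. Ps (t, x))" for t
  using Ps periodic_funpow[OF s, of 0 j t] periodic_funpow[OF s, of 1 0 t] by auto
 have sp: "supp_within Ps (-r) r" using Ps supp_within_funpow[OF r, of 0 j] supp_within_funpow[OF r, of 1 0] by auto
 obtain C where "!!t k. t \<in> {-r..r} ==> k ~= 0 ==> norm (md Ps k t) <= C / (real_of_int k)^2"
  "!!t. t \<in> {-r..r} ==> norm (md Ps 0 t) <= C" using Ps md_decay2_dx[OF s, of r j] md_decay2_dt[OF s, of r] by metis
 from distr_of_real_modes[of u R Ps r C, OF uL rc_cont rc_le c p sp this]
 show "integrable lborel (%t. LINT x|circle. of_real (u t x) * Ps (t, x))"
  "(%X. 2 * pi * (\<Sum>k\<in>symF X. LINT t|lborel. rc (u t) k * md Ps (-k) t)) ----> f Ps" by blast+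
qed

lemma f_bound:
 assumes s: "smooth_RT phi" and r: "supp_within phi (-r) r" "r >= 0" and Ps: "Ps = (dx ^^ j) phi \<or> Ps = dt phi"
  and S: "!!p. norm (Ps p) <= S"
 shows "norm (f Ps) <= 2 * r * (2 * pi * R) * S"
proof -
 let ?I = "%t. LINT x|circle. of_real (u t x) * Ps (t, x)"
 have c: "continuous_on UNIV Ps" using Ps continuous_funpow[OF s, of 0 j] continuous_funpow[OF s, of 1 0] by auto
 have sp: "supp_within Ps (-r) r"
  using Ps supp_within_funpow[OF r(1), of 0 j] supp_within_funpow[OF r(1), of 1 0] by auto
 have i: "integrable lborel ?I" by (rule outer_integrable(1)[OF s r(1) Ps])
 have b: "norm (?I t) <= (2 * pi * R * S) * indicat_real {-r..r} t" for t proof (cases "t \<in> {-r..r}")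
  case True
  then show ?thesis using inner_bound[OF c, of t S] S by simp
 next
  case False
  then have "Ps (t, x) = 0" for x using sp unfolding supp_within_def by blast
  then show ?thesis using False by simp
 qed
 have ii: "integrable lborel (indicat_real {-r..r})" by (intro integrable_real_indicator) (auto simp: emeasure_lborel_Icc_eq)
 have "norm (f Ps) = norm (LINT t|lborel. ?I t)" by (simp add: distr_of_real_def distr_of_def)
 also have "... <= (LINT t|lborel. norm (?I t))" by (rule integral_norm_bound)
 also have "... <= (LINT t|lborel. (2 * pi * R * S) * indicat_real {-r..r} t)"
  by (rule Bochner_Integration.integral_mono) (use i ii b in auto)
 also have "... = (2 * pi * R * S) * measure lborel {-r..r}" by simp
 also have "measure lborel {-r..r} = 2 * r" using r(2) by (subst measure_lborel_Icc) auto
 finally show ?thesis by (simp add: mult_ac)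
qed

lemma f_lin:
 assumes s: "smooth_RT phi" "smooth_RT rho" and r: "supp_within phi (-r) r" "supp_within rho (-r') r'"
  and Ps: "Ps = (dx ^^ j) phi \<or> Ps = dt phi" "Ps' = (dx ^^ j') rho \<or> Ps' = dt rho"
 shows "f (%p. a * Ps p + b * Ps' p) = a * f Ps + b * f Ps'"
proof -
 have c: "continuous_on UNIV Ps" "continuous_on UNIV Ps'"
  using Ps continuous_funpow[OF s(1), of 0 j] continuous_funpow[OF s(1), of 1 0]
   continuous_funpow[OF s(2), of 0 j'] continuous_funpow[OF s(2), of 1 0] by auto
 let ?I = "%Ps t. LINT x|circle. of_real (u t x) * Ps (t, x)"
 have e: "?I (%p. a * Ps p + b * Ps' p) t = a * ?I Ps t + b * ?I Ps' t" for t proof -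
  have "?I (%p. a * Ps p + b * Ps' p) t = (LINT x|circle. a * (of_real (u t x) * Ps (t, x)) + b * (of_real (u t x) * Ps' (t, x)))"
   by (simp add: algebra_simps)
  also have "... = (LINT x|circle. a * (of_real (u t x) * Ps (t, x))) + (LINT x|circle. b * (of_real (u t x) * Ps' (t, x)))"
   by (intro Bochner_Integration.integral_add integrable_mult_right inner_integrable c)
  finally show ?thesis by simp
 qed
 have "f (%p. a * Ps p + b * Ps' p) = (LINT t|lborel. a * ?I Ps t + b * ?I Ps' t)"
  unfolding e[symmetric] by (simp add: distr_of_real_def distr_of_def)
 also have "... = (LINT t|lborel. a * ?I Ps t) + (LINT t|lborel. b * ?I Ps' t)"
  by (intro Bochner_Integration.integral_add integrable_mult_right outer_integrable(1)[OF s(1) r(1) Ps(1)] outer_integrable(1)[OF s(2) r(2) Ps(2)])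
 also have "... = a * f Ps + b * f Ps'" by (simp add: distr_of_real_def distr_of_def)
 finally show ?thesis .
qed

lemma distribution_f: "distribution f" unfolding distribution_def
proof (intro conjI allI)
 show "linear_fun_on test_RT f" unfolding linear_fun_on_def proof (intro ballI allI)
  fix phi rho :: "real \<times> real => complex" and a b assume "phi \<in> test_RT" "rho \<in> test_RT"
  then obtain r r' where "smooth_RT phi" "supp_within phi (-r) r" "smooth_RT rho" "supp_within rho (-r') r'"
   unfolding test_RT_def by blast
  then show "f (lc a b phi rho) = a * f phi + b * f rho" using f_lin[of phi rho r r' phi 0 rho 0 a b] by simp
 qed
 fix r :: real
 show "\<exists>C N. \<forall>phi\<in>test_RT. supp_within phi (-r) r --> norm (f phi) <= C * (\<Sum>i\<le>N. \<Sum>j\<le>N. seminorm_RT 0 i j phi)"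
 proof (intro exI ballI impI)
  fix phi assume phi: "phi \<in> test_RT" and r: "supp_within phi (-r) r"
  have s: "smooth_RT phi" using phi unfolding test_RT_def by blast
  have "norm (f phi) <= 2 * max r 0 * (2 * pi * R) * seminorm_RT 0 0 0 phi"
   by (rule f_bound[OF s supp_within_mono[OF r], of "max r 0" phi 0]) (use seminorm_upper[OF phi, of 0 0] in auto)
  also have "... = 2 * max r 0 * (2 * pi * R) * (\<Sum>i\<le>0. \<Sum>j\<le>0. seminorm_RT 0 i j phi)" by simp
  finally show "norm (f phi) <= 2 * max r 0 * (2 * pi * R) * (\<Sum>i\<le>0. \<Sum>j\<le>0. seminorm_RT 0 i j phi)" .
 qed
qed

definition P where "P = P0 (%x. (u0 x)^2)"

text \<open>The nonlinear term is read off from the linear side of the equation, solved by means of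
  sg * sg = 1. The equation then holds by construction, and the content is moved to
  \<open>is_N_f\<close>: the truncated nonlinearities converge to this distribution.\<close>

definition L :: distr where
 "L phi = of_real sg * (distr_dt f phi + distr_dx (distr_dx (distr_dx f)) phi - of_real (sg * 6 * P) * distr_dx f phi)"

lemma L_eq: "L phi = of_real sg * (- f (dt phi) - f ((dx ^^ 3) phi) + of_real (sg * 6 * P) * f ((dx ^^ 1) phi))"
 by (simp add: L_def distr_dt_def distr_dx_def eval_nat_numeral)

lemma sigma_sq: "complex_of_real sg * of_real sg = 1"
proof -
 have "sg * sg = 1" using sigma by (metis abs_mult_self_eq mult_1)
 then show ?thesis by (metis of_real_1 of_real_mult)
qed

lemma equation:
 "distr_dt f phi + distr_dx (distr_dx (distr_dx f)) phi - of_real sg * L phi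
   - of_real (sg * 6 * P0 (%x. (u0 x)^2)) * distr_dx f phi = 0"
 unfolding L_def P_def mult.assoc[symmetric] sigma_sq by simp

lemma distribution_L: "distribution L" unfolding distribution_def
proof (intro conjI allI)
 show "linear_fun_on test_RT L" unfolding linear_fun_on_def proof (intro ballI allI)
  fix phi rho :: "real \<times> real => complex" and a b assume "phi \<in> test_RT" "rho \<in> test_RT"
  then obtain r r' where s: "smooth_RT phi" "smooth_RT rho" and r: "supp_within phi (-r) r" "supp_within rho (-r') r'"
   unfolding test_RT_def by blast
  have "f (dt (lc a b phi rho)) = a * f (dt phi) + b * f (dt rho)"
   using smooth_RT_dxj_diff[OF s(1), of 0] smooth_RT_dxj_diff[OF s(2), of 0]
   by (subst test_deriv_lin(1)) (auto intro!: f_lin[OF s r])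
  moreover have "f ((dx ^^ j) (lc a b phi rho)) = a * f ((dx ^^ j) phi) + b * f ((dx ^^ j) rho)" for j
   unfolding test_dxj_lin[OF s] by (rule f_lin[OF s r]) auto
  ultimately show "L (lc a b phi rho) = a * L phi + b * L rho"
   unfolding L_eq by (simp only: distrib_left distrib_right right_diff_distrib minus_add_distrib mult_minus_right mult_ac) (simp only: algebra_simps)
 qed
 fix r :: real
 let ?K = "2 * max r 0 * (2 * pi * R)"
 have K: "?K >= 0" using R_nonneg by simp
 show "\<exists>C N. \<forall>phi\<in>test_RT. supp_within phi (-r) r --> norm (L phi) <= C * (\<Sum>i\<le>N. \<Sum>j\<le>N. seminorm_RT 0 i j phi)"
 proof (intro exI ballI impI)
  fix phi assume phi: "phi \<in> test_RT" and r: "supp_within phi (-r) r"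
  have s: "smooth_RT phi" using phi unfolding test_RT_def by blast
  have r': "supp_within phi (- max r 0) (max r 0)" by (rule supp_within_mono[OF r]) simp
  let ?S = "\<Sum>i\<le>3. \<Sum>j\<le>3. seminorm_RT 0 i j phi"
  have 1: "norm (f (dt phi)) <= ?K * ?S" proof (rule f_bound[OF s r', of "dt phi" 0])
   show "norm (dt phi p) <= ?S" for p using seminorm_upper[OF phi, of 1 0 p] seminorm_le_sum[OF phi, of 1 3 0] by simp
  qed auto
  have 2: "norm (f ((dx ^^ j) phi)) <= ?K * ?S" if "j <= 3" for j proof (rule f_bound[OF s r', of "(dx ^^ j) phi" j])
   show "norm ((dx ^^ j) phi p) <= ?S" for p
    using seminorm_upper[OF phi, of 0 j p] seminorm_le_sum[OF phi, of 0 3 j] that by simp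
  qed auto
  have "norm (L phi) = norm (- f (dt phi) - f ((dx ^^ 3) phi) + of_real (sg * 6 * P) * f ((dx ^^ 1) phi))"
   unfolding L_eq norm_mult norm_of_real sigma by simp
  also have "... <= norm (f (dt phi)) + norm (f ((dx ^^ 3) phi)) + norm (of_real (sg * 6 * P) * f ((dx ^^ 1) phi))"
   using norm_triangle_ineq[of "- f (dt phi) - f ((dx ^^ 3) phi)" "of_real (sg * 6 * P) * f ((dx ^^ 1) phi)"]
    norm_triangle_ineq4[of "- f (dt phi)" "f ((dx ^^ 3) phi)"] unfolding norm_minus_cancel by linarith
  also have "norm (of_real (sg * 6 * P) * f ((dx ^^ 1) phi)) = 6 * \<bar>P\<bar> * norm (f ((dx ^^ 1) phi))"
   unfolding norm_mult norm_of_real abs_mult sigma by simp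
  also have "norm (f (dt phi)) + norm (f ((dx ^^ 3) phi)) + 6 * \<bar>P\<bar> * norm (f ((dx ^^ 1) phi))
    <= ?K * ?S + ?K * ?S + 6 * \<bar>P\<bar> * (?K * ?S)"
   using 2[of 3] 2[of 1] by (intro add_mono mult_left_mono 1) auto
  finally show "norm (L phi) <= (2 * ?K + 6 * \<bar>P\<bar> * ?K) * ?S" by (simp add: algebra_simps)
 qed
qed

lemma fourier_modes_f: "fourier_modes f (%k t. rc (u t) k)" unfolding fourier_modes_def
proof (intro allI conjI ballI)
 fix xi :: int
 show "(%t. rc (u t) xi) \<in> borel_measurable borel" by (rule continuous_imp_borel[OF rc_cont])
 show "set_integrable lborel {-r..r} (%t. (norm (rc (u t) xi)) ^ 3)" for r
  by (intro borel_integrable_atLeastAtMost' continuous_intros continuous_on_subset[OF rc_cont]) auto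
 fix ta :: "real => complex"
 have "(LINT x|circle. of_real (u t x) * (ta t * cis (- of_int xi * x))) = 2 * pi * (rc (u t) xi * ta t)" for t proof -
  have "(LINT x|circle. of_real (u t x) * (ta t * cis (- of_int xi * x))) = (LINT x|circle. ta t * (of_real (u t x) * cis (- of_int xi * x)))"
   by (simp add: mult_ac)
  also have "... = ta t * (LINT x|circle. of_real (u t x) * cis (- of_int xi * x))"
   by (rule Bochner_Integration.integral_mult_right_zero)
  finally show ?thesis by (simp add: rc_def fc_eq)
 qed
 then show "f (%(t, x). ta t * cis (- of_int xi * x)) / of_real (2 * pi) = (LINT t|lborel. rc (u t) xi * ta t)"
  by (simp add: distr_of_real_def distr_of_def)
qed

end

section \<open>The nonlinear term\<close>

lemma S_fun_trig:
 assumes "cutoff psi"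
 shows "S_fun psi n c = (%(t, x). trig (%k. of_real (mlt psi n k) * c k t) (symF (2 ^ Suc n)) x)"
proof (intro ext, clarify)
 fix t x
 have z: "mlt psi n k = 0" if "k \<notin> symF (2 ^ Suc n)" for k using that mlt_zero[OF assms, of n k] by simp
 have "S_fun psi n c (t, x) = infsum (%k. of_real (mlt psi n k) * c k t * cis (of_int k * x)) UNIV"
  by (simp add: S_fun_def mlt_def)
 also have "... = infsum (%k. of_real (mlt psi n k) * c k t * cis (of_int k * x)) (symF (2 ^ Suc n))"
  by (rule infsum_cong_neutral) (use z in auto)
 finally show "S_fun psi n c (t, x) = trig (%k. of_real (mlt psi n k) * c k t) (symF (2 ^ Suc n)) x"
  by (simp add: trig_def)
qed

lemma supp_within_md: "supp_within phi (-r) r ==> t \<notin> {-r..r} ==> md phi k t = 0"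
 unfolding md_def fc_eq supp_within_def by simp

text \<open>Conservation of the mean. It covers the frequency 0, which \<open>tested_limit\<close>
  excludes.\<close>

lemma limit_sol_0_const:
 assumes "limit_sol sg R v" shows "v 0 t = v 0 s"
proof -
 have "v 0 t = v 0 s" if st: "s <= t" for s t proof -
  obtain N T ep vj where *:
   "!!j. approx_sol sg (N j) (T j) (ep j) R (vj j)" "!!j. 0 <= ep j" "!!j. ep j <= 1"
   "!!j. 0 <= N j" "!!j. \<bar>t\<bar> + \<bar>s\<bar> <= T j" "ep ----> 0" "!!k t. (%j. vj j k t) ----> v k t"
   using limit_solE[OF assms, of 0 "\<bar>t\<bar> + \<bar>s\<bar>"] by metis
  have b: "norm (vj j 0 t - vj j 0 s) <= ep j * (t - s)" for j proof -
   have "- T j <= s" "t <= T j" "0 \<in> {-N j..N j}" using *(5)[of j] *(4)[of j] by auto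
   then have "norm (vj j 0 t - vj j 0 s - integral {s..t} (gf sg (N j) (vj j) 0)) <= ep j * (t - s)"
    using *(1)[of j] st unfolding approx_sol_def by blast
   moreover have "gf sg (N j) (vj j) 0 = (%t. 0)" by (simp add: fun_eq_iff gf_0)
   ultimately show ?thesis by simp
  qed
  have "(%j. norm (vj j 0 t - vj j 0 s)) ----> norm (v 0 t - v 0 s)" by (intro tendsto_intros *)
  moreover have "(%j. ep j * (t - s)) ----> 0 * (t - s)" by (intro tendsto_intros *)
  ultimately have "norm (v 0 t - v 0 s) <= 0 * (t - s)" by (rule LIMSEQ_le) (use b in blast)
  then show ?thesis by simp
 qed
 from this[of s t] this[of t s] show ?thesis by (cases "s <= t") auto
qed

context wsol
begin

text \<open>The mode of phi that pairs with the frequency xi, multiplied by the phase so that it can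
  be tested against the profile instead of the mode of u; \<open>th'\<close> is its time
  derivative.\<close>

definition th where "th phi xi t = cis (q xi * t) * md phi (-xi) t"
definition th' where "th' phi xi t = cis (q xi * t) * (\<i> * q xi * md phi (-xi) t + md (dt phi) (-xi) t)"

lemma th_deriv:
 assumes s: "smooth_RT phi"
 shows "(th phi xi has_vector_derivative th' phi xi t) (at t)"
proof -
 have "(md phi (-xi) has_vector_derivative md (dt phi) (-xi) t) (at t)" using smooth_RT_md_dt[OF s, of 0] by simp
 from has_vector_derivative_mult[OF has_vector_derivative_cis this, of "q xi"]
 show ?thesis unfolding th_def th'_def by (simp add: algebra_simps)
qed

lemma th'_cont: assumes "smooth_RT phi" shows "continuous_on UNIV (th' phi xi)"
 using md_continuous[OF continuous_funpow[OF assms, of 0 0]] md_continuous[OF continuous_funpow[OF assms, of 1 0]]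
 unfolding th'_def by (intro continuous_intros) simp_all

lemma gf_mv_cont: "continuous_on S (gf s N (mv psi n v) xi)" unfolding gf_def mv_def by (intro continuous_intros v_cont)

lemma inner_nonlin:
 assumes s: "smooth_RT phi"
 shows "(LINT x|circle. nonlin (S_fun psi n (%k t. rc (u t) k)) (t, x) * phi (t, x))
  = 2 * pi * (\<Sum>xi\<in>symF (3 * 2 ^ Suc n). th phi xi t * gf 1 (2 ^ Suc n) (mv psi n v) xi t)"
proof -
 let ?K = "2 ^ Suc n :: nat"
 let ?b = "%k. cis (q k * t) * mv psi n v k t"
 have S: "S_fun psi n (%k t. rc (u t) k) (t, x) = trig ?b (symF ?K) x" for x
  unfolding S_fun_trig[OF psi] by (simp add: trig_def modes mv_def mult_ac)
 have z: "?b k = 0" if "\<bar>k\<bar> > int ?K" for k using mv_zero[OF psi, of n k v t] that by simp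
 have d: "((%y. phi (t, y)) has_vector_derivative dx phi (t, x)) (at x)" for x
  by (rule has_dx) (use smooth_RT_dxj_diff[OF s, of 0] in simp)
 have c: "continuous_on UNIV (%y. dx phi (t, y))" using cont_slice[OF continuous_funpow[OF s, of 0 1]] by simp
 have "(LINT x|circle. nonlin (S_fun psi n (%k t. rc (u t) k)) (t, x) * phi (t, x)) =
  (LINT x|circle. 6 * ((trig ?b (symF ?K) x)^2 - P0 (%y. (trig ?b (symF ?K) y)^2)) * trig (%k. \<i> * of_int k * ?b k) (symF ?K) x * phi (t, x))"
  unfolding nonlin_def dx_def prod.case S vector_derivative_at[OF has_vector_derivative_trig] ..
 also have "... = 2 * pi * (\<Sum>xi\<in>symF (3 * ?K). nlm ?b ?K xi * fc (%x. phi (t, x)) (-xi))"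
  by (rule integral_nonlin[OF z d c smooth_RT_periodic[OF s, of 0, unfolded funpow_0]])
 finally show ?thesis unfolding nlm_gf[of q, OF qsym_om qsym_neg] th_def md_def by (simp add: mult_ac)
qed

text \<open>One frequency at a time the truncated terms converge by \<open>tested_limit\<close>;
  \<open>tested_bound\<close> with the decay of test functions dominates them, so
  \<open>sym_tannery\<close> permits summation over xi; and the sum of the limits is the linear side
  of the equation tested with phi.\<close>

lemma is_N_f: "is_N psi f L" unfolding is_N_def
proof (intro conjI distribution_L exI ballI, rule fourier_modes_f)
 fix phi assume phi: "phi \<in> test_RT"
 obtain r0 where s: "smooth_RT phi" and r0: "supp_within phi (-r0) r0" using phi unfolding test_RT_def by blast
 \<comment> \<open>The margin 1 makes \<open>th\<close> vanish at both ends, as the integration by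
   parts in \<open>tested_limit\<close> requires.\<close>
 define r where "r = max r0 0 + 1"
 have r: "r > 0" "r0 < r" unfolding r_def by auto
 have sr: "supp_within phi (-r) r" by (rule supp_within_mono[OF r0]) (use r in simp)
 have out: "th phi xi t = 0" "th' phi xi t = 0" if "t \<notin> {-r0..r0}" for xi t
  using supp_within_md[OF r0 that] supp_within_md[OF supp_within_dt[OF r0] that] by (auto simp: th_def th'_def)
 have outr: "th phi xi t = 0" "th' phi xi t = 0" if "t \<notin> {-r..r}" for xi t by (rule out; use that r in auto)+
 have ends: "th phi xi (-r) = 0" "th phi xi r = 0" for xi by (rule out; use r in auto)+
 note d = th_deriv[OF s] and c' = th'_cont[OF s]
 have c: "continuous_on S (th phi xi)" for S xi by (rule vector_derivative_continuous_on[OF d])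
 obtain B where B: "B >= 1" "!!x. \<bar>psi x\<bar> <= B" using cutoff_bounded[OF psi] by blast
 \<comment> \<open>Order 7 of decay: q costs three powers in \<open>th'\<close>,
   \<open>tested_bound\<close> costs two, and two are left for the sum over xi.\<close>
 obtain C where C: "C >= 0" and C1: "!!t k. t \<in> {-r..r} ==> mag k ^ 7 * norm (md phi k t) <= C"
   "!!t k. t \<in> {-r..r} ==> mag k ^ 7 * norm (md (dt phi) k t) <= C" using test_md_decay[OF s, of r 7] by metis
 define I where "I n xi = integral {-r..r} (%t. th phi xi t * gf 1 (2 ^ Suc n) (mv psi n v) xi t)" for n xi
 define g where "g n xi = (if xi \<in> symF (3 * 2 ^ Suc n) then 2 * pi * I n xi else 0)" for n xi
 define l where "l xi = - (2 * pi * (of_real sg * integral {-r..r} (%t. th' phi xi t * v xi t)))" for xi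
 define K where "K = (12 * r * (B * R) ^ 3 + 2 * B ^ 3 * (2 + 2 * r) * (48 * zeta0) * cst (2 * r) R (Mh R))"
 define Q where "Q = 2 + 6 * \<bar>P\<bar>"
 show "(%n. distr_of (nonlin (S_fun psi n (%k t. rc (u t) k))) phi) ----> L phi" proof (rule sym_tannery)
  show "norm (g n xi) <= (2 * pi * (\<bar>K\<bar> * (Q * C))) / (real_of_int xi)^2" if xi: "xi ~= 0" for n xi proof -
   let ?x = "mag xi"
   have x1: "?x >= 1" using xi by linarith
   define A where "A = Q * C / ?x ^ 4"
   have qb: "\<bar>q xi\<bar> <= (1 + 6 * \<bar>P\<bar>) * ?x ^ 3" proof -
    have "\<bar>q xi\<bar> <= ?x ^ 3 + 6 * \<bar>P\<bar> * ?x"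
     unfolding qsym_def P_def[symmetric] using abs_triangle_ineq[of "real_of_int xi ^ 3" "sg * 6 * P * real_of_int xi"]
     by (simp add: abs_mult sigma power_abs)
    also have "... <= ?x ^ 3 + 6 * \<bar>P\<bar> * ?x ^ 3"
     using self_le_power[OF x1, of 3] by (intro add_left_mono mult_left_mono) auto
    finally show ?thesis by (simp add: algebra_simps)
   qed
   have m: "norm (md phi (-xi) t) <= C / ?x ^ 7" "norm (md (dt phi) (-xi) t) <= C / ?x ^ 7" if "t \<in> {-r..r}" for t
    using C1(1)[OF that, of "-xi"] C1(2)[OF that, of "-xi"] x1 by (auto simp: field_simps)
   have p: "?x ^ 3 * (C / ?x ^ 7) = C / ?x ^ 4" using x1 by (simp add: field_simps power_add[symmetric] del: power_even_abs_numeral power_even_abs)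
   have p1: "C / ?x ^ 7 <= C / ?x ^ 4" using x1 C by (intro divide_left_mono power_increasing) auto
   have QA: "(1 + 6 * \<bar>P\<bar>) * (C / ?x ^ 4) + C / ?x ^ 4 = A" by (simp add: A_def Q_def add_divide_distrib algebra_simps)
   have A1: "norm (th' phi xi t) <= A" if t: "t \<in> {-r..r}" for t proof -
    have "norm (th' phi xi t) <= \<bar>q xi\<bar> * norm (md phi (-xi) t) + norm (md (dt phi) (-xi) t)"
     unfolding th'_def norm_mult norm_cis using norm_triangle_ineq[of "\<i> * q xi * md phi (-xi) t" "md (dt phi) (-xi) t"]
     by (simp add: norm_mult)
    also have "... <= (1 + 6 * \<bar>P\<bar>) * ?x ^ 3 * (C / ?x ^ 7) + C / ?x ^ 7"
     by (intro add_mono mult_mono qb m t) auto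
    also have "(1 + 6 * \<bar>P\<bar>) * ?x ^ 3 * (C / ?x ^ 7) = (1 + 6 * \<bar>P\<bar>) * (C / ?x ^ 4)" by (simp only: mult.assoc p)
    finally show ?thesis using p1 QA by linarith
   qed
   have A0: "norm (th phi xi t) <= A" if t: "t \<in> {-r..r}" for t proof -
    have "norm (th phi xi t) <= C / ?x ^ 4" unfolding th_def norm_mult using m(1)[OF t] p1 by simp
    moreover have "0 <= (1 + 6 * \<bar>P\<bar>) * (C / ?x ^ 4)" using C by (intro mult_nonneg_nonneg) auto
    ultimately show ?thesis using QA by linarith
   qed
   have A: "A >= 0" using A0[of 0] r order_trans[OF norm_ge_zero] by fastforce
   have "norm (I n xi) <= K * ?x^2 * A"
    unfolding I_def K_def by (rule tested_bound[OF psi B sol sigma _ xi r(1) d A0 A1]) simp_all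
   also have "... <= \<bar>K\<bar> * ?x^2 * A" using A by (intro mult_right_mono) auto
   also have "... = \<bar>K\<bar> * (Q * C) / ?x^2" using x1 by (simp add: A_def field_simps power_add[symmetric])
   finally have "norm (I n xi) <= \<bar>K\<bar> * (Q * C) / (real_of_int xi)^2" by simp
   moreover have "norm (g n xi) <= 2 * pi * norm (I n xi)" unfolding g_def by (simp add: norm_mult)
   ultimately show ?thesis using mult_left_mono[of "norm (I n xi)" "\<bar>K\<bar> * (Q * C) / (real_of_int xi)^2" "2 * pi"] by simp
  qed
  show "(%n. g n xi) ----> l xi" for xi proof (cases "xi = 0")
   case True
   have "(%t. th' phi 0 t * v 0 t) = (%t. th' phi 0 t * v 0 0)" using limit_sol_0_const[OF sol, of _ 0] by metis
   moreover have "(th' phi 0 has_integral (th phi 0 r - th phi 0 (-r))) {-r..r}"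
    by (rule fundamental_theorem_of_calculus) (use r d in \<open>auto intro: has_vector_derivative_at_within\<close>)
   ultimately have "integral {-r..r} (%t. th' phi 0 t * v 0 t) = 0" by (simp add: ends integral_unique)
   then show ?thesis using True unfolding g_def l_def I_def by (simp add: gf_0)
  next
   case False
   have "(%n. 2 * pi * (of_real sg * integral {-r..r} (%t. th phi xi t * gf sg (2 ^ Suc n) (mv psi n v) xi t)))
     ----> 2 * pi * (of_real sg * - integral {-r..r} (%t. th' phi xi t * v xi t))"
    by (intro tendsto_mult_left tendsto_mult tendsto_const tested_limit[OF psi sol sigma False r(1) d ends c'])
   moreover have "integral {-r..r} (%t. th phi xi t * gf sg (2 ^ Suc n) (mv psi n v) xi t) = of_real sg * I n xi" for n
    unfolding I_def gf_sigma[of sg] by (simp add: mult.left_commute)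
   moreover have "of_real sg * (of_real sg * z) = z" for z :: complex using sigma_sq by (simp add: mult.assoc[symmetric])
   ultimately have "(%n. 2 * pi * I n xi) ----> l xi" by (simp only: l_def mult_minus_right mult.assoc)
   moreover have "\<forall>\<^sub>F n in sequentially. g n xi = 2 * pi * I n xi"
   proof (rule eventually_sequentiallyI[of "nat \<bar>xi\<bar>"])
    fix n assume n: "nat \<bar>xi\<bar> <= n"
    have "n < 2 ^ n" by (rule less_exp)
    then have "nat \<bar>xi\<bar> <= 3 * 2 ^ Suc n" using n unfolding power_Suc by linarith
    then have "\<bar>xi\<bar> <= int (3 * 2 ^ Suc n)" by linarith
    then show "g n xi = 2 * pi * I n xi" unfolding g_def by simp
   qed
   ultimately show ?thesis by (simp add: tendsto_cong)
  qed
  show "(%X. \<Sum>xi\<in>symF X. g n xi) ----> distr_of (nonlin (S_fun psi n (%k t. rc (u t) k))) phi" for n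
  proof (rule tendsto_eventually, rule eventually_sequentiallyI[of "3 * 2 ^ Suc n"])
   fix X :: nat assume X: "3 * 2 ^ Suc n <= X"
   let ?h = "%xi t. th phi xi t * gf 1 (2 ^ Suc n) (mv psi n v) xi t"
   have h: "integrable lborel (?h xi)" "(LINT t|lborel. ?h xi t) = I n xi" for xi
    unfolding I_def by (rule supp_integrable[of _ "-r" r]; use outr in \<open>auto intro!: continuous_intros c gf_mv_cont\<close>)+
   have "distr_of (nonlin (S_fun psi n (%k t. rc (u t) k))) phi = (LINT t|lborel. 2 * pi * (\<Sum>xi\<in>symF (3 * 2 ^ Suc n). ?h xi t))"
    unfolding distr_of_def inner_nonlin[OF s] ..
   also have "... = 2 * pi * (\<Sum>xi\<in>symF (3 * 2 ^ Suc n). I n xi)"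
    unfolding h(2)[symmetric] Bochner_Integration.integral_mult_right_zero
    by (subst Bochner_Integration.integral_sum) (use h(1) in auto)
   also have "... = (\<Sum>xi\<in>symF (3 * 2 ^ Suc n). g n xi)" unfolding g_def by (simp add: sum_distrib_left)
   also have "... = (\<Sum>xi\<in>symF X. g n xi)"
    by (rule sum.mono_neutral_left[OF _ symF_mono[OF X]]) (auto simp: g_def)
   finally show "(\<Sum>xi\<in>symF X. g n xi) = distr_of (nonlin (S_fun psi n (%k t. rc (u t) k))) phi" ..
  qed
  show "(%X. \<Sum>xi\<in>symF X. l xi) ----> L phi" proof -
   let ?J = "%Ps X. 2 * pi * (\<Sum>k\<in>symF X. LINT t|lborel. rc (u t) k * md Ps (-k) t)"
   have J: "(%X. of_real sg * (- ?J (dt phi) X - ?J ((dx ^^ 3) phi) X + of_real (sg * 6 * P) * ?J ((dx ^^ 1) phi) X)) ----> L phi"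
    unfolding L_eq by (intro tendsto_intros outer_integrable(2)[OF s sr disjI1[OF refl]] outer_integrable(2)[OF s sr disjI2[OF refl]])
   have mi: "integrable lborel (%t. rc (u t) k * md Ps (-k) t)" if Ps: "Ps = (dx ^^ j) phi \<or> Ps = dt phi" for Ps k j
   proof (rule supp_integrable(1)[of _ "-r" r])
    show "continuous_on UNIV (%t. rc (u t) k * md Ps (-k) t)"
     using Ps continuous_funpow[OF s, of 0 j] continuous_funpow[OF s, of 1 0] by (intro continuous_intros rc_cont md_continuous) auto
    show "rc (u t) k * md Ps (-k) t = 0" if "t \<notin> {-r..r}" for t
     using Ps supp_within_funpow[OF sr, of 0 j] supp_within_funpow[OF sr, of 1 0] supp_within_md[OF _ that, of Ps] by auto
   qed
   \<comment> \<open>Differentiating the phase in \<open>th'\<close> produces i q(k); its parts k^3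
     and 6 P k are the symbols that turn the mode of phi into those of its third and first
     x-derivatives.\<close>
   have e: "- (LINT t|lborel. rc (u t) k * md (dt phi) (-k) t) - (LINT t|lborel. rc (u t) k * md ((dx ^^ 3) phi) (-k) t)
     + of_real (sg * 6 * P) * (LINT t|lborel. rc (u t) k * md ((dx ^^ 1) phi) (-k) t) = - integral {-r..r} (%t. th' phi k t * v k t)" for k
   proof -
    have "integral {-r..r} (%t. th' phi k t * v k t) = (LINT t|lborel. th' phi k t * v k t)"
     by (rule supp_integrable(2)[of _ "-r" r, symmetric]) (use outr in \<open>auto intro!: continuous_intros c' v_cont\<close>)
    also have "... = (LINT t|lborel. rc (u t) k * md (dt phi) (-k) t + rc (u t) k * md ((dx ^^ 3) phi) (-k) t
      - of_real (sg * 6 * P) * (rc (u t) k * md ((dx ^^ 1) phi) (-k) t))" unfolding md_dx[OF s] modes th'_def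
     by (intro Bochner_Integration.integral_cong refl) (simp add: qsym_def P_def power3_eq_cube algebra_simps)
    also have "... = (LINT t|lborel. rc (u t) k * md (dt phi) (-k) t) + (LINT t|lborel. rc (u t) k * md ((dx ^^ 3) phi) (-k) t)
      - (LINT t|lborel. of_real (sg * 6 * P) * (rc (u t) k * md ((dx ^^ 1) phi) (-k) t))"
     by (subst Bochner_Integration.integral_diff) (auto intro!: mi integrable_mult_right Bochner_Integration.integrable_add Bochner_Integration.integral_add simp del: funpow.simps)
    finally show ?thesis unfolding Bochner_Integration.integral_mult_right_zero
     by (simp only: diff_conv_add_uminus minus_add_distrib minus_minus)
   qed
   have "(\<Sum>xi\<in>symF X. l xi) = of_real sg * (- ?J (dt phi) X - ?J ((dx ^^ 3) phi) X + of_real (sg * 6 * P) * ?J ((dx ^^ 1) phi) X)" for X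
   proof -
    have "(\<Sum>xi\<in>symF X. l xi) = 2 * pi * (of_real sg :: complex) * (\<Sum>k\<in>symF X. - integral {-r..r} (%t. th' phi k t * v k t))"
     unfolding l_def by (simp add: sum_distrib_left mult.assoc)
    then show ?thesis unfolding e[symmetric] sum.distrib sum_subtractf sum_negf sum_distrib_left[symmetric]
     by (simp add: algebra_simps)
   qed
   then show ?thesis using J by simp
  qed
 qed
qed

text \<open>Replacing g by its partial sums gives finite sums of continuous modes, and the error is
  uniform in time because the L2 norm of u is bounded uniformly in time.\<close>

lemma weakly_continuous: "u \<in> Cw_L2T"
proof -
 have "continuous_on UNIV (%t. LINT x|circle. u t x * g x)" if g: "g \<in> L2T" for g proof -
  let ?h = "%n t. LINT x|circle. u t x * psum (rc g) n x"
  have "?h n t = Re (2 * pi * (\<Sum>k\<in>symF n. rc g k * rc (u t) (-k)))" for n t proof -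
   have "complex_of_real (?h n t) = (LINT x|circle. of_real (u t x) * trig (rc g) (symF n) x)"
    unfolding integral_complex_of_real[symmetric] of_real_mult psum_def trig_real[of "rc g", OF rc_neg] ..
   also have "... = 2 * pi * (\<Sum>k\<in>symF n. rc g k * rc (u t) (-k))"
    by (subst integral_mult_trig[OF L2T_integrable_c[OF uL]]) (simp_all add: rc_def)
   finally show ?thesis by (metis Re_complex_of_real)
  qed
  then have c: "continuous_on UNIV (?h n)" for n by (simp only:) (intro continuous_intros rc_cont)
  have lim: "(%n. sqrt (2 * pi) * R * rem g n) ----> sqrt (2 * pi) * R * 0" by (intro tendsto_intros L2T_psum_tendsto g)
  have b: "\<bar>(LINT x|circle. u t x * g x) - ?h n t\<bar> <= sqrt (2 * pi) * R * rem g n" for n t proof -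
   have "(LINT x|circle. u t x * g x) - ?h n t = (LINT x|circle. u t x * (g x - psum (rc g) n x))"
    by (subst Bochner_Integration.integral_diff[symmetric]) (auto intro!: L2T_prod uL g psum_L2T simp: algebra_simps)
   also have "\<bar>...\<bar> <= L2T_norm (u t) * rem g n" by (rule L2T_Cauchy_Schwarz[OF uL L2T_diff[OF g psum_L2T]])
   also have "... <= sqrt (2 * pi) * R * rem g n" by (intro mult_right_mono uL_norm) (simp add: L2T_norm_def)
   finally show ?thesis .
  qed
  have "uniform_limit UNIV ?h (%t. LINT x|circle. u t x * g x) sequentially" proof (rule uniform_limitI)
   fix e :: real assume "e > 0"
   then have "\<forall>\<^sub>F n in sequentially. sqrt (2 * pi) * R * rem g n < e"
    using order_tendstoD(2)[OF lim, of e] by simp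
   then show "\<forall>\<^sub>F n in sequentially. \<forall>t\<in>UNIV. dist (?h n t) (LINT x|circle. u t x * g x) < e"
    by eventually_elim (use b in \<open>auto simp: dist_real_def abs_minus_commute intro: le_less_trans\<close>)
  qed
  then show ?thesis by (rule uniform_limit_theorem[rotated]) (simp_all add: c)
 qed
 then show ?thesis using uL by (simp add: Cw_L2T_def)
qed

end

section \<open>Plancherel's inequality\<close>

text \<open>The function g is not assumed periodic, since it will be one window of a function on the
  line. Folding the line by p makes real and imaginary part periodic without changing them on the
  circle. Adding the coefficients at k and -k cancels the mixed terms of the two parts.\<close>

lemma bessel_c:
 assumes g: "continuous_on UNIV g"
 shows "2 * pi * msq n (fc g) <= (LINT x|circle. (norm (g x))^2)"
proof -
 define p where "p x = x - 2 * pi * real_of_int \<lfloor>x / (2 * pi)\<rfloor>" for x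
 have p: "p x = x" if "x \<in> {0..<2*pi}" for x proof -
  have "\<lfloor>x / (2 * pi)\<rfloor> = 0" using that by (intro floor_unique) (auto simp: field_simps)
  then show ?thesis by (simp add: p_def)
 qed
 have pp: "p (x + 2 * pi) = p x" for x unfolding p_def by (simp add: add_divide_distrib algebra_simps)
 have pm: "p \<in> borel_measurable borel" unfolding p_def by measurable
 have L: "(%x. h (p x)) \<in> L2T" if h: "continuous_on UNIV h" for h :: "real => real" proof -
  have "integrable circle (%x. (h x)^2)" by (intro integrable_circle_continuous continuous_intros h)
  then have "integrable circle (%x. (h (p x))^2)"
   by (rule Bochner_Integration.integrable_cong[THEN iffD1, rotated -1]) (simp_all add: p)
  then show ?thesis using measurable_compose[OF pm continuous_imp_borel[OF h]] by (simp add: L2T_def periodic_def pp)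
 qed
 let ?a = "%x. Re (g (p x))" and ?b = "%x. Im (g (p x))"
 have ab: "?a \<in> L2T" "?b \<in> L2T" by (rule L; intro continuous_intros g)+
 have "fc g k = fc (%x. 1 * of_real (?a x) + \<i> * of_real (?b x)) k" for k
  unfolding fc_eq by (intro arg_cong2[of _ _ _ _ "(/)"] Bochner_Integration.integral_cong refl)
   (simp add: p complex_eq[symmetric])
 then have e: "fc g k = rc ?a k + \<i> * rc ?b k" for k
  using fc_lin[OF L2T_integrable_c[OF ab(1)] L2T_integrable_c[OF ab(2)], of 1 \<i>] by (simp add: rc_def)
 have two: "(norm (fc g k))^2 + (norm (fc g (-k)))^2 = 2 * ((norm (rc ?a k))^2 + (norm (rc ?b k))^2)" for k
  unfolding e rc_neg cmod_power2 by (simp add: power2_eq_square algebra_simps)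
 have "(\<Sum>k\<in>symF n. (norm (fc g (-k)))^2) = msq n (fc g)"
  by (rule sum.reindex_bij_witness[of _ uminus uminus]) auto
 then have "2 * msq n (fc g) = (\<Sum>k\<in>symF n. (norm (fc g k))^2 + (norm (fc g (-k)))^2)"
  by (simp add: sum.distrib)
 then have "msq n (fc g) = msq n (rc ?a) + msq n (rc ?b)" unfolding two sum_distrib_left[symmetric] sum.distrib by simp
 then have "2 * pi * msq n (fc g) <= (LINT x|circle. (?a x)^2) + (LINT x|circle. (?b x)^2)"
  using bessel[OF ab(1), of n] bessel[OF ab(2), of n] by (simp add: distrib_left)
 also have "... = (LINT x|circle. (?a x)^2 + (?b x)^2)"
  using ab by (intro Bochner_Integration.integral_add[symmetric]) (simp_all add: L2T_def)
 also have "... = (LINT x|circle. (norm (g x))^2)"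
  by (rule Bochner_Integration.integral_cong) (simp_all add: p cmod_power2)
 finally show ?thesis .
qed

definition ft :: "(real => complex) => real => complex" where
 "ft h tau = (LINT t|lborel. h t * cis (- t * tau))"

lemma ft_HK:
 assumes "continuous_on UNIV h" "!!t. t \<notin> {a..b} ==> h t = 0"
 shows "ft h tau = integral {a..b} (%t. h t * cis (- t * tau))"
 unfolding ft_def by (rule supp_integrable(2)) (use assms in \<open>auto intro!: continuous_intros\<close>)

lemma ft_continuous:
 assumes h: "continuous_on UNIV h" "!!t. t \<notin> {a..b} ==> h t = 0"
 shows "continuous_on UNIV (ft h)"
proof -
 have "ft h = (%tau. integral (cbox a b) (%t. h t * cis (- t * tau)))" using ft_HK[OF h] by auto
 then show ?thesis
  by (simp only:) (intro integral_continuous_on_param, auto simp: case_prod_unfold intro!: continuous_intros continuous_on_compose2[OF h(1)])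
qed

lemma ft_shift_diff:
 assumes h: "continuous_on UNIV h" "!!t. t \<notin> {a..b} ==> h t = 0"
 shows "ft (%t. h (t + s) - h t) tau = (cis (s * tau) - 1) * ft h tau"
proof -
 have i: "integrable lborel (%t. h t * cis (- t * tau))"
  by (rule supp_integrable(1)[of _ a b]) (use h in \<open>auto intro!: continuous_intros\<close>)
 have j: "integrable lborel (%t. h (t + s) * cis (- t * tau))" proof (rule supp_integrable(1)[of _ "a - s" "b - s"])
  show "continuous_on UNIV (%t. h (t + s) * cis (- t * tau))" by (intro continuous_intros continuous_on_compose2[OF h(1)]) auto
  show "h (t + s) * cis (- t * tau) = 0" if "t \<notin> {a - s..b - s}" for t using h(2)[of "t + s"] that by auto
 qed
 have c: "cis (s * tau) * cis (- (s + t) * tau) = cis (- t * tau)" for t by (simp add: cis_mult algebra_simps)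
 have "ft h tau = (LINT t|lborel. h (s + 1 * t) * cis (- (s + 1 * t) * tau))"
  unfolding ft_def by (subst lborel_integral_real_affine[of 1 _ s]) simp_all
 then have "cis (s * tau) * ft h tau = (LINT t|lborel. cis (s * tau) * (h (s + t) * cis (- (s + t) * tau)))" by simp
 also have "... = (LINT t|lborel. h (t + s) * cis (- t * tau))" unfolding mult.left_commute[of "cis (s * tau)"] c by (simp add: add.commute)
 finally show ?thesis unfolding ft_def left_diff_distrib using i j by simp
qed

lemma nn_integral_unit_pieces:
 fixes g :: "real => ennreal"
 assumes g: "g \<in> borel_measurable borel" and b: "!!n ta. (\<Sum>k\<in>symF n. g (of_int k + ta)) <= C"
 shows "(\<integral>\<^sup>+ tau. g tau \<partial>lborel) <= C"
proof -
 let ?I = "%n tau. g tau * indicator {- real n..<real n + 1} tau"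
 have b': "(\<integral>\<^sup>+ tau. ?I n tau \<partial>lborel) <= C" for n proof -
  have u: "indicator {- real n..<real n + 1} tau = (\<Sum>k\<in>symF n. indicator {0..<1} (tau - of_int k) :: ennreal)" for tau
  proof -
   have "(\<Sum>k\<in>symF n. indicator {0..<1} (tau - of_int k) :: ennreal) = (\<Sum>k\<in>symF n. if k = \<lfloor>tau\<rfloor> then 1 else 0)"
    by (intro sum.cong refl) (auto simp: indicator_def floor_eq_iff, linarith+)
   moreover have "\<bar>\<lfloor>tau\<rfloor>\<bar> <= int n \<longleftrightarrow> tau \<in> {- real n..<real n + 1}"
    unfolding abs_le_iff atLeastLessThan_iff by linarith
   ultimately show ?thesis by (simp add: indicator_def)
  qed
  have m: "(%tau. g tau * indicator {0..<1} (tau - of_int k)) \<in> borel_measurable lborel" for k :: int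
   using g by measurable
  have mk: "(%tau. g (of_int k + tau)) \<in> borel_measurable lborel" for k :: int
   using measurable_compose[OF _ g, of "%tau. of_int k + tau" borel] by measurable
  have "(\<integral>\<^sup>+ tau. ?I n tau \<partial>lborel) = (\<Sum>k\<in>symF n. \<integral>\<^sup>+ tau. g tau * indicator {0..<1} (tau - of_int k) \<partial>lborel)"
   unfolding u sum_distrib_left by (rule nn_integral_sum[OF m])
  also have "... = (\<Sum>k\<in>symF n. \<integral>\<^sup>+ tau. g (of_int k + tau) * indicator {0..<1} tau \<partial>lborel)"
  proof (rule sum.cong[OF refl])
   fix k
   show "(\<integral>\<^sup>+ tau. g tau * indicator {0..<1} (tau - of_int k) \<partial>lborel) = (\<integral>\<^sup>+ tau. g (of_int k + tau) * indicator {0..<1} tau \<partial>lborel)"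
    by (subst nn_integral_real_affine[where c = 1 and t = "of_int k"]) (use m[of k] in simp_all)
  qed
  also have "... = (\<integral>\<^sup>+ tau. (\<Sum>k\<in>symF n. g (of_int k + tau)) * indicator {0..<1} tau \<partial>lborel)"
   unfolding sum_distrib_right by (rule nn_integral_sum[symmetric]) (intro borel_measurable_times_ennreal mk, simp)
  also have "... <= (\<integral>\<^sup>+ tau. C * indicator {0..<1::real} tau \<partial>lborel)"
   by (intro nn_integral_mono mult_right_mono b) simp
  also have "... = C" by (simp add: nn_integral_cmult_indicator)
  finally show ?thesis .
 qed
 have "(%n. \<integral>\<^sup>+ tau. ?I n tau \<partial>lborel) ----> (\<integral>\<^sup>+ tau. g tau \<partial>lborel)"
 proof (rule nn_integral_LIMSEQ)
  show "incseq ?I" by (auto simp: incseq_def le_fun_def indicator_def)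
  show "?I n \<in> borel_measurable lborel" for n using g by simp
  show "(%n. ?I n tau) ----> g tau" for tau proof (rule tendsto_eventually)
   obtain n0 where n0: "\<bar>tau\<bar> < real n0" using reals_Archimedean2 by blast
   show "\<forall>\<^sub>F n in sequentially. ?I n tau = g tau"
    by (rule eventually_sequentiallyI[of n0]) (use n0 in \<open>auto simp: indicator_def\<close>)
  qed
 qed
 then show ?thesis by (rule LIMSEQ_le_const2) (use b' in blast)
qed

abbreviation nsq :: "(real => complex) => ennreal" where
 "nsq f \<equiv> (\<integral>\<^sup>+ tau. ennreal ((norm (f tau))^2) \<partial>lborel)"

text \<open>Bessel's inequality for \<open>h\<close> modulated by \<open>ta\<close> bounds the sum of $|\hat h|^2$ over the integers shifted by
 \<open>ta\<close>; integration over \<open>ta\<close> in the unit interval gives the inequality.\<close>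

lemma plancherel_le:
 assumes h: "continuous_on UNIV h" "!!t. t \<notin> {c..c + 2 * pi} ==> h t = 0"
 shows "nsq (ft h) <= ennreal (2 * pi * integral {c..c + 2 * pi} (%t. (norm (h t))^2))"
proof (rule nn_integral_unit_pieces)
 show "(%tau. ennreal ((norm (ft h tau))^2)) \<in> borel_measurable borel"
  using continuous_imp_borel[OF ft_continuous[OF h]] by measurable
 fix n ta
 define g where "g x = h (c + x) * cis (- ta * x)" for x
 have hc: "continuous_on UNIV (%x. h (c + x))" by (intro continuous_on_compose2[OF h(1)] continuous_intros) auto
 have gc: "continuous_on UNIV g" unfolding g_def by (intro continuous_intros hc)
 have cv: "integral {c..c + 2 * pi} F = integral {0..2 * pi} (%x. F (c + x))" for F :: "real => 'b::real_normed_vector"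
  using integral_shift_real_ivl[where a = c and b = "c + 2 * pi" and c = c and f = F] by (simp add: add.commute)
 have e: "norm (ft h (of_int k + ta)) = 2 * pi * norm (fc g k)" for k proof -
  let ?tau = "of_int k + ta"
  have "ft h ?tau = integral {0..2 * pi} (%x. h (c + x) * cis (- (c + x) * ?tau))"
   using cv[of "%t. h t * cis (- t * ?tau)"] ft_HK[of h c "c + 2 * pi" ?tau] h by simp
  also have "... = integral {0..2 * pi} (%x. cis (- c * ?tau) * (g x * cis (- of_int k * x)))"
   unfolding g_def by (intro Henstock_Kurzweil_Integration.integral_cong) (simp add: cis_mult algebra_simps)
  also have "... = cis (- c * ?tau) * (LINT x|circle. g x * cis (- of_int k * x))"
   by (subst integral_circle_HK) (auto intro!: continuous_intros gc)
  finally show ?thesis by (simp add: fc_eq norm_mult norm_divide)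
 qed
 have "(\<Sum>k\<in>symF n. ennreal ((norm (ft h (of_int k + ta)))^2)) = ennreal (\<Sum>k\<in>symF n. (2 * pi * norm (fc g k))^2)"
  unfolding e by (rule sum_ennreal) simp
 also have "(\<Sum>k\<in>symF n. (2 * pi * norm (fc g k))^2) = 2 * pi * (2 * pi * msq n (fc g))"
  unfolding power_mult_distrib sum_distrib_left[symmetric] by (simp add: power2_eq_square)
 also have "... <= 2 * pi * (LINT x|circle. (norm (g x))^2)" by (intro mult_left_mono bessel_c gc) simp
 also have "(LINT x|circle. (norm (g x))^2) = integral {0..2 * pi} (%x. (norm (h (c + x)))^2)"
  by (subst integral_circle_HK) (auto intro!: continuous_intros gc hc simp: g_def norm_mult)
 also have "... = integral {c..c + 2 * pi} (%t. (norm (h t))^2)" by (rule cv[symmetric])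
 finally show "(\<Sum>k\<in>symF n. ennreal ((norm (ft h (of_int k + ta)))^2)) <= ennreal (2 * pi * integral {c..c + 2 * pi} (%t. (norm (h t))^2))"
  by (simp add: ennreal_leI)
qed

section \<open>Cutoffs\<close>

lemma cutoff_lipschitz:
 assumes psi: "cutoff psi"
 obtains M where "M >= 0" "!!x y. \<bar>psi x - psi y\<bar> <= M * \<bar>x - y\<bar>"
proof -
 have s: "!!n x. (vderiv ^^ n) psi differentiable (at x)" and z: "!!x. \<bar>x\<bar> > 3/2 ==> psi x = 0"
  using psi unfolding cutoff_def smooth1_def by blast+
 have "vderiv psi differentiable (at x)" for x using s[of 1 x] by simp
 then have c: "continuous_on {-2..2} (vderiv psi)"
  by (meson continuous_at_imp_continuous_on differentiable_imp_continuous_within)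
 have d: "(psi has_real_derivative vderiv psi x) (at x)" for x
  using s[of 0 x] vector_derivative_works[of psi "at x"] by (simp add: vderiv_def has_real_derivative_iff_has_vector_derivative)
 have "bounded (vderiv psi ` {-2..2})" by (intro compact_imp_bounded compact_continuous_image c compact_Icc)
 then obtain M where M: "!!x. x \<in> {-2..2} ==> norm (vderiv psi x) <= M" unfolding bounded_iff by blast
 have M0: "M >= 0" using order_trans[OF norm_ge_zero M[of 0]] by simp
 have b: "norm (vderiv psi x) <= M" for x proof (cases "x \<in> {-2..2}")
  case False
  have "((%_. 0) has_real_derivative 0) (at x)" by simp
  then have "(psi has_real_derivative 0) (at x)"
   by (rule has_field_derivative_transform_within_open[where S = "- {-2..2}"]) (use z False in \<open>auto intro!: open_Compl\<close>)
  then have "vderiv psi x = 0" using DERIV_unique[OF d] by blast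
  then show ?thesis using M0 by simp
 qed (use M in auto)
 have "norm (psi x - psi y) <= M * norm (x - y)" for x y
  by (rule field_differentiable_bound[of UNIV psi "vderiv psi"]) (use d b in auto)
 then show ?thesis using that M0 by simp
qed

lemma eta_supp_upper:
 assumes psi: "cutoff psi" and "\<bar>x\<bar> > 3/2 * 2 ^ k" shows "eta psi k x = 0"
proof -
 have z: "!!x. \<bar>x\<bar> > 3/2 ==> psi x = 0" using psi unfolding cutoff_def by blast
 have 1: "2 powr (- real k) * \<bar>x\<bar> > 3/2" using assms(2) by (simp add: powr_minus powr_realpow field_simps)
 then have "\<bar>2 powr (- real k) * x\<bar> > 3/2" "\<bar>2 powr (- real k + 1) * x\<bar> > 3/2"
  unfolding powr_add by (auto simp: abs_mult)
 then show ?thesis using 1 unfolding eta_def by (cases "k = 0") (simp_all add: z)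
qed

lemma eta_supp_lower:
 assumes psi: "cutoff psi" and k: "k ~= 0" "\<bar>x\<bar> <= 5/8 * 2 ^ k" shows "eta psi k x = 0"
proof -
 have z: "!!x. \<bar>x\<bar> <= 5/4 ==> psi x = 1" using psi unfolding cutoff_def by blast
 have 1: "2 powr (- real k) * \<bar>x\<bar> <= 5/8" using k(2) by (simp add: powr_minus powr_realpow field_simps)
 then have "\<bar>2 powr (- real k) * x\<bar> <= 5/4" "\<bar>2 powr (- real k + 1) * x\<bar> <= 5/4"
  unfolding powr_add by (auto simp: abs_mult)
 then show ?thesis using k unfolding eta_def by (simp add: z)
qed

lemma eta_bound:
 assumes B: "!!x. \<bar>psi x\<bar> <= B" "B >= 1" shows "\<bar>eta psi k x\<bar> <= 2 * B"
 using B(1)[of x] B(1)[of "2 powr (- real k) * x"] B(1)[of "2 powr (- real k + 1) * x"] B(2)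
 unfolding eta_def by (auto simp: abs_le_iff)

lemma eta_even: "cutoff psi ==> eta psi k (-x) = eta psi k x" unfolding eta_def cutoff_def by simp

text \<open>$e^{i 2^{-j} x} - 1$ is the multiplier of the difference with step $2^{-j}$.\<close>

lemma eta_difference:
 assumes psi: "cutoff psi" and j: "j ~= 0" and x: "eta psi j x ~= 0"
 shows "(norm (cis (x / 2 ^ j) - 1))^2 >= 2 - 2 * cos (5/8)"
proof -
 let ?y = "\<bar>x\<bar> / 2 ^ j"
 have "\<bar>x\<bar> <= 3/2 * 2 ^ j" "5/8 * 2 ^ j < \<bar>x\<bar>" using eta_supp_upper[OF psi] eta_supp_lower[OF psi j] x by (meson not_le)+
 then have y: "5/8 <= ?y" "?y <= 3/2" by (auto simp: field_simps)
 have "cos ?y <= cos (5/8)" by (rule cos_monotone_0_pi_le) (use y pi_gt3 in linarith)+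
 moreover have "cos ?y = cos (x / 2 ^ j)" by (metis abs_divide abs_numeral cos_abs_real power_abs)
 moreover have "(norm (cis (x / 2 ^ j) - 1))^2 = 2 - 2 * cos (x / 2 ^ j)" proof -
  have "(cos (x / 2 ^ j))^2 + (sin (x / 2 ^ j))^2 = 1" by simp
  then show ?thesis unfolding cmod_power2 by (simp add: power2_diff)
 qed
 ultimately show ?thesis by simp
qed

lemma cos_58: "2 - 2 * cos (5/8 :: real) > 0" using cos_monotone_0_pi[of 0 "5/8"] pi_gt3 by simp

section \<open>Membership in the function spaces\<close>

text \<open>The multiplication formula. It connects \<open>fourier_st\<close>, which is defined by
  duality, with the explicit transform of the localized profile.\<close>

lemma ft_swap:
 assumes h: "continuous_on UNIV h" "!!t. t \<notin> {a..b} ==> h t = 0"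
  and k: "continuous_on UNIV k" "!!t. t \<notin> {c..d} ==> k t = 0"
 shows "(LINT t|lborel. h t * ft k t) = (LINT t|lborel. ft h t * k t)"
proof -
 have fh: "ft h tau = integral {a..b} (%t. h t * cis (- t * tau))" for tau by (rule ft_HK) (use h in auto)
 have "(LINT t|lborel. h t * ft k t) = integral {a..b} (%t. h t * ft k t)"
  by (rule supp_integrable(2)) (use h in \<open>auto intro!: continuous_intros ft_continuous[OF k]\<close>)
 also have "... = integral (cbox a b) (%t. integral (cbox c d) (%tau. h t * (k tau * cis (- tau * t))))"
  using ft_HK[of k c d] k by simp
 also have "... = integral (cbox c d) (%tau. integral (cbox a b) (%t. h t * (k tau * cis (- tau * t))))"
  by (rule integral_swap_continuous)
   (auto simp: case_prod_unfold intro!: continuous_intros continuous_on_compose2[OF h(1)] continuous_on_compose2[OF k(1)])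
 also have "... = integral (cbox c d) (%tau. ft h tau * k tau)" proof (rule Henstock_Kurzweil_Integration.integral_cong)
  fix tau
  have "h t * (k tau * cis (- tau * t)) = k tau * (h t * cis (- t * tau))" for t by (simp add: mult_ac)
  then show "integral (cbox a b) (%t. h t * (k tau * cis (- tau * t))) = ft h tau * k tau"
   by (simp only: fh integral_mult_right cbox_interval mult.commute[of "integral _ _"])
 qed
 also have "... = (LINT t|lborel. ft h t * k t)"
  unfolding cbox_interval by (rule supp_integrable(2)[symmetric]) (use k in \<open>auto intro!: continuous_intros ft_continuous[OF h]\<close>)
 finally show ?thesis .
qed

lemma supp_integral_le:
 fixes F :: "real => real"
 assumes F: "continuous_on UNIV F" "!!t. t \<notin> {a..b} ==> F t = 0" "!!t. t \<notin> {c..d} ==> F t = 0"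
  and M: "!!t. F t <= M" and ab: "a <= b"
 shows "integral {c..d} F <= M * (b - a)"
proof -
 have "integral {c..d} F = integral {a..b} F" using supp_integrable(2)[of F a b] supp_integrable(2)[of F c d] F by simp
 also have "... <= integral {a..b} (%_. M)"
  by (rule integral_le) (use M F in \<open>auto intro: integrable_continuous_real continuous_on_subset\<close>)
 finally show ?thesis using ab by (simp add: mult.commute)
qed

lemma norm_md_seminorm:
 assumes "phi \<in> schwartz_RT" shows "norm (md phi k t) <= seminorm_RT 0 0 0 phi"
proof -
 have s: "smooth_RT phi" and "bounded (range (%p. of_real (fst p) ^ 0 * (dt ^^ 0) ((dx ^^ 0) phi) p))"
  using assms unfolding schwartz_RT_def by blast+
 then have "bdd_above (range (%p. norm (phi p)))" unfolding bounded_iff bdd_above_def by auto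
 from cSUP_upper[OF UNIV_I this] have "norm (phi p) <= seminorm_RT 0 0 0 phi" for p by (simp add: seminorm_RT_def)
 then show ?thesis by (intro norm_md_le) (use continuous_funpow[OF s, of 0 0] in auto)
qed

lemma md_lin:
 assumes "continuous_on UNIV phi" "continuous_on UNIV rho"
 shows "md (lc a b phi rho) k t = a * md phi k t + b * md rho k t"
 unfolding md_def by (rule fc_lin) (intro integrable_circle_continuous cont_slice assms)+

lemma powr_nat: "2 powr real k = 2 ^ k" by (simp add: powr_realpow)

lemma esqrt_le:
 assumes "x <= ennreal e" "e >= 0" shows "esqrt x <= ennreal (sqrt e)"
proof -
 have "x ~= top" using assms(1) by (auto simp: top_unique)
 moreover have "enn2real x <= e" using enn2real_mono[OF assms(1)] assms(2) by simp
 ultimately show ?thesis unfolding esqrt_def by (auto intro!: ennreal_leI)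
qed

lemma plancherel_sum:
 assumes F: "finite F" and W: "!!xi. continuous_on UNIV (W xi)" "!!xi t. t \<notin> {a..b} ==> W xi t = 0"
  and ab: "a <= b" "b <= a + 2 * pi" and m: "!!t. (\<Sum>xi\<in>F. (norm (W xi t))^2) <= m"
 shows "(\<Sum>xi\<in>F. nsq (ft (W xi))) <= ennreal (2 * pi * (m * (b - a)))"
proof -
 let ?n = "%xi t. (norm (W xi t))^2"
 have W': "W xi t = 0" if "t \<notin> {a..a + 2 * pi}" for xi t using W(2)[of t xi] that ab by auto
 have "(\<Sum>xi\<in>F. nsq (ft (W xi))) <= (\<Sum>xi\<in>F. ennreal (2 * pi * integral {a..a + 2 * pi} (?n xi)))"
  by (intro sum_mono plancherel_le W W')
 also have "... = ennreal (\<Sum>xi\<in>F. 2 * pi * integral {a..a + 2 * pi} (?n xi))"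
  by (rule sum_ennreal) (simp add: integral_nonneg integrable_continuous_real continuous_on_subset[OF W(1)] continuous_intros)
 also have "(\<Sum>xi\<in>F. 2 * pi * integral {a..a + 2 * pi} (?n xi)) = 2 * pi * integral {a..a + 2 * pi} (%t. \<Sum>xi\<in>F. ?n xi t)"
  unfolding sum_distrib_left[symmetric] by (subst Henstock_Kurzweil_Integration.integral_sum[OF F])
   (auto intro!: integrable_continuous_real continuous_intros continuous_on_subset[OF W(1)])
 also have "... <= 2 * pi * (m * (b - a))"
  by (intro mult_left_mono supp_integral_le) (use W W' ab m in \<open>auto intro!: continuous_intros sum.neutral\<close>)
 finally show ?thesis by (simp add: ennreal_leI)
qed

lemma suminf_geometric_ennreal:
 assumes "A >= 0" "0 < r" "r < 1" shows "(\<Sum>j. ennreal (A * r ^ j)) = ennreal (A * (1 / (1 - r)))"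
 by (rule suminf_ennreal_eq) (use assms sums_mult[OF geometric_sums[of r], of A] in auto)

section \<open>Extensions of the frequency pieces and their modulation\<close>

context wsol
begin

definition ch :: "nat => real => real => complex" where "ch k t0 t = of_real (psi (2 ^ k * (t - t0)))"

text \<open>The competitor in the infimum of \<open>Fk_norm\<close>: the piece
  \<open>Delta psi k f\<close> times the cutoff psi(2^k (t - t0)), which is 1 on the interval of
  length 2^(1-k) around t0. Written with finitely many modes it makes sense on Schwartz functions,
  hence is tempered.\<close>

definition ext :: "nat => real => distr" where
 "ext k t0 phi = 2 * pi * (\<Sum>xi\<in>symF (2 ^ Suc k). of_real (eta psi k xi) * (LINT t|lborel. ch k t0 t * rc (u t) xi * md phi (-xi) t))"

lemma ch_cont: "continuous_on S (ch k t0)"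
 unfolding ch_def by (intro continuous_intros continuous_on_compose2[OF cutoff_continuous[OF psi, of UNIV]]) auto

lemma ch_supp: "t \<notin> {t0 - 3/2 / 2 ^ k..t0 + 3/2 / 2 ^ k} ==> ch k t0 t = 0"
proof -
 assume "t \<notin> {t0 - 3/2 / 2 ^ k..t0 + 3/2 / 2 ^ k}"
 then have "\<bar>t - t0\<bar> > 3/2 / 2 ^ k" by auto
 then have "\<bar>2 ^ k * (t - t0)\<bar> > 3/2" by (simp add: abs_mult pos_divide_less_eq mult.commute)
 then show ?thesis using psi unfolding cutoff_def ch_def by simp
qed

lemma Delta_modes:
 assumes phi: "phi \<in> test_RT"
 shows "Delta psi k f phi = 2 * pi * (\<Sum>xi\<in>symF (2 ^ Suc k). of_real (eta psi k xi) * (LINT t|lborel. rc (u t) xi * md phi (-xi) t))"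
proof -
 obtain r where s: "smooth_RT phi" and r: "supp_within phi (-r) r" using phi unfolding test_RT_def by blast
 let ?F = "symF (2 ^ Suc k)"
 have z: "eta psi k (of_int xi) = 0" if "xi \<notin> ?F" for xi proof (rule eta_supp_upper[OF psi])
  have "real_of_int (2 ^ Suc k) < real_of_int \<bar>xi\<bar>" using that unfolding of_int_less_iff by simp
  then have "2 * 2 ^ k < mag xi" by simp
  then show "3/2 * 2 ^ k < mag xi" using zero_less_power[of "2::real" k] by linarith
 qed
 have m: "mult_fun (%xi. eta psi k (- xi)) phi (t, x) = trig (%xi. of_real (eta psi k xi) * md phi xi t) ?F x" for t x
 proof -
  have "mult_fun (%xi. eta psi k (- xi)) phi (t, x) = infsum (%xi. of_real (eta psi k xi) * md phi xi t * cis (of_int xi * x)) UNIV"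
   unfolding mult_fun_def prod.case md_def fc_def eta_even[OF psi] ..
  also have "... = infsum (%xi. of_real (eta psi k xi) * md phi xi t * cis (of_int xi * x)) ?F"
   by (rule infsum_cong_neutral) (use z in auto)
  finally show ?thesis by (simp add: trig_def)
 qed
 have i: "integrable lborel (%t. rc (u t) xi * md phi (-xi) t)" for xi by (rule supp_integrable(1)[of _ "-r" r])
   (use supp_within_md[OF r] continuous_funpow[OF s, of 0 0] in \<open>auto intro!: continuous_intros rc_cont md_continuous\<close>)
 have "Delta psi k f phi = (LINT t|lborel. LINT x|circle. of_real (u t x) * trig (%xi. of_real (eta psi k xi) * md phi xi t) ?F x)"
  by (simp add: Delta_def mult_distr_def distr_of_real_def distr_of_def m)
 also have "... = (LINT t|lborel. 2 * pi * (\<Sum>xi\<in>?F. of_real (eta psi k xi) * md phi xi t * rc (u t) (-xi)))"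
  by (subst integral_mult_trig[OF L2T_integrable_c[OF uL]]) (simp_all add: rc_def)
 also have "(%t. \<Sum>xi\<in>?F. of_real (eta psi k xi) * md phi xi t * rc (u t) (-xi)) =
   (%t. \<Sum>xi\<in>?F. of_real (eta psi k xi) * (rc (u t) xi * md phi (-xi) t))"
  by (intro ext sum.reindex_bij_witness[of _ uminus uminus]) (auto simp: eta_even[OF psi])
 finally show ?thesis by (simp add: i Bochner_Integration.integral_sum)
qed

lemma ext_integrable:
 assumes "continuous_on UNIV m"
 shows "integrable lborel (%t. ch k t0 t * rc (u t) xi * m t)"
 by (rule supp_integrable(1)[of _ "t0 - 3/2 / 2 ^ k" "t0 + 3/2 / 2 ^ k"])
  (use ch_supp[of _ t0 k] assms in \<open>auto intro!: continuous_intros rc_cont ch_cont\<close>)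

lemma ext_agree: "agree_on (t0 - 2 powr (- real k)) (t0 + 2 powr (- real k)) (ext k t0) (Delta psi k f)"
 unfolding agree_on_def
proof (intro ballI impI)
 fix phi assume phi: "phi \<in> test_RT" and "\<exists>c d. t0 - 2 powr (- real k) < c \<and> d < t0 + 2 powr (- real k) \<and> supp_within phi c d"
 then obtain c d where cd: "t0 - 2 powr (- real k) < c" "d < t0 + 2 powr (- real k)" "supp_within phi c d" by blast
 have "ch k t0 t * rc (u t) xi * md phi (-xi) t = rc (u t) xi * md phi (-xi) t" for t xi proof (cases "t \<in> {c..d}")
  case True
  then have "\<bar>t - t0\<bar> <= 2 powr (- real k)" using cd by auto
  then have "\<bar>2 ^ k * (t - t0)\<bar> <= 1" by (simp add: abs_mult powr_minus powr_nat pos_le_divide_eq[symmetric] inverse_eq_divide mult.commute[of "2 ^ k"] del: right_diff_distrib_numeral)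
  then show ?thesis using psi unfolding ch_def cutoff_def by simp
 next
  case False
  then have "phi (t, x) = 0" for x using cd(3) unfolding supp_within_def by blast
  then show ?thesis by (simp add: md_def fc_eq)
 qed
 then show "ext k t0 phi = Delta psi k f phi" unfolding ext_def Delta_modes[OF phi] by (simp only:)
qed

lemma ext_tempered: "tempered (ext k t0)" unfolding tempered_def
proof
 have c: "continuous_on UNIV phi" if "phi \<in> schwartz_RT" for phi
  using that continuous_funpow[of phi 0 0] unfolding schwartz_RT_def by simp
 show "linear_fun_on schwartz_RT (ext k t0)" unfolding linear_fun_on_def proof (intro ballI allI)
  fix phi rho a b assume "phi \<in> schwartz_RT" "rho \<in> schwartz_RT"
  note c = c[OF this(1)] c[OF this(2)]
  let ?J = "%phi xi. LINT t|lborel. ch k t0 t * rc (u t) xi * md phi (-xi) t"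
  have "?J (lc a b phi rho) xi = (LINT t|lborel. a * (ch k t0 t * rc (u t) xi * md phi (-xi) t) + b * (ch k t0 t * rc (u t) xi * md rho (-xi) t))" for xi
   unfolding md_lin[OF c] by (simp add: algebra_simps)
  also have "... xi = a * ?J phi xi + b * ?J rho xi" for xi
   by (subst Bochner_Integration.integral_add) (auto intro!: integrable_mult_right ext_integrable md_continuous c)
  finally show "ext k t0 (lc a b phi rho) = a * ext k t0 phi + b * ext k t0 rho"
   unfolding ext_def by (simp add: sum.distrib sum_distrib_left algebra_simps)
 qed
 let ?C = "2 * pi * (\<Sum>xi\<in>symF (2 ^ Suc k). \<bar>eta psi k xi\<bar> * (LINT t|lborel. norm (ch k t0 t * rc (u t) xi * 1)))"
 show "\<exists>C N. \<forall>phi\<in>schwartz_RT. norm (ext k t0 phi) <= C * (\<Sum>m\<le>N. \<Sum>i\<le>N. \<Sum>j\<le>N. seminorm_RT m i j phi)"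
 proof (intro exI[of _ ?C] exI[of _ 0] ballI)
  fix phi assume phi: "phi \<in> schwartz_RT"
  let ?S = "seminorm_RT 0 0 0 phi"
  have "norm (LINT t|lborel. ch k t0 t * rc (u t) xi * md phi (-xi) t) <= (LINT t|lborel. norm (ch k t0 t * rc (u t) xi * 1) * ?S)" for xi
  proof -
   have "norm (LINT t|lborel. ch k t0 t * rc (u t) xi * md phi (-xi) t) <= (LINT t|lborel. norm (ch k t0 t * rc (u t) xi * md phi (-xi) t))"
    by (rule integral_norm_bound)
   also have "... <= (LINT t|lborel. norm (ch k t0 t * rc (u t) xi * 1) * ?S)"
    by (intro Bochner_Integration.integral_mono integrable_norm integrable_mult_left ext_integrable md_continuous c[OF phi] continuous_on_const)
     (simp add: norm_mult mult_left_mono norm_md_seminorm[OF phi])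
   finally show ?thesis .
  qed
  then have "norm (ext k t0 phi) <= 2 * pi * (\<Sum>xi\<in>symF (2 ^ Suc k). \<bar>eta psi k xi\<bar> * (LINT t|lborel. norm (ch k t0 t * rc (u t) xi * 1) * ?S))"
   unfolding ext_def norm_mult norm_of_real
   by (intro mult_mono order_trans[OF norm_sum] sum_mono) (auto simp: norm_mult intro!: mult_left_mono sum_nonneg)
  also have "... = ?C * ?S" by (simp add: sum_distrib_right sum_distrib_left mult_ac)
  finally show "norm (ext k t0 phi) <= ?C * (\<Sum>m\<le>0. \<Sum>i\<le>0. \<Sum>j\<le>0. seminorm_RT m i j phi)" by simp
 qed
qed

definition w where "w k t0 xi t = ch k t0 t * v xi t"

lemma w_cont: "continuous_on S (w k t0 xi)" unfolding w_def by (intro continuous_intros ch_cont v_cont)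

lemma w_supp: "t \<notin> {t0 - 3/2 / 2 ^ k..t0 + 3/2 / 2 ^ k} ==> w k t0 xi t = 0"
 unfolding w_def using ch_supp[of t t0 k] by simp

text \<open>Removing the phase from the mode of u shifts tau by q(xi). So the modulation tau - q(xi)
  in the norm is simply the time frequency of the localized profile \<open>w\<close>.\<close>

lemma fourier_st_ext:
 assumes ta: "continuous_on UNIV ta" "!!t. t \<notin> {-r..r} ==> ta t = 0"
 shows "fourier_st (ext k t0) xi ta =
  (LINT tau|lborel. (if xi \<in> symF (2 ^ Suc k) then 2 * pi * eta psi k xi * ft (w k t0 xi) (tau - q xi) else 0) * ta tau)"
proof -
 let ?h = "%t. ch k t0 t * rc (u t) xi"
 have md: "md (%(t, x). (LINT tau|lborel. ta tau * cis (- t * tau)) * cis (- of_int xi * x)) (-\<zeta>) t = (if \<zeta> = xi then ft ta t else 0)" for \<zeta> t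
 proof -
  have "cis (- of_int xi * x) * cis (- of_int (-\<zeta>) * x) = cis (of_int (\<zeta> - xi) * x)" for x
   by (simp add: cis_mult algebra_simps)
  then have "md (%(t, x). (LINT tau|lborel. ta tau * cis (- t * tau)) * cis (- of_int xi * x)) (-\<zeta>) t
   = (LINT tau|lborel. ta tau * cis (- t * tau)) * (LINT x|circle. cis (of_int (\<zeta> - xi) * x)) / (2 * pi)"
   by (simp add: md_def fc_eq mult.assoc)
  then show ?thesis unfolding integral_circle_cis ft_def by (auto simp: mult.commute[of t])
 qed
 have h: "continuous_on UNIV ?h" by (intro continuous_intros ch_cont rc_cont)
 have hs: "?h t = 0" if "t \<notin> {t0 - 3/2 / 2 ^ k..t0 + 3/2 / 2 ^ k}" for t using ch_supp[OF that] by simp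
 have e: "ft ?h tau = ft (w k t0 xi) (tau - q xi)" for tau
  unfolding ft_def w_def modes by (intro Bochner_Integration.integral_cong refl) (simp add: mult_ac cis_mult algebra_simps)
 have "fourier_st (ext k t0) xi ta = 2 * pi * (\<Sum>\<zeta>\<in>symF (2 ^ Suc k). if \<zeta> = xi then of_real (eta psi k xi) * (LINT t|lborel. ?h t * ft ta t) else 0)"
  unfolding fourier_st_def ext_def md by (intro arg_cong2[of _ _ _ _ "(*)"] sum.cong refl) auto
 also have "... = (if xi \<in> symF (2 ^ Suc k) then 2 * pi * eta psi k xi * (LINT t|lborel. ?h t * ft ta t) else 0)"
  by (simp add: sum.delta)
 also have "(LINT t|lborel. ?h t * ft ta t) = (LINT tau|lborel. ft (w k t0 xi) (tau - q xi) * ta tau)"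
  unfolding e[symmetric] by (rule ft_swap[OF h _ ta]) (rule hs)
 finally show ?thesis by (simp add: mult.assoc)
qed

lemma L2_sum_le:
 assumes "finite F" shows "(\<Sum>xi\<in>F. (norm (v xi t))^2) <= R^2"
 using limit_sol_L2[OF sol assms, of t] unfolding L2_set_def by (rule sqrt_le_D)

text \<open>On frequencies up to 2^(k+1) the weight of the Hoelder norm is bounded below; 33/32 and
  129/128 are twice kappa and beta because norms are squared.\<close>

lemma hold_sum_le:
 assumes s: "s > 0"
 shows "(\<Sum>xi\<in>symF (2 ^ Suc k). (norm (v xi (t + s) - v xi t))^2) <= (2 * 2 ^ k) powr (33/32) * ((Mh R)^2 * s powr (129/128))"
proof -
 let ?F = "symF (2 ^ Suc k)" and ?d = "%xi. norm (v xi (t + s) - v xi t)"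
 have "sqrt (\<Sum>xi\<in>?F. (jb xi powr (-(33/64)) * ?d xi)^2) <= Mh R * s powr (129/256)"
  using limit_sol_hold[OF sol sigma, of ?F t "t + s"] s by (simp add: L2_set_def)
 then have "(\<Sum>xi\<in>?F. (jb xi powr (-(33/64)) * ?d xi)^2) <= (Mh R * s powr (129/256))^2" by (rule sqrt_le_D)
 also have "... = (Mh R)^2 * s powr (129/128)" by (simp add: power_mult_distrib power2_eq_square powr_add[symmetric])
 finally have 1: "(\<Sum>xi\<in>?F. (jb xi powr (-(33/64)) * ?d xi)^2) <= (Mh R)^2 * s powr (129/128)" .
 have "(\<Sum>xi\<in>?F. (?d xi)^2) <= (\<Sum>xi\<in>?F. (2 * 2 ^ k) powr (33/32) * (jb xi powr (-(33/64)) * ?d xi)^2)"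
 proof (rule sum_mono)
  fix xi assume "xi \<in> ?F"
  then have "real_of_int \<bar>xi\<bar> <= real_of_int (2 ^ Suc k)" unfolding of_int_le_iff by simp
  then have "jb xi <= 2 * 2 ^ k" using one_le_power[of "2::real" "Suc k"] unfolding jb_def by simp
  moreover have "jb xi ~= 0" using jb_pos[of xi] by linarith
  ultimately have "1 * (?d xi)^2 <= ((2 * 2 ^ k) powr (33/32) * jb xi powr (-(33/32))) * (?d xi)^2"
   using powr_mono2[OF _ less_imp_le[OF jb_pos], of "33/32" xi "2 * 2 ^ k"] by (intro mult_right_mono) (simp_all add: powr_minus pos_le_divide_eq divide_inverse[symmetric])
  then show "(?d xi)^2 <= (2 * 2 ^ k) powr (33/32) * (jb xi powr (-(33/64)) * ?d xi)^2"
   unfolding power_mult_distrib by (simp add: power2_eq_square[of "_ powr _"] powr_add[symmetric] mult.assoc)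
 qed
 also have "... <= (2 * 2 ^ k) powr (33/32) * ((Mh R)^2 * s powr (129/128))"
  unfolding sum_distrib_left[symmetric] by (intro mult_left_mono 1) simp
 finally show ?thesis .
qed

text \<open>Both estimates of \<open>modulation_bound\<close> are instances: W is the localized
  profile, or its difference in time, whose multiplier is bounded below where
  \<open>eta psi j\<close> lives. The infimum in \<open>L2_RZ_norm\<close> is bounded by the
  explicit density G; the factor 4 pi B is 2 pi times the bound 2 B of
  \<open>eta psi k\<close>.\<close>

lemma density_bound:
 assumes m: "!!xi l. (norm (of_real (eta psi j l) * ft (w k t0 xi) l))^2 <= K * (norm (ft (W xi) l))^2" and K: "K >= 0"
  and W: "!!xi. continuous_on UNIV (W xi)" "!!xi t. t \<notin> {a..b} ==> W xi t = 0" "a <= b" "b <= a + 2 * pi"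
  and M: "!!t. (\<Sum>xi\<in>symF (2 ^ Suc k). (norm (W xi t))^2) <= M" "M >= 0" and B: "B >= 1" "!!x. \<bar>psi x\<bar> <= B"
 shows "L2_RZ_norm (%xi ta. fourier_st (ext k t0) xi (%tau. of_real (eta psi j (tau - q xi)) * ta tau))
  <= ennreal (sqrt ((4 * pi * B)^2 * K * (2 * pi * (M * (b - a)))))"
proof -
 let ?F = "symF (2 ^ Suc k)"
 let ?h = "%xi l. of_real (eta psi j l) * ft (w k t0 xi) l"
 define G where "G xi tau = (if xi \<in> ?F then 2 * pi * eta psi k xi * ?h xi (tau - q xi) else 0)" for xi tau
 have ec: "continuous_on UNIV (eta psi j)"
  unfolding eta_def by (cases "j = 0") (auto intro!: continuous_intros continuous_on_compose2[OF cutoff_continuous[OF psi, of UNIV]])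
 have fc: "continuous_on UNIV (ft (w k t0 xi))" for xi by (rule ft_continuous[OF w_cont]) (rule w_supp)
 have hc: "continuous_on UNIV (?h xi)" for xi by (intro continuous_intros ec fc)
 have hm: "(%tau. ennreal ((norm (?h xi tau))^2)) \<in> borel_measurable borel" for xi
  using continuous_imp_borel[OF hc[of xi]] by measurable
 have Gc: "continuous_on UNIV (G xi)" for xi
  unfolding G_def by (cases "xi \<in> ?F") (auto intro!: continuous_intros continuous_on_compose2[OF hc[of xi]])
 have mem: "G \<in> {g. (\<forall>xi. g xi \<in> borel_measurable borel) \<and>
    (\<forall>xi. \<forall>ta\<in>test_R. fourier_st (ext k t0) xi (%tau. of_real (eta psi j (tau - q xi)) * ta tau) = (LINT tau|lborel. g xi tau * ta tau))}"
 proof (intro CollectI conjI allI ballI)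
  show "G xi \<in> borel_measurable borel" for xi by (rule continuous_imp_borel[OF Gc])
  fix xi ta assume ta: "ta \<in> test_R"
  then obtain r where r: "!!t. \<bar>t\<bar> > r ==> ta t = 0" and "!!x. (vderiv ^^ 0) ta differentiable (at x)"
   unfolding test_R_def smooth1_def by blast
  then have tc: "continuous_on UNIV ta"
   by (simp add: continuous_at_imp_continuous_on differentiable_imp_continuous_within)
  have z: "of_real (eta psi j (tau - q xi)) * ta tau = 0" if "tau \<notin> {-r..r}" for tau proof -
   have "\<bar>tau\<bar> > r" using that unfolding atLeastAtMost_iff by linarith
   then show ?thesis using r by simp
  qed
  show "fourier_st (ext k t0) xi (%tau. of_real (eta psi j (tau - q xi)) * ta tau) = (LINT tau|lborel. G xi tau * ta tau)"
   by (subst fourier_st_ext[OF _ z])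
    (auto simp: G_def mult_ac intro!: continuous_intros tc continuous_on_compose2[OF ec] Bochner_Integration.integral_cong)
 qed
 have fW: "(%tau. ennreal ((norm (ft (W xi) tau))^2)) \<in> borel_measurable borel" for xi proof -
  have "continuous_on UNIV (ft (W xi))" by (rule ft_continuous[OF W(1)]) (rule W(2))
  from continuous_imp_borel[OF this] show ?thesis by measurable
 qed
 have one: "nsq (G xi) <= ennreal ((4 * pi * B)^2 * K) * nsq (ft (W xi))" for xi proof -
  have "\<bar>2 * pi * eta psi k xi\<bar> <= 4 * pi * B" using eta_bound[of psi B k xi, OF B(2,1)] by (simp add: abs_mult)
  then have "\<bar>2 * pi * eta psi k xi\<bar>^2 <= (4 * pi * B)^2" by (rule power_mono) simp
  then have g: "(norm (G xi (q xi + l)))^2 <= (4 * pi * B)^2 * (K * (norm (ft (W xi) l))^2)" for l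
   using mult_mono[OF _ m[of l xi], of "\<bar>2 * pi * eta psi k xi\<bar>^2" "(4 * pi * B)^2"] K
   by (auto simp: G_def norm_mult power_mult_distrib)
  have "nsq (G xi) = (\<integral>\<^sup>+ tau. ennreal ((norm (G xi (q xi + tau)))^2) \<partial>lborel)"
   by (subst nn_integral_real_affine[where c = 1 and t = "q xi"]) (use continuous_imp_borel[OF Gc[of xi]] in simp_all)
  also have "... <= (\<integral>\<^sup>+ tau. ennreal ((4 * pi * B)^2 * K) * ennreal ((norm (ft (W xi) tau))^2) \<partial>lborel)"
   by (intro nn_integral_mono) (use g K in \<open>simp add: ennreal_mult[symmetric] ennreal_leI mult.assoc\<close>)
  also have "... = ennreal ((4 * pi * B)^2 * K) * nsq (ft (W xi))" by (rule nn_integral_cmult) (use fW in simp)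
  finally show ?thesis .
 qed
 have "(\<integral>\<^sup>+ xi. nsq (G xi) \<partial>count_space UNIV) = (\<Sum>xi\<in>?F. nsq (G xi))"
  by (rule nn_integral_count_space') (auto simp: G_def)
 also have "... <= ennreal ((4 * pi * B)^2 * K) * (\<Sum>xi\<in>?F. nsq (ft (W xi)))"
  unfolding sum_distrib_left by (rule sum_mono) (rule one)
 also have "... <= ennreal ((4 * pi * B)^2 * K) * ennreal (2 * pi * (M * (b - a)))"
  by (intro mult_left_mono plancherel_sum W M) simp_all
 also have "... = ennreal ((4 * pi * B)^2 * K * (2 * pi * (M * (b - a))))" using K M W(3) by (intro ennreal_mult[symmetric]) auto
 finally have "esqrt (\<integral>\<^sup>+ xi. nsq (G xi) \<partial>count_space UNIV) <= ennreal (sqrt ((4 * pi * B)^2 * K * (2 * pi * (M * (b - a)))))"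
  by (rule esqrt_le) (use K M W(3) in \<open>intro mult_nonneg_nonneg, simp_all\<close>)
 then show ?thesis unfolding L2_RZ_norm_def by (rule order_trans[OF INF_lower[OF mem]])
qed

text \<open>One bound is by the $L^2$ norm of the localized profiles; for $j > k$ another one is by the $L^2$ norm
 of their differences with step $2^{-j}$. They are combined through
 $\min(1, y) \le y^{257/258}$ for $y = 2^{33k/32 - 129j/128}$.\<close>

lemma modulation_bound:
 "\<exists>C\<ge>0. \<forall>k t0 j. L2_RZ_norm (%xi ta. fourier_st (ext k t0) xi (%tau. of_real (eta psi j (tau - q xi)) * ta tau))
   <= ennreal (C * 2 powr (75/5504 * k - 257/512 * j))"
proof -
 obtain B where B: "B >= 1" "!!x. \<bar>psi x\<bar> <= B" using cutoff_bounded[OF psi] by blast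
 obtain M where M: "M >= 0" "!!x y. \<bar>psi x - psi y\<bar> <= M * \<bar>x - y\<bar>" using cutoff_lipschitz[OF psi] by blast
 \<comment> \<open>K and m are sums of one constant for the direct estimate and one for the estimate
   by differences, so that a single C serves both. The 4 in C bounds 2^k times the length of the
   time support, at most 3 + 1 after the shift.\<close>
 define K where "K = (2 * B)^2 + (2 * B)^2 / (2 - 2 * cos (5/8))"
 define m where "m = B^2 * R^2 + (2 * B^2 * (2 powr (33/32) * (Mh R)^2) + 2 * M^2 * R^2)"
 define C where "C = (4 * pi * B)^2 * K * (2 * pi * (m * 4))"
 have K0: "K >= 0" unfolding K_def using cos_58 by simp
 have m0: "m >= 0" unfolding m_def by simp
 have C0: "C >= 0" unfolding C_def using K0 m0 by simp
 have eb: "(norm (of_real (eta psi j l) * z))^2 <= (2 * B)^2 * (norm z)^2" for j l and z :: complex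
  unfolding norm_mult norm_of_real power_mult_distrib
  by (intro mult_right_mono) (use power_mono[OF eta_bound[of psi B j l, OF B(2,1)], of 2] in \<open>simp_all add: power_mult_distrib\<close>)
 have cb: "norm (ch k t0 t) <= B" for k t0 t using B(2) by (simp add: ch_def)
 have ws: "(\<Sum>xi\<in>symF (2 ^ Suc k). (norm (w k t0 xi t))^2) <= m" for k t0 t proof -
  have "(\<Sum>xi\<in>symF (2 ^ Suc k). (norm (w k t0 xi t))^2) = (norm (ch k t0 t))^2 * (\<Sum>xi\<in>symF (2 ^ Suc k). (norm (v xi t))^2)"
   unfolding w_def norm_mult power_mult_distrib sum_distrib_left ..
  also have "... <= B^2 * R^2" by (intro mult_mono power_mono cb L2_sum_le) (auto intro: sum_nonneg)
  finally show ?thesis unfolding m_def by (rule order_trans) simp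
 qed
 let ?N = "%k t0 j. L2_RZ_norm (%xi ta. fourier_st (ext k t0) xi (%tau. of_real (eta psi j (tau - q xi)) * ta tau))"
 let ?a = "%k t0. t0 - 3/2 / 2 ^ k :: real" and ?b = "%k t0. t0 + 3/2 / 2 ^ k :: real"
 have two: "(1::real) / 2 ^ k <= 1" "(0::real) < 1 / 2 ^ k" "3/2 / 2 ^ k = 3/2 * (1 / 2 ^ k :: real)" for k by simp_all
 have 1: "?N k t0 j <= ennreal (sqrt (C * (1 / 2 ^ k)))" for k t0 j proof -
  have "?N k t0 j <= ennreal (sqrt ((4 * pi * B)^2 * K * (2 * pi * (m * (?b k t0 - ?a k t0)))))"
  proof (rule density_bound[of _ _ _ _ "w k t0"])
   show "(norm (of_real (eta psi j l) * ft (w k t0 xi) l))^2 <= K * (norm (ft (w k t0 xi) l))^2" for xi l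
    by (rule order_trans[OF eb], intro mult_right_mono) (use cos_58 in \<open>simp_all add: K_def\<close>)
   show "?b k t0 <= ?a k t0 + 2 * pi" using two(1,3)[of k] pi_gt3 by linarith
  qed (use w_cont w_supp[of _ t0 k] K0 m0 ws B in auto)
  also have "... <= ennreal (sqrt (C * (1 / 2 ^ k)))"
   unfolding C_def by (intro ennreal_leI real_sqrt_le_mono) (use K0 m0 in \<open>simp add: divide_right_mono mult_left_mono\<close>)
  finally show ?thesis .
 qed
 have 2: "?N k t0 j <= ennreal (sqrt (C * (1 / 2 ^ k) * 2 powr (33/32 * k - 129/128 * j)))" if kj: "k < j" for k t0 j
 proof -
  let ?s = "1 / 2 ^ j :: real" and ?y = "2 powr (33/32 * k - 129/128 * j)"
  let ?W = "%xi t. w k t0 xi (t + ?s) - w k t0 xi t"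
  have sk: "?s <= 1 / 2 ^ k" using kj by (intro divide_left_mono power_increasing) auto
  have "?N k t0 j <= ennreal (sqrt ((4 * pi * B)^2 * K * (2 * pi * ((m * ?y) * (?b k t0 - (?a k t0 - ?s))))))"
  proof (rule density_bound[of _ _ _ _ ?W])
   have f: "ft (?W xi) l = (cis (?s * l) - 1) * ft (w k t0 xi) l" for xi l
    by (rule ft_shift_diff[OF w_cont]) (rule w_supp)
   show "(norm (of_real (eta psi j l) * ft (w k t0 xi) l))^2 <= K * (norm (ft (?W xi) l))^2" for xi l
   proof (cases "eta psi j l = 0")
    case False
    let ?c = "2 - 2 * cos (5/8) :: real"
    have e: "?c <= (norm (cis (l / 2 ^ j) - 1))^2" using eta_difference[OF psi _ False] kj by simp
    have "(norm (of_real (eta psi j l) * ft (w k t0 xi) l))^2 <= (2 * B)^2 / ?c * (?c * (norm (ft (w k t0 xi) l))^2)"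
     using eb[of j l "ft (w k t0 xi) l"] cos_58 by simp
    also have "... <= K * ((norm (cis (l / 2 ^ j) - 1))^2 * (norm (ft (w k t0 xi) l))^2)"
     by (intro mult_mono mult_right_mono e) (use cos_58 K0 in \<open>simp_all add: K_def\<close>)
    finally show ?thesis unfolding f norm_mult power_mult_distrib by simp
   qed (use K0 in simp)
   show "?a k t0 - ?s <= ?b k t0" using two(2)[of j] two(2,3)[of k] by linarith
   show "?b k t0 <= ?a k t0 - ?s + 2 * pi" using sk two(1,3)[of k] pi_gt3 by linarith
   show "continuous_on UNIV (?W xi)" for xi by (intro continuous_intros continuous_on_compose2[OF w_cont[of UNIV]] w_cont) auto
   show "?W xi t = 0" if "t \<notin> {?a k t0 - ?s..?b k t0}" for xi t proof -
    have o: "t \<notin> {?a k t0..?b k t0}" "t + ?s \<notin> {?a k t0..?b k t0}"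
     using that two(2)[of j] unfolding atLeastAtMost_iff by linarith+
    show ?thesis using w_supp[OF o(1), of xi] w_supp[OF o(2), of xi] by (simp only: diff_self)
   qed
   show "(\<Sum>xi\<in>symF (2 ^ Suc k). (norm (?W xi t))^2) <= m * ?y" for t proof -
    let ?F = "symF (2 ^ Suc k)" and ?d = "%xi. norm (v xi (t + ?s) - v xi t)"
    let ?e = "norm (ch k t0 (t + ?s) - ch k t0 t)"
    have "\<bar>psi (2 ^ k * (t + ?s - t0)) - psi (2 ^ k * (t - t0))\<bar> <= M * \<bar>2 ^ k * (t + ?s - t0) - 2 ^ k * (t - t0)\<bar>" by (rule M)
    also have "2 ^ k * (t + ?s - t0) - 2 ^ k * (t - t0) = 2 ^ k * ?s" by (simp add: algebra_simps)
    finally have e: "?e <= M * (2 ^ k * ?s)" unfolding ch_def of_real_diff[symmetric] norm_of_real by simp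
    have "(2 ^ k * ?s)^2 = (2 powr (real k - real j))^2" by (simp add: powr_diff powr_nat)
    also have "... = 2 powr (2 * (real k - real j))" by (simp add: power2_eq_square powr_add[symmetric])
    \<comment> \<open>The inequality of exponents is 31/32 k <= 127/128 j, true for k < j. Hence the
      increment of the cutoff is no worse than that of the profiles.\<close>
    also have "... <= ?y" by (rule powr_mono) (use kj in simp_all)
    finally have y: "(2 ^ k * ?s)^2 <= ?y" .
    have h: "(\<Sum>xi\<in>?F. (?d xi)^2) <= 2 powr (33/32) * (Mh R)^2 * ?y" proof -
     have "?s = 2 powr (- real j)" by (simp add: powr_minus powr_nat inverse_eq_divide)
     then have "?s powr (129/128) = 2 powr (- (129/128 * j))" by (simp only: powr_powr) (simp add: mult.commute)
     moreover have "?y = 2 powr (33/32 * k) * 2 powr (- (129/128 * j))" by (simp add: powr_add[symmetric])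
     moreover have "(2 * 2 ^ k) powr (33/32) = 2 powr (33/32) * 2 powr (33/32 * k)"
      by (simp add: powr_mult powr_nat[symmetric] powr_powr mult.commute)
     ultimately show ?thesis using hold_sum_le[of ?s t k, OF two(2)] by (simp only: mult_ac)
    qed
    have "(norm (?W xi t))^2 <= 2 * B^2 * (?d xi)^2 + 2 * (M * (2 ^ k * ?s))^2 * (norm (v xi t))^2" for xi proof -
     have "norm (?W xi t) = norm (ch k t0 (t + ?s) * (v xi (t + ?s) - v xi t) + (ch k t0 (t + ?s) - ch k t0 t) * v xi t)"
      unfolding w_def by (simp add: algebra_simps)
     also have "... <= norm (ch k t0 (t + ?s)) * ?d xi + ?e * norm (v xi t)"
      unfolding norm_mult[symmetric] by (rule norm_triangle_ineq)
     also have "... <= B * ?d xi + M * (2 ^ k * ?s) * norm (v xi t)" by (intro add_mono mult_right_mono cb e) simp_all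
     finally have "(norm (?W xi t))^2 <= (B * ?d xi + M * (2 ^ k * ?s) * norm (v xi t))^2" by (rule power_mono) simp
     also have "... <= 2 * (B * ?d xi)^2 + 2 * (M * (2 ^ k * ?s) * norm (v xi t))^2"
      using sum_squares_bound[of "B * ?d xi" "M * (2 ^ k * ?s) * norm (v xi t)"] by (simp add: power2_sum)
     finally show ?thesis by (simp only: power_mult_distrib mult.assoc)
    qed
    then have "(\<Sum>xi\<in>?F. (norm (?W xi t))^2) <= 2 * B^2 * (\<Sum>xi\<in>?F. (?d xi)^2) + 2 * (M * (2 ^ k * ?s))^2 * (\<Sum>xi\<in>?F. (norm (v xi t))^2)"
     unfolding sum_distrib_left sum.distrib[symmetric] by (rule sum_mono)
    also have "... <= 2 * B^2 * (2 powr (33/32) * (Mh R)^2 * ?y) + 2 * (M^2 * ?y) * R^2"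
     unfolding power_mult_distrib[of M]
     by (intro add_mono mult_left_mono mult_mono h y L2_sum_le) (auto intro: sum_nonneg)
    also have "... <= m * ?y" unfolding m_def by (simp add: algebra_simps)
    finally show ?thesis .
   qed
  qed (use K0 m0 B in auto)
  also have "... <= ennreal (sqrt (C * (1 / 2 ^ k) * ?y))" proof (intro ennreal_leI real_sqrt_le_mono)
   have "?b k t0 - (?a k t0 - ?s) <= 4 * (1 / 2 ^ k)" using sk by simp
   from mult_left_mono[OF this, of "(4 * pi * B)^2 * K * (2 * pi * (m * ?y))"]
   show "(4 * pi * B)^2 * K * (2 * pi * (m * ?y * (?b k t0 - (?a k t0 - ?s)))) <= C * (1 / 2 ^ k) * ?y"
    unfolding C_def using K0 m0 by (simp only: mult_nonneg_nonneg zero_le_power2 pi_ge_zero powr_ge_zero zero_le_numeral mult_ac)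
  qed
  finally show ?thesis .
 qed
 have "?N k t0 j <= ennreal (sqrt C * 2 powr (75/5504 * k - 257/512 * j))" for k t0 j proof -
  let ?x = "33/32 * real k - 129/128 * real j"
  \<comment> \<open>The exponent 257/258 is chosen because half of 257/258 * 129/128 is 257/512 =
    1/2 + 1/512: the decay in j just beats b = 1/2. The growth left in k is 2^(75k/5504).\<close>
  have "?N k t0 j <= ennreal (sqrt (C * (1 / 2 ^ k) * 2 powr (257/258 * ?x)))" proof (cases "?x >= 0")
   case True
   have "C * (1 / 2 ^ k) * 1 <= C * (1 / 2 ^ k) * 2 powr (257/258 * ?x)"
    by (rule mult_left_mono) (use True C0 in \<open>simp_all add: ge_one_powr_ge_zero\<close>)
   then show ?thesis by (intro order_trans[OF 1] ennreal_leI real_sqrt_le_mono) simp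
  next
   case False
   then have kj: "k < j" by simp
   have "C * (1 / 2 ^ k) * 2 powr ?x <= C * (1 / 2 ^ k) * 2 powr (257/258 * ?x)"
    by (intro mult_left_mono powr_mono) (use False C0 in simp_all)
   then show ?thesis by (intro order_trans[OF 2[OF kj]] ennreal_leI real_sqrt_le_mono)
  qed
  also have "1 / 2 ^ k * 2 powr (257/258 * ?x) = (2 powr (75/5504 * k - 257/512 * j))^2" proof -
   have "1 / 2 ^ k * 2 powr (257/258 * ?x) = 2 powr (- real k + 257/258 * ?x)" by (simp only: powr_add powr_minus powr_nat inverse_eq_divide)
   also have "- real k + 257/258 * ?x = (75/5504 * k - 257/512 * j) + (75/5504 * k - 257/512 * j)" by (simp add: field_simps)
   finally show ?thesis unfolding powr_add power2_eq_square .
  qed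
  then have "sqrt (C * (1 / 2 ^ k) * 2 powr (257/258 * ?x)) = sqrt C * 2 powr (75/5504 * k - 257/512 * j)"
   by (simp only: mult.assoc real_sqrt_mult real_sqrt_abs) simp
  finally show ?thesis .
 qed
 then show ?thesis by (intro exI[of _ "sqrt C"] conjI allI) (use C0 in simp)
qed

text \<open>For b <= 1/2 the surplus 1/512 sums the modulations. In k the weight 2^(-k/64) beats the
  growth, since 75/5504 - 1/64 = -11/5504. As 2^(-6) = 1/64, one value of s serves both spaces of
  the theorem.\<close>

lemma in_F_space:
 assumes b: "b <= 1/2" shows "f \<in> F_space psi q (- 1/64) b"
proof -
 obtain C where C: "C >= 0" "!!k t0 j. L2_RZ_norm (%xi ta. fourier_st (ext k t0) xi (%tau. of_real (eta psi j (tau - q xi)) * ta tau))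
   <= ennreal (C * 2 powr (75/5504 * k - 257/512 * j))" using modulation_bound by blast
 define r :: real where "r = 2 powr (-1/512)"
 define r' :: real where "r' = 2 powr (-11/5504)"
 have r: "0 < r" "r < 1" "0 < r'" "r' < 1" unfolding r_def r'_def by (auto simp: powr_less_one)
 have rn: "r ^ j = 2 powr (-1/512 * j)" "r' ^ j = 2 powr (-11/5504 * j)" for j unfolding r_def r'_def by (simp_all add: powr_realpow[symmetric] powr_powr)
 define D where "D = C * (1 / (1 - r))"
 have D: "D >= 0" unfolding D_def using C r by simp
 have X: "X_norm psi q b (ext k t0) <= ennreal (D * 2 powr (75/5504 * k))" for k t0 proof -
  have "ennreal (2 powr (real j * b)) * L2_RZ_norm (%xi ta. fourier_st (ext k t0) xi (%tau. of_real (eta psi j (tau - q xi)) * ta tau))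
   <= ennreal (C * 2 powr (75/5504 * k) * r ^ j)" for j proof -
   have "ennreal (2 powr (real j * b)) * L2_RZ_norm (%xi ta. fourier_st (ext k t0) xi (%tau. of_real (eta psi j (tau - q xi)) * ta tau))
    <= ennreal (2 powr (real j * (1/2))) * ennreal (C * 2 powr (75/5504 * k - 257/512 * j))"
    using b by (intro mult_mono C ennreal_leI powr_mono mult_left_mono) auto
   also have "... = ennreal (C * (2 powr (real j * (1/2)) * 2 powr (75/5504 * k - 257/512 * j)))"
    using C by (simp add: ennreal_mult[symmetric] mult_ac)
   also have "2 powr (real j * (1/2)) * 2 powr (75/5504 * k - 257/512 * j) = 2 powr (75/5504 * k) * r ^ j"
    unfolding rn powr_add[symmetric] by (rule arg_cong[of _ _ "(powr) 2"]) simp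
   finally show ?thesis by (simp only: mult.assoc)
  qed
  then have "X_norm psi q b (ext k t0) <= (\<Sum>j. ennreal (C * 2 powr (75/5504 * k) * r ^ j))"
   unfolding X_norm_def by (intro suminf_le) auto
  also have "... = ennreal (D * 2 powr (75/5504 * k))"
   by (subst suminf_geometric_ennreal) (use C r in \<open>simp_all add: D_def\<close>)
  finally show ?thesis .
 qed
 have "ennreal (2 powr (real k * (- 1/64))) * Fk_norm psi q b k t (Delta psi k f) <= ennreal (D * r' ^ k)" for k t
 proof -
  have "Fk_norm psi q b k t (Delta psi k f) <= X_norm psi q b (ext k t)"
   unfolding Fk_norm_def by (rule INF_lower) (use ext_tempered ext_agree in blast)
  then have "ennreal (2 powr (real k * (- 1/64))) * Fk_norm psi q b k t (Delta psi k f) <= ennreal (2 powr (real k * (- 1/64))) * ennreal (D * 2 powr (75/5504 * k))"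
   by (intro mult_left_mono order_trans[OF _ X]) auto
  also have "... = ennreal (D * (2 powr (real k * (- 1/64)) * 2 powr (75/5504 * k)))" using D by (simp add: ennreal_mult[symmetric] mult_ac)
  also have "... <= ennreal (D * r' ^ k)"
   unfolding rn powr_add[symmetric] by (intro ennreal_leI mult_left_mono powr_mono D) simp_all
  finally show ?thesis .
 qed
 then have "(SUP t. ennreal (2 powr (real k * (- 1/64))) * Fk_norm psi q b k t (Delta psi k f))^2 <= (ennreal (D * r' ^ k))^2" for k
  by (intro power_mono SUP_least) simp_all
 moreover have "(ennreal (D * r' ^ k))^2 = ennreal (D^2 * (r'^2) ^ k)" for k
  using D r by (simp add: ennreal_power power_mult_distrib power_mult[symmetric] mult.commute)
 ultimately have "(\<Sum>k. (SUP t. ennreal (2 powr (real k * (- 1/64))) * Fk_norm psi q b k t (Delta psi k f))^2) <= (\<Sum>k. ennreal (D^2 * (r'^2) ^ k))"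
  by (intro suminf_le) auto
 also have "... < top" by (subst suminf_geometric_ennreal) (use r power_strict_mono[of r' 1 2] in simp_all)
 finally show ?thesis unfolding F_space_def using distribution_f by simp
qed

lemma weak_sol:
 assumes "AE x in circle. u 0 x = u0 x"
 shows "weak_solution psi sg u0 u" "\<exists>s<0. f \<in> F_space psi q s (1/2)"
proof -
 have e: "- (2 powr (- 6)) = (- 1/64 :: real)" by (simp add: powr_minus)
 then show "weak_solution psi sg u0 u"
  unfolding weak_solution_def e using weakly_continuous in_F_space[of "15/32"] assms is_N_f equation by auto
 show "\<exists>s<0. f \<in> F_space psi q s (1/2)" by (intro exI[of _ "- 1/64"] conjI in_F_space) simp_all
qed

end

section \<open>Galerkin approximations\<close>

lemma gf_state: "gf sg N v xi r = gf sg N (%k _. v k r) xi r" by (simp add: gf_def)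

lemma norm_cis_diff: "norm (cis a - cis b) <= \<bar>a - b\<bar>"
proof -
 have s: "(cos x)^2 + (sin x)^2 = 1" for x :: real by simp
 have "(norm (cis a - cis b))^2 = (cos a - cos b)^2 + (sin a - sin b)^2" by (simp add: cmod_power2)
 also have "... = 2 - 2 * cos (a - b)" using s[of a] s[of b] unfolding cos_diff by algebra
 also have "cos (a - b) = cos (2 * ((a - b) / 2))" by (rule arg_cong[of _ _ cos]) (simp add: field_simps)
 also have "2 - 2 * cos (2 * ((a - b) / 2)) = (2 * \<bar>sin ((a - b) / 2)\<bar>)^2" unfolding cos_double_sin by (simp add: power_mult_distrib)
 also have "... <= \<bar>a - b\<bar>^2" using abs_sin_x_le_abs_x[of "(a - b) / 2"] by (intro power_mono) auto
 finally show ?thesis by (rule power2_le_imp_le) simp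
qed

lemma trilinear_diff:
 assumes b: "norm x <= R" "norm y <= R" "norm z <= R" "norm x' <= R" "norm y' <= R" "norm z' <= R"
  and d: "norm (x - x') <= \<delta>" "norm (y - y') <= \<delta>" "norm (z - z') <= \<delta>"
 shows "norm (cis a * (x * y * z) - cis a' * (x' * y' * z')) <= (R ^ 3 * \<bar>a - a'\<bar> + 3 * R^2 * \<delta>)"
proof -
 have R: "R >= 0" "\<delta> >= 0" using order_trans[OF norm_ge_zero] b(1) d(1) by blast+
 have "cis a * (x * y * z) - cis a' * (x' * y' * z') = (cis a - cis a') * (x * y * z)
   + cis a' * ((x - x') * y * z) + cis a' * (x' * (y - y') * z) + cis a' * (x' * y' * (z - z'))"
  by (simp add: algebra_simps)
 also have "norm ... <= norm ((cis a - cis a') * (x * y * z)) + norm (cis a' * ((x - x') * y * z))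
   + norm (cis a' * (x' * (y - y') * z)) + norm (cis a' * (x' * y' * (z - z')))" by (intro norm_add_rule_thm order_refl)
 also have "... <= \<bar>a - a'\<bar> * (R * R * R) + 1 * (\<delta> * R * R) + 1 * (R * \<delta> * R) + 1 * (R * R * \<delta>)"
  unfolding norm_mult norm_cis
  by (intro add_mono mult_mono mult_nonneg_nonneg norm_cis_diff b d R order_refl norm_ge_zero abs_ge_zero zero_le_one)
 finally show ?thesis by (simp add: power3_eq_cube power2_eq_square mult_ac)
qed

text \<open>The constant depends on N. This is harmless, as it only determines the step of the Euler
  polygons.\<close>

lemma gf_lipschitz:
 fixes R :: real
 assumes sg: "\<bar>sg\<bar> = 1" and R: "R >= 0"
 obtains K where "K >= 0" "!!xi s s' r r' \<delta>. xi \<in> {-N..N} ==> (!!k. norm (s k) <= R) ==> (!!k. norm (s' k) <= R) ==>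
   (!!k. norm (s k - s' k) <= \<delta>) ==> norm (gf sg N (%k _. s k) xi r - gf sg N (%k _. s' k) xi r') <= K * (\<bar>r - r'\<bar> + \<delta>)"
proof -
 define a where "a xi = 2 * mag xi" for xi
 define J where "J xi = 3 * a xi * (3 * R^2) + (\<Sum>p\<in>nres {-N..N} xi. a xi * (R ^ 3 * \<bar>omp xi p\<bar> + 3 * R^2))" for xi
 have J0: "J xi >= 0" for xi unfolding J_def a_def using R by (auto intro!: add_nonneg_nonneg sum_nonneg)
 show ?thesis proof (rule that[of "\<Sum>xi\<in>{-N..N}. J xi"])
  show "0 <= (\<Sum>xi\<in>{-N..N}. J xi)" using J0 by (intro sum_nonneg)
  fix xi and s s' :: "int => complex" and r r' \<delta> :: real
  assume xi: "xi \<in> {-N..N}" and s: "!!k. norm (s k) <= R" "!!k. norm (s' k) <= R" "!!k. norm (s k - s' k) <= \<delta>"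
  let ?e = "\<bar>r - r'\<bar> + \<delta>"
  let ?c = "nlc sg xi"
  let ?P = "%s r p. ?c * (cis (omp xi p * r) * (s (fst p) * s (snd p) * s (xi - fst p - snd p)))"
  let ?Q = "%s. 3 * (?c * (cis 0 * (s xi * s xi * s (-xi))))"
  have \<delta>: "0 <= \<delta>" using order_trans[OF norm_ge_zero s(3)] by blast
  have c: "norm ?c = a xi" unfolding a_def using sg by (simp add: norm_mult)
  have a0: "a xi >= 0" by (simp add: a_def)
  have g: "gf sg N (%k _. s k) xi r = - ?Q s + (\<Sum>p\<in>nres {-N..N} xi. ?P s r p)" for s r
   unfolding gf_def by (simp add: power2_eq_square)
  have "norm (?P s r p - ?P s' r' p) <= a xi * (R ^ 3 * \<bar>omp xi p\<bar> + 3 * R^2) * ?e" for p proof -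
   let ?o = "omp xi p"
   have "norm (?P s r p - ?P s' r' p) <= a xi * (R ^ 3 * \<bar>?o * r - ?o * r'\<bar> + 3 * R^2 * \<delta>)"
    unfolding right_diff_distrib[of ?c, symmetric] norm_mult[of ?c] c by (intro mult_left_mono trilinear_diff s a0)
   also have "... <= a xi * (R ^ 3 * (\<bar>?o\<bar> * ?e) + 3 * R^2 * ?e)"
    unfolding right_diff_distrib[symmetric] abs_mult by (intro mult_left_mono add_mono a0) (use R \<delta> in auto)
   finally show ?thesis by (simp add: algebra_simps)
  qed
  then have P: "norm ((\<Sum>p\<in>nres {-N..N} xi. ?P s r p) - (\<Sum>p\<in>nres {-N..N} xi. ?P s' r' p)) <=
    (\<Sum>p\<in>nres {-N..N} xi. a xi * (R ^ 3 * \<bar>omp xi p\<bar> + 3 * R^2)) * ?e"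
   unfolding sum_subtractf[symmetric] sum_distrib_right by (intro order_trans[OF norm_sum] sum_mono)
  have "norm (?Q s - ?Q s') = 3 * (a xi * norm (cis 0 * (s xi * s xi * s (-xi)) - cis 0 * (s' xi * s' xi * s' (-xi))))"
   unfolding right_diff_distrib[symmetric] norm_mult[of 3] norm_mult[of ?c] c by simp
  also have "... <= 3 * (a xi * (R ^ 3 * \<bar>0 - 0\<bar> + 3 * R^2 * \<delta>))"
   by (intro mult_left_mono trilinear_diff s a0) simp_all
  also have "... <= 3 * a xi * (3 * R^2) * ?e" using a0 by (simp add: mult.assoc mult_left_mono)
  finally have "norm (gf sg N (%k _. s k) xi r - gf sg N (%k _. s' k) xi r') <= J xi * ?e"
   using P norm_triangle_ineq[of "?Q s' - ?Q s" "(\<Sum>p\<in>nres {-N..N} xi. ?P s r p) - (\<Sum>p\<in>nres {-N..N} xi. ?P s' r' p)"]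
   unfolding g J_def by (simp add: algebra_simps norm_minus_commute)
  also have "... <= (\<Sum>xi\<in>{-N..N}. J xi) * ?e"
   by (intro mult_right_mono member_le_sum xi J0) (use \<delta> in auto)
  finally show "norm (gf sg N (%k _. s k) xi r - gf sg N (%k _. s' k) xi r') <= (\<Sum>xi\<in>{-N..N}. J xi) * ?e" .
 qed
qed

text \<open>The quantity below is, up to a factor, the integral of $6(w^2 - P_0(w^2)) w_x w$, which is the derivative of a
 periodic function.\<close>

lemma gf_conservation:
 assumes s: "!!k. \<bar>k\<bar> > int K ==> s k = 0"
 shows "(\<Sum>xi\<in>symF K. gf sg (int K) (%k _. s k) xi r * s (-xi)) = 0"
proof -
 \<comment> \<open>Here q(k) = k^3. Its oddness and its resonance function turn \<open>gf\<close>
   into the modes of a nonlinearity in x, to which integration over the circle applies.\<close>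
 define q where "q = qsym 0 (%_. 0)"
 define b where "b k = cis (q k * r) * s k" for k
 let ?w = "trig b (symF K)" and ?w' = "trig (%k. \<i> * of_int k * b k) (symF K)"
 let ?P = "P0 (%y. (?w y)^2)"
 have bz: "b k = 0" if "\<bar>k\<bar> > int K" for k using s[OF that] by (simp add: b_def)
 have d: "(?w has_vector_derivative ?w' x) (at x)" for x by (rule has_vector_derivative_trig)
 have nb: "nlm b K xi = cis (q xi * r) * gf 1 (int K) (%k _. s k) xi r" for xi
  unfolding b_def q_def using nlm_gf[OF qsym_om qsym_neg, of 0 "%_. 0" r "%k _. s k" K xi] by simp
 have "((%x. 3/2 * (?w x) ^ 4 - 3 * ?P * (?w x)^2) has_vector_derivative 6 * ((?w x)^2 - ?P) * ?w' x * ?w x) (at x)" for x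
 proof -
  have D: "((%x. ?w x ^ 2) has_vector_derivative 2 * ?w x * ?w' x) (at x)"
   using has_vector_derivative_mult[OF d d, of x] by (simp add: power2_eq_square algebra_simps)
  have "((%x. (?w x ^ 2) * (?w x ^ 2)) has_vector_derivative ?w x ^ 2 * (2 * ?w x * ?w' x) + 2 * ?w x * ?w' x * ?w x ^ 2) (at x)"
   by (rule has_vector_derivative_mult[OF D D])
  then have "((%x. ?w x ^ 4) has_vector_derivative ?w x ^ 2 * (2 * ?w x * ?w' x) + 2 * ?w x * ?w' x * ?w x ^ 2) (at x)"
   by (simp add: power_add[symmetric])
  from has_vector_derivative_diff[OF has_vector_derivative_mult_right[OF this, of "3/2"] has_vector_derivative_mult_right[OF D, of "3 * ?P"]]
  show ?thesis by (simp add: algebra_simps power2_eq_square)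
 qed
 then have "(LINT x|circle. 6 * ((?w x)^2 - ?P) * ?w' x * ?w x) = 3/2 * (?w (2 * pi)) ^ 4 - 3 * ?P * (?w (2 * pi))^2 - (3/2 * (?w 0) ^ 4 - 3 * ?P * (?w 0)^2)"
  by (rule integral_circle_FTC) (intro continuous_intros)
 also have "... = 0" using periodic_trig[of b "symF K"] unfolding periodic_def by (metis add_0 cancel_comm_monoid_add_class.diff_cancel)
 finally have "(\<Sum>xi\<in>symF (3 * K). nlm b K xi * fc ?w (-xi)) = 0"
  using integral_nonlin[of K b, OF bz d _ periodic_trig] by (simp add: continuous_trig)
 moreover have "(\<Sum>xi\<in>symF K. nlm b K xi * b (-xi)) = (\<Sum>xi\<in>symF (3 * K). nlm b K xi * fc ?w (-xi))"
  by (rule sum.mono_neutral_cong_left) (use symF_mono[of K "3 * K"] in \<open>auto simp: fc_trig\<close>)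
 moreover have "nlm b K xi * b (-xi) = gf 1 (int K) (%k _. s k) xi r * s (-xi)" for xi proof -
  have "cis (q xi * r) * cis (q (-xi) * r) = 1" unfolding q_def qsym_neg by (simp add: cis_mult)
  then show ?thesis unfolding nb b_def by (simp add: mult_ac)
 qed
 ultimately have "(\<Sum>xi\<in>symF K. gf 1 (int K) (%k _. s k) xi r * s (-xi)) = 0" by simp
 then show ?thesis unfolding gf_sigma[of sg] by (simp add: mult.assoc sum_distrib_left[symmetric])
qed

lemma gf_cnj:
 assumes s: "!!k. v (-k) r = cnj (v k r)"
 shows "gf sg N v (-xi) r = cnj (gf sg N v xi r)"
proof -
 have o: "om (-xi) k l = - om xi (-k) (-l)" for k l by (simp add: om_def algebra_simps)
 have c: "v (-xi - k - l) r = cnj (v (xi + k + l) r)" for k l using s[of "xi + k + l"] by (simp only: minus_add diff_conv_add_uminus add_ac)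
 have "(\<Sum>p\<in>nres {-N..N} (-xi). nlc sg (-xi) * (cis (omp (-xi) p * r) * (cub v (-xi) p r)))
   = (\<Sum>p\<in>nres {-N..N} xi. cnj (nlc sg xi * (cis (omp xi p * r) * cub v xi p r)))"
  by (rule sum.reindex_bij_witness[of _ "%p. (- fst p, - snd p)" "%p. (- fst p, - snd p)"])
   (auto simp: nres_def conv3_def o s c cis_cnj)
 then show ?thesis unfolding gf_def by (simp add: s)
qed

text \<open>A version of \<open>approx_sol\<close> that can be built step by step: on any time
  interval, with a bound A on the squared norm that may grow slightly, and with the symmetry of real
  functions, needed for the conservation law.\<close>

definition gsol :: "real => nat => real => real => real => real => (int => real => complex) => bool" where
 "gsol sg K ep A a b v \<longleftrightarrow> (\<forall>k t. \<bar>k\<bar> > int K --> v k t = 0) \<and> (\<forall>k t. v (-k) t = cnj (v k t)) \<and>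
   (\<forall>k. continuous_on {a..b} (v k)) \<and> (\<forall>t\<in>{a..b}. (\<Sum>k\<in>symF K. (norm (v k t))^2) <= A) \<and>
   (\<forall>xi\<in>symF K. \<forall>s t. a <= s \<and> s <= t \<and> t <= b --> norm (v xi t - v xi s - integral {s..t} (gf sg (int K) v xi)) <= ep * (t - s))"

lemma gsol_mono:
 assumes "gsol sg K ep A a b v" "a <= a'" "b' <= b" "A <= A'" shows "gsol sg K ep A' a' b' v"
proof -
 have "continuous_on {a'..b'} (v k)" for k
  using assms unfolding gsol_def by (meson continuous_on_subset atLeastatMost_subset_iff)
 then show ?thesis using assms unfolding gsol_def by (auto intro: order_trans)
qed

lemma gf_cont: "(!!k. continuous_on S (v k)) ==> continuous_on S (gf sg N v xi)"
 unfolding gf_def by (intro continuous_intros) auto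

text \<open>The error ep * (t - s) is additive over adjacent intervals, so gluing does not enlarge
  it.\<close>

lemma gsol_glue:
 assumes 1: "gsol sg K ep A a b v1" and 2: "gsol sg K ep A b c v2" and e: "!!k. v1 k b = v2 k b" and abc: "a <= b" "b <= c"
 shows "gsol sg K ep A a c (%k t. if t <= b then v1 k t else v2 k t)"
proof -
 define v where "v k t = (if t <= b then v1 k t else v2 k t)" for k t
 have v1: "v k t = v1 k t" if "t <= b" for k t using that by (simp add: v_def)
 have v2: "v k t = v2 k t" if "b <= t" for k t using that e by (auto simp: v_def)
 have U: "{a..c} = {a..b} \<union> {b..c}" using abc by auto
 have c1: "continuous_on {a..b} (v k)" for k using 1 unfolding gsol_def by (auto simp: v1 cong: continuous_on_cong_simp)
 have c2: "continuous_on {b..c} (v k)" for k using 2 unfolding gsol_def by (auto simp: v2 cong: continuous_on_cong_simp)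
 have vc: "continuous_on {a..c} (v k)" for k unfolding U by (intro continuous_on_closed_Un c1 c2) auto
 have i1: "norm (v xi t - v xi s - integral {s..t} (gf sg (int K) v xi)) <= ep * (t - s)" if "xi \<in> symF K" "a <= s" "s <= t" "t <= b" for xi s t
 proof -
  have "integral {s..t} (gf sg (int K) v xi) = integral {s..t} (gf sg (int K) v1 xi)"
   by (rule Henstock_Kurzweil_Integration.integral_cong) (subst (1 2) gf_state, use that in \<open>simp add: v1\<close>)
  then show ?thesis using 1 that unfolding gsol_def by (simp add: v1)
 qed
 have i2: "norm (v xi t - v xi s - integral {s..t} (gf sg (int K) v xi)) <= ep * (t - s)" if "xi \<in> symF K" "b <= s" "s <= t" "t <= c" for xi s t
 proof -
  have "integral {s..t} (gf sg (int K) v xi) = integral {s..t} (gf sg (int K) v2 xi)"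
   by (rule Henstock_Kurzweil_Integration.integral_cong) (subst (1 2) gf_state, use that in \<open>simp add: v2\<close>)
  then show ?thesis using 2 that unfolding gsol_def by (simp add: v2)
 qed
 have "norm (v xi t - v xi s - integral {s..t} (gf sg (int K) v xi)) <= ep * (t - s)" if *: "xi \<in> symF K" "a <= s" "s <= t" "t <= c" for xi s t
 proof -
  consider "t <= b" | "b <= s" | "s <= b" "b <= t" by linarith
  then show ?thesis proof cases
   case 3
   let ?g = "gf sg (int K) v xi"
   have "?g integrable_on {s..t}"
    by (intro integrable_continuous_real gf_cont continuous_on_subset[OF vc]) (use * in auto)
   from Henstock_Kurzweil_Integration.integral_combine[OF 3 this]
   have e: "v xi t - v xi s - integral {s..t} ?g = (v xi t - v xi b - integral {b..t} ?g) + (v xi b - v xi s - integral {s..b} ?g)"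
    by (simp add: algebra_simps)
   then have "norm (v xi t - v xi s - integral {s..t} ?g) <= ep * (t - b) + ep * (b - s)"
    unfolding e by (intro order_trans[OF norm_triangle_ineq add_mono] i1 i2) (use 3 * in auto)
   then show ?thesis by (simp add: algebra_simps)
  qed (use i1 i2 * in auto)
 qed
 moreover have "(\<Sum>k\<in>symF K. (norm (v k t))^2) <= A" if "t \<in> {a..c}" for t
  using 1 2 that unfolding gsol_def by (cases "t <= b") (auto simp: v_def)
 moreover have "v (-k) t = cnj (v k t)" "\<bar>k\<bar> > int K ==> v k t = 0" for k t using 1 2 unfolding gsol_def by (auto simp: v_def)
 ultimately have "gsol sg K ep A a c v" using vc unfolding gsol_def by blast
 then show ?thesis unfolding v_def .
qed

text \<open>One Euler step from the point p at time c, in both directions of time. By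
  \<open>gf_conservation\<close> the first-order change of the squared norm vanishes, so it grows
  only by a term of order h^2; a sum of many small steps therefore costs arbitrarily little.\<close>

lemma gsol_cell:
 fixes R M :: real
 assumes lip: "!!xi s s' r r' \<delta>. xi \<in> {-int K..int K} ==> (!!k. norm (s k) <= R) ==> (!!k. norm (s' k) <= R) ==>
   (!!k. norm (s k - s' k) <= \<delta>) ==> norm (gf sg (int K) (%k _. s k) xi r - gf sg (int K) (%k _. s' k) xi r') <= M * (\<bar>r - r'\<bar> + \<delta>)"
  and M: "M >= 0" and R: "R >= 0" and h: "h >= 0" "M * (h + h * (M * R)) <= ep"
  and A: "A + h^2 * (card (symF K) * (M * R)^2) <= A'" "A' <= R^2"
  and p: "!!k. \<bar>k\<bar> > int K ==> p k = 0" "!!k. p (-k) = cnj (p k)" "(\<Sum>k\<in>symF K. (norm (p k))^2) <= A"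
 shows "gsol sg K ep A' (c - h) (c + h) (%k t. if \<bar>k\<bar> <= int K then p k + of_real (t - c) * gf sg (int K) (%k _. p k) k c else 0)"
proof -
 let ?g = "%xi. gf sg (int K) (%k _. p k) xi c"
 define l where "l k t = (if \<bar>k\<bar> <= int K then p k + of_real (t - c) * ?g k else 0)" for k t
 have le: "norm (z k) <= R" if z: "(\<Sum>k\<in>symF K. (norm (z k))^2) <= A'" "!!k. \<bar>k\<bar> > int K ==> z k = 0" for z :: "int => complex" and k
 proof (cases "k \<in> symF K")
  case True
  then have "(norm (z k))^2 <= (\<Sum>k\<in>symF K. (norm (z k))^2)" by (intro member_le_sum) auto
  then have "(norm (z k))^2 <= R^2" using z(1) A(2) by linarith
  then show ?thesis using R by (rule power2_le_imp_le)
 qed (use z(2)[of k] R in auto)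
 have "0 <= h^2 * (card (symF K) * (M * R)^2)" by simp
 then have pA: "(\<Sum>k\<in>symF K. (norm (p k))^2) <= A'" using p(3) A(1) by linarith
 note pR = le[OF pA p(1)]
 have g: "norm (?g xi) <= M * R" if "xi \<in> symF K" for xi
  using lip[of xi p "%_. 0" R c c] that pR R by (simp add: gf_def abs_le_iff)
 have ll: "(\<Sum>k\<in>symF K. (norm (l k t))^2) <= A'" if t: "t \<in> {c - h..c + h}" for t proof -
  have "(norm (l k t))^2 = (norm (p k))^2 + 2 * (t - c) * Re (?g k * p (-k)) + (t - c)^2 * (norm (?g k))^2" if "k \<in> symF K" for k
   using that unfolding l_def p(2) cmod_power2 by (simp add: power2_eq_square algebra_simps)
  then have "(\<Sum>k\<in>symF K. (norm (l k t))^2) = (\<Sum>k\<in>symF K. (norm (p k))^2) + 2 * (t - c) * Re (\<Sum>k\<in>symF K. ?g k * p (-k)) + (\<Sum>k\<in>symF K. (t - c)^2 * (norm (?g k))^2)"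
   by (simp add: sum.distrib sum_distrib_left)
  also have "(\<Sum>k\<in>symF K. ?g k * p (-k)) = 0" by (rule gf_conservation[OF p(1)])
  also have "(\<Sum>k\<in>symF K. (t - c)^2 * (norm (?g k))^2) <= (\<Sum>k\<in>symF K. h^2 * (M * R)^2)"
   using abs_le_square_iff[of "t - c" h] t h by (intro sum_mono mult_mono[OF _ power_mono[OF g]]) auto
  finally show ?thesis using p(3) A(1) by (simp add: mult_ac)
 qed
 have lz: "l k t = 0" if "\<bar>k\<bar> > int K" for k t using that by (simp add: l_def)
 have lc: "continuous_on S (l k)" for S k unfolding l_def by (cases "\<bar>k\<bar> <= int K") (auto intro!: continuous_intros)
 have rl: "l (-k) t = cnj (l k t)" for k t unfolding l_def using gf_cnj[of "%k _. p k" c, OF p(2)] p(2) by simp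
 have lp: "norm (p k - l k t) <= h * (M * R)" if "t \<in> {c - h..c + h}" for k t proof (cases "k \<in> symF K")
  case True
  then have "norm (p k - l k t) = \<bar>t - c\<bar> * norm (?g k)" by (simp add: l_def norm_mult flip: of_real_diff)
  also have "... <= h * (M * R)" using that by (intro mult_mono g True) (use h in auto)
  finally show ?thesis .
 qed (use p(1) h M R in \<open>simp add: l_def\<close>)
 have "norm (l xi t - l xi s - integral {s..t} (gf sg (int K) l xi)) <= ep * (t - s)"
  if xi: "xi \<in> symF K" and st: "c - h <= s" "s <= t" "t <= c + h" for xi s t proof -
  have i: "gf sg (int K) l xi integrable_on {s..t}" by (intro integrable_continuous_real gf_cont lc)
  have "l xi t - l xi s = integral {s..t} (%_. ?g xi)" using xi st by (simp add: l_def algebra_simps scaleR_conv_of_real)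
  then have "l xi t - l xi s - integral {s..t} (gf sg (int K) l xi) = integral {s..t} (%r. ?g xi - gf sg (int K) l xi r)"
   by (simp only: Henstock_Kurzweil_Integration.integral_diff[OF integrable_const_ivl i])
  also have "norm ... <= integral {s..t} (%_. ep)" proof (rule integral_norm_bound_integral)
   fix r assume r: "r \<in> {s..t}"
   have "norm (?g xi - gf sg (int K) (%k _. l k r) xi r) <= M * (\<bar>c - r\<bar> + h * (M * R))"
    by (rule lip) (use xi r st in \<open>auto simp: abs_le_iff intro!: pR lp le[OF ll lz]\<close>)
   also have "... <= M * (h + h * (M * R))" using M r st by (intro mult_left_mono add_right_mono) auto
   finally show "norm (?g xi - gf sg (int K) l xi r) <= ep" using h(2) gf_state[of sg "int K" l xi r] by simp
  qed (use i in \<open>auto intro: integrable_diff\<close>)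
  finally show ?thesis using st by (simp add: mult.commute)
 qed
 then have "gsol sg K ep A' (c - h) (c + h) l" unfolding gsol_def using lz lc rl ll by blast
 then show ?thesis unfolding l_def .
qed

lemma gsol_exists:
 assumes sg: "\<bar>sg\<bar> = 1" and pos: "ep > 0" "\<delta> > 0" "T > 0"
  and d: "!!k. \<bar>k\<bar> > int K ==> d k = 0" "!!k. d (-k) = cnj (d k)" "(\<Sum>k\<in>symF K. (norm (d k))^2) <= S"
 shows "\<exists>v. gsol sg K ep (S + \<delta>) (-T) T v \<and> (\<forall>k. v k 0 = d k)"
proof -
 define R where "R = sqrt (S + \<delta>)"
 have "0 <= (\<Sum>k\<in>symF K. (norm (d k))^2)" by (rule sum_nonneg) simp
 then have S: "S >= 0" using d(3) by linarith
 have R: "R >= 0" "R^2 = S + \<delta>" unfolding R_def using S pos by auto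
 obtain M where M: "M >= 0" and lip: "!!xi s s' r r' \<delta>. xi \<in> {-int K..int K} ==> (!!k. norm (s k) <= R) ==> (!!k. norm (s' k) <= R) ==>
   (!!k. norm (s k - s' k) <= \<delta>) ==> norm (gf sg (int K) (%k _. s k) xi r - gf sg (int K) (%k _. s' k) xi r') <= M * (\<bar>r - r'\<bar> + \<delta>)"
  using gf_lipschitz[OF sg R(1), of "int K"] by blast
 define L where "L = card (symF K) * (M * R)^2"
 have L: "L >= 0" by (simp add: L_def)
 \<comment> \<open>With h = T/m0 the defect is T M (1 + M R)/m0 and the total growth of the squared
   norm is T^2 L/m0; the choice makes them at most ep and \<delta>.\<close>
 obtain m0 :: nat where m0: "T * (M * (1 + M * R)) / ep + T^2 * L / \<delta> + 1 < m0" using reals_Archimedean2 by blast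
 have z: "0 <= T * (M * (1 + M * R)) / ep" "0 <= T^2 * L / \<delta>" using pos M R L by simp_all
 have m0p: "real m0 > 0" using m0 z by linarith
 define h where "h = T / m0"
 have h: "h >= 0" "h * m0 = T" using pos m0p by (simp_all add: h_def)
 have "T * (M * (1 + M * R)) / ep <= m0" "T^2 * L / \<delta> <= m0" using m0 z by linarith+
 then have hep: "M * (h + h * (M * R)) <= ep" and h\<delta>: "m0 * (h^2 * L) <= \<delta>"
  unfolding h_def using pos m0p by (simp_all add: field_simps power2_eq_square)
 have "m <= m0 ==> \<exists>v. gsol sg K ep (S + m * (h^2 * L)) (- (m * h)) (m * h) v \<and> (\<forall>k. v k 0 = d k)" for m
 proof (induction m)
  case 0
  have "s = 0 \<and> t = 0" if "0 <= s" "s <= t" "t <= 0" for s t :: real using that by linarith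
  then have "norm (integral {s..t} F) <= ep * (t - s)" if "0 <= s" "s <= t" "t <= 0" for s t :: real and F :: "real => complex"
   using that by fastforce
  then show ?case using d by (intro exI[of _ "%k _. d k"]) (auto simp: gsol_def)
 next
  case (Suc m)
  then obtain v where v: "gsol sg K ep (S + m * (h^2 * L)) (- (m * h)) (m * h) v" "!!k. v k 0 = d k" by auto
  let ?A = "S + Suc m * (h^2 * L)" and ?b = "m * h" and ?c = "Suc m * h"
  have b: "0 <= ?b" using h by simp
  have c: "?c = ?b + h" by (simp add: algebra_simps)
  have "real (Suc m) * (h^2 * L) <= m0 * (h^2 * L)" using Suc.prems L by (intro mult_right_mono) auto
  then have A: "?A <= R^2" using R h\<delta> by linarith
  have A1: "S + m * (h^2 * L) + h^2 * (card (symF K) * (M * R)^2) <= ?A" by (simp add: L_def algebra_simps)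
  define l where "l c k t = (if \<bar>k\<bar> <= int K then v k c + of_real (t - c) * gf sg (int K) (%k _. v k c) k c else 0)" for c k t
  have l: "gsol sg K ep ?A (c - h) (c + h) (l c)" if "c \<in> {-?b..?b}" for c
   unfolding l_def by (rule gsol_cell[OF lip M R(1) h(1) hep A1 A]) (use v(1) that in \<open>auto simp: gsol_def\<close>)
  have lv: "l c k c = v k c" for c k using v(1) unfolding l_def gsol_def by auto
  have vA: "gsol sg K ep ?A (- ?b) ?b v" by (rule gsol_mono[OF v(1)]) (use L in \<open>simp_all add: mult_right_mono\<close>)
  have "gsol sg K ep ?A ?b ?c (l ?b)" by (rule gsol_mono[OF l]) (use b h c in auto)
  then have 1: "gsol sg K ep ?A (- ?b) ?c (%k t. if t <= ?b then v k t else l ?b k t)"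
   by (rule gsol_glue[OF vA]) (use lv b h c in auto)
  have "gsol sg K ep ?A (- ?c) (- ?b) (l (- ?b))" by (rule gsol_mono[OF l]) (use b h c in auto)
  then have "gsol sg K ep ?A (- ?c) ?c (%k t. if t <= - ?b then l (- ?b) k t else if t <= ?b then v k t else l ?b k t)"
   by (rule gsol_glue[OF _ 1]) (use lv b h c in auto)
  moreover have "(if 0 <= - ?b then l (- ?b) k 0 else if 0 <= ?b then v k 0 else l ?b k 0) = d k" for k
   using b lv[of 0 k] v(2) by (auto simp: antisym_conv)
  ultimately show ?case by blast
 qed
 from this[of m0] obtain v where "gsol sg K ep (S + m0 * (h^2 * L)) (- (m0 * h)) (m0 * h) v" "\<forall>k. v k 0 = d k" by auto
 then show ?thesis using gsol_mono[of sg K ep "S + m0 * (h^2 * L)" "- (m0 * h)" "m0 * h" v "-T" T "S + \<delta>"] h h\<delta> by (auto simp: mult.commute)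
qed

section \<open>Existence of weak solutions\<close>

lemma approx_sol_hold1:
 assumes v: "approx_sol sg N T ep R v" "hold_bd N T v M" and st: "\<bar>s\<bar> <= T" "\<bar>t\<bar> <= T"
 shows "norm (v k t - v k s) <= jb k powr (33/64) * M * \<bar>t - s\<bar> powr (129/256)"
proof -
 have *: "norm (v k t - v k s) <= jb k powr (33/64) * M * \<bar>t - s\<bar> powr (129/256)" if "s < t" "-T <= s" "t <= T" for s t
 proof -
  have "incr v s t k <= M * (t - s) powr (129/256)" using approx_sol_hold[OF v, of s t "{k}"] that by simp
  from norm_le_jb[OF this] show ?thesis using that by (simp add: mult.assoc)
 qed
 show ?thesis
  using *[of s t] *[of t s] st by (cases s t rule: linorder_cases) (auto simp: norm_minus_commute abs_minus_commute abs_le_iff)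
qed

text \<open>Tychonoff's theorem over integer frequencies and rational times replaces a diagonal
  argument. The uniform Hoelder bound at each frequency then carries convergence from rational to
  all times.\<close>

lemma approx_sol_subsequence:
 assumes sg: "\<bar>sg\<bar> = 1" and R: "R >= 0" and v: "!!j. approx_sol sg (int j) (real j + 1) (1 / (real j + 1)) R (v j)"
 obtains r l where "strict_mono r" "!!k t. (%n. v (r n) k t) ----> l k t" "limit_sol sg R l"
proof -
 \<comment> \<open>Outside the time interval of the n-th approximation the value 0 keeps the
   coordinate in the compact ball; a fixed time is affected for finitely many n only.\<close>
 define f :: "nat => int \<times> rat => complex" where
  "f n p = (if of_rat (snd p) \<in> {- (real n + 1)..real n + 1} then v n (fst p) (of_rat (snd p)) else 0)" for n p
 let ?C = "PiE UNIV (%_. cball 0 R) :: (int \<times> rat => complex) set"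
 have "compact ?C"
  using compactin_PiE[of "%_. euclidean" UNIV "%_. cball 0 R :: complex set"] by (simp add: euclidean_product_topology)
 moreover have "norm (f n p) <= R" for n p
  using approx_sol_L2[OF v, of "of_rat (snd p)" n "{fst p}"] R unfolding f_def by (auto simp: abs_le_iff)
 then have "\<forall>n. f n \<in> ?C" by (simp add: PiE_def)
 ultimately obtain l0 r where r: "strict_mono (r :: nat => nat)" and "(f \<circ> r) ----> l0"
  using seq_compactE[OF compact_imp_seq_compact] by metis
 then have c: "(%n. f (r n) p) ----> l0 p" for p
  using continuous_on_tendsto_compose[OF continuous_on_product_coordinates[of p], of "f \<circ> r" l0 sequentially] by (simp add: o_def)
 have hold: "norm (v j k t - v j k s) <= jb k powr (33/64) * Mh R * \<bar>t - s\<bar> powr (129/256)" if "\<bar>s\<bar> <= j + 1" "\<bar>t\<bar> <= j + 1" for j k s t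
  by (rule approx_sol_hold1[OF v Mh(2)[OF R sg _ _ v]]) (use that in auto)
 have rn: "real n <= real (r n)" for n using seq_suble[OF r, of n] by simp
 have "convergent (%n. v (r n) k t)" for k t proof (rule Cauchy_convergent, rule metric_CauchyI)
  fix e :: real assume e: "e > 0"
  have "((%s. jb k powr (33/64) * Mh R * \<bar>s - t\<bar> powr (129/256)) \<longlongrightarrow> jb k powr (33/64) * Mh R * 0) (at t)"
   by (intro tendsto_mult_left powr_tendsto_0)
  then have "\<forall>\<^sub>F s in at t. jb k powr (33/64) * Mh R * \<bar>s - t\<bar> powr (129/256) < e / 3"
   by (rule order_tendstoD) (use e in simp)
  then obtain d where d: "d > 0" "!!s. s ~= t ==> dist s t < d ==> jb k powr (33/64) * Mh R * \<bar>s - t\<bar> powr (129/256) < e / 3"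
   unfolding eventually_at by blast
  obtain s s' where s: "s = of_rat s'" "t < s" "s < t + d" using of_rat_dense[of t "t + d"] d by auto
  have ds: "jb k powr (33/64) * Mh R * \<bar>s - t\<bar> powr (129/256) < e / 3" by (rule d) (use s in \<open>auto simp: dist_real_def\<close>)
  have "Cauchy (%n. f (r n) (k, s'))" by (rule LIMSEQ_imp_Cauchy[OF c])
  then obtain M where M: "!!m n. m >= M ==> n >= M ==> dist (f (r m) (k, s')) (f (r n) (k, s')) < e / 3"
   using e metric_CauchyD[of "%n. f (r n) (k, s')" "e / 3"] by auto
  obtain M' :: nat where M': "\<bar>s\<bar> + \<bar>t\<bar> < M'" using reals_Archimedean2 by blast
  show "\<exists>M. \<forall>m\<ge>M. \<forall>n\<ge>M. dist (v (r m) k t) (v (r n) k t) < e"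
  proof (intro exI[of _ "max M M'"] allI impI)
   fix m n assume mn: "max M M' <= m" "max M M' <= n"
   have b: "\<bar>s\<bar> <= r n + 1" "\<bar>t\<bar> <= r n + 1" if "max M M' <= n" for n using that M' rn[of n] by auto
   have fs: "f (r n) (k, s') = v (r n) k s" if "max M M' <= n" for n proof -
    have "s \<in> {- (real (r n) + 1)..real (r n) + 1}" using b(1)[OF that] by (auto simp: abs_le_iff)
    then show ?thesis by (simp add: f_def s(1))
   qed
   have h: "dist (v (r n) k s) (v (r n) k t) < e / 3" if "max M M' <= n" for n
    using hold[OF b(2,1)[OF that], of k] ds unfolding dist_norm by linarith
   have "dist (v (r m) k s) (v (r n) k s) < e / 3" using M[of m n] mn unfolding fs[OF mn(1)] fs[OF mn(2)] by simp
   then show "dist (v (r m) k t) (v (r n) k t) < e" using h[OF mn(1)] h[OF mn(2)] by metric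
  qed
 qed
 then obtain l where l: "!!k t. (%n. v (r n) k t) ----> l k t" unfolding convergent_def by metis
 have top: "filterlim (%n. real (r n)) at_top sequentially"
  by (rule filterlim_at_top_mono[OF filterlim_real_sequentially]) (use rn in auto)
 have "limit_sol sg R l" unfolding limit_sol_def
 proof (rule exI[of _ "%n. int (r n)"], rule exI[of _ "%n. real (r n) + 1"], rule exI[of _ "%n. 1 / (real (r n) + 1)"],
   rule exI[of _ "%n. v (r n)"], intro conjI allI l v)
  show T: "filterlim (%n. real (r n) + 1) at_top sequentially" by (rule filterlim_at_top_mono[OF top]) simp
  show "(%n. 1 / (real (r n) + 1)) ----> 0" by (rule real_tendsto_divide_at_top[OF tendsto_const T])
  show "filterlim (%n. int (r n)) at_top sequentially"
   using filterlim_compose[OF filterlim_int_sequentially filterlim_subseq[OF r]] .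
 qed auto
 then show ?thesis using that r l by blast
qed

lemma gsol_approx_sol:
 assumes g: "gsol sg K ep A (-T) T v" and A: "A <= R^2" "R >= 0"
 shows "approx_sol sg (int K) T ep R v"
proof -
 have "sqrt (\<Sum>k\<in>symF K. (norm (v k t))^2) <= R" if "t \<in> {-T..T}" for t
  using g A that unfolding gsol_def by (intro real_le_lsqrt) (auto intro: order_trans sum_nonneg)
 then show ?thesis using g unfolding gsol_def approx_sol_def L2_set_def symF_def by auto
qed

text \<open>The squared norm of the j-th polygon is at most S + 1/(j+1). The surplus vanishes in the
  limit, so the squared norm is bounded by S itself; strong continuity at time 0 depends on this
  sharp constant.\<close>

lemma limit_sol_exists:
 assumes sg: "\<bar>sg\<bar> = 1" and c: "!!k. c (-k) = cnj (c k)" "!!n. msq n c <= S"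
 obtains v R where "limit_sol sg R v" "!!k. v k 0 = c k" "!!k t. v (-k) t = cnj (v k t)"
  "!!n t. (\<Sum>k\<in>symF n. (norm (v k t))^2) <= S"
proof -
 have S: "S >= 0" using order_trans[OF _ c(2)[of 0]] by (simp add: sum_nonneg)
 define R where "R = sqrt (S + 1)"
 have R: "R >= 0" "R^2 = S + 1" unfolding R_def using S by auto
 let ?e = "%j. 1 / (real j + 1)"
 have "\<exists>v. gsol sg j (?e j) (S + ?e j) (- (real j + 1)) (real j + 1) v \<and> (\<forall>k. v k 0 = (if \<bar>k\<bar> <= int j then c k else 0))" for j
  by (rule gsol_exists[OF sg]) (use c in \<open>auto intro!: order_trans[OF eq_refl c(2)[of j]]\<close>)
 then obtain w where w: "!!j. gsol sg j (?e j) (S + ?e j) (- (real j + 1)) (real j + 1) (w j)"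
  "!!j k. w j k 0 = (if \<bar>k\<bar> <= int j then c k else 0)" by metis
 have e1: "?e j <= 1" for j by simp
 have "approx_sol sg (int j) (real j + 1) (?e j) R (w j)" for j by (rule gsol_approx_sol[OF w(1)]) (use R e1 in auto)
 then obtain r l where r: "strict_mono r" and l: "!!k t. (%n. w (r n) k t) ----> l k t" and sol: "limit_sol sg R l"
  using approx_sol_subsequence[OF sg R(1)] by blast
 have rn: "n <= r n" for n by (rule seq_suble[OF r])
 show ?thesis proof (rule that[OF sol])
  show "l k 0 = c k" for k proof (rule LIMSEQ_unique[OF l])
   show "(%n. w (r n) k 0) ----> c k"
   proof (rule tendsto_eventually, rule eventually_sequentiallyI[of "nat \<bar>k\<bar>"])
    fix n assume "nat \<bar>k\<bar> <= n"
    then have "\<bar>k\<bar> <= int (r n)" using rn[of n] by linarith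
    then show "w (r n) k 0 = c k" by (simp add: w)
   qed
  qed
  show "l (-k) t = cnj (l k t)" for k t proof (rule LIMSEQ_unique[OF l])
   show "(%n. w (r n) (-k) t) ----> cnj (l k t)" using w(1) tendsto_cnj[OF l] unfolding gsol_def by simp
  qed
  show "(\<Sum>k\<in>symF n. (norm (l k t))^2) <= S" for n t proof (rule LIMSEQ_le)
   show "(%j. \<Sum>k\<in>symF n. (norm (w (r j) k t))^2) ----> (\<Sum>k\<in>symF n. (norm (l k t))^2)" by (intro tendsto_intros l)
   have "?e ----> 0" using LIMSEQ_inverse_real_of_nat by (simp add: inverse_eq_divide add.commute)
   from tendsto_add[OF tendsto_const LIMSEQ_subseq_LIMSEQ[OF this r], of S]
   show "(%j. S + ?e (r j)) ----> S" by (simp add: o_def)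
   obtain m :: nat where m: "\<bar>t\<bar> < m" using reals_Archimedean2 by blast
   have "(\<Sum>k\<in>symF n. (norm (w (r j) k t))^2) <= S + ?e (r j)" if j: "max n m <= j" for j proof -
    have "(\<Sum>k\<in>symF n. (norm (w (r j) k t))^2) <= (\<Sum>k\<in>symF (r j). (norm (w (r j) k t))^2)"
     using j rn[of j] by (intro sum_mono2 symF_mono) auto
    also have "... <= S + ?e (r j)" proof -
     have "t \<in> {- (real (r j) + 1)..real (r j) + 1}" using j rn[of j] m by auto
     then show ?thesis using w(1)[of "r j"] unfolding gsol_def by blast
    qed
    finally show ?thesis .
   qed
   then show "\<exists>N. \<forall>j\<ge>N. (\<Sum>k\<in>symF n. (norm (w (r j) k t))^2) <= S + ?e (r j)" by blast
  qed
 qed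
qed

text \<open>The $L^2$ norm of the solution never exceeds that of the datum, so weak continuity at time $0$ is strong.\<close>

lemma weak_solution_exists:
 assumes psi: "cutoff psi" and sg: "\<bar>sg\<bar> = 1" and u0: "u0 \<in> L2T"
 shows "\<exists>u. weak_solution psi sg u0 u \<and> (\<exists>s<0. distr_of_real u \<in> F_space psi (qsym sg u0) s (1/2)) \<and>
   ((%t. L2T_norm (%x. u t x - u0 x)) \<longlongrightarrow> 0) (at 0)"
proof -
 define S where "S = P0 (%x. (u0 x)^2)"
 have S: "2 * pi * S = (L2T_norm u0)^2" by (simp add: S_def P0_def L2T_norm_sq)
 have sums: "msq n (rc u0) <= S" for n proof -
  have "2 * pi * msq n (rc u0) <= 2 * pi * S" using bessel[OF u0, of n] S by (simp only: L2T_norm_sq)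
  then show ?thesis by (rule mult_left_le_imp_le) simp
 qed
 obtain v R where v: "limit_sol sg R v" "!!k. v k 0 = rc u0 k" "!!k t. v (-k) t = cnj (v k t)"
  "!!n t. (\<Sum>k\<in>symF n. (norm (v k t))^2) <= S" by (rule limit_sol_exists[OF sg rc_neg sums]) blast
 let ?c = "%t k. cis (qsym sg u0 k * t) * v k t"
 have "\<exists>u\<in>L2T. \<forall>k. rc u k = ?c t k" for t proof -
  have "?c t (-k) = cnj (?c t k)" for k by (simp add: qsym_neg v(3) cis_cnj)
  moreover have "msq n (?c t) <= S" for n using v(4)[of t n] by (simp add: norm_mult)
  ultimately show ?thesis using riesz_fischer[of "?c t" S] by metis
 qed
 then obtain u1 where u1: "!!t. u1 t \<in> L2T" "!!t k. rc (u1 t) k = ?c t k" by metis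
 \<comment> \<open>\<open>u1 0\<close> agrees with the datum only almost everywhere; with this
   choice of representative u 0 = u0 holds literally.\<close>
 define u where "u t = (if t = 0 then u0 else u1 t)" for t
 interpret wsol psi sg u0 R v u by unfold_locales (use psi sg v u0 u1 in \<open>auto simp: u_def\<close>)
 have "u 0 = u0" by (simp add: u_def)
 have S0: "S >= 0" using order_trans[OF _ sums[of 0], of 0] by (simp add: sum_nonneg)
 have le: "(LINT x|circle. (u t x)^2) <= (L2T_norm u0)^2" for t proof -
  have "L2T_norm (u t) <= sqrt (2 * pi) * sqrt S"
   by (rule L2T_norm_le_modes[OF uL]) (use v(4)[of t] S0 in \<open>simp_all add: norm_rc\<close>)
  also have "... = sqrt ((L2T_norm u0)^2)" unfolding S[symmetric] by (simp add: real_sqrt_mult)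
  finally show ?thesis unfolding L2T_norm_sq[symmetric] by (intro power_mono) (simp_all add: L2T_norm_def)
 qed
 have b: "L2T_norm (%x. u t x - u0 x) <= sqrt (2 * (L2T_norm u0)^2 - 2 * (LINT x|circle. u t x * u0 x))" for t
  using le[of t] L2T_norm_sq_lin[OF uL[of t] u0, of 1 "-1"] unfolding L2T_norm_def[of "%x. u t x - u0 x"]
  by (intro real_sqrt_le_mono) (simp add: L2T_norm_sq)
 have "continuous_on UNIV (%t. LINT x|circle. u t x * u0 x)" using weakly_continuous u0 unfolding Cw_L2T_def by blast
 then have "((%t. LINT x|circle. u t x * u0 x) \<longlongrightarrow> (LINT x|circle. u 0 x * u0 x)) (at 0)"
  by (simp add: continuous_on_def)
 moreover have "(LINT x|circle. u 0 x * u0 x) = (L2T_norm u0)^2" unfolding L2T_norm_sq by (simp add: u_def power2_eq_square)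
 ultimately have "((%t. LINT x|circle. u t x * u0 x) \<longlongrightarrow> (L2T_norm u0)^2) (at 0)" by simp
 then have "((%t. sqrt (2 * (L2T_norm u0)^2 - 2 * (LINT x|circle. u t x * u0 x))) \<longlongrightarrow> sqrt (2 * (L2T_norm u0)^2 - 2 * (L2T_norm u0)^2)) (at 0)"
  by (intro tendsto_intros)
 then have "((%t. sqrt (2 * (L2T_norm u0)^2 - 2 * (LINT x|circle. u t x * u0 x))) \<longlongrightarrow> 0) (at 0)" by simp
 then have "((%t. L2T_norm (%x. u t x - u0 x)) \<longlongrightarrow> 0) (at 0)"
  by (rule Lim_null_comparison[rotated]) (use b in \<open>auto simp: L2T_norm_def\<close>)
 then show ?thesis using weak_sol \<open>u 0 = u0\<close> by auto
qed

section \<open>Smooth solutions\<close>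

lemma periodic_vderiv:
 fixes f :: "real => real"
 assumes d: "!!x. (f has_vector_derivative f' x) (at x)" and p: "periodic f"
 shows "periodic f'" unfolding periodic_def
proof
 fix x
 have "DERIV (%x. f (x + 2 * pi)) x :> f' (x + 2 * pi)"
  using d[of "x + 2 * pi"] by (simp add: DERIV_shift has_real_derivative_iff_has_vector_derivative[symmetric])
 then have "DERIV f x :> f' (x + 2 * pi)" using p by (simp add: periodic_def)
 then show "f' (x + 2 * pi) = f' x" using d[of x] by (simp add: DERIV_unique has_real_derivative_iff_has_vector_derivative[symmetric])
qed

lemma Hinf_deriv:
 assumes "u \<in> Hinf"
 shows "((vderiv ^^ j) u has_vector_derivative (vderiv ^^ Suc j) u x) (at x)"
  and "continuous_on UNIV ((vderiv ^^ j) u)" and "periodic ((vderiv ^^ j) u)" and "(vderiv ^^ j) u \<in> L2T"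
proof -
 have s: "(vderiv ^^ j) u differentiable (at x)" for j x using assms unfolding Hinf_def smooth1_def by blast
 show d: "((vderiv ^^ j) u has_vector_derivative (vderiv ^^ Suc j) u x) (at x)" for j x
  using s[of j x] unfolding vector_derivative_works by (simp add: vderiv_def)
 show c: "continuous_on UNIV ((vderiv ^^ j) u)"
  using s by (simp add: continuous_at_imp_continuous_on differentiable_imp_continuous_within)
 show p: "periodic ((vderiv ^^ j) u)" proof (induction j)
  case 0
  then show ?case using assms by (simp add: Hinf_def)
 next
  case (Suc j)
  then show ?case by (rule periodic_vderiv[OF d])
 qed
 show "(vderiv ^^ j) u \<in> L2T" by (rule L2T_continuous[OF p c])
qed

text \<open>Two values of f differ by at most the integral of |f'|; averaging over the second point
  bounds |f x| by the mean of |f| plus that integral, and both are bounded by L2 norms.\<close>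

lemma sobolev:
 assumes f: "!!x. (f has_vector_derivative f' x) (at x)" "continuous_on UNIV f'" "periodic f"
 shows "\<bar>f x\<bar> <= sqrt (2 * pi) * (L2T_norm f + L2T_norm f')"
proof -
 let ?I = "LINT x|circle. \<bar>f' x\<bar>"
 have fc: "continuous_on UNIV f" by (rule vector_derivative_continuous_on[OF f(1)])
 have L: "f \<in> L2T" "f' \<in> L2T" using f fc periodic_vderiv[OF f(1,3)] by (auto intro: L2T_continuous)
 have I: "?I = integral {0..2 * pi} (%x. \<bar>f' x\<bar>)" by (intro integral_circle_HK continuous_intros f)
 have ii: "(%x. \<bar>f' x\<bar>) integrable_on {a..b}" for a b by (intro integrable_continuous_real continuous_intros continuous_on_subset[OF f(2)]) auto
 have d: "\<bar>f x - f y\<bar> <= ?I" if xy: "y \<in> {0..2*pi}" "x \<in> {0..2*pi}" "y <= x" for x y proof -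
  have "(f' has_integral f x - f y) {y..x}"
   by (rule fundamental_theorem_of_calculus) (use xy f in \<open>auto intro: has_vector_derivative_at_within\<close>)
  then have "\<bar>f x - f y\<bar> = norm (integral {y..x} f')" "f' integrable_on {y..x}" by (auto simp: integral_unique)
  then have "\<bar>f x - f y\<bar> <= integral {y..x} (%x. \<bar>f' x\<bar>)"
   using integral_norm_bound_integral[of f' "{y..x}" "%x. \<bar>f' x\<bar>"] ii by auto
  also have "... <= ?I" unfolding I by (rule integral_subset_le) (use xy ii in auto)
  finally show ?thesis .
 qed
 have "\<bar>f x\<bar> <= sqrt (2 * pi) * (L2T_norm f + L2T_norm f')" if x: "x \<in> {0..<2*pi}" for x proof -
  have m: "\<bar>f x\<bar> <= \<bar>f y\<bar> + ?I" if "y \<in> {0..<2*pi}" for y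
   using d[of x y] d[of y x] that x by (cases "x <= y") auto
  have i: "integrable circle (%y. \<bar>f y\<bar>)" by (intro integrable_circle_continuous continuous_intros fc)
  have "(LINT y|circle. \<bar>f x\<bar>) <= (LINT y|circle. \<bar>f y\<bar> + ?I)"
   by (rule Bochner_Integration.integral_mono_AE) (use m i in auto)
  then have "2 * pi * \<bar>f x\<bar> <= (LINT y|circle. \<bar>f y\<bar>) + 2 * pi * ?I" using i by (simp add: measure_circle)
  moreover have "(LINT y|circle. \<bar>f y\<bar>) <= 2 * pi * (LINT y|circle. \<bar>f y\<bar>)"
   using mult_right_mono[of 1 "2 * pi" "LINT y|circle. \<bar>f y\<bar>"] pi_gt3 by simp
  ultimately have "2 * pi * \<bar>f x\<bar> <= 2 * pi * ((LINT y|circle. \<bar>f y\<bar>) + ?I)" by (simp add: distrib_left)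
  then have "\<bar>f x\<bar> <= (LINT y|circle. \<bar>f y\<bar>) + ?I" by simp
  then show ?thesis using L2T_L1_le[OF L(1)] L2T_L1_le[OF L(2)] by (simp add: distrib_left)
 qed
 moreover obtain y k where "y \<in> {0..<2*pi}" "x = y + 2 * pi * of_int k" using circle_rep[of x] by blast
 ultimately show ?thesis using periodic_int[OF f(3)] by metis
qed

text \<open>Convergence of two consecutive derivatives in L2 as s tends to t is, by
  \<open>sobolev\<close> applied to the difference, convergence uniform in x; together with
  continuity in x this gives joint continuity.\<close>

lemma C_Hinf_continuous:
 assumes u: "u \<in> C_Hinf"
 shows "continuous_on UNIV (%p. (vderiv ^^ j) (u (fst p)) (snd p))"
proof -
 have uH: "u t \<in> Hinf" for t using u by (simp add: C_Hinf_def)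
 let ?D = "%j t x. (vderiv ^^ j) (u t) x"
 let ?m = "%s t. sqrt (2 * pi) * (L2T_norm (%x. ?D j s x - ?D j t x) + L2T_norm (%x. ?D (Suc j) s x - ?D (Suc j) t x))"
 have m: "\<bar>?D j s x - ?D j t x\<bar> <= ?m s t" for s t x proof (rule sobolev)
  show "((%x. ?D j s x - ?D j t x) has_vector_derivative ?D (Suc j) s x - ?D (Suc j) t x) (at x)" for x
   by (intro has_vector_derivative_diff Hinf_deriv uH)
  show "continuous_on UNIV (%x. ?D (Suc j) s x - ?D (Suc j) t x)" by (intro continuous_on_diff Hinf_deriv uH)
  show "periodic (%x. ?D j s x - ?D j t x)" using Hinf_deriv(3)[OF uH, of j] by (simp add: periodic_def)
 qed
 have "isCont (%p. ?D j (fst p) (snd p)) (t, x)" for t x unfolding isCont_def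
 proof (rule LIM_zero_cancel, rule Lim_null_comparison, rule always_eventually, rule allI)
  fix p
  show "norm (?D j (fst p) (snd p) - ?D j (fst (t, x)) (snd (t, x))) <= ?m (fst p) t + \<bar>?D j t (snd p) - ?D j t x\<bar>"
   using m[of "fst p" "snd p" t] by simp
  have tt: "((%s. L2T_norm (%x. ?D i s x - ?D i t x)) \<longlongrightarrow> L2T_norm (%x. ?D i t x - ?D i t x)) (at t)" for i
   using u by (simp add: C_Hinf_def L2T_norm_def)
  then have ic: "isCont (%s. L2T_norm (%x. ?D i s x - ?D i t x)) t" for i by (simp add: isCont_def)
  have f: "((%p. fst p) \<longlongrightarrow> t) (at (t, x))" "((%p. snd p) \<longlongrightarrow> x) (at (t, x))"
   using tendsto_fst[OF tendsto_ident_at, of "(t, x)" UNIV] tendsto_snd[OF tendsto_ident_at, of "(t, x)" UNIV] by simp_all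
  have "isCont (?D j t) x" using Hinf_deriv(2)[OF uH, of j t] by (simp add: continuous_on_eq_continuous_at)
  from isCont_tendsto_compose[OF this f(2)] isCont_tendsto_compose[OF ic f(1)]
  have "((%p. ?m (fst p) t + \<bar>?D j t (snd p) - ?D j t x\<bar>) \<longlongrightarrow>
   sqrt (2 * pi) * (L2T_norm (%x. ?D j t x - ?D j t x) + L2T_norm (%x. ?D (Suc j) t x - ?D (Suc j) t x)) + \<bar>?D j t x - ?D j t x\<bar>) (at (t, x))"
   by (intro tendsto_add tendsto_mult_left tendsto_rabs tendsto_diff tendsto_const)
  then show "((%p. ?m (fst p) t + \<bar>?D j t (snd p) - ?D j t x\<bar>) \<longlongrightarrow> 0) (at (t, x))" by (simp add: L2T_norm_def)
 qed
 then show ?thesis by (simp add: continuous_at_imp_continuous_on)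
qed

lemma rc_deriv:
 assumes g: "!!x. (g has_vector_derivative g' x) (at x)" "continuous_on UNIV g'" "periodic g"
 shows "rc g' k = \<i> * of_int k * rc g k" unfolding rc_def
proof (rule fc_deriv)
 show "((%x. complex_of_real (g x)) has_vector_derivative of_real (g' x)) (at x)" for x
  using g(1)[of x] by (intro has_vector_derivative_of_real) (simp add: has_real_derivative_iff_has_vector_derivative)
qed (use g in \<open>auto intro!: continuous_intros simp: periodic_def\<close>)

text \<open>On the omitted modes |k| >= n, so the coefficient of g is at most 1/n times that of g';
  Bessel's inequality for g' does the rest, first up to m and then in the limit.\<close>

lemma psum_tail:
 assumes g: "!!x. (g has_vector_derivative g' x) (at x)" "continuous_on UNIV g'" "periodic g" and n: "n > 0"
 shows "rem g n <= L2T_norm g' / n"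
proof -
 have gc: "continuous_on UNIV g" by (rule vector_derivative_continuous_on[OF g(1)])
 have L: "g \<in> L2T" "g' \<in> L2T" using g gc periodic_vderiv[OF g(1,3)] by (auto intro: L2T_continuous)
 note rc' = rc_deriv[OF g(1-3)]
 let ?D = "%n. (rem g n)^2"
 have D: "?D n = (LINT x|circle. (g x)^2) - 2 * pi * msq n (rc g)" for n
  unfolding L2T_norm_sq by (rule L2T_sub_psum[OF L(1)])
 have "?D n <= (L2T_norm g' / n)^2 + ?D m" if nm: "n <= m" for m proof -
  have "?D n - ?D m = 2 * pi * (\<Sum>k\<in>symF m - symF n. (norm (rc g k))^2)"
   unfolding D using symF_mono[OF nm] by (subst sum_diff) (auto simp: algebra_simps)
  also have "... <= 2 * pi * (\<Sum>k\<in>symF m - symF n. (norm (rc g' k))^2 / (real n)^2)"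
  proof (intro mult_left_mono sum_mono)
   fix k assume "k \<in> symF m - symF n"
   then have "real_of_int (int n) <= real_of_int \<bar>k\<bar>" unfolding of_int_le_iff by simp
   then have "real n <= mag k" by simp
   then have "(real n)^2 * (norm (rc g k))^2 <= mag k^2 * (norm (rc g k))^2" by (intro mult_right_mono power_mono) auto
   then show "(norm (rc g k))^2 <= (norm (rc g' k))^2 / (real n)^2"
    using n unfolding rc' by (simp add: norm_mult power_mult_distrib field_simps)
  qed simp
  also have "... = 2 * pi * (\<Sum>k\<in>symF m - symF n. (norm (rc g' k))^2) / (real n)^2" by (simp add: sum_divide_distrib[symmetric])
  also have "... <= (2 * pi * msq m (rc g')) / (real n)^2" by (intro divide_right_mono mult_left_mono sum_mono2) auto
  also have "... <= (L2T_norm g')^2 / (real n)^2" unfolding L2T_norm_sq by (intro divide_right_mono bessel L) simp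
  finally show ?thesis by (simp add: power_divide)
 qed
 moreover have "(%m. (L2T_norm g' / n)^2 + ?D m) ----> (L2T_norm g' / n)^2 + 0^2"
  by (intro tendsto_intros L2T_psum_tendsto L)
 ultimately have "?D n <= (L2T_norm g' / n)^2 + 0^2" by (intro LIMSEQ_le_const[of _ _ "?D n"]) blast+
 then show ?thesis by (intro power2_le_imp_le[of "rem g n"]) (simp_all add: L2T_norm_def)
qed

lemma psum_deriv: "(psum c n has_vector_derivative psum (%k. \<i> * of_int k * c k) n x) (at x)"
 using bounded_linear.has_vector_derivative[OF bounded_linear_Re has_vector_derivative_trig[of c "symF n" x]]
 unfolding psum_def by simp

lemma psum_cont: "continuous_on S (psum c n)" unfolding psum_def by (intro continuous_intros)

lemma psum_Hinf: "psum c n \<in> Hinf"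
proof -
 have "\<exists>c'. (vderiv ^^ j) (psum c n) = psum c' n" for j proof (induction j)
  case (Suc j)
  then obtain c' where "(vderiv ^^ j) (psum c n) = psum c' n" by blast
  moreover have "vderiv (psum c' n) = psum (%k. \<i> * of_int k * c' k) n"
   unfolding vderiv_def using vector_derivative_at[OF psum_deriv] by blast
  ultimately show ?case by auto
 qed auto
 moreover have "psum c' n differentiable (at x)" for c' x using psum_deriv[of c' n x] by (rule differentiableI_vector)
 ultimately have "smooth1 (psum c n)" unfolding smooth1_def by metis
 then show ?thesis using psum_L2T[of c n] unfolding Hinf_def L2T_def by simp
qed

lemma psum_sup:
 assumes u: "u \<in> Hinf" and n: "n > 0" and B: "!!j. j <= 3 ==> L2T_norm ((vderiv ^^ j) u) <= B" and i: "i <= 1"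
 shows "\<bar>(vderiv ^^ i) u x - psum (rc ((vderiv ^^ i) u)) n x\<bar> <= sqrt (2 * pi) * (2 * B / n)"
proof -
 let ?D = "%j. (vderiv ^^ j) u"
 have rc': "rc (?D (Suc j)) k = \<i> * of_int k * rc (?D j) k" for j k
  by (rule rc_deriv[OF Hinf_deriv(1)[OF u] Hinf_deriv(2,3)[OF u]])
 have t: "L2T_norm (%x. ?D j x - psum (rc (?D j)) n x) <= B / n" if "j <= 2" for j proof -
  have "L2T_norm (%x. ?D j x - psum (rc (?D j)) n x) <= L2T_norm (?D (Suc j)) / n"
   by (rule psum_tail[OF Hinf_deriv(1)[OF u] Hinf_deriv(2,3)[OF u] n])
  also have "... <= B / n" by (intro divide_right_mono B) (use that in auto)
  finally show ?thesis .
 qed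
 have "\<bar>?D i x - psum (rc (?D i)) n x\<bar> <= sqrt (2 * pi) * (L2T_norm (%x. ?D i x - psum (rc (?D i)) n x) + L2T_norm (%x. ?D (Suc i) x - psum (rc (?D (Suc i))) n x))"
 proof (rule sobolev)
  show "((%x. ?D i x - psum (rc (?D i)) n x) has_vector_derivative ?D (Suc i) x - psum (rc (?D (Suc i))) n x) (at x)" for x
   unfolding rc'[abs_def] by (intro has_vector_derivative_diff Hinf_deriv u psum_deriv)
  show "continuous_on UNIV (%x. ?D (Suc i) x - psum (rc (?D (Suc i))) n x)" by (intro continuous_on_diff Hinf_deriv u psum_cont)
  show "periodic (%x. ?D i x - psum (rc (?D i)) n x)" using Hinf_deriv(3)[OF u, of i] psum_L2T[of "rc (?D i)" n] by (simp add: periodic_def L2T_def)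
 qed
 also have "... <= sqrt (2 * pi) * (B / n + B / n)" by (intro mult_left_mono add_mono t) (use i in auto)
 finally show ?thesis by simp
qed

section \<open>Truncations of a smooth solution\<close>

locale smooth_sol =
 fixes w0 :: "real => real" and u :: "real => real => real"
 assumes sol: "smooth_solution 1 w0 u"
begin

abbreviation D where "D j t x \<equiv> (vderiv ^^ j) (u t) x"

definition rhs where "rhs t x = 6 * (D 0 t x)^2 * D 1 t x - D 3 t x"

lemma uC: "u \<in> C_Hinf" and uH: "u t \<in> Hinf" and u_0: "u 0 = w0"
 and ut: "((%s. u s x) has_vector_derivative rhs t x) (at t)"
 using sol unfolding smooth_solution_def C_Hinf_def rhs_def by auto

lemma D_cont: "continuous_on UNIV (%p. D j (fst p) (snd p))" by (rule C_Hinf_continuous[OF uC])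

lemma D_deriv: "(D j t has_vector_derivative D (Suc j) t x) (at x)" by (rule Hinf_deriv(1)[OF uH])

lemma D_slice: "continuous_on S (D j t)" using Hinf_deriv(2)[OF uH] by (rule continuous_on_subset) simp

lemma rhs_cont: "continuous_on UNIV (%p. rhs (fst p) (snd p))" unfolding rhs_def by (intro continuous_intros D_cont)

lemma uL: "u t \<in> L2T" using Hinf_deriv(4)[OF uH, of 0 t] by simp

text \<open>$2 u (6 u^2 u_x - u_{xxx})$ is the derivative of $3 u^4 - 2 u u_{xx} + u_x^2$.\<close>

lemma mass: "P0 (%x. (u t x)^2) = P0 (%x. (w0 x)^2)"
proof -
 let ?F = "%t x. 3 * (D 0 t x * D 0 t x) * (D 0 t x * D 0 t x) - 2 * D 0 t x * D 2 t x + D 1 t x * D 1 t x"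
 have i0: "(LINT x|circle. 2 * D 0 t x * rhs t x) = 0" for t proof -
  have d: "(D 0 t has_real_derivative D 1 t x) (at x)" "(D 1 t has_real_derivative D 2 t x) (at x)" "(D 2 t has_real_derivative D 3 t x) (at x)" for x
   using D_deriv[of 0 t x] D_deriv[of 1 t x] D_deriv[of 2 t x] unfolding has_real_derivative_iff_has_vector_derivative by (simp_all add: numeral_2_eq_2 numeral_3_eq_3)
  have "(?F t has_vector_derivative 2 * D 0 t x * rhs t x) (at x)" for x
   unfolding has_real_derivative_iff_has_vector_derivative[symmetric] rhs_def
   by (rule derivative_eq_intros d refl)+ (simp add: algebra_simps power2_eq_square)
  then have "(LINT x|circle. 2 * D 0 t x * rhs t x) = ?F t (2 * pi) - ?F t 0"
   by (rule integral_circle_FTC) (unfold rhs_def, intro continuous_intros D_slice)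
  also have "... = 0" proof -
   have "D j t (2 * pi) = D j t 0" for j using Hinf_deriv(3)[OF uH, of j t] unfolding periodic_def by (metis add_0)
   then show ?thesis by (simp only: diff_self)
  qed
  finally show ?thesis .
 qed
 have d: "((%s. LINT x|circle. (u s x)^2) has_vector_derivative 0) (at t)" for t proof -
  have "((%s. u s x * u s x) has_vector_derivative u s x * rhs s x + rhs s x * u s x) (at s)" for s x
   by (rule has_vector_derivative_mult[OF ut ut])
  then have "((%s. (u s x)^2) has_vector_derivative 2 * D 0 s x * rhs s x) (at s)" for s x
   by (simp add: power2_eq_square algebra_simps)
  then have "((%s. LINT x|circle. (%(s, x). (u s x)^2) (s, x)) has_vector_derivative (LINT x|circle. (%(s, x). 2 * D 0 s x * rhs s x) (t, x))) (at t)"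
   using D_cont[of 0] rhs_cont by (intro circle_leibniz) (auto simp: case_prod_unfold intro!: continuous_intros)
  then show ?thesis using i0[of t] by simp
 qed
 then have "(LINT x|circle. (u t x)^2) = (LINT x|circle. (u 0 x)^2)"
  using has_vector_derivative_zero_constant[of UNIV "%s. LINT x|circle. (u s x)^2"] by (metis UNIV_I convex_UNIV has_vector_derivative_at_within)
 then show ?thesis by (simp add: P0_def u_0)
qed

abbreviation P where "P \<equiv> P0 (%x. (w0 x)^2)"
abbreviation q where "q \<equiv> qsym 1 w0"

definition prof where "prof k t = cis (- q k * t) * rc (u t) k"

lemma D_Lc: "integrable circle (%x. complex_of_real (g x))" if "continuous_on UNIV g" for g
 by (intro integrable_circle_continuous continuous_intros that)

lemma rc_D: "rc (D (Suc j) t) k = \<i> * of_int k * rc (D j t) k"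
 by (rule rc_deriv[OF D_deriv D_slice Hinf_deriv(3)[OF uH]])

text \<open>The symbol q collects exactly the third derivative and 6 P u_x. The phase removes both
  and leaves the mode of the nonlinearity with the mean subtracted.\<close>

lemma prof_deriv:
 "(prof k has_vector_derivative cis (- q k * t) * rc (%x. 6 * ((D 0 t x)^2 - P) * D 1 t x) k) (at t)"
proof -
 have "((%s. LINT y|circle. (%(s, y). of_real (u s y) * cis (- of_int k * y)) (s, y)) has_vector_derivative
   (LINT y|circle. (%(s, y). of_real (rhs s y) * cis (- of_int k * y)) (t, y))) (at t)" proof (rule circle_leibniz)
  show "((%s. (%(s, y). complex_of_real (u s y) * cis (- of_int k * y)) (s, y)) has_vector_derivative (%(s, y). of_real (rhs s y) * cis (- of_int k * y)) (s, y)) (at s)" for s y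
   unfolding prod.case using ut[of y s] by (intro has_vector_derivative_mult_left has_vector_derivative_of_real) (simp add: has_real_derivative_iff_has_vector_derivative)
 qed (use D_cont[of 0] rhs_cont in \<open>auto simp: case_prod_unfold intro!: continuous_intros\<close>)
 from has_vector_derivative_mult_right[OF this, of "1 / (2 * pi)"]
 have d: "((%s. rc (u s) k) has_vector_derivative rc (rhs t) k) (at t)" by (simp add: rc_def fc_eq)
 let ?n = "%x. 6 * ((D 0 t x)^2 - P) * D 1 t x"
 have "rc (rhs t) k = fc (%x. 1 * of_real (?n x) + 1 * (of_real (6 * P) * of_real (D 1 t x) + (-1) * of_real (D 3 t x))) k"
  unfolding rc_def by (rule arg_cong[of _ _ "%f. fc f k"]) (auto simp: rhs_def algebra_simps)
 also have "... = rc ?n k + of_real (6 * P) * rc (D 1 t) k - rc (D 3 t) k"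
  by (subst fc_lin, (intro D_Lc integrable_circle_continuous continuous_intros D_slice)+)+ (simp add: rc_def)
 also have "rc (D 1 t) k = \<i> * of_int k * rc (u t) k" using rc_D[of 0 t k] by simp
 also have "rc (D 3 t) k = - \<i> * of_int k ^ 3 * rc (u t) k"
  using rc_D[of 0 t k] rc_D[of 1 t k] rc_D[of 2 t k] by (simp add: numeral_2_eq_2 numeral_3_eq_3 mult_ac)
 finally have e: "rc (rhs t) k = rc ?n k + \<i> * q k * rc (u t) k" by (simp add: qsym_def algebra_simps power3_eq_cube)
 show ?thesis
  unfolding prof_def using has_vector_derivative_mult[OF has_vector_derivative_cis[of "- q k" t] d] e by (simp add: algebra_simps)
qed

lemma nlm_truncation:
 assumes k: "\<bar>k\<bar> <= int n"
 shows "rc (%x. 6 * ((psum (rc (u t)) n x)^2 - P0 (%y. (psum (rc (u t)) n y)^2)) * psum (rc (D 1 t)) n x) k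
   = nlm (%k. if \<bar>k\<bar> <= int n then rc (u t) k else 0) n k"
proof -
 let ?b = "%k. if \<bar>k\<bar> <= int n then rc (u t) k else 0"
 have w: "of_real (psum (rc (u t)) n x) = trig ?b (symF n) x" for x
  unfolding psum_def trig_real[of "rc (u t)", OF rc_neg] by (simp add: trig_def)
 have w': "of_real (psum (rc (D 1 t)) n x) = trig (%k. \<i> * of_int k * ?b k) (symF n) x" for x
  unfolding psum_def trig_real[of "rc (D 1 t)", OF rc_neg] using rc_D[of 0 t] by (simp add: trig_def)
 have p: "of_real (P0 (%y. (psum (rc (u t)) n y)^2)) = P0 (%y. (trig ?b (symF n) y)^2)"
  unfolding w[symmetric] P0_def of_real_power[symmetric] integral_complex_of_real by (simp add: scaleR_conv_of_real)
 let ?f = "%x. cis (- of_int k * x)"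
 have "(LINT x|circle. 6 * ((trig ?b (symF n) x)^2 - P0 (%y. (trig ?b (symF n) y)^2)) * trig (%k. \<i> * of_int k * ?b k) (symF n) x * ?f x)
   = 2 * pi * (\<Sum>xi\<in>symF (3 * n). nlm ?b n xi * fc ?f (-xi))"
  by (rule integral_nonlin[where f' = "%x. \<i> * of_real (- of_int k) * ?f x"])
   (use has_vector_derivative_cis[of "- of_int k"] periodic_cis[of "-k"] in \<open>auto intro!: continuous_intros\<close>)
 also have "(\<Sum>xi\<in>symF (3 * n). nlm ?b n xi * fc ?f (-xi)) = (\<Sum>xi\<in>symF (3 * n). if xi = k then nlm ?b n xi else 0)"
  using fc_cis[of "-k"] by (intro sum.cong refl) auto
 also have "... = nlm ?b n k" using k by (simp add: sum.delta')
 finally show ?thesis unfolding rc_def fc_eq of_real_mult of_real_diff of_real_power w w' p by simp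
qed

lemma sq_diff_le:
 fixes a b B e :: real
 assumes "\<bar>a\<bar> <= B" "\<bar>b\<bar> <= B" "\<bar>a - b\<bar> <= e" shows "\<bar>a^2 - b^2\<bar> <= e * (2 * B)"
proof -
 have "\<bar>a - b\<bar> * \<bar>a + b\<bar> <= e * (2 * B)" using assms by (intro mult_mono) auto
 then show ?thesis unfolding abs_mult[symmetric] by (simp add: power2_eq_square algebra_simps)
qed

lemma nonlin_diff_bound:
 fixes a a' b b' p p' B e :: real
 assumes B: "\<bar>a\<bar> <= B" "\<bar>a'\<bar> <= B" "\<bar>b\<bar> <= B" "\<bar>p\<bar> <= B^2"
  and e: "\<bar>a - a'\<bar> <= e" "\<bar>b - b'\<bar> <= e" "\<bar>p - p'\<bar> <= 2 * B * e" "\<bar>p'\<bar> <= B^2"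
 shows "\<bar>6 * (a^2 - p) * b - 6 * (a'^2 - p') * b'\<bar> <= 36 * B^2 * e"
proof -
 have B0: "B >= 0" "e >= 0" using B e by linarith+
 have a2: "\<bar>a^2 - a'^2\<bar> <= e * (2 * B)" by (rule sq_diff_le[OF B(1,2) e(1)])
 have "6 * (a^2 - p) * b - 6 * (a'^2 - p') * b' = 6 * (((a^2 - a'^2) - (p - p')) * b + (a'^2 - p') * (b - b'))"
  by (simp add: algebra_simps)
 then have "\<bar>6 * (a^2 - p) * b - 6 * (a'^2 - p') * b'\<bar> = 6 * \<bar>((a^2 - a'^2) - (p - p')) * b + (a'^2 - p') * (b - b')\<bar>"
  by (simp only: abs_mult abs_numeral)
 also have "... <= 6 * ((e * (2 * B) + 2 * B * e) * B + (B^2 + B^2) * e)"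
 proof (intro mult_left_mono order_trans[OF abs_triangle_ineq] add_mono)
  show "\<bar>(a^2 - a'^2 - (p - p')) * b\<bar> <= (e * (2 * B) + 2 * B * e) * B"
   unfolding abs_mult by (intro mult_mono order_trans[OF abs_triangle_ineq4] add_mono a2 e B) (use B0 in auto)
  have "\<bar>a'^2\<bar> <= B^2" using power_mono[OF B(2), of 2] by simp
  then show "\<bar>(a'^2 - p') * (b - b')\<bar> <= (B^2 + B^2) * e"
   unfolding abs_mult by (intro mult_mono order_trans[OF abs_triangle_ineq4] add_mono e) (use B0 in auto)
 qed simp
 finally show ?thesis by (simp add: power2_eq_square algebra_simps)
qed

text \<open>The modes |k| <= n of the solution obey the profile equation with the nonlinearity of u
  in place of that of its truncation. For a smooth solution the two differ by O(1/n) uniformly on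
  {-T..T}, hence so do all their modes. The bound R persists in time by \<open>mass\<close>.\<close>

lemma truncation_approx_sol:
 assumes T: "T >= 0" and e: "ep > 0" and R: "P <= R^2" "R >= 0"
 shows "\<exists>n\<ge>m. approx_sol 1 (int n) T ep R (%k t. if \<bar>k\<bar> <= int n then prof k t else 0)"
proof -
 have "\<exists>B\<ge>0. \<forall>t\<in>{-T..T}. \<forall>x. norm (complex_of_real (D j t x)) <= B" for j
  using periodic_bounded[of "%p. complex_of_real (D j (fst p) (snd p))" T] Hinf_deriv(3)[OF uH, of j] D_cont[of j]
  by (simp add: periodic_def continuous_intros)
 then obtain Bj where Bj: "!!j. Bj j >= 0" "!!j t x. t \<in> {-T..T} ==> \<bar>D j t x\<bar> <= Bj j" by (simp only: norm_of_real) metis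
 define A where "A = (\<Sum>j\<le>3. sqrt (2 * pi) * Bj j)"
 have A: "L2T_norm (D j t) <= A" if "j <= 3" "t \<in> {-T..T}" for j t proof -
  have "(LINT x|circle. (D j t x)^2) <= (LINT x|circle. (Bj j)^2)" proof (rule Bochner_Integration.integral_mono)
   show "integrable circle (%x. (D j t x)^2)" by (intro integrable_circle_continuous continuous_intros D_slice)
   show "(D j t x)^2 <= (Bj j)^2" for x using power_mono[OF Bj(2)[OF that(2)], of j x 2] by simp
  qed simp
  then have "L2T_norm (D j t) <= sqrt (2 * pi * (Bj j)^2)" unfolding L2T_norm_def by (intro real_sqrt_le_mono) (simp add: measure_circle)
  also have "... = sqrt (2 * pi) * Bj j" using Bj(1)[of j] by (simp add: real_sqrt_mult)
  also have "... <= A" unfolding A_def using that Bj(1) by (intro member_le_sum[of j "{..3}" "%j. sqrt (2 * pi) * Bj j"]) auto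
  finally show ?thesis .
 qed
 define B where "B = Bj 0 + Bj 1 + 1"
 define c where "c = sqrt (2 * pi) * (2 * A)"
 have A0: "A >= 0" unfolding A_def using Bj(1) by (intro sum_nonneg) auto
 have c0: "c >= 0" unfolding c_def using A0 by simp
 \<comment> \<open>The truncation error is at most c/n by \<open>psum_sup\<close>. The choice makes
   it at most 1, so that B also bounds the truncation, and makes 36 B^2 c/n, the error of the
   nonlinearity, at most ep.\<close>
 obtain n0 :: nat where n0: "c + 36 * B^2 * c / ep < n0" using reals_Archimedean2 by blast
 define n where "n = max (max m 1) n0"
 have n: "n >= m" "n > 0" "n0 <= n" unfolding n_def by auto
 define \<eta> where "\<eta> = c / n"
 have n': "c <= n" "36 * B^2 * c / ep <= n" using n0 n(3) c0 e by (smt (verit) divide_nonneg_pos mult_nonneg_nonneg of_nat_le_iff zero_le_power2)+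
 have \<eta>: "0 <= \<eta>" "\<eta> <= 1" "36 * B^2 * \<eta> <= ep" unfolding \<eta>_def using n n' c0 e by (simp_all add: field_simps)
 have sup: "\<bar>D i t x - psum (rc (D i t)) n x\<bar> <= \<eta>" if "t \<in> {-T..T}" "i <= 1" for i t x
  using psum_sup[OF uH[of t] n(2) A that(2), of x] that(1) unfolding \<eta>_def c_def by simp
 define b where "b t k = (if \<bar>k\<bar> <= int n then rc (u t) k else 0)" for t k
 define vn where "vn k t = (if \<bar>k\<bar> <= int n then prof k t else 0)" for k t
 have gf: "gf 1 (int n) vn k t = cis (- q k * t) * nlm (b t) n k" for k t proof -
  have "(%k. cis (q k * t) * vn k t) = b t" by (auto simp: vn_def b_def prof_def mult.assoc[symmetric] cis_mult)
  then have "nlm (b t) n k = cis (q k * t) * gf 1 (int n) vn k t"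
   using nlm_gf[of q, OF qsym_om qsym_neg, of t vn n k] by simp
  then show ?thesis by (simp add: mult.assoc[symmetric] cis_mult)
 qed
 have err: "norm (cis (- q k * t) * rc (%x. 6 * ((D 0 t x)^2 - P) * D 1 t x) k - gf 1 (int n) vn k t) <= ep"
  if t: "t \<in> {-T..T}" and k: "\<bar>k\<bar> <= int n" for k t proof -
  let ?w = "psum (rc (u t)) n" and ?w' = "psum (rc (D 1 t)) n"
  let ?f = "%x. 6 * ((D 0 t x)^2 - P) * D 1 t x" and ?g = "%x. 6 * ((?w x)^2 - P0 (%y. (?w y)^2)) * ?w' x"
  have d0: "\<bar>D 0 t x - ?w x\<bar> <= \<eta>" "\<bar>D 1 t x - ?w' x\<bar> <= \<eta>" for x using sup[OF t, of 0 x] sup[OF t, of 1 x] by simp_all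
  have bd: "\<bar>D 0 t x\<bar> <= B" "\<bar>?w x\<bar> <= B" "\<bar>D 1 t x\<bar> <= B" for x
   using Bj(2)[OF t, of 0 x] Bj(2)[OF t, of 1 x] Bj(1)[of 0] Bj(1)[of 1] d0(1)[of x] \<eta>(2) unfolding B_def by linarith+
  have sq: "\<bar>P0 f\<bar> <= M" if "continuous_on UNIV f" "!!x. \<bar>f x\<bar> <= M" for f :: "real => real" and M
  proof -
   have "\<bar>LINT x|circle. f x\<bar> <= (LINT x|circle. \<bar>f x\<bar>)" by (rule integral_abs_bound)
   also have "... <= (LINT x|circle. M)"
    by (rule Bochner_Integration.integral_mono) (use that in \<open>auto intro!: integrable_circle_continuous continuous_intros\<close>)
   also have "... = 2 * pi * M" by (simp add: measure_circle)
   finally show ?thesis by (simp add: P0_def abs_mult field_simps)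
  qed
  have Pt: "P = P0 (%x. (D 0 t x)^2)" using mass[of t] by simp
  have p1: "\<bar>P\<bar> <= B^2" unfolding Pt
   by (rule sq) (use power_mono[OF bd(1), of _ 2] in \<open>auto intro!: continuous_intros D_slice[of _ 0, unfolded funpow_0]\<close>)
  have p2: "\<bar>P0 (%y. (?w y)^2)\<bar> <= B^2"
   by (rule sq) (use power_mono[OF bd(2), of _ 2] in \<open>auto intro!: continuous_intros psum_cont\<close>)
  have "\<bar>P0 (%x. (D 0 t x)^2 - (?w x)^2)\<bar> <= \<eta> * (2 * B)" proof (rule sq)
   show "\<bar>(D 0 t x)^2 - (?w x)^2\<bar> <= \<eta> * (2 * B)" for x by (rule sq_diff_le[OF bd(1,2) d0(1)])
  qed (intro continuous_intros D_slice psum_cont)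
  also have "P0 (%x. (D 0 t x)^2 - (?w x)^2) = P - P0 (%y. (?w y)^2)"
   unfolding Pt P0_def by (subst Bochner_Integration.integral_diff)
    (auto simp: right_diff_distrib intro!: integrable_circle_continuous continuous_intros D_slice[of _ 0, unfolded funpow_0] psum_cont)
  finally have p3: "\<bar>P - P0 (%y. (?w y)^2)\<bar> <= 2 * B * \<eta>" by (simp add: mult_ac)
  have fgc: "continuous_on UNIV ?f" "continuous_on UNIV ?g" by (intro continuous_intros D_slice psum_cont)+
  have le: "\<bar>?f x - ?g x\<bar> <= ep" for x
   using nonlin_diff_bound[OF bd[of x] p1 d0[of x] p3 p2] \<eta>(3) by linarith
  define z where "z x = complex_of_real (?f x) - of_real (?g x)" for x
  have zi: "integrable circle z" unfolding z_def by (intro Bochner_Integration.integrable_diff D_Lc fgc)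
  have zn: "norm (z x) <= ep" for x using le[of x] unfolding z_def of_real_diff[symmetric] norm_of_real .
  have rz: "rc ?f k - rc ?g k = fc z k"
   unfolding rc_def[of ?f] rc_def[of ?g] z_def by (rule fc_diff[symmetric]) (intro D_Lc fgc)+
  have "norm (fc z k) <= (LINT x|circle. norm (z x)) / (2 * pi)" by (rule norm_fc_le[OF zi])
  also have "... <= (LINT x|circle. ep) / (2 * pi)"
   by (intro divide_right_mono Bochner_Integration.integral_mono zn integrable_norm zi) simp_all
  also have "... = ep" by (simp add: measure_circle)
  finally have "norm (rc ?f k - rc ?g k) <= ep" by (simp only: rz)
  moreover have "b t = (%k. if \<bar>k\<bar> <= int n then rc (u t) k else 0)" by (auto simp: b_def)
  then have "nlm (b t) n k = rc ?g k" using nlm_truncation[OF k, of t] by (simp only:)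
  then have "cis (- q k * t) * rc ?f k - gf 1 (int n) vn k t = cis (- q k * t) * (rc ?f k - rc ?g k)"
   unfolding gf by (simp only: right_diff_distrib)
  ultimately show ?thesis by (simp only: norm_mult norm_cis mult_1)
 qed
 have vc: "continuous_on S (vn k)" for S k proof -
  have "continuous_on UNIV (prof k)"
   by (intro continuous_at_imp_continuous_on ballI has_vector_derivative_continuous[OF prof_deriv])
  then show ?thesis unfolding vn_def by (cases "\<bar>k\<bar> <= int n") (auto intro: continuous_on_subset)
 qed
 have "approx_sol 1 (int n) T ep R vn" unfolding approx_sol_def proof (intro conjI allI impI ballI)
  show "vn k t = 0" if "\<bar>k\<bar> > int n" for k t using that by (simp add: vn_def)
  show "continuous_on {-T..T} (vn k)" for k by (rule vc)
  fix t
  have s: "(\<Sum>k\<in>symF n. (norm (vn k t))^2) = msq n (rc (u t))"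
   by (intro sum.cong refl) (simp add: vn_def prof_def norm_mult)
  have "(LINT x|circle. (u t x)^2) = 2 * pi * P" unfolding mass[of t, symmetric] by (simp add: P0_def)
  then have "2 * pi * (\<Sum>k\<in>symF n. (norm (vn k t))^2) <= 2 * pi * P" using bessel[OF uL, of t n] unfolding s by linarith
  then have "(\<Sum>k\<in>symF n. (norm (vn k t))^2) <= P" by (rule mult_left_le_imp_le) simp
  then have "(\<Sum>k\<in>symF n. (norm (vn k t))^2) <= R^2" using R(1) by linarith
  then show "L2_set (%k. norm (vn k t)) {- int n..int n} <= R"
   unfolding L2_set_def symF_def by (intro real_le_lsqrt) (use R in \<open>auto intro: sum_nonneg\<close>)
 next
  fix xi s t assume xi: "xi \<in> {- int n..int n}" and st: "-T <= s \<and> s <= t \<and> t <= T"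
  let ?h = "%t. cis (- q xi * t) * rc (%x. 6 * ((D 0 t x)^2 - P) * D 1 t x) xi"
  have k: "\<bar>xi\<bar> <= int n" using xi by auto
  have "(?h has_integral prof xi t - prof xi s) {s..t}"
   by (rule fundamental_theorem_of_calculus) (use st prof_deriv in \<open>auto intro: has_vector_derivative_at_within\<close>)
  then have h: "?h integrable_on {s..t}" "vn xi t - vn xi s = integral {s..t} ?h"
   using k by (auto simp: vn_def integral_unique)
  have g: "gf 1 (int n) vn xi integrable_on {s..t}" by (intro integrable_continuous_real gf_cont vc)
  have e: "vn xi t - vn xi s - integral {s..t} (gf 1 (int n) vn xi) = integral {s..t} (%r. ?h r - gf 1 (int n) vn xi r)"
   unfolding h(2) by (rule Henstock_Kurzweil_Integration.integral_diff[symmetric, OF h(1) g])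
  have "norm (integral {s..t} (%r. ?h r - gf 1 (int n) vn xi r)) <= integral {s..t} (%_. ep)"
  proof (rule integral_norm_bound_integral)
   show "norm (?h r - gf 1 (int n) vn xi r) <= ep" if "r \<in> {s..t}" for r by (rule err[OF _ k]) (use that st in auto)
  qed (intro integrable_diff h g integrable_const_ivl)+
  then show "norm (vn xi t - vn xi s - integral {s..t} (gf 1 (int n) vn xi)) <= ep * (t - s)"
   unfolding e using st by (simp add: mult.commute)
 qed
 then show ?thesis using n unfolding vn_def by blast
qed

end

section \<open>The flow of the defocusing equation\<close>

text \<open>The data are truncated to trigonometric polynomials, where the flow is the smooth
  solution; each solution is truncated in turn far enough to be an approximate solution with error
  1/(n+1) on a time interval of half-length n+1. Continuity of the flow identifies the limit of the
  modes.\<close>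

lemma flow_weak_solution:
 assumes psi: "cutoff psi" and Ph: "defocusing_flow_extension Ph" and u0: "u0 \<in> L2T"
 shows "weak_solution psi 1 u0 (Ph u0)" "\<exists>s<0. distr_of_real (Ph u0) \<in> F_space psi (qsym 1 u0) s (1/2)"
proof -
 define w where "w n = psum (rc u0) n" for n
 have wH: "w n \<in> Hinf" and wL: "w n \<in> L2T" for n unfolding w_def by (rule psum_Hinf, rule psum_L2T)
 have rcw: "rc (w n) k = (if \<bar>k\<bar> <= int n then rc u0 k else 0)" for n k
  unfolding w_def by (rule rc_psum[of "rc u0", OF rc_neg])
 have wlim: "(%n. L2T_norm (%x. w n x - u0 x)) ----> 0"
  unfolding w_def by (subst L2T_norm_minus_commute) (rule L2T_psum_tendsto[OF u0])
 have PhL: "Ph a t \<in> L2T" if "a \<in> L2T" for a t using Ph that unfolding defocusing_flow_extension_def C_L2T_def by blast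
 have "\<exists>u. smooth_solution 1 (w n) u \<and> (\<forall>t. AE x in circle. Ph (w n) t x = u t x)" for n
  using Ph wH unfolding defocusing_flow_extension_def by blast
 then obtain u where u: "!!n. smooth_solution 1 (w n) (u n)" "!!n t. AE x in circle. Ph (w n) t x = u n t x" by metis
 interpret sm: smooth_sol "w n" "u n" for n by unfold_locales (rule u)
 have rcu: "rc (u n t) k = rc (Ph (w n) t) k" for n t k
  unfolding rc_def by (rule fc_cong_AE[symmetric]) (use u(2)[of n t] PhL[OF wL] sm.uL in \<open>auto intro: L2T_integrable_c\<close>)
 have Phlim: "(%n. rc (Ph (w n) t) k) ----> rc (Ph u0 t) k" for t k proof (rule LIM_zero_cancel, rule tendstoI)
  fix e :: real assume "e > 0"
  then obtain d where d: "d > 0" "!!a. a \<in> L2T ==> L2T_norm (%x. a x - u0 x) < d ==> (\<forall>t\<in>{- \<bar>t\<bar>..\<bar>t\<bar>}. L2T_norm (%x. Ph a t x - Ph u0 t x) < e)"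
   using Ph u0 unfolding defocusing_flow_extension_def by blast
  have "\<forall>\<^sub>F n in sequentially. L2T_norm (%x. w n x - u0 x) < d" using order_tendstoD(2)[OF wlim] d(1) by blast
  then show "\<forall>\<^sub>F n in sequentially. dist (rc (Ph (w n) t) k - rc (Ph u0 t) k) 0 < e" proof eventually_elim
   case (elim n)
   have "L2T_norm (%x. Ph (w n) t x - Ph u0 t x) < e" using d(2)[OF wL elim] by (rule bspec) auto
   moreover have "norm (rc (%x. Ph (w n) t x - Ph u0 t x) k) <= L2T_norm (%x. Ph (w n) t x - Ph u0 t x)"
    by (intro norm_rc_le L2T_diff PhL wL u0)
   ultimately show ?case by (simp add: rc_diff[OF PhL[OF wL] PhL[OF u0]])
  qed
 qed
 let ?P = "%a. P0 (%x. (a x)^2)"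
 have Pn: "?P a = (L2T_norm a)^2 / (2 * pi)" for a by (simp add: P0_def L2T_norm_sq)
 have "(%n. L2T_norm (w n) - L2T_norm u0) ----> 0"
  by (rule Lim_null_comparison[OF _ wlim]) (simp add: L2T_norm_diff_abs wL u0)
 then have "(%n. L2T_norm (w n)) ----> L2T_norm u0" by (rule LIM_zero_cancel)
 then have Plim: "(%n. ?P (w n)) ----> ?P u0" unfolding Pn by (intro tendsto_divide tendsto_power tendsto_const) simp_all
 \<comment> \<open>Truncation shortens the coefficient sequence, so a single R, taken from u0,
   bounds all approximations.\<close>
 have Ple: "?P (w n) <= ?P u0" for n proof (rule LIMSEQ_le_const2[OF parseval[OF wL]], intro exI[of _ 0] allI impI)
  fix m
  have "msq m (rc (w n)) <= msq m (rc u0)" by (intro sum_mono) (simp add: rcw)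
  also have "... <= ?P u0" using bessel[OF u0, of m] by (simp add: P0_def field_simps)
  finally show "msq m (rc (w n)) <= ?P u0" .
 qed
 define R where "R = sqrt (?P u0)"
 have R: "R >= 0" "?P (w n) <= R^2" for n unfolding R_def using Ple[of n] by (simp_all add: Pn)
 let ?e = "%n. 1 / (real n + 1)"
 define A where "A n m \<longleftrightarrow> approx_sol 1 (int m) (real n + 1) (?e n) R (%k t. if \<bar>k\<bar> <= int m then sm.prof n k t else 0)" for n m
 have "\<exists>m\<ge>n. A n m" for n unfolding A_def by (rule sm.truncation_approx_sol) (use R in auto)
 then obtain N where N: "!!n. N n >= n" "!!n. A n (N n)" by metis
 define v where "v k t = cis (- qsym 1 u0 k * t) * rc (Ph u0 t) k" for k t
 \<comment> \<open>The profiles of the n-th solution are formed with its own conserved mean square,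
   not with that of u0; convergence of the norms of the data makes these phases converge.\<close>
 have qlim: "(%n. qsym 1 (w n) k) ----> qsym 1 u0 k" for k unfolding qsym_def by (intro tendsto_intros Plim)
 have T: "filterlim (%n. real n + 1) at_top sequentially"
  by (rule filterlim_at_top_mono[OF filterlim_real_sequentially]) simp
 have "limit_sol 1 R v" unfolding limit_sol_def
 proof (rule exI[of _ "%n. int (N n)"], rule exI[of _ "%n. real n + 1"], rule exI[of _ ?e],
   rule exI[of _ "%n k t. if \<bar>k\<bar> <= int (N n) then sm.prof n k t else 0"], intro conjI allI N[unfolded A_def] T)
  show "filterlim (%n. int (N n)) at_top sequentially"
   by (rule filterlim_at_top_mono[OF filterlim_int_sequentially]) (use N(1) in simp)
  show "?e ----> 0" by (rule real_tendsto_divide_at_top[OF tendsto_const T])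
  fix k t
  have "(%n. cis (- qsym 1 (w n) k * t) * rc (Ph (w n) t) k) ----> v k t"
   unfolding v_def by (intro tendsto_intros Phlim qlim)
  moreover have "\<forall>\<^sub>F n in sequentially. cis (- qsym 1 (w n) k * t) * rc (Ph (w n) t) k = (if \<bar>k\<bar> <= int (N n) then sm.prof n k t else 0)"
  proof (rule eventually_sequentiallyI[of "nat \<bar>k\<bar>"])
   fix n assume "nat \<bar>k\<bar> <= n"
   then have "\<bar>k\<bar> <= int (N n)" using N(1)[of n] by linarith
   then show "cis (- qsym 1 (w n) k * t) * rc (Ph (w n) t) k = (if \<bar>k\<bar> <= int (N n) then sm.prof n k t else 0)"
    by (simp add: sm.prof_def rcu)
  qed
  ultimately show "(%n. if \<bar>k\<bar> <= int (N n) then sm.prof n k t else 0) ----> v k t" by (rule Lim_transform_eventually)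
 qed auto
 then interpret wsol psi 1 u0 R v "Ph u0"
  by unfold_locales (use psi PhL[OF u0] in \<open>auto simp: v_def mult.assoc[symmetric] cis_mult\<close>)
 have "rc (Ph u0 0) k = rc u0 k" for k proof (rule LIMSEQ_unique[OF Phlim])
  have "\<forall>\<^sub>F n in sequentially. rc (Ph (w n) 0) k = rc u0 k"
   by (rule eventually_sequentiallyI[of "nat \<bar>k\<bar>"]) (auto simp: rcu[symmetric] sm.u_0 rcw)
  then show "(%n. rc (Ph (w n) 0) k) ----> rc u0 k" by (rule tendsto_eventually)
 qed
 then have "AE x in circle. Ph u0 0 x = u0 x" by (rule rc_unique[OF PhL[OF u0] u0])
 from weak_sol[OF this] show "weak_solution psi 1 u0 (Ph u0)" "\<exists>s<0. distr_of_real (Ph u0) \<in> F_space psi (qsym 1 u0) s (1/2)" .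
qed

theorem theorem1p2:
  fixes \<psi> :: "real \<Rightarrow> real"
  assumes "cutoff \<psi>"
  shows
    "(\<forall>\<sigma>\<in>{1, -1}. \<forall>u0\<in>L2T. \<exists>u. weak_solution \<psi> \<sigma> u0 u \<and>
        (\<exists>s<0. distr_of_real u \<in> F_space \<psi> (qsym \<sigma> u0) s (1/2)) \<and>
        ((\<lambda>t. L2T_norm (\<lambda>x. u t x - u0 x)) \<longlongrightarrow> 0) (at 0)) \<and>
     (\<forall>\<Phi>. defocusing_flow_extension \<Phi> \<longrightarrow>
        (\<forall>u0\<in>L2T. weak_solution \<psi> 1 u0 (\<Phi> u0) \<and>
          (\<exists>s<0. distr_of_real (\<Phi> u0) \<in> F_space \<psi> (qsym 1 u0) s (1/2))))"
proof (intro conjI ballI allI impI)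
 show "\<exists>u. weak_solution \<psi> \<sigma> u0 u \<and> (\<exists>s<0. distr_of_real u \<in> F_space \<psi> (qsym \<sigma> u0) s (1/2)) \<and>
   ((%t. L2T_norm (%x. u t x - u0 x)) \<longlongrightarrow> 0) (at 0)" if "\<sigma> \<in> {1, -1}" "u0 \<in> L2T" for \<sigma> u0
  by (rule weak_solution_exists[OF assms]) (use that in auto)
qed (auto intro: flow_weak_solution[OF assms])

end
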